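(* Assume $d\geq 7$. For any $(\frac1p,\frac1q)\in\mathrm{int}(\mathcal{R}_1)$ and $r\in(0,\infty)$ given by $\frac1r=\frac1p+\frac1q$, there is a constant $C$ such that for all $f\in L^p(\mathbb{R}^d)$, $g\in L^q(\mathbb{R}^d)$, $$\|\mathcal{T}_{lac}(f,g)\|_r\leq C\|f\|_p\|g\|_q .$$ Moreover, for any $d\geq 2$ and any $q\in(1,\infty]$ there is a constant $C$ such that $$\|\mathcal{T}_{lac}(f,g)\|_q\leq C\|f\|_\infty\|g\|_q\quad\text{for all } f\in L^\infty(\mathbb{R}^d),\ g\in L^q(\mathbb{R}^d),$$ and $$\|\mathcal{T}_{lac}(f,g)\|_q\leq C\|f\|_q\|g\|_\infty\quad\text{for all } f\in L^q(\mathbb{R}^d),\ g\in L^\infty(\mathbb{R}^d).$$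
   Context: Let $\mathcal{I}=\{(y,z)\in\mathbb{R}^{2d}:|y|=|z|=|y-z|=1\}$ with its natural (normalized) surface measure $\mu$. The triangle averaging operator at scale $t>0$ is $$\mathcal{T}_t(f,g)(x)=\int_{\mathcal{I}}f(x-ty)\,g(x-tz)\,d\mu(y,z),\qquad x\in\mathbb{R}^d .$$ Equivalently, for any fixed $u,v\in\mathbb{R}^d$ with $|u|=|v|=|u-v|=1$, $\mathcal{T}_t(f,g)(x)=\int_{O(d)}f(x-tRu)g(x-tRv)\,dR$, where $dR$ is normalized Haar measure on the orthogonal group $O(d)$. Set $\mathcal{T}_{lac}(f,g)(x)=\sup_{l\in\mathbb{Z}}|\mathcal{T}_{2^l}(f,g)(x)|$. The region $\mathcal{R}_1\subset[0,1]\times[0,1]$ is the (closed) convex hull of the points $(0,0),(0,1),(1,0)$ and $\left(\frac{d}{d+1},\frac{d}{d+1}\right)$. For $0<r<\infty$, $\|f\|_r=(\int_{\mathbb{R}^d}|f|^r)^{1/r}$ (also when $r<1$). *)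

theory Defs
  imports "HOL-Probability.Probability"
begin

text \<open>Powers with a positive real exponent, with \<open>\<infinity>\<close> raised to \<open>a\<close> equal to \<open>\<infinity>\<close>.\<close>

definition ennreal_power :: "ennreal \<Rightarrow> real \<Rightarrow> ennreal" where
  "ennreal_power x a = (if x = \<infinity> then \<infinity> else ennreal (enn2real x powr a))"

text \<open>
  For \<open>0 < p \<le> \<infinity>\<close> (including \<open>p < 1\<close>, where this is only a quasi-norm). The argument is
  extended nonnegative valued, so that it applies to \<open>|f|\<close> as well as to a maximal function,
  which may take the value \<open>\<infinity>\<close>.
\<close>

definition Lp_norm :: "ennreal \<Rightarrow> ('a::euclidean_space \<Rightarrow> ennreal) \<Rightarrow> ennreal" where
  "Lp_norm p h =
    (if p = \<infinity> then esssup lebesgue h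
     else ennreal_power (\<integral>\<^sup>+x. ennreal_power (h x) (enn2real p) \<partial>lebesgue) (1 / enn2real p))"

abbreviation cLp_norm :: "ennreal \<Rightarrow> ('a::euclidean_space \<Rightarrow> complex) \<Rightarrow> ennreal" where
  "cLp_norm p f \<equiv> Lp_norm p (\<lambda>x. ennreal (cmod (f x)))"

definition Lp :: "ennreal \<Rightarrow> ('a::euclidean_space \<Rightarrow> complex) set" where
  "Lp p = {f \<in> borel_measurable lebesgue. cLp_norm p f < \<infinity>}"

text \<open>
  The normalized Haar measure of the compact group \<open>O(d)\<close>, \<open>d = CARD('n)\<close>: the (unique)
  left-invariant Borel probability measure.
\<close>

definition normalized_haar_orthogonal :: "(real^'n^'n) measure \<Rightarrow> bool" where
  "normalized_haar_orthogonal H \<longleftrightarrow>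
     prob_space H \<and>
     sets H = sets (restrict_space borel {R. orthogonal_matrix R}) \<and>
     (\<forall>Q. orthogonal_matrix Q \<longrightarrow> distr H H (\<lambda>R. Q ** R) = H)"

definition triangle_set :: "((real^'n) \<times> (real^'n)) set" where
  "triangle_set = {(y, z). norm y = 1 \<and> norm z = 1 \<and> norm (y - z) = 1}"

text \<open>
  For \<open>(u, v) \<in> triangle_set\<close>, the image of \<open>H\<close> under \<open>R \<mapsto> (R u, R v)\<close> is the normalized
  surface measure on \<open>triangle_set\<close>. The completion of \<open>H\<close> is used because \<open>f\<close> and \<open>g\<close> are
  Lebesgue measurable rather than Borel measurable; it makes the value for almost every \<open>x\<close>
  independent of the choice of representatives of \<open>f\<close> and \<open>g\<close>.
\<close>

definition triangle_avg ::
  "(real^'n^'n) measure \<Rightarrow> real^'n \<Rightarrow> real^'n \<Rightarrow> real \<Rightarrow>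
     (real^'n \<Rightarrow> complex) \<Rightarrow> (real^'n \<Rightarrow> complex) \<Rightarrow> real^'n \<Rightarrow> complex" where
  "triangle_avg H u v t f g x =
     (\<integral>R. f (x - t *\<^sub>R (R *v u)) * g (x - t *\<^sub>R (R *v v)) \<partial>(completion H))"

definition triangle_lac ::
  "(real^'n^'n) measure \<Rightarrow> real^'n \<Rightarrow> real^'n \<Rightarrow>
     (real^'n \<Rightarrow> complex) \<Rightarrow> (real^'n \<Rightarrow> complex) \<Rightarrow> real^'n \<Rightarrow> ennreal" where
  "triangle_lac H u v f g x =
     (SUP l::int. ennreal (cmod (triangle_avg H u v (2 powi l) f g x)))"

definition region_R1 :: "nat \<Rightarrow> (real \<times> real) set" where
  "region_R1 d = convex hull
     {(0, 0), (0, 1), (1, 0), (real d / (real d + 1), real d / (real d + 1))}"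

end

theory Submission
  imports Defs
begin

text \<open>
  Calderon-Zygmund decompositions of two indicator functions reduce the lacunary maximal function
  to pieces with cancellation below the scale of the average. Such a piece may first be averaged
  over the circle of points \<open>u'\<close> for which the triangle \<open>(u', v)\<close> is congruent to \<open>(u, v)\<close>, because
  \<open>H\<close> is invariant under the isometries that fix \<open>v\<close>; this circle exists for \<open>d \<ge> 3\<close>. The
  resulting square function is governed by the spherical average, whose Fourier multiplier decays,
  so that it gains a power of the ratio of the scales. Interpolating this gain with the trivial
  bounds and with the restricted estimate of the single averages at \<open>(d/(d+1), d/(d+1))\<close> gives
  restricted weak type bounds in the interior of the region, which are then interpolated by dyadic
  layers; exponents with \<open>r > 1\<close> are reduced to \<open>r = 1\<close> by Jensen's inequality. When one function
  is constant, \<open>u'\<close> may be moved freely on the sphere, which only requires \<open>d \<ge> 2\<close>.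
\<close>


text \<open>Circles enter only through finitely many points: replacing a piece by the mean of its
  translates along N points turns its squared L2 norm into N^2 correlations over spheres. The
  diagonal costs 1/N, the other lags are at least of order t/N, and N is a small power of the ratio
  of scales; there any rate of decay of the multiplier suffices. Fourier analysis is confined to
  bilinear forms: frequency integrals carry a Gaussian weight that is removed at the end. This
  replaces Plancherel and inversion but asks for functions continuous almost everywhere, so the L2
  estimates are made for finite unions of dyadic cubes and reach Borel sets only afterwards. The
  decay itself comes from a differential equation in the radius, a consequence of rotation
  invariance alone. Weak type bounds are parametrised by the allowed measure \<open>V\<close>
  instead of the level, so that both decompositions are made at heights |E|/V and |F|/V and all
  exceptional sets have measure O(V). The linear maximal function is treated by the same bilinear
  interpolation, applied to the product of two copies of it.\<close>

abbreviation nn_lborel (binder "LN " 10) where "nn_lborel f \<equiv> nn_integral lborel (f :: 'a::euclidean_space \<Rightarrow> ennreal)"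
abbreviation int_lborel (binder "LI " 10) where "int_lborel f \<equiv> integral\<^sup>L lborel (f :: 'a::euclidean_space \<Rightarrow> 'b::{banach, second_countable_topology})"
abbreviation "vol \<equiv> measure lborel"
abbreviation "evol \<equiv> emeasure lborel"
abbreviation "Bor \<equiv> borel_measurable borel"
abbreviation "epow \<equiv> ennreal_power"

section \<open>Gaussian regularisation and Fourier multipliers\<close>

definition gdens :: "real => 'a::euclidean_space => real" where
 "gdens s z = (\<Prod>b\<in>Basis. normal_density 0 s (z \<bullet> b))"

definition gauss :: "real => 'a::euclidean_space measure" where
 "gauss s = density lborel (%z. ennreal (gdens s z))"

definition charf :: "'a::euclidean_space measure => 'a => complex" where
 "charf M \<xi> = (\<integral>z. cis (\<xi> \<bullet> z) \<partial>M)"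

lemma cis_borel_measurable [measurable]: "cis \<in> Bor"
 by (intro borel_measurable_continuous_onI continuous_on_cis continuous_on_id)

lemma cnj_borel_measurable [measurable]: "cnj \<in> Bor"
 by (intro borel_measurable_continuous_onI continuous_intros)

lemma gdens_nonneg [simp]: "0 <= gdens s z"
 unfolding gdens_def by (intro prod_nonneg) auto

lemma gdens_measurable [measurable]: "gdens s \<in> Bor"
 unfolding gdens_def by measurable

lemma gdens_eq:
 fixes z :: "'a::euclidean_space"
 assumes "s > 0"
 shows "gdens s z = (1 / (sqrt (2 * pi) * s)) ^ DIM('a) * exp (- (norm z)\<^sup>2 / (2 * s\<^sup>2))"
proof -
 have "(norm z)\<^sup>2 = (\<Sum>b\<in>Basis. (z \<bullet> b)\<^sup>2)"
  unfolding power2_norm_eq_inner by (subst euclidean_inner) (simp add: power2_eq_square)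
 hence "exp (- (norm z)\<^sup>2 / (2 * s\<^sup>2)) = (\<Prod>b\<in>Basis. exp (- (z \<bullet> b)\<^sup>2 / (2 * s\<^sup>2)))"
  by (subst exp_sum [symmetric]) (simp_all add: sum_negf sum_divide_distrib)
 moreover have "sqrt (2 * pi * s\<^sup>2) = sqrt (2 * pi) * s"
  using assms by (simp add: real_sqrt_mult)
 ultimately show ?thesis
  unfolding gdens_def normal_density_def by (simp add: prod_dividef power_divide prod_constant)
qed

lemma integral_lborel_prod:
 fixes h :: "'a::euclidean_space => real => 'b::{real_normed_field,banach,second_countable_topology}"
 assumes int: "!!b. b \<in> Basis ==> integrable lborel (h b)"
 shows "(LI x. (\<Prod>b\<in>Basis. h b (x \<bullet> b))) = (\<Prod>b\<in>Basis. (LI x. h b x))"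
proof -
 interpret product_sigma_finite "%b::'a. lborel :: real measure" ..
 have m: "h b \<in> Bor" if "b \<in> Basis" for b
  using borel_measurable_integrable[OF int[OF that]] by simp
 have "(LI x. (\<Prod>b\<in>Basis. h b (x \<bullet> b))) =
   (\<integral>x. (\<Prod>b\<in>Basis. h b ((\<Sum>c\<in>Basis. x c *\<^sub>R c) \<bullet> b)) \<partial>(\<Pi>\<^sub>M b\<in>Basis. lborel))"
  apply (subst lborel_eq)
  apply (rule integral_distr)
  apply measurable
  using m
  apply measurable
  done
 also have "... = (\<integral>x. (\<Prod>b\<in>Basis. h b (x b)) \<partial>(\<Pi>\<^sub>M b\<in>Basis. lborel))"
  by (intro Bochner_Integration.integral_cong prod.cong refl) (simp add: inner_sum_left_Basis)
 also have "... = (\<Prod>b\<in>Basis. (LI x. h b x))"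
  by (intro product_integral_prod finite_Basis int)
 finally show ?thesis .
qed

lemma integral_gdens_eq_1:
 assumes "s > 0"
 shows "(LN z. gdens s (z::'a::euclidean_space)) = 1"
proof -
 have "(LN z. gdens s (z::'a)) = (LN z. (\<Prod>b\<in>(Basis::'a set). ennreal (normal_density 0 s (z \<bullet> b))))"
  unfolding gdens_def by (intro nn_integral_cong) (simp add: prod_ennreal)
 also have "... = (\<Prod>b\<in>(Basis::'a set). (LN x. ennreal (normal_density 0 s x)))"
  by (intro nn_integral_lborel_prod) auto
 also have "(LN x. ennreal (normal_density 0 s x)) = 1"
  using assms by (subst nn_integral_eq_integral) auto
 finally show ?thesis by simp
qed

lemma sets_gauss [simp, measurable_cong]: "sets (gauss s) = sets borel"
 by (simp add: gauss_def)

lemma space_gauss [simp]: "space (gauss s) = UNIV"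
 by (simp add: gauss_def)

lemma prob_space_gauss: "s > 0 ==> prob_space (gauss s :: 'a::euclidean_space measure)"
 by (rule prob_spaceI) (simp add: gauss_def emeasure_density integral_gdens_eq_1)

lemma integral_normal_cis:
 assumes "s > 0"
 shows "(LI x. normal_density 0 s x *\<^sub>R cis (u * x)) = exp (- (s\<^sup>2 * u\<^sup>2) / 2)"
proof -
 have eq: "s * normal_density 0 s (s * x) = std_normal_density x" for x
  using assms by (simp add: normal_density_def real_sqrt_mult power_mult_distrib field_simps)
 have "(LI x. normal_density 0 s x *\<^sub>R cis (u * x))
  = \<bar>s\<bar> *\<^sub>R (LI x. normal_density 0 s (0 + s * x) *\<^sub>R cis (u * (0 + s * x)))"
  using assms by (intro lborel_integral_real_affine) auto
 also have "... = (LI x. (s * normal_density 0 s (s * x)) *\<^sub>R cis (u * s * x))"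
  using assms by (subst integral_scaleR_right [symmetric]) (simp add: mult.assoc)
 also have "... = (LI x. std_normal_density x *\<^sub>R cis (u * s * x))"
  by (simp add: eq)
 also have "... = char std_normal_distribution (u * s)"
  unfolding char_def cis_conv_exp
  by (subst integral_density) auto
 also have "... = exp (- (s\<^sup>2 * u\<^sup>2) / 2)"
  by (simp add: char_std_normal_distribution power_mult_distrib mult.commute)
 finally show ?thesis .
qed

lemma cis_sum: "finite A ==> cis (\<Sum>a\<in>A. f a) = (\<Prod>a\<in>A. cis (f a))"
 by (induction A rule: finite_induct) (auto simp: cis_mult [symmetric])

lemma charf_gauss:
 assumes "s > 0"
 shows "charf (gauss s) (\<xi>::'a::euclidean_space) = exp (- (s\<^sup>2 * (norm \<xi>)\<^sup>2) / 2)"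
proof -
 have "charf (gauss s) \<xi> = (LI z. gdens s z *\<^sub>R cis (\<xi> \<bullet> z))"
  unfolding charf_def gauss_def by (subst integral_density) auto
 also have "... = (LI z. (\<Prod>b\<in>Basis. normal_density 0 s (z \<bullet> b) *\<^sub>R cis ((\<xi> \<bullet> b) * (z \<bullet> b))))"
  unfolding gdens_def
 proof (intro Bochner_Integration.integral_cong refl)
  fix z :: 'a
  have "cis (\<xi> \<bullet> z) = (\<Prod>b\<in>Basis. cis ((\<xi> \<bullet> b) * (z \<bullet> b)))"
   by (subst euclidean_inner) (simp add: cis_sum)
  thus "(\<Prod>b\<in>Basis. normal_density 0 s (z \<bullet> b)) *\<^sub>R cis (\<xi> \<bullet> z) =
    (\<Prod>b\<in>Basis. normal_density 0 s (z \<bullet> b) *\<^sub>R cis ((\<xi> \<bullet> b) * (z \<bullet> b)))"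
   by (simp add: scaleR_conv_of_real prod.distrib)
 qed
 also have "... = (\<Prod>b\<in>Basis. (LI x. normal_density 0 s x *\<^sub>R cis ((\<xi> \<bullet> b) * x)))"
 proof (rule integral_lborel_prod)
  fix b :: 'a
  have "(%x. normal_density 0 s x *\<^sub>R cis ((\<xi> \<bullet> b) * x)) \<in> borel_measurable lborel"
   by measurable
  thus "integrable lborel (%x. normal_density 0 s x *\<^sub>R cis ((\<xi> \<bullet> b) * x))"
   by (rule Bochner_Integration.integrable_bound[OF integrable_normal_density[OF assms, of 0]]) simp
 qed
 also have "... = (\<Prod>b\<in>Basis. of_real (exp (- (s\<^sup>2 * (\<xi> \<bullet> b)\<^sup>2) / 2)))"
  using assms by (simp add: integral_normal_cis)
 also have "... = of_real (exp (\<Sum>b\<in>Basis. - (s\<^sup>2 * (\<xi> \<bullet> b)\<^sup>2) / 2))"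
  by (simp only: exp_sum finite_Basis of_real_prod)
 also have "(\<Sum>b\<in>Basis. - (s\<^sup>2 * (\<xi> \<bullet> b)\<^sup>2) / 2) = - (s\<^sup>2 * (norm \<xi>)\<^sup>2) / 2"
  unfolding power2_norm_eq_inner euclidean_inner[of \<xi> \<xi>]
  by (simp add: sum_distrib_left sum_divide_distrib sum_negf power2_eq_square)
 finally show ?thesis by (simp add: exp_of_real)
qed

lemma integral_mult_pair:
 fixes f :: "'a => 'c::{real_normed_field,banach,second_countable_topology}" and g :: "'b => 'c"
 assumes "sigma_finite_measure M" "sigma_finite_measure N" and f: "integrable M f" and g: "integrable N g"
 shows "integrable (M \<Otimes>\<^sub>M N) (%p. f (fst p) * g (snd p))" (is ?A)
  and "(\<integral>p. f (fst p) * g (snd p) \<partial>(M \<Otimes>\<^sub>M N)) = (\<integral>x. f x \<partial>M) * (\<integral>y. g y \<partial>N)" (is ?B)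
proof -
 interpret M: sigma_finite_measure M by fact
 interpret N: sigma_finite_measure N by fact
 interpret pair_sigma_finite M N ..
 have [measurable]: "f \<in> borel_measurable M" "g \<in> borel_measurable N" using f g by auto
 show i: ?A
 proof (rule Fubini_integrable)
  show "integrable M (%x. \<integral>y. norm (f (fst (x, y)) * g (snd (x, y))) \<partial>N)"
   using f by (simp add: norm_mult)
  show "AE x in M. integrable N (%y. f (fst (x, y)) * g (snd (x, y)))"
   using g by simp
 qed measurable
 show ?B
  using integral_fst'[OF i] f g by simp
qed


lemma lborel_integral_affine:
 fixes f :: "'a::euclidean_space => 'b::{banach,second_countable_topology}"
 assumes c: "c ~= 0" and [measurable]: "f \<in> Bor"
 shows "(LI x. f x) = \<bar>c\<bar> ^ DIM('a) *\<^sub>R (LI x. f (t + c *\<^sub>R x))"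
 by (subst lborel_affine[OF c, of t]) (simp add: integral_density integral_distr)

lemma lborel_nn_integral_affine:
 fixes f :: "'a::euclidean_space => ennreal"
 assumes c: "c ~= 0" and [measurable]: "f \<in> Bor"
 shows "(LN x. f x) = ennreal (\<bar>c\<bar> ^ DIM('a)) * (LN x. f (t + c *\<^sub>R x))"
 by (subst lborel_affine[OF c, of t]) (simp add: nn_integral_density nn_integral_distr nn_integral_cmult)

lemma lborel_nn_integral_shift:
 fixes f :: "'a::euclidean_space => ennreal"
 assumes [measurable]: "f \<in> Bor"
 shows "(LN x. f (x + t)) = (LN x. f x)"
 using lborel_nn_integral_affine[of 1 f t] by (simp add: add.commute)

lemma lborel_integral_shift:
 fixes f :: "'a::euclidean_space => 'b::{banach,second_countable_topology}"
 assumes [measurable]: "f \<in> Bor"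
 shows "(LI x. f (x + t)) = (LI x. f x)"
 using lborel_integral_affine[of 1 f t] by (simp add: add.commute)

section \<open>Parseval's identity with a Gaussian weight\<close>

definition ftrans :: "('a::euclidean_space => real) => 'a => complex" where
 "ftrans f \<xi> = (LI x. f x *\<^sub>R cis (\<xi> \<bullet> x))"

text \<open>The Gaussian weight in frequency makes the Fubini exchange legitimate; on the space side
  it becomes convolution with the Gaussian of inverse width.\<close>

lemma parseval_gauss_aux:
 fixes f g :: "'a::euclidean_space => real" and M :: "'a measure"
 assumes a: "a > 0" and f: "integrable lborel f" and g: "integrable lborel g"
  and M: "prob_space M" "sets M = sets borel"
 shows "(\<integral>\<xi>. ftrans f \<xi> * cnj (ftrans g \<xi>) * charf M \<xi> \<partial>gauss a) =
  of_real (\<integral>p. f (fst p) * (g (snd (snd p)) * exp (- (a\<^sup>2 * (norm (fst p + fst (snd p) - snd (snd p)))\<^sup>2) / 2))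
    \<partial>(lborel \<Otimes>\<^sub>M (M \<Otimes>\<^sub>M lborel)))"
  and "integrable (lborel \<Otimes>\<^sub>M (M \<Otimes>\<^sub>M lborel)) (%p. f (fst p) * (g (snd (snd p)) * exp (- (a\<^sup>2 * (norm (fst p + fst (snd p) - snd (snd p)))\<^sup>2) / 2)))"
proof -
 interpret M: prob_space M by fact
 interpret G: prob_space "gauss a :: 'a measure" using a by (rule prob_space_gauss)
 note M(2) [measurable_cong]
 let ?Q = "M \<Otimes>\<^sub>M lborel" and ?P = "lborel \<Otimes>\<^sub>M (M \<Otimes>\<^sub>M lborel)"
 have [measurable]: "f \<in> Bor" "g \<in> Bor" using f g by auto
 have sQ: "sigma_finite_measure ?Q"
  by (intro sigma_finite_pair_measure M.sigma_finite_measure_axioms) (rule sigma_finite_lborel)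
 have sP: "sigma_finite_measure ?P"
  by (intro sigma_finite_pair_measure sQ) (rule sigma_finite_lborel)
 interpret P: sigma_finite_measure ?P by (rule sP)
 interpret GP: pair_sigma_finite "gauss a :: 'a measure" ?P ..
 have if0: "integrable lborel (%x. complex_of_real (f x) * cis (\<xi> \<bullet> x))" if "integrable lborel f" for \<xi> :: 'a and f
 proof -
  have [measurable]: "f \<in> Bor" using that by auto
  have "(%x. complex_of_real (f x) * cis (\<xi> \<bullet> x)) \<in> borel_measurable lborel" by measurable
  thus ?thesis
   by (rule Bochner_Integration.integrable_bound[OF that]) (simp add: norm_mult)
 qed
 have ig: "integrable lborel (%x. cnj (complex_of_real (g x) * cis (\<xi> \<bullet> x)))" for \<xi> :: 'a
  by (rule integrable_cnj[OF if0[OF g]])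
 have "(%z. cis (\<xi> \<bullet> z)) \<in> borel_measurable M" for \<xi> :: 'a by measurable
 hence im: "integrable M (%z. cis (\<xi> \<bullet> z))" for \<xi> :: 'a
  by (intro M.integrable_const_bound[of _ 1]) simp_all
 have step1: "ftrans f \<xi> * cnj (ftrans g \<xi>) * charf M \<xi> =
   (\<integral>p. complex_of_real (f (fst p)) * cis (\<xi> \<bullet> fst p) * (cis (\<xi> \<bullet> fst (snd p)) * cnj (complex_of_real (g (snd (snd p))) * cis (\<xi> \<bullet> snd (snd p)))) \<partial>?P)"
  for \<xi>
 proof -
  have 1: "integrable ?Q (%p. cis (\<xi> \<bullet> fst p) * cnj (complex_of_real (g (snd p)) * cis (\<xi> \<bullet> snd p)))"
   "(\<integral>p. cis (\<xi> \<bullet> fst p) * cnj (complex_of_real (g (snd p)) * cis (\<xi> \<bullet> snd p)) \<partial>?Q) = charf M \<xi> * cnj (ftrans g \<xi>)"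
   using integral_mult_pair[OF M.sigma_finite_measure_axioms sigma_finite_lborel im ig]
   by (simp_all add: ftrans_def charf_def scaleR_conv_of_real del: complex_cnj_mult)
  show ?thesis
   using integral_mult_pair(2)[OF sigma_finite_lborel sQ if0[OF f] 1(1), of \<xi>]
   unfolding 1(2) by (simp add: ftrans_def scaleR_conv_of_real mult_ac del: complex_cnj_mult)
 qed
 have ifg: "integrable ?P (%p. f (fst p) * (1 * g (snd (snd p))))"
  by (rule integral_mult_pair(1)[OF sigma_finite_lborel sQ f, of "%q. 1 * g (snd q)"],
    rule integral_mult_pair(1)[OF M.sigma_finite_measure_axioms sigma_finite_lborel _ g, of "%q. 1"]) simp
 show iE: "integrable ?P (%p. f (fst p) * (g (snd (snd p)) * exp (- (a\<^sup>2 * (norm (fst p + fst (snd p) - snd (snd p)))\<^sup>2) / 2)))"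
  by (rule Bochner_Integration.integrable_bound[OF ifg])
   (measurable, simp add: abs_mult mult_left_le mult_left_mono)
 let ?h = "%\<xi> p. complex_of_real (f (fst p) * g (snd (snd p))) * cis (\<xi> \<bullet> (fst p + fst (snd p) - snd (snd p)))"
 have ih: "integrable (gauss a \<Otimes>\<^sub>M ?P) (%(\<xi>, p). ?h \<xi> p)"
 proof (rule Bochner_Integration.integrable_bound)
  show "integrable (gauss a \<Otimes>\<^sub>M ?P) (%q. (%\<xi>::'a. 1) (fst q) * (%p. f (fst p) * (1 * g (snd (snd p)))) (snd q))"
   by (rule integral_mult_pair(1)[OF G.sigma_finite_measure_axioms sP _ ifg]) simp
  show "(%(\<xi>, p). ?h \<xi> p) \<in> borel_measurable (gauss a \<Otimes>\<^sub>M ?P)" by measurable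
 qed (simp add: norm_mult case_prod_beta)
 have "(\<integral>\<xi>. ftrans f \<xi> * cnj (ftrans g \<xi>) * charf M \<xi> \<partial>gauss a) = (\<integral>\<xi>. (\<integral>p. ?h \<xi> p \<partial>?P) \<partial>gauss a)"
  unfolding step1
 proof (intro Bochner_Integration.integral_cong refl)
  fix \<xi> :: 'a and p :: "'a \<times> 'a \<times> 'a"
  have "cis (\<xi> \<bullet> (fst p + fst (snd p) - snd (snd p))) = cis (\<xi> \<bullet> fst p) * cis (\<xi> \<bullet> fst (snd p)) * cnj (cis (\<xi> \<bullet> snd (snd p)))"
   by (simp add: cis_cnj cis_mult cis_inverse inner_diff_right inner_add_right)
  thus "complex_of_real (f (fst p)) * cis (\<xi> \<bullet> fst p) * (cis (\<xi> \<bullet> fst (snd p)) * cnj (complex_of_real (g (snd (snd p))) * cis (\<xi> \<bullet> snd (snd p)))) = ?h \<xi> p"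
   by (simp add: mult_ac)
 qed
 also have "... = (\<integral>p. (\<integral>\<xi>. ?h \<xi> p \<partial>gauss a) \<partial>?P)"
  using GP.Fubini_integral[OF ih] by simp
 also have "... = (\<integral>p. complex_of_real (f (fst p) * (g (snd (snd p)) *
   exp (- (a\<^sup>2 * (norm (fst p + fst (snd p) - snd (snd p)))\<^sup>2) / 2))) \<partial>?P)"
 proof (intro Bochner_Integration.integral_cong refl)
  fix p :: "'a \<times> 'a \<times> 'a"
  let ?w = "fst p + fst (snd p) - snd (snd p)"
  have "(\<integral>\<xi>. ?h \<xi> p \<partial>gauss a) = complex_of_real (f (fst p) * g (snd (snd p))) * charf (gauss a) ?w"
   unfolding charf_def inner_commute[of ?w] by (rule integral_mult_right_zero)
  thus "(\<integral>\<xi>. ?h \<xi> p \<partial>gauss a) = complex_of_real (f (fst p) * (g (snd (snd p)) * exp (- (a\<^sup>2 * (norm ?w)\<^sup>2) / 2)))"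
   using a by (simp add: charf_gauss)
 qed
 also have "... = of_real (\<integral>p. f (fst p) * (g (snd (snd p)) *
   exp (- (a\<^sup>2 * (norm (fst p + fst (snd p) - snd (snd p)))\<^sup>2) / 2)) \<partial>?P)"
  by (rule integral_of_real[OF iE])
 finally show "(\<integral>\<xi>. ftrans f \<xi> * cnj (ftrans g \<xi>) * charf M \<xi> \<partial>gauss a) =
  of_real (\<integral>p. f (fst p) * (g (snd (snd p)) * exp (- (a\<^sup>2 * (norm (fst p + fst (snd p) - snd (snd p)))\<^sup>2) / 2)) \<partial>?P)" .
qed

text \<open>The correlation \<open>conv_form\<close> blurred by a Gaussian of width 1/a, the space
  side of the weighted Parseval identity. The Gaussian is rescaled to \<open>gauss 1\<close> so that
  the limit of large \<open>a\<close> is taken in one fixed measure space.\<close>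

definition smooth_form :: "real => 'a::euclidean_space measure => ('a => real) => ('a => real) => real" where
 "smooth_form a M f g = (\<integral>q. f (fst q) * g (fst q + fst (snd q) - (1 / a) *\<^sub>R snd (snd q))
   \<partial>(lborel \<Otimes>\<^sub>M (M \<Otimes>\<^sub>M gauss 1)))"

definition conv_form :: "'a::euclidean_space measure => ('a => real) => ('a => real) => real" where
 "conv_form M f g = (LI x. (\<integral>z. f x * g (x + z) \<partial>M))"

lemma exp_gauss_shift_integral:
 fixes g :: "'a::euclidean_space => real"
 assumes a: "a > 0" and [measurable]: "g \<in> Bor"
 shows "(LI y. g y * exp (- (a\<^sup>2 * (norm (x - y))\<^sup>2) / 2)) =
  (sqrt (2 * pi) / a) ^ DIM('a) * (\<integral>w. g (x - (1 / a) *\<^sub>R w) \<partial>gauss 1)"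
proof -
 have "(LI y. g y * exp (- (a\<^sup>2 * (norm (x - y))\<^sup>2) / 2)) =
  \<bar>- (1 / a)\<bar> ^ DIM('a) *\<^sub>R (LI w. g (x + (- (1 / a)) *\<^sub>R w) * exp (- (a\<^sup>2 * (norm (x - (x + (- (1 / a)) *\<^sub>R w)))\<^sup>2) / 2))"
  using a by (intro lborel_integral_affine) auto
 also have "... = (1 / a) ^ DIM('a) * (LI w. sqrt (2 * pi) ^ DIM('a) * (gdens 1 w * g (x - (1 / a) *\<^sub>R w)))"
  using a by (auto simp: gdens_eq power_divide power_mult_distrib mult.commute intro!: Bochner_Integration.integral_cong)
 also have "... = (sqrt (2 * pi) / a) ^ DIM('a) * (LI w. gdens 1 w * g (x - (1 / a) *\<^sub>R w))"
  by (simp add: power_divide)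
 also have "(LI w. gdens 1 w * g (x - (1 / a) *\<^sub>R w)) = (\<integral>w. g (x - (1 / a) *\<^sub>R w) \<partial>gauss 1)"
  unfolding gauss_def by (subst integral_density) auto
 finally show ?thesis .
qed

lemma smooth_form_integrable:
 fixes f g :: "'a::euclidean_space => real"
 assumes f: "integrable lborel f" and [measurable]: "g \<in> Bor"
  and B: "!!x. \<bar>g x\<bar> <= B" and M: "prob_space M" "sets M = sets borel"
 shows "integrable (lborel \<Otimes>\<^sub>M (M \<Otimes>\<^sub>M gauss 1)) (%q. f (fst q) * g (fst q + fst (snd q) - c *\<^sub>R snd (snd q)))"
proof -
 interpret M: prob_space M by fact
 interpret G: prob_space "gauss 1 :: 'a measure" by (rule prob_space_gauss) simp
 interpret MG: pair_prob_space M "gauss 1 :: 'a measure" ..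
 note M(2) [measurable_cong]
 have [measurable]: "f \<in> Bor" using f by auto
 have "integrable (lborel \<Otimes>\<^sub>M (M \<Otimes>\<^sub>M (gauss 1 :: 'a measure))) (%q. f (fst q) * (%_. B) (snd q))"
  by (rule integral_mult_pair(1)[OF sigma_finite_lborel _ f]) (auto intro: MG.P.sigma_finite_measure_axioms)
 thus ?thesis
  by (rule Bochner_Integration.integrable_bound)
   (measurable, auto simp: abs_mult intro!: mult_left_mono B order_trans[OF B abs_ge_self] AE_I2)
qed

text \<open>The normalising constant depends on \<open>a\<close> and the dimension only; it cancels
  when a bound on the multiplier is carried through the identity.\<close>

lemma parseval_gauss:
 fixes f g :: "'a::euclidean_space => real" and M :: "'a measure"
 assumes a: "a > 0" and f: "integrable lborel f" and g: "integrable lborel g"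
  and B: "!!x. \<bar>g x\<bar> <= B" and M: "prob_space M" "sets M = sets borel"
 shows "(\<integral>\<xi>. ftrans f \<xi> * cnj (ftrans g \<xi>) * charf M \<xi> \<partial>gauss a) =
  of_real ((sqrt (2 * pi) / a) ^ DIM('a) * smooth_form a M f g)"
proof -
 interpret M: prob_space M by fact
 interpret G: prob_space "gauss 1 :: 'a measure" by (rule prob_space_gauss) simp
 interpret MG: pair_prob_space M "gauss 1 :: 'a measure" ..
 interpret Mlb: pair_sigma_finite M "lborel :: 'a measure" ..
 note M(2) [measurable_cong]
 have [measurable]: "f \<in> Bor" "g \<in> Bor" using f g by auto
 have sQ: "sigma_finite_measure (M \<Otimes>\<^sub>M (lborel :: 'a measure))"
  by (intro sigma_finite_pair_measure M.sigma_finite_measure_axioms) (rule sigma_finite_lborel)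
 interpret LP: pair_sigma_finite "lborel :: 'a measure" "M \<Otimes>\<^sub>M (lborel :: 'a measure)"
  by (intro pair_sigma_finite.intro sQ sigma_finite_lborel)
 interpret LG: pair_sigma_finite "lborel :: 'a measure" "M \<Otimes>\<^sub>M (gauss 1 :: 'a measure)"
  by (intro pair_sigma_finite.intro sigma_finite_lborel MG.P.sigma_finite_measure_axioms)
 let ?K = "(sqrt (2 * pi) / a) ^ DIM('a)"
 have sf: "smooth_form a M f g = (LI x. (\<integral>z. (\<integral>w. f x * g (x + z - (1 / a) *\<^sub>R w) \<partial>gauss 1) \<partial>M))"
  unfolding smooth_form_def
 proof (subst LG.integral_fst'[OF smooth_form_integrable[OF f _ B M], symmetric], simp, intro Bochner_Integration.integral_cong refl)
  fix x :: 'a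
  have "integrable (M \<Otimes>\<^sub>M gauss 1) (%q. f x * g (x + fst q - (1 / a) *\<^sub>R snd q))"
   by (rule MG.P.integrable_const_bound[of _ "\<bar>f x\<bar> * B"])
    (auto simp: abs_mult intro!: mult_left_mono B)
  thus "(\<integral>y. f (fst (x, y)) * g (fst (x, y) + fst (snd (x, y)) - (1 / a) *\<^sub>R snd (snd (x, y))) \<partial>(M \<Otimes>\<^sub>M gauss 1)) =
    (\<integral>z. (\<integral>w. f x * g (x + z - (1 / a) *\<^sub>R w) \<partial>gauss 1) \<partial>M)"
   by (subst MG.integral_fst'[symmetric]) simp_all
 qed
 have "(\<integral>p. f (fst p) * (g (snd (snd p)) * exp (- (a\<^sup>2 * (norm (fst p + fst (snd p) - snd (snd p)))\<^sup>2) / 2))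
    \<partial>(lborel \<Otimes>\<^sub>M (M \<Otimes>\<^sub>M lborel))) =
  (LI x. (\<integral>z. (LI y. f x * (g y * exp (- (a\<^sup>2 * (norm (x + z - y))\<^sup>2) / 2))) \<partial>M))"
 proof (subst LP.integral_fst'[OF parseval_gauss_aux(2)[OF a f g M], symmetric], intro Bochner_Integration.integral_cong refl)
  fix x :: 'a
  have "integrable (M \<Otimes>\<^sub>M lborel) (%q. (%_. 1) (fst q) * g (snd q))"
   by (rule integral_mult_pair(1)[OF M.sigma_finite_measure_axioms sigma_finite_lborel _ g]) simp
  hence "integrable (M \<Otimes>\<^sub>M lborel) (%q. f x * ((%_. 1) (fst q) * g (snd q)))"
   by (rule integrable_mult_right)
  hence "integrable (M \<Otimes>\<^sub>M lborel) (%q. f x * (g (snd q) * exp (- (a\<^sup>2 * (norm (x + fst q - snd q))\<^sup>2) / 2)))"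
   by (rule Bochner_Integration.integrable_bound)
    (measurable, simp add: abs_mult mult_left_le mult_left_mono)
  thus "(\<integral>y. f (fst (x, y)) * (g (snd (snd (x, y))) * exp (- (a\<^sup>2 * (norm (fst (x, y) + fst (snd (x, y)) - snd (snd (x, y))))\<^sup>2) / 2)) \<partial>(M \<Otimes>\<^sub>M lborel)) =
   (\<integral>z. (LI y. f x * (g y * exp (- (a\<^sup>2 * (norm (x + z - y))\<^sup>2) / 2))) \<partial>M)"
   by (subst Mlb.integral_fst'[symmetric]) simp_all
 qed
 also have "... = (LI x. (\<integral>z. ?K * (\<integral>w. f x * g (x + z - (1 / a) *\<^sub>R w) \<partial>gauss 1) \<partial>M))"
  by (intro Bochner_Integration.integral_cong refl)
   (simp only: integral_mult_right_zero exp_gauss_shift_integral[OF a \<open>g \<in> Bor\<close>] mult.left_commute)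
 also have "... = ?K * smooth_form a M f g"
  unfolding sf by simp
 finally show ?thesis
  unfolding parseval_gauss_aux(1)[OF a f g M] by simp
qed

text \<open>Pointwise 2|fg| <= s f^2 + g^2/s, and translations preserve the integral of g^2. The
  free weight \<open>s\<close> replaces Cauchy-Schwarz and avoids square roots of integrals.\<close>

lemma smooth_form_le:
 fixes f g :: "'a::euclidean_space => real" and M :: "'a measure"
 assumes f: "integrable lborel f" and g: "integrable lborel g"
  and f2: "integrable lborel (%x. (f x)\<^sup>2)" and g2: "integrable lborel (%x. (g x)\<^sup>2)"
  and B: "!!x. \<bar>g x\<bar> <= B" and M: "prob_space M" "sets M = sets borel" and s: "s > 0"
 shows "\<bar>smooth_form a M f g\<bar> <= (s * (LI x. (f x)\<^sup>2) + (LI x. (g x)\<^sup>2) / s) / 2"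
proof -
 interpret M: prob_space M by fact
 interpret G: prob_space "gauss 1 :: 'a measure" by (rule prob_space_gauss) simp
 interpret MG: pair_prob_space M "gauss 1 :: 'a measure" ..
 interpret LG: pair_sigma_finite "lborel :: 'a measure" "M \<Otimes>\<^sub>M (gauss 1 :: 'a measure)"
  by (intro pair_sigma_finite.intro sigma_finite_lborel MG.P.sigma_finite_measure_axioms)
 note M(2) [measurable_cong]
 have [measurable]: "f \<in> Bor" "g \<in> Bor" using f g by auto
 let ?L = "lborel \<Otimes>\<^sub>M (M \<Otimes>\<^sub>M (gauss 1 :: 'a measure))"
 let ?G = "%q::'a\<times>'a\<times>'a. fst q + fst (snd q) - (1 / a) *\<^sub>R snd (snd q)"
 have if2: "integrable ?L (%q. (f (fst q))\<^sup>2)" "(\<integral>q. (f (fst q))\<^sup>2 \<partial>?L) = (LI x. (f x)\<^sup>2)"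
  using integral_mult_pair[OF sigma_finite_lborel MG.P.sigma_finite_measure_axioms f2, of "%_. 1"]
  by (simp_all add: MG.P.prob_space)
 have nn: "(\<integral>\<^sup>+q. ennreal ((g (?G q))\<^sup>2) \<partial>?L) = (LN x. ennreal ((g x)\<^sup>2))"
 proof -
  have "(\<integral>\<^sup>+q. ennreal ((g (?G q))\<^sup>2) \<partial>?L) = (\<integral>\<^sup>+p. (LN x. ennreal ((g (x + (fst p - (1 / a) *\<^sub>R snd p)))\<^sup>2)) \<partial>(M \<Otimes>\<^sub>M (gauss 1 :: 'a measure)))"
   by (subst LG.nn_integral_snd [symmetric]) (simp_all add: algebra_simps)
  also have "... = (\<integral>\<^sup>+p. (LN x. ennreal ((g x)\<^sup>2)) \<partial>(M \<Otimes>\<^sub>M (gauss 1 :: 'a measure)))"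
   by (subst lborel_nn_integral_shift[of "%x. ennreal ((g x)\<^sup>2)"]) simp_all
  finally show ?thesis by (simp add: MG.P.emeasure_space_1)
 qed
 have ig2: "integrable ?L (%q. (g (?G q))\<^sup>2)"
  using g2 unfolding integrable_iff_bounded by (auto simp: nn)
 have ig2': "(\<integral>q. (g (?G q))\<^sup>2 \<partial>?L) = (LI x. (g x)\<^sup>2)"
  using nn by (simp add: integral_eq_nn_integral)
 have "\<bar>smooth_form a M f g\<bar> <= (\<integral>q. \<bar>f (fst q) * g (?G q)\<bar> \<partial>?L)"
  unfolding smooth_form_def by (rule integral_abs_bound)
 also have "... <= (\<integral>q. s / 2 * (f (fst q))\<^sup>2 + 1 / (2 * s) * (g (?G q))\<^sup>2 \<partial>?L)"
 proof (rule integral_mono)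
  show "integrable ?L (%q. \<bar>f (fst q) * g (?G q)\<bar>)"
   using smooth_form_integrable[OF f \<open>g \<in> Bor\<close> B M, of "1 / a"] by (intro integrable_abs)
  show "integrable ?L (%q. s / 2 * (f (fst q))\<^sup>2 + 1 / (2 * s) * (g (?G q))\<^sup>2)"
   using if2 ig2 by simp
  fix q
  have "0 <= (s * \<bar>f (fst q)\<bar> - \<bar>g (?G q)\<bar>)\<^sup>2 / (2 * s)" using s by simp
  also have "... = s / 2 * (f (fst q))\<^sup>2 + 1 / (2 * s) * (g (?G q))\<^sup>2 - \<bar>f (fst q) * g (?G q)\<bar>"
   using s by (simp add: power2_diff abs_mult field_simps power2_eq_square)
  finally show "\<bar>f (fst q) * g (?G q)\<bar> <= s / 2 * (f (fst q))\<^sup>2 + 1 / (2 * s) * (g (?G q))\<^sup>2" by simp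
 qed
 also have "... = (s * (LI x. (f x)\<^sup>2) + (LI x. (g x)\<^sup>2) / s) / 2"
  using if2 ig2 ig2' s by (simp add: field_simps)
 finally show ?thesis .
qed

lemma ftrans_bound:
 assumes "integrable lborel f"
 shows "cmod (ftrans f \<xi>) <= (LI x. \<bar>f x\<bar>)"
 unfolding ftrans_def by (rule order_trans[OF integral_norm_bound]) simp

lemma ftrans_measurable:
 assumes "integrable lborel f"
 shows "ftrans f \<in> Bor"
proof -
 have [measurable]: "f \<in> Bor" using assms by auto
 have "(%\<xi>. (LI x. f x *\<^sub>R cis (\<xi> \<bullet> x))) \<in> Bor" by measurable
 thus ?thesis by (simp add: ftrans_def[abs_def])
qed

lemma charf_measurable:
 fixes M :: "'a::euclidean_space measure"
 assumes M: "prob_space M" "sets M = sets borel"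
 shows "charf M \<in> Bor"
proof -
 interpret M: prob_space M by fact
 note M(2) [measurable_cong]
 have "(%\<xi>::'a. \<integral>x. cis (\<xi> \<bullet> x) \<partial>M) \<in> Bor" by measurable
 thus ?thesis by (simp add: charf_def[abs_def])
qed

lemma cmod_charf_le_1:
 fixes M :: "'a::euclidean_space measure"
 assumes M: "prob_space M"
 shows "cmod (charf M \<xi>) <= 1"
proof -
 interpret M: prob_space M by fact
 show ?thesis
  unfolding charf_def by (rule order_trans[OF integral_norm_bound]) (simp add: M.prob_space)
qed

lemma integrable_power2_of_bounded:
 fixes f :: "'a => real"
 assumes f: "integrable M f" and B: "!!x. \<bar>f x\<bar> <= B"
 shows "integrable M (%x. (f x)\<^sup>2)"
proof (rule Bochner_Integration.integrable_bound)
 show "integrable M (%x. B * f x)" using f by simp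
 show "AE x in M. norm ((f x)\<^sup>2) <= norm (B * f x)"
 proof (rule AE_I2)
  fix x
  have "norm ((f x)\<^sup>2) = \<bar>f x\<bar> * \<bar>f x\<bar>" by (simp add: power2_eq_square)
  also have "... <= \<bar>B\<bar> * \<bar>f x\<bar>"
   by (intro mult_right_mono order_trans[OF B abs_ge_self]) auto
  finally show "norm ((f x)\<^sup>2) <= norm (B * f x)" by (simp add: abs_mult)
 qed
qed (use f in simp)

text \<open>The point mass at 0 has characteristic function 1; the weighted Parseval identity for it
  is the half of Plancherel that the multiplier estimates use.\<close>

lemma ftrans_L2:
 fixes f :: "'a::euclidean_space => real"
 assumes a: "a > 0" and f: "integrable lborel f" and B: "!!x. \<bar>f x\<bar> <= B"
 shows "integrable (gauss a) (%\<xi>. (cmod (ftrans f \<xi>))\<^sup>2)"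
  and "(\<integral>\<xi>. (cmod (ftrans f \<xi>))\<^sup>2 \<partial>gauss a) <= (sqrt (2 * pi) / a) ^ DIM('a) * (LI x. (f x)\<^sup>2)"
proof -
 interpret G: prob_space "gauss a :: 'a measure" by (rule prob_space_gauss) fact
 have [measurable]: "ftrans f \<in> Bor" by (rule ftrans_measurable) fact
 show "integrable (gauss a) (%\<xi>. (cmod (ftrans f \<xi>))\<^sup>2)"
  by (rule G.integrable_const_bound[of _ "(LI x. \<bar>f x\<bar>)\<^sup>2"])
   (auto intro!: power_mono ftrans_bound f)
 let ?R = "return borel 0 :: 'a measure"
 have R: "prob_space ?R" "sets ?R = sets borel" by (auto intro: prob_space_return)
 have c: "charf ?R \<xi> = 1" for \<xi> unfolding charf_def by (subst integral_return) auto
 have "complex_of_real (\<integral>\<xi>. (cmod (ftrans f \<xi>))\<^sup>2 \<partial>gauss a) = (\<integral>\<xi>. ftrans f \<xi> * cnj (ftrans f \<xi>) * charf ?R \<xi> \<partial>gauss a)"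
  by (simp add: c complex_norm_square[symmetric] flip: integral_of_real of_real_power)
 also have "... = of_real ((sqrt (2 * pi) / a) ^ DIM('a) * smooth_form a ?R f f)"
  by (rule parseval_gauss[OF a f f B R])
 finally have "(\<integral>\<xi>. (cmod (ftrans f \<xi>))\<^sup>2 \<partial>gauss a) = (sqrt (2 * pi) / a) ^ DIM('a) * smooth_form a ?R f f"
  unfolding of_real_eq_iff .
 also have "smooth_form a ?R f f <= (1 * (LI x. (f x)\<^sup>2) + (LI x. (f x)\<^sup>2) / 1) / 2"
  by (rule order_trans[OF abs_ge_self smooth_form_le[OF f f _ _ B R]])
   (auto intro: integrable_power2_of_bounded f B)
 finally show "(\<integral>\<xi>. (cmod (ftrans f \<xi>))\<^sup>2 \<partial>gauss a) <= (sqrt (2 * pi) / a) ^ DIM('a) * (LI x. (f x)\<^sup>2)"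
  using a by (simp add: mult_left_mono)
qed

text \<open>The Gaussian in the multiplier bound is itself the characteristic function of
  \<open>gauss t\<close>. Parseval therefore reads the low frequencies back as a Gaussian
  correlation of each function with itself, where cancellation can be exploited.\<close>

lemma smooth_form_multiplier_le:
 fixes f g :: "'a::euclidean_space => real" and M :: "'i => 'a measure"
 assumes a: "a > 0" and f: "integrable lborel f" and g: "integrable lborel g"
  and Bf: "!!x. \<bar>f x\<bar> <= Bf" and Bg: "!!x. \<bar>g x\<bar> <= Bg"
  and I: "finite I" and M: "!!i. i \<in> I ==> prob_space (M i)" "!!i. i \<in> I ==> sets (M i) = sets borel"
  and s: "s > 0" and t: "t > 0" and D: "D >= 0"
  and e: "!!\<xi>. cmod (\<Sum>i\<in>I. of_real (c i) * charf (M i) \<xi>) <= eps + D * exp (- (t\<^sup>2 * (norm \<xi>)\<^sup>2) / 2)"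
  and e0: "eps >= 0"
 shows "\<bar>\<Sum>i\<in>I. c i * smooth_form a (M i) f g\<bar> <=
  eps * (s * (LI x. (f x)\<^sup>2) + (LI x. (g x)\<^sup>2) / s) / 2
  + D * (s * smooth_form a (gauss t) f f + smooth_form a (gauss t) g g / s) / 2"
proof -
 interpret G: prob_space "gauss a :: 'a measure" by (rule prob_space_gauss) fact
 have [measurable]: "ftrans f \<in> Bor" "ftrans g \<in> Bor"
  by (auto intro: ftrans_measurable f g)
 have [measurable]: "charf (M i) \<in> Bor" if "i \<in> I" for i
  using that M by (intro charf_measurable)
 have gt: "prob_space (gauss t :: 'a measure)" "sets (gauss t :: 'a measure) = sets borel"
  using t by (auto intro: prob_space_gauss)
 let ?K = "(sqrt (2 * pi) / a) ^ DIM('a)"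
 have K: "?K > 0" using a by simp
 let ?m = "%\<xi>. \<Sum>i\<in>I. of_real (c i) * charf (M i) \<xi>"
 let ?E = "%\<xi>::'a. exp (- (t\<^sup>2 * (norm \<xi>)\<^sup>2) / 2)"
 have gen: "eps * (s * (K * A) + (K * B) / s) / 2 + D * (s * (K * A') + (K * B') / s) / 2 =
   K * (eps * (s * A + B / s) / 2 + D * (s * A' + B' / s) / 2)" for K A B A' B' :: real
  by (simp add: algebra_simps add_divide_distrib)
 have low: "(\<integral>\<xi>. (cmod (ftrans h \<xi>))\<^sup>2 * ?E \<xi> \<partial>gauss a) = ?K * smooth_form a (gauss t) h h"
  "integrable (gauss a) (%\<xi>. (cmod (ftrans h \<xi>))\<^sup>2 * ?E \<xi>)"
  if h: "integrable lborel h" and B: "!!x. \<bar>h x\<bar> <= B" for h B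
 proof -
  have [measurable]: "ftrans h \<in> Bor" by (rule ftrans_measurable) fact
  have "complex_of_real (\<integral>\<xi>. (cmod (ftrans h \<xi>))\<^sup>2 * ?E \<xi> \<partial>gauss a) = (\<integral>\<xi>. ftrans h \<xi> * cnj (ftrans h \<xi>) * charf (gauss t) \<xi> \<partial>gauss a)"
   using t by (simp add: charf_gauss complex_norm_square[symmetric] flip: integral_of_real of_real_power of_real_mult)
  also have "... = of_real (?K * smooth_form a (gauss t) h h)"
   by (rule parseval_gauss[OF a h h B gt])
  finally show "(\<integral>\<xi>. (cmod (ftrans h \<xi>))\<^sup>2 * ?E \<xi> \<partial>gauss a) = ?K * smooth_form a (gauss t) h h"
   unfolding of_real_eq_iff .
  show "integrable (gauss a) (%\<xi>. (cmod (ftrans h \<xi>))\<^sup>2 * ?E \<xi>)"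
   by (rule Bochner_Integration.integrable_bound[OF ftrans_L2(1)[OF a h B]])
    (auto simp: abs_mult mult_left_le)
 qed
 have int: "integrable (gauss a) (%\<xi>. ftrans f \<xi> * cnj (ftrans g \<xi>) * charf (M i) \<xi>)" if "i \<in> I" for i
 proof (rule G.integrable_const_bound[of _ "(LI x. \<bar>f x\<bar>) * (LI x. \<bar>g x\<bar>) * 1"])
  show "AE \<xi> in gauss a. norm (ftrans f \<xi> * cnj (ftrans g \<xi>) * charf (M i) \<xi>) <= (LI x. \<bar>f x\<bar>) * (LI x. \<bar>g x\<bar>) * 1"
   unfolding norm_mult complex_mod_cnj
   by (intro AE_I2 mult_mono ftrans_bound f g cmod_charf_le_1 M that) auto
 qed (use that in measurable)
 have "of_real (?K * (\<Sum>i\<in>I. c i * smooth_form a (M i) f g)) = (\<Sum>i\<in>I. of_real (c i) * (\<integral>\<xi>. ftrans f \<xi> * cnj (ftrans g \<xi>) * charf (M i) \<xi> \<partial>gauss a))"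
  unfolding sum_distrib_left of_real_sum
  by (intro sum.cong refl, subst parseval_gauss[OF a f g Bg M]) auto
 also have "... = (\<integral>\<xi>. ftrans f \<xi> * cnj (ftrans g \<xi>) * ?m \<xi> \<partial>gauss a)"
  using int by (simp add: sum_distrib_left mult_ac flip: integral_sum)
 finally have eq: "of_real (?K * (\<Sum>i\<in>I. c i * smooth_form a (M i) f g)) = (\<integral>\<xi>. ftrans f \<xi> * cnj (ftrans g \<xi>) * ?m \<xi> \<partial>gauss a)" .
 have "?K * \<bar>\<Sum>i\<in>I. c i * smooth_form a (M i) f g\<bar> = cmod (\<integral>\<xi>. ftrans f \<xi> * cnj (ftrans g \<xi>) * ?m \<xi> \<partial>gauss a)"
  unfolding eq[symmetric] norm_of_real abs_mult using K by simp
 also have "... <= (\<integral>\<xi>. eps * (s * (cmod (ftrans f \<xi>))\<^sup>2 + (cmod (ftrans g \<xi>))\<^sup>2 / s) / 2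
   + D * (s * ((cmod (ftrans f \<xi>))\<^sup>2 * ?E \<xi>) + ((cmod (ftrans g \<xi>))\<^sup>2 * ?E \<xi>) / s) / 2 \<partial>gauss a)"
 proof (rule Bochner_Integration.integral_norm_bound_integral)
  show "integrable (gauss a) (%\<xi>. ftrans f \<xi> * cnj (ftrans g \<xi>) * ?m \<xi>)"
   unfolding sum_distrib_left using int by (intro Bochner_Integration.integrable_sum) (simp add: mult.left_commute)
  show "integrable (gauss a) (%\<xi>. eps * (s * (cmod (ftrans f \<xi>))\<^sup>2 + (cmod (ftrans g \<xi>))\<^sup>2 / s) / 2
   + D * (s * ((cmod (ftrans f \<xi>))\<^sup>2 * ?E \<xi>) + ((cmod (ftrans g \<xi>))\<^sup>2 * ?E \<xi>) / s) / 2)"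
   using ftrans_L2(1)[OF a f Bf] ftrans_L2(1)[OF a g Bg] low(2)[OF f Bf] low(2)[OF g Bg] by simp
  fix \<xi> :: 'a
  let ?p = "cmod (ftrans f \<xi>)" and ?q = "cmod (ftrans g \<xi>)"
  have "0 <= (s * ?p - ?q)\<^sup>2 / (2 * s)" using s by simp
  also have "... = (s * ?p\<^sup>2 + ?q\<^sup>2 / s) / 2 - ?p * ?q"
   using s by (simp add: power2_diff field_simps power2_eq_square)
  finally have pq: "?p * ?q <= (s * ?p\<^sup>2 + ?q\<^sup>2 / s) / 2" by simp
  have "norm (ftrans f \<xi> * cnj (ftrans g \<xi>) * ?m \<xi>) <= (?p * ?q) * (eps + D * ?E \<xi>)"
   unfolding norm_mult complex_mod_cnj by (intro mult_left_mono e) auto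
  also have "... <= (s * ?p\<^sup>2 + ?q\<^sup>2 / s) / 2 * (eps + D * ?E \<xi>)"
   using e0 D by (intro mult_right_mono pq) auto
  also have "... = eps * (s * ?p\<^sup>2 + ?q\<^sup>2 / s) / 2 + D * (s * (?p\<^sup>2 * ?E \<xi>) + (?q\<^sup>2 * ?E \<xi>) / s) / 2"
   by (simp add: field_simps)
  finally show "norm (ftrans f \<xi> * cnj (ftrans g \<xi>) * ?m \<xi>) <= ..." .
 qed
 also have "... = eps * (s * (\<integral>\<xi>. (cmod (ftrans f \<xi>))\<^sup>2 \<partial>gauss a) + (\<integral>\<xi>. (cmod (ftrans g \<xi>))\<^sup>2 \<partial>gauss a) / s) / 2
   + D * (s * (?K * smooth_form a (gauss t) f f) + (?K * smooth_form a (gauss t) g g) / s) / 2"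
  using ftrans_L2(1)[OF a f Bf] ftrans_L2(1)[OF a g Bg] low(2)[OF f Bf] low(2)[OF g Bg]
  unfolding low(1)[OF f Bf, symmetric] low(1)[OF g Bg, symmetric] by simp
 also have "... <= eps * (s * (?K * (LI x. (f x)\<^sup>2)) + (?K * (LI x. (g x)\<^sup>2)) / s) / 2
   + D * (s * (?K * smooth_form a (gauss t) f f) + (?K * smooth_form a (gauss t) g g) / s) / 2"
  using ftrans_L2(2)[OF a f Bf] ftrans_L2(2)[OF a g Bg] s e0
  by (intro add_right_mono divide_right_mono mult_left_mono add_mono) auto
 also have "... = ?K * (eps * (s * (LI x. (f x)\<^sup>2) + (LI x. (g x)\<^sup>2) / s) / 2
  + D * (s * smooth_form a (gauss t) f f + smooth_form a (gauss t) g g / s) / 2)"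
  by (rule gen)
 finally show ?thesis
  using K by (simp only: mult_le_cancel_left_pos)
qed

text \<open>Lebesgue measure is invariant under the random shift z, so x + z avoids the null set for
  almost every pair, and dominated convergence applies at the points of continuity.\<close>

lemma smooth_form_tendsto:
 fixes f g :: "'a::euclidean_space => real" and M :: "'a measure"
 assumes f: "integrable lborel f" and g[measurable]: "g \<in> Bor"
  and B: "!!x. \<bar>g x\<bar> <= B" and M: "prob_space M" "sets M = sets borel"
  and N: "N \<in> null_sets lborel" and c: "!!y. y \<notin> N ==> isCont g y"
 shows "(%n. smooth_form (real (Suc n)) M f g) \<longlonglongrightarrow> conv_form M f g"
proof -
 interpret M: prob_space M by fact
 interpret G: prob_space "gauss 1 :: 'a measure" by (rule prob_space_gauss) simp
 interpret MG: pair_prob_space M "gauss 1 :: 'a measure" ..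
 interpret LG: pair_sigma_finite "lborel :: 'a measure" "M \<Otimes>\<^sub>M (gauss 1 :: 'a measure)"
  by (intro pair_sigma_finite.intro sigma_finite_lborel MG.P.sigma_finite_measure_axioms)
 note M(2) [measurable_cong]
 have [measurable]: "f \<in> Bor" using f by auto
 have [measurable]: "N \<in> sets borel" using N by auto
 let ?L = "lborel \<Otimes>\<^sub>M (M \<Otimes>\<^sub>M (gauss 1 :: 'a measure))"
 have cf: "conv_form M f g = (\<integral>q. f (fst q) * g (fst q + fst (snd q)) \<partial>?L)"
  unfolding conv_form_def
 proof -
  have "(\<integral>q. f (fst q) * g (fst q + fst (snd q)) \<partial>?L) = (LI x. (\<integral>q. f x * g (x + fst q) \<partial>(M \<Otimes>\<^sub>M (gauss 1 :: 'a measure))))"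
   using LG.integral_fst'[OF smooth_form_integrable[OF f g B M, of 0], symmetric] by simp
  also have "... = (LI x. (\<integral>z. f x * g (x + z) \<partial>M))"
  proof (intro Bochner_Integration.integral_cong refl)
   fix x :: 'a
   have "integrable M (%z. f x * g (x + z))"
    by (rule M.integrable_const_bound[of _ "\<bar>f x\<bar> * B"]) (auto simp: abs_mult intro!: mult_left_mono B)
   from integral_mult_pair(2)[OF M.sigma_finite_measure_axioms G.sigma_finite_measure_axioms this, of "%_. 1"]
   show "(\<integral>q. f x * g (x + fst q) \<partial>(M \<Otimes>\<^sub>M (gauss 1 :: 'a measure))) = (\<integral>z. f x * g (x + z) \<partial>M)"
    using G.prob_space by simp
  qed
  finally show "(LI x. (\<integral>z. f x * g (x + z) \<partial>M)) = (\<integral>q. f (fst q) * g (fst q + fst (snd q)) \<partial>?L)" by simp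
 qed
 have nn: "(\<integral>\<^sup>+q. indicator N (fst q + fst (snd q)) \<partial>?L) = 0"
 proof -
  have "(\<integral>\<^sup>+q. indicator N (fst q + fst (snd q)) \<partial>?L) = (\<integral>\<^sup>+p. (LN x. indicator N (x + fst p)) \<partial>(M \<Otimes>\<^sub>M (gauss 1 :: 'a measure)))"
   by (subst LG.nn_integral_snd [symmetric]) (simp_all)
  also have "... = (\<integral>\<^sup>+p. (LN x. indicator N x) \<partial>(M \<Otimes>\<^sub>M (gauss 1 :: 'a measure)))"
   by (subst lborel_nn_integral_shift[of "indicator N"]) simp_all
  finally show ?thesis using N by (simp add: null_setsD1)
 qed
 have ae: "AE q in ?L. fst q + fst (snd q) \<notin> N"
  using nn by (subst (asm) nn_integral_0_iff_AE) (auto simp: indicator_def split: if_splits)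
 show ?thesis
  unfolding smooth_form_def cf
 proof (rule integral_dominated_convergence[where w="%q. \<bar>f (fst q) * B\<bar>"])
  show "integrable ?L (%q. \<bar>f (fst q) * B\<bar>)"
   using integral_mult_pair(1)[OF sigma_finite_lborel MG.P.sigma_finite_measure_axioms f, of "%_. B"]
   by (intro integrable_abs) simp
  show "AE q in ?L. (%n. f (fst q) * g (fst q + fst (snd q) - (1 / real (Suc n)) *\<^sub>R snd (snd q))) \<longlonglongrightarrow> f (fst q) * g (fst q + fst (snd q))"
   using ae
  proof (eventually_elim, intro tendsto_mult tendsto_const)
   fix q :: "'a \<times> 'a \<times> 'a" assume q: "fst q + fst (snd q) \<notin> N"
   have "(%n. fst q + fst (snd q) - (1 / real (Suc n)) *\<^sub>R snd (snd q)) \<longlonglongrightarrow> fst q + fst (snd q) - 0 *\<^sub>R snd (snd q)"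
    using LIMSEQ_inverse_real_of_nat by (intro tendsto_intros) (simp add: inverse_eq_divide)
   thus "(%n. g (fst q + fst (snd q) - (1 / real (Suc n)) *\<^sub>R snd (snd q))) \<longlonglongrightarrow> g (fst q + fst (snd q))"
    by (intro isCont_tendsto_compose[OF c[OF q]]) simp
  qed
  show "AE q in ?L. norm (f (fst q) * g (fst q + fst (snd q) - (1 / real (Suc n)) *\<^sub>R snd (snd q))) <= \<bar>f (fst q) * B\<bar>" for n
   by (auto simp: abs_mult intro!: mult_left_mono order_trans[OF B abs_ge_self])
 qed measurable
qed

text \<open>The limit of large \<open>a\<close> in the weighted inequality; the Gaussian weight
  disappears here, and almost everywhere continuity is the price.\<close>

lemma conv_form_multiplier_le:
 fixes f g :: "'a::euclidean_space => real" and M :: "'i => 'a measure"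
 assumes f: "integrable lborel f" and g: "integrable lborel g"
  and Bf: "!!x. \<bar>f x\<bar> <= Bf" and Bg: "!!x. \<bar>g x\<bar> <= Bg"
  and Nf: "Nf \<in> null_sets lborel" "!!y. y \<notin> Nf ==> isCont f y"
  and Ng: "Ng \<in> null_sets lborel" "!!y. y \<notin> Ng ==> isCont g y"
  and I: "finite I" and M: "!!i. i \<in> I ==> prob_space (M i)" "!!i. i \<in> I ==> sets (M i) = sets borel"
  and s: "s > 0" and t: "t > 0" and D: "D >= 0"
  and e: "!!\<xi>. cmod (\<Sum>i\<in>I. of_real (c i) * charf (M i) \<xi>) <= eps + D * exp (- (t\<^sup>2 * (norm \<xi>)\<^sup>2) / 2)"
  and e0: "eps >= 0"
 shows "\<bar>\<Sum>i\<in>I. c i * conv_form (M i) f g\<bar> <=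
  eps * (s * (LI x. (f x)\<^sup>2) + (LI x. (g x)\<^sup>2) / s) / 2
  + D * (s * conv_form (gauss t) f f + conv_form (gauss t) g g / s) / 2"
proof (rule LIMSEQ_le)
 have [measurable]: "f \<in> Bor" "g \<in> Bor" using f g by auto
 have gt: "prob_space (gauss t :: 'a measure)" "sets (gauss t :: 'a measure) = sets borel"
  using t by (auto intro: prob_space_gauss)
 show "(%n. \<bar>\<Sum>i\<in>I. c i * smooth_form (real (Suc n)) (M i) f g\<bar>) \<longlonglongrightarrow> \<bar>\<Sum>i\<in>I. c i * conv_form (M i) f g\<bar>"
  by (intro tendsto_rabs tendsto_sum tendsto_mult tendsto_const smooth_form_tendsto[OF f _ Bg M Ng]) auto
 show "(%n. eps * (s * (LI x. (f x)\<^sup>2) + (LI x. (g x)\<^sup>2) / s) / 2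
  + D * (s * smooth_form (real (Suc n)) (gauss t) f f + smooth_form (real (Suc n)) (gauss t) g g / s) / 2)
 \<longlonglongrightarrow> eps * (s * (LI x. (f x)\<^sup>2) + (LI x. (g x)\<^sup>2) / s) / 2
  + D * (s * conv_form (gauss t) f f + conv_form (gauss t) g g / s) / 2"
  using s by (intro tendsto_intros smooth_form_tendsto[OF f _ Bf gt Nf] smooth_form_tendsto[OF g _ Bg gt Ng]) auto
 show "\<exists>N. \<forall>n\<ge>N. \<bar>\<Sum>i\<in>I. c i * smooth_form (real (Suc n)) (M i) f g\<bar> <= eps * (s * (LI x. (f x)\<^sup>2) + (LI x. (g x)\<^sup>2) / s) / 2
  + D * (s * smooth_form (real (Suc n)) (gauss t) f f + smooth_form (real (Suc n)) (gauss t) g g / s) / 2"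
  by (intro exI[of _ 0] allI impI smooth_form_multiplier_le[OF _ f g Bf Bg I M s t D e e0]) auto
qed

section \<open>Spherical averages\<close>

lemma DERIV_integral_bounded:
 fixes F D :: "real => 'a => real"
 assumes "finite_measure M"
  and F: "!!t. integrable M (F t)"
  and D: "D t0 \<in> borel_measurable M"
  and der: "!!t \<omega>. \<omega> \<in> space M ==> ((%t. F t \<omega>) has_real_derivative D t \<omega>) (at t)"
  and B: "!!t \<omega>. \<omega> \<in> space M ==> \<bar>D t \<omega>\<bar> <= B"
 shows "((%t. \<integral>\<omega>. F t \<omega> \<partial>M) has_real_derivative (\<integral>\<omega>. D t0 \<omega> \<partial>M)) (at t0)"
proof -
 interpret finite_measure M by fact
 have [measurable]: "F t \<in> borel_measurable M" for t using F by auto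
 note D [measurable]
 show ?thesis
  unfolding DERIV_def tendsto_at_iff_sequentially comp_def
 proof (intro allI impI)
  fix X :: "nat => real"
  assume X: "\<forall>i. X i \<in> UNIV - {0}" "X \<longlonglongrightarrow> 0"
  have "(%i. \<integral>\<omega>. (F (t0 + X i) \<omega> - F t0 \<omega>) / X i \<partial>M) \<longlonglongrightarrow> (\<integral>\<omega>. D t0 \<omega> \<partial>M)"
  proof (rule integral_dominated_convergence[where w="%_. B"])
   show "AE \<omega> in M. (%i. (F (t0 + X i) \<omega> - F t0 \<omega>) / X i) \<longlonglongrightarrow> D t0 \<omega>"
   proof (rule AE_I2)
    fix \<omega> assume "\<omega> \<in> space M"
    from der[OF this, of t0] X show "(%i. (F (t0 + X i) \<omega> - F t0 \<omega>) / X i) \<longlonglongrightarrow> D t0 \<omega>"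
     unfolding DERIV_def tendsto_at_iff_sequentially comp_def by auto
   qed
   show "AE \<omega> in M. norm ((F (t0 + X i) \<omega> - F t0 \<omega>) / X i) <= B" for i
   proof (rule AE_I2)
    fix \<omega> assume w: "\<omega> \<in> space M"
    have "\<bar>F (t0 + X i) \<omega> - F t0 \<omega>\<bar> <= B * \<bar>t0 + X i - t0\<bar>"
     using field_differentiable_bound[of UNIV "%t. F t \<omega>" "%t. D t \<omega>" B "t0 + X i" t0] der[OF w] B[OF w] by simp
    thus "norm ((F (t0 + X i) \<omega> - F t0 \<omega>) / X i) <= B"
     using X(1) by (simp add: divide_le_eq abs_mult)
   qed
  qed auto
  thus "(%i. ((\<integral>\<omega>. F (t0 + X i) \<omega> \<partial>M) - (\<integral>\<omega>. F t0 \<omega> \<partial>M)) / X i) \<longlonglongrightarrow> (\<integral>\<omega>. D t0 \<omega> \<partial>M)"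
   using F by (simp add: Bochner_Integration.integral_diff)
 qed
qed

lemma matrix_vector_mult_measurable [measurable (raw)]:
 fixes f :: "'x => real^'n^'m"
 assumes "f \<in> borel_measurable M" "g \<in> borel_measurable M"
 shows "(%x. f x *v g x) \<in> borel_measurable M"
proof -
 have "(%p. fst p *v snd p :: real^'m) \<in> borel_measurable (borel \<Otimes>\<^sub>M (borel :: (real^'n) measure))"
  unfolding borel_prod matrix_vector_mult_def
  by (intro borel_measurable_continuous_onI continuous_intros)
 from measurable_compose[OF measurable_Pair[OF assms] this] show ?thesis by simp
qed

lemma matrix_matrix_mult_measurable [measurable (raw)]:
 fixes f :: "'x => real^'n^'m" and g :: "'x => real^'k^'n"
 assumes "f \<in> borel_measurable M" "g \<in> borel_measurable M"
 shows "(%x. f x ** g x) \<in> borel_measurable M"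
proof -
 have "(%p. fst p ** snd p :: real^'k^'m) \<in> borel_measurable (borel \<Otimes>\<^sub>M (borel :: (real^'k^'n) measure))"
  unfolding borel_prod matrix_matrix_mult_def
  by (intro borel_measurable_continuous_onI continuous_intros)
 from measurable_compose[OF measurable_Pair[OF assms] this] show ?thesis by simp
qed

lemma transpose_measurable [measurable]:
 "(transpose :: real^'n^'m => _) \<in> Bor"
 unfolding transpose_def by (intro borel_measurable_continuous_onI continuous_intros)

lemma vec_nth_measurable [measurable (raw)]:
 fixes f :: "'x => real^'n"
 assumes "f \<in> borel_measurable M"
 shows "(%x. f x $ i) \<in> borel_measurable M"
proof -
 have "(%x::real^'n. x $ i) \<in> Bor"
  by (intro borel_measurable_continuous_onI continuous_intros)
 from measurable_compose[OF assms this] show ?thesis .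
qed

section \<open>Invariance properties of the Haar measure\<close>

locale haar_orthogonal =
 fixes H :: "(real^'n^'n) measure"
 assumes haar: "normalized_haar_orthogonal H"
begin

abbreviation nn_haar (binder "HN " 10) where "nn_haar f \<equiv> nn_integral H f"
abbreviation int_haar (binder "HI " 10) where "int_haar f \<equiv> integral\<^sup>L H (f :: _ \<Rightarrow> 'b::{banach, second_countable_topology})"

sublocale prob_space H
 using haar by (simp add: normalized_haar_orthogonal_def)

lemma sets_H: "sets H = sets (restrict_space borel {R. orthogonal_matrix R})"
 using haar by (simp add: normalized_haar_orthogonal_def)

lemma space_H: "space H = {R. orthogonal_matrix R}"
 using sets_eq_imp_space_eq[OF sets_H] by (simp add: space_restrict_space)

lemma measurable_H [measurable (raw)]: "f \<in> borel \<rightarrow>\<^sub>M N ==> f \<in> H \<rightarrow>\<^sub>M N"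
 using measurable_restrict_space1[of f borel N] measurable_cong_sets[OF sets_H refl] by blast

lemma measurable_H_id [measurable]: "(%R. R) \<in> borel_measurable H"
 by (rule measurable_H) simp

text \<open>The push-forward of \<open>H\<close> to all matrices, where integrands only have to be
  Borel on the full matrix space.\<close>

abbreviation "HB \<equiv> distr H borel (%R. R)"

lemma left_mult_distr:
 assumes Q: "orthogonal_matrix Q"
 shows "distr H borel (%R. Q ** R) = HB"
proof -
 have m: "(%R. Q ** R) \<in> H \<rightarrow>\<^sub>M H"
 proof -
  have "(%R. Q ** R) \<in> H \<rightarrow>\<^sub>M restrict_space borel {R. orthogonal_matrix R}"
   by (rule measurable_restrict_space2) (auto simp: space_H orthogonal_matrix_mul Q)
  thus ?thesis using measurable_cong_sets[OF refl sets_H] by blast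
 qed
 have "HB = distr (distr H H (%R. Q ** R)) borel (%R. R)"
  using haar Q by (simp add: normalized_haar_orthogonal_def)
 also have "... = distr H borel (%R. Q ** R)"
  by (subst distr_distr[OF _ m]) (auto simp: comp_def)
 finally show ?thesis ..
qed

lemma nn_integral_HB: "F \<in> Bor ==> (\<integral>\<^sup>+R. F R \<partial>HB) = (HN R. F R)"
 by (simp add: nn_integral_distr)

lemma nn_integral_left_mult:
 assumes "orthogonal_matrix Q" and [measurable]: "F \<in> Bor"
 shows "(HN R. F (Q ** R)) = (HN R. F R)"
 using nn_integral_distr[of "%R. Q ** R" H borel F] left_mult_distr[OF assms(1)] nn_integral_HB[of F] by simp

text \<open>Integrate F(T^t R) over both variables: with R innermost, left invariance gives the
  integral of F; with T innermost, it gives the integral of F after transposition.\<close>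

lemma nn_integral_transpose:
 assumes F[measurable]: "F \<in> Bor"
 shows "(HN R. F (transpose R)) = (HN R. F R)"
proof -
 interpret HH: pair_prob_space H H ..
 have "(HN T. (HN R. F (transpose T ** R))) = (HN T. (HN R. F R))"
  by (intro nn_integral_cong nn_integral_left_mult) (auto simp: space_H)
 hence "(HN R. F R) = (HN T. (HN R. F (transpose T ** R)))"
  by (simp add: emeasure_space_1)
 also have "... = (HN R. (HN T. F (transpose T ** R)))"
  by (rule HH.Fubini'[symmetric]) measurable
 also have "... = (HN R. (HN T. F (transpose (transpose R ** T))))"
  by (simp add: matrix_transpose_mul)
 also have "... = (HN R. (HN T. F (transpose T)))"
  by (intro nn_integral_cong nn_integral_left_mult[of _ "%T. F (transpose T)"]) (auto simp: space_H)
 finally show ?thesis by (simp add: emeasure_space_1)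
qed

text \<open>Transposition turns multiplication on the right into multiplication on the left.\<close>

lemma nn_integral_right_mult:
 assumes Q: "orthogonal_matrix Q" and [measurable]: "F \<in> Bor"
 shows "(HN R. F (R ** Q)) = (HN R. F R)"
proof -
 have "(HN R. F (R ** Q)) = (HN R. F (transpose R ** Q))"
  by (subst nn_integral_transpose[of "%R. F (R ** Q)"]) simp_all
 also have "... = (HN R. F (transpose (transpose Q ** R)))"
  by (simp add: matrix_transpose_mul)
 also have "... = (HN R. F (transpose R))"
  by (rule nn_integral_left_mult[of _ "%R. F (transpose R)"]) (auto simp: Q)
 also have "... = (HN R. F R)"
  by (rule nn_integral_transpose) simp
 finally show ?thesis .
qed

lemma right_mult_distr:
 assumes Q: "orthogonal_matrix Q"
 shows "distr H borel (%R. R ** Q) = HB"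
proof (rule measure_eqI)
 fix A assume "A \<in> sets (distr H borel (%R. R ** Q))"
 hence A: "A \<in> sets borel" by simp
 have "emeasure (distr H borel (%R. R ** Q)) A = (HN R. indicator A (R ** Q))"
  using A by (subst nn_integral_indicator[symmetric], simp, subst nn_integral_distr) auto
 also have "... = emeasure HB A"
  using A by (subst nn_integral_right_mult[OF Q], simp, subst nn_integral_indicator[symmetric], simp, subst nn_integral_distr) auto
 finally show "emeasure (distr H borel (%R. R ** Q)) A = emeasure HB A" .
qed simp

lemma integral_left_mult:
 fixes F :: "_ => 'b::{banach,second_countable_topology}"
 assumes "orthogonal_matrix Q" and [measurable]: "F \<in> Bor"
 shows "(HI R. F (Q ** R)) = (HI R. F R)"
 using integral_distr[of "%R. Q ** R" H borel F] integral_distr[of "%R. R" H borel F] left_mult_distr[OF assms(1)] by simp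

lemma integral_right_mult:
 fixes F :: "_ => 'b::{banach,second_countable_topology}"
 assumes "orthogonal_matrix Q" and [measurable]: "F \<in> Bor"
 shows "(HI R. F (R ** Q)) = (HI R. F R)"
 using integral_distr[of "%R. R ** Q" H borel F] integral_distr[of "%R. R" H borel F] right_mult_distr[OF assms(1)] by simp

section \<open>Spherical measures and their Fourier multiplier\<close>

definition sph :: "real^'n => (real^'n) measure" where
 "sph w = distr H borel (%R. R *v w)"

lemma sets_sph [simp, measurable_cong]: "sets (sph w) = sets borel"
 by (simp add: sph_def)

lemma prob_space_sph: "prob_space (sph w)"
 unfolding sph_def by (rule prob_space_distr) simp

text \<open>An orthogonal map that takes one vector to the other is absorbed by right
  invariance.\<close>

lemma sph_cong:
 assumes "norm w = norm w'"
 shows "sph w = sph w'"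
proof -
 obtain f where f: "orthogonal_transformation f" "f w = w'"
  using orthogonal_transformation_exists[OF assms] by metis
 let ?Q = "matrix f"
 have Q: "orthogonal_matrix ?Q" "?Q *v w = w'"
  using f by (auto simp: orthogonal_transformation_matrix)
 have "sph w' = distr H borel (%R. (R ** ?Q) *v w)"
  unfolding sph_def by (simp add: matrix_vector_mul_assoc[symmetric] Q)
 also have "... = distr (distr H borel (%R. R ** ?Q)) borel (%R. R *v w)"
  by (subst distr_distr) (auto simp: comp_def)
 also have "... = sph w"
  unfolding right_mult_distr[OF Q(1)] by (subst distr_distr) (auto simp: comp_def sph_def)
 finally show ?thesis ..
qed

definition axis0 :: "real^'n" where "axis0 = axis undefined 1"

lemma norm_axis0 [simp]: "norm axis0 = 1"
 by (simp add: axis0_def)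

text \<open>The Fourier transform of the normalised unit sphere as a function of the radius: a
  Bessel function up to a constant and a power of r. As an average over \<open>H\<close> it can be
  differentiated under the integral.\<close>

definition sphm :: "real => real" where
 "sphm r = (HI R. cos (r * (axis0 \<bullet> (R *v axis0))))"

lemma charf_sph: "charf (sph w) \<xi> = of_real (sphm (norm w * norm \<xi>))"
proof -
 obtain S where S: "orthogonal_transformation S" "S axis0 = \<xi> /\<^sub>R norm \<xi> | \<xi> = 0"
 proof (cases "\<xi> = 0")
  case True
  show ?thesis by (rule that[of id]) (auto simp: True orthogonal_transformation linear_id)
 next
  case False
  hence "norm axis0 = norm (\<xi> /\<^sub>R norm \<xi>)" by simp
  from orthogonal_transformation_exists[OF this] that show ?thesis by metis
 qed
 let ?S = "matrix S"
 have Sm: "orthogonal_matrix ?S" "\<xi> = norm \<xi> *\<^sub>R (?S *v axis0)"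
  using S by (cases "\<xi> = 0"; auto simp: orthogonal_transformation_matrix)+
 have norms: "norm w = norm (norm w *\<^sub>R axis0)" by simp
 let ?r = "norm w * norm \<xi>"
 let ?s = "%R::real^'n^'n. ?r * (axis0 \<bullet> (R *v axis0))"
 have "charf (sph w) \<xi> = charf (sph (norm w *\<^sub>R axis0)) \<xi>"
  using sph_cong[OF norms] by simp
 also have "... = (HI R. cis (\<xi> \<bullet> (R *v (norm w *\<^sub>R axis0))))"
  unfolding charf_def sph_def by (subst integral_distr) auto
 also have "... = (HI R. cis (?s (transpose ?S ** R)))"
 proof -
  have "(?S *v axis0) \<bullet> x = axis0 \<bullet> (transpose ?S *v x)" for x
   by (metis dot_lmul_matrix inner_commute transpose_matrix_vector)
  hence "\<xi> \<bullet> (R *v (norm w *\<^sub>R axis0)) = ?s (transpose ?S ** R)" for R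
   by (subst Sm(2)) (simp add: matrix_vector_mul_assoc[symmetric] matrix_vector_mult_scaleR)
  thus ?thesis by simp
 qed
 also have "... = (HI R. cis (?s R))"
  using Sm(1) by (intro integral_left_mult) auto
 finally have 1: "charf (sph w) \<xi> = (HI R. cis (?s R))" .
 have i: "integrable H (%R. cis (?s R))"
  by (rule integrable_const_bound[of _ 1]) (auto)
 \<comment> \<open>Invariance under the antipodal map kills the sine part, so the multiplier is
   real.\<close>
 have neg: "orthogonal_matrix (- mat 1 :: real^'n^'n)"
 proof -
  have "orthogonal_transformation (uminus :: real^'n => _)"
   unfolding orthogonal_transformation_def by (auto intro!: linearI)
  moreover have "matrix (uminus :: real^'n => real^'n) = - mat 1"
   by (simp add: matrix_def mat_def vec_eq_iff axis_def)
  ultimately show ?thesis by (metis orthogonal_transformation_matrix)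
 qed
 have "(HI R. sin (?s R)) = (HI R. sin (?s (- mat 1 ** R)))"
  by (rule integral_left_mult[symmetric, OF neg]) auto
 also have "... = (HI R. - sin (?s R))"
 proof -
  have "- mat 1 *v x = - x" for x :: "real^'n"
  proof -
   have "(- mat 1 :: real^'n^'n) = (- 1) *\<^sub>R mat 1" by simp
   thus ?thesis by (simp only: scaleR_matrix_vector_assoc[symmetric]) simp
  qed
  thus ?thesis by (simp add: matrix_vector_mul_assoc[symmetric])
 qed
 also have "... = - (HI R. sin (?s R))"
  by (rule Bochner_Integration.integral_minus)
 finally have "(HI R. sin (?s R)) = 0" by simp
 hence "Im (HI R. cis (?s R)) = 0" "Re (HI R. cis (?s R)) = sphm ?r"
  using integral_Im[OF i] integral_Re[OF i] by (simp_all add: sphm_def)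
 thus ?thesis unfolding 1 by (simp add: complex_eq_iff)
qed

lemma abs_sphm_le_1: "\<bar>sphm r\<bar> <= 1"
proof -
 have "\<bar>sphm r\<bar> <= (HI R. \<bar>cos (r * (axis0 \<bullet> (R *v axis0)))\<bar>)"
  unfolding sphm_def by (rule integral_abs_bound)
 also have "... <= (HI R. 1)"
  by (rule integral_mono) (auto intro!: integrable_const_bound[of _ 1])
 finally show ?thesis by (simp add: prob_space)
qed

abbreviation (input) "ct R \<equiv> axis0 \<bullet> (R *v axis0)"

lemma abs_ct_le_1: "R \<in> space H ==> \<bar>ct R\<bar> <= 1"
proof -
 assume "R \<in> space H"
 hence "norm (R *v axis0) = 1"
  using orthogonal_transformation_norm[of "(*v) R" axis0]
  by (simp add: space_H orthogonal_transformation_matrix matrix_of_matrix_vector_mul)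
 thus ?thesis
  using Cauchy_Schwarz_ineq2[of axis0 "R *v axis0"] by simp
qed

text \<open>Differentiating the invariance under plane rotations at the identity; summed over the planes
 containing \<open>axis0\<close> this is the radial Helmholtz equation for the multiplier.\<close>

lemma plane_rotation_identity:
 assumes j: "j ~= (undefined::'n)"
 shows "(HI R. ct R * sin (r * ct R) - r * ((R *v axis0) $ j)\<^sup>2 * cos (r * ct R)) = 0"
proof -
 define k :: 'n where "k = undefined"
 have jk: "j ~= k" using j by (simp add: k_def)
 have ct: "axis0 \<bullet> x = x $ k" for x :: "real^'n"
  by (simp add: axis0_def k_def inner_axis' )
 define rot :: "real => real^'n => real^'n" where
  "rot t x = (\<chi> i. if i = k then cos t * x $ k - sin t * x $ j else if i = j then sin t * x $ k + cos t * x $ j else x $ i)" for t x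
 have rot: "orthogonal_transformation (rot t)" for t
  unfolding orthogonal_transformation_def
 proof (intro conjI allI)
  show "linear (rot t)"
   by (rule linearI) (auto simp: rot_def vec_eq_iff algebra_simps)
  fix x y :: "real^'n"
  have split: "a \<bullet> b = a $ k * b $ k + a $ j * b $ j + (\<Sum>i\<in>UNIV - {k, j}. a $ i * b $ i)" for a b :: "real^'n"
   unfolding inner_vec_def
   by (subst sum.subset_diff[of "{k, j}"]) (use jk in auto)
  have gen: "(c * a - s * b) * (c * a' - s * b') + (s * a + c * b) * (s * a' + c * b') = (s\<^sup>2 + c\<^sup>2) * (a * a' + b * b')"
   for s c a b a' b' :: real
   by (simp add: power2_eq_square algebra_simps)
  have "rot t x $ k * rot t y $ k + rot t x $ j * rot t y $ j = ((sin t)\<^sup>2 + (cos t)\<^sup>2) * (x $ k * y $ k + x $ j * y $ j)"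
   using jk by (simp only: rot_def vec_lambda_beta if_True if_False refl not_False_eq_True gen)
  hence "rot t x $ k * rot t y $ k + rot t x $ j * rot t y $ j = x $ k * y $ k + x $ j * y $ j"
   by simp
  thus "rot t x \<bullet> rot t y = x \<bullet> y"
   unfolding split by (simp add: rot_def)
 qed
 \<comment> \<open>The integrand at angle 0 composed with the rotation by t in the plane of the
   coordinates k and j; by invariance its mean does not depend on t.\<close>
 let ?F = "%t R. (sin t * (R *v axis0) $ k + cos t * (R *v axis0) $ j) * sin (r * (cos t * (R *v axis0) $ k - sin t * (R *v axis0) $ j))"
 have [measurable]: "(%R. (R *v axis0) $ i) \<in> Bor" for i
  by measurable
 let ?D = "%t R. (cos t * (R *v axis0) $ k - sin t * (R *v axis0) $ j) * sin (r * (cos t * (R *v axis0) $ k - sin t * (R *v axis0) $ j))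
   + (sin t * (R *v axis0) $ k + cos t * (R *v axis0) $ j) * (cos (r * (cos t * (R *v axis0) $ k - sin t * (R *v axis0) $ j)) * (r * (- sin t * (R *v axis0) $ k - cos t * (R *v axis0) $ j)))"
 have nb: "\<bar>(R *v axis0) $ i\<bar> <= 1" if "R \<in> space H" for R i
 proof -
  have "norm (R *v axis0) = 1"
   using that orthogonal_transformation_norm[of "(*v) R" axis0]
   by (simp add: space_H orthogonal_transformation_matrix matrix_of_matrix_vector_mul)
  thus ?thesis using component_le_norm_cart[of "R *v axis0" i] by simp
 qed
 have lin: "\<bar>p * x + q * y\<bar> <= 2" "\<bar>p * x - q * y\<bar> <= 2"
  if "\<bar>p\<bar> <= 1" "\<bar>q\<bar> <= 1" "\<bar>x\<bar> <= 1" "\<bar>y\<bar> <= 1" for p q x y :: real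
 proof -
  have "\<bar>p * x\<bar> <= 1" "\<bar>q * y\<bar> <= 1" using that by (simp_all add: abs_mult mult_le_one)
  thus "\<bar>p * x + q * y\<bar> <= 2" "\<bar>p * x - q * y\<bar> <= 2" by linarith+
 qed
 have const: "(HI R. ?F t R) = (HI R. (R *v axis0) $ j * sin (r * (R *v axis0) $ k))" for t
 proof -
  have Q: "orthogonal_matrix (matrix (rot t))" using rot orthogonal_transformation_matrix by blast
  have mv: "matrix (rot t) *v x = rot t x" for x
   using rot[of t] by (simp add: orthogonal_transformation_linear matrix_works)
  have "(HI R. (R *v axis0) $ j * sin (r * (R *v axis0) $ k))
    = (HI R. ((matrix (rot t) ** R) *v axis0) $ j * sin (r * ((matrix (rot t) ** R) *v axis0) $ k))"
   by (rule integral_left_mult[symmetric, OF Q]) measurable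
  also have "... = (HI R. ?F t R)"
   using jk by (simp add: matrix_vector_mul_assoc[symmetric] mv rot_def)
  finally show ?thesis ..
 qed
 have "((%t. (HI R. ?F t R)) has_real_derivative (HI R. ?D 0 R)) (at 0)"
 proof (rule DERIV_integral_bounded[where B="2 * 1 + 2 * (1 * (\<bar>r\<bar> * 2))"])
  show "finite_measure H" by (rule finite_measure_axioms)
  show "integrable H (?F t)" for t
  proof (rule integrable_const_bound[of _ "2 * 1"])
   show "AE R in H. norm (?F t R) <= 2 * 1"
    unfolding real_norm_def abs_mult
    by (intro AE_I2 mult_mono lin nb) auto
  qed measurable
  show "?D 0 \<in> borel_measurable H" by measurable
  show "((%t. ?F t R) has_real_derivative ?D t R) (at t)" for t R
   by (auto intro!: derivative_eq_intros simp: algebra_simps)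
  show "\<bar>?D t R\<bar> <= 2 * 1 + 2 * (1 * (\<bar>r\<bar> * 2))" if R: "R \<in> space H" for t R
  proof (rule order_trans[OF abs_triangle_ineq], rule add_mono)
   show "\<bar>(cos t * (R *v axis0) $ k - sin t * (R *v axis0) $ j) * sin (r * (cos t * (R *v axis0) $ k - sin t * (R *v axis0) $ j))\<bar> <= 2 * 1"
    unfolding abs_mult by (intro mult_mono lin nb R) auto
   show "\<bar>(sin t * (R *v axis0) $ k + cos t * (R *v axis0) $ j) * (cos (r * (cos t * (R *v axis0) $ k - sin t * (R *v axis0) $ j)) * (r * (- sin t * (R *v axis0) $ k - cos t * (R *v axis0) $ j)))\<bar> <= 2 * (1 * (\<bar>r\<bar> * 2))"
    unfolding abs_mult by (intro mult_mono lin nb R) auto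
  qed
 qed
 moreover have "((%t. (HI R. ?F t R)) has_real_derivative 0) (at 0)"
  unfolding const by simp
 ultimately have "(HI R. ?D 0 R) = 0" by (rule DERIV_unique)
 thus ?thesis
  unfolding ct by (simp add: power2_eq_square mult_ac)
qed

lemma DERIV_sphm:
 "(sphm has_real_derivative (HI R. - (ct R * sin (r * ct R)))) (at r)"
 unfolding sphm_def[abs_def]
 by (rule DERIV_integral_bounded[where B=1, OF finite_measure_axioms])
  (auto intro!: integrable_const_bound[of _ 1] derivative_eq_intros mult_le_one abs_ct_le_1 simp: abs_mult)

definition sphm' :: "real => real" where
 "sphm' r = (HI R. - (ct R * sin (r * ct R)))"

lemma DERIV_sphm':
 "(sphm' has_real_derivative (HI R. - ((ct R)\<^sup>2 * cos (r * ct R)))) (at r)"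
 unfolding sphm'_def[abs_def]
proof (rule DERIV_integral_bounded[where B=1, OF finite_measure_axioms])
 show "integrable H (%R. - (ct R * sin (t * ct R)))" for t
  by (rule integrable_const_bound[of _ 1]) (auto intro!: AE_I2 mult_le_one abs_ct_le_1 simp: abs_mult)
 show "((%t. - (ct \<omega> * sin (t * ct \<omega>))) has_real_derivative - ((ct \<omega>)\<^sup>2 * cos (t * ct \<omega>))) (at t)" for t \<omega>
  by (auto intro!: derivative_eq_intros simp: power2_eq_square)
 show "\<bar>- ((ct \<omega>)\<^sup>2 * cos (t * ct \<omega>))\<bar> <= 1" if "\<omega> \<in> space H" for t \<omega>
  using abs_ct_le_1[OF that] by (auto simp: abs_mult power_le_one_iff abs_square_le_1 intro!: mult_le_one)
qed measurable

text \<open>\<open>plane_rotation_identity\<close> is summed over the d - 1 planes through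
  \<open>axis0\<close>; on the unit sphere the squares of the other coordinates add up to one minus
  the square of the first.\<close>

lemma sphm_ode:
 "r * (sphm r + (HI R. - ((ct R)\<^sup>2 * cos (r * ct R)))) = - real (CARD('n) - 1) * sphm' r"
proof -
 have [measurable]: "(%R. (R *v axis0) $ i) \<in> Bor" for i
  by measurable
 define k :: 'n where "k = undefined"
 have ct: "axis0 \<bullet> x = x $ k" for x :: "real^'n"
  by (simp add: axis0_def k_def inner_axis' )
 have nR: "norm (R *v axis0) = 1" if "R \<in> space H" for R
  using that orthogonal_transformation_norm[of "(*v) R" axis0]
  by (simp add: space_H orthogonal_transformation_matrix matrix_of_matrix_vector_mul)
 have nb: "\<bar>(R *v axis0) $ i\<bar> <= 1" if "R \<in> space H" for R i
  using component_le_norm_cart[of "R *v axis0" i] nR[OF that] by simp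
 have i1: "integrable H (%R. ct R * sin (r * ct R))"
  by (rule integrable_const_bound[of _ 1]) (auto intro!: AE_I2 mult_le_one abs_ct_le_1 simp: abs_mult)
 have i2: "integrable H (%R. ((R *v axis0) $ j)\<^sup>2 * cos (r * ct R))" for j
  by (rule integrable_const_bound[of _ 1]) (auto intro!: AE_I2 mult_le_one nb simp: abs_mult abs_square_le_1)
 have i3: "integrable H (%R. cos (r * ct R))"
  by (rule integrable_const_bound[of _ 1]) auto
 have sq: "(\<Sum>j\<in>UNIV - {k}. ((R *v axis0) $ j)\<^sup>2) = 1 - (ct R)\<^sup>2" if "R \<in> space H" for R
 proof -
  have "1 = (norm (R *v axis0))\<^sup>2" using nR[OF that] by simp
  also have "... = (\<Sum>j\<in>UNIV. ((R *v axis0) $ j)\<^sup>2)"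
   unfolding power2_norm_eq_inner inner_vec_def by (simp add: power2_eq_square)
  also have "... = (\<Sum>j\<in>UNIV - {k}. ((R *v axis0) $ j)\<^sup>2) + ((R *v axis0) $ k)\<^sup>2"
   by (subst sum.remove[of UNIV k]) auto
  finally show ?thesis by (simp add: ct)
 qed
 have "0 = (\<Sum>j\<in>UNIV - {k}. (HI R. ct R * sin (r * ct R) - r * (((R *v axis0) $ j)\<^sup>2 * cos (r * ct R))))"
  using plane_rotation_identity[of _ r] by (simp add: k_def mult.assoc)
 also have "... = (\<Sum>j\<in>UNIV - {k}. (HI R. ct R * sin (r * ct R)) - r * (HI R. ((R *v axis0) $ j)\<^sup>2 * cos (r * ct R)))"
  using i1 i2 by simp
 also have "... = - real (CARD('n) - 1) * sphm' r - r * (HI R. (\<Sum>j\<in>UNIV - {k}. ((R *v axis0) $ j)\<^sup>2 * cos (r * ct R)))"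
  using i1 i2 by (simp add: sum_subtractf sum_distrib_left sphm'_def Bochner_Integration.integral_sum left_diff_distrib)
 also have "(HI R. (\<Sum>j\<in>UNIV - {k}. ((R *v axis0) $ j)\<^sup>2 * cos (r * ct R))) = (HI R. cos (r * ct R) - (ct R)\<^sup>2 * cos (r * ct R))"
 proof (intro Bochner_Integration.integral_cong refl)
  fix R assume R: "R \<in> space H"
  have "(\<Sum>j\<in>UNIV - {k}. ((R *v axis0) $ j)\<^sup>2 * cos (r * ct R)) = (1 - (ct R)\<^sup>2) * cos (r * ct R)"
   unfolding sum_distrib_right[symmetric] sq[OF R] ..
  thus "(\<Sum>j\<in>UNIV - {k}. ((R *v axis0) $ j)\<^sup>2 * cos (r * ct R)) = cos (r * ct R) - (ct R)\<^sup>2 * cos (r * ct R)"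
   by (simp add: left_diff_distrib)
 qed
 also have "... = sphm r + (HI R. - ((ct R)\<^sup>2 * cos (r * ct R)))"
  using i3 i2[of k] by (simp add: sphm_def ct)
 finally show ?thesis by simp
qed

text \<open>An energy argument with n = d - 1. The derivative of r^n (m^2 + m'^2) contains
  oscillating terms of relative size 1/r, too large to integrate in absolute value. The cross term n
  r^(n-1) m m' cancels them and leaves E' = O(E / r^2), which keeps E bounded.\<close>

lemma sphm_decay:
 assumes d: "CARD('n) >= 2"
 obtains C where "C > 0" "!!r. r > 0 ==> (sphm r)\<^sup>2 * r ^ (CARD('n) - 1) <= C"
proof -
 define n where "n = CARD('n) - 1"
 have n: "n >= 1" using d by (simp add: n_def)
 define m2 where "m2 r = (HI R. - ((ct R)\<^sup>2 * cos (r * ct R)))" for r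
 have d1: "(sphm has_real_derivative sphm' r) (at r)" for r
  using DERIV_sphm[of r] by (simp add: sphm'_def)
 have d2: "(sphm' has_real_derivative m2 r) (at r)" for r
  using DERIV_sphm'[of r] by (simp add: m2_def)
 have ode: "m2 r = - sphm r - real n / r * sphm' r" if "r > 0" for r
  using sphm_ode[of r] that by (simp add: m2_def n_def field_simps)
 define E where "E r = r ^ n * ((sphm r)\<^sup>2 + (sphm' r)\<^sup>2) + real n * r ^ (n - 1) * (sphm r * sphm' r)" for r
 define E' where "E' r = - (real n * r ^ n * (sphm r * sphm' r) / r\<^sup>2)" for r
 have dE: "(E has_real_derivative E' r) (at r)" if r: "r > 0" for r
 proof -
  obtain q where q: "n = Suc q" using n by (cases n) auto
  have "(E has_real_derivative (real n * r ^ (n - 1) * ((sphm r)\<^sup>2 + (sphm' r)\<^sup>2) + r ^ n * (2 * sphm r * sphm' r + 2 * sphm' r * m2 r)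
   + (real n * (real (n - 1) * r ^ (n - 1 - 1)) * (sphm r * sphm' r) + real n * r ^ (n - 1) * (sphm' r * sphm' r + sphm r * m2 r)))) (at r)"
   unfolding E_def[abs_def] by (auto intro!: derivative_eq_intros d1 d2 simp: algebra_simps)
  also have "(real n * r ^ (n - 1) * ((sphm r)\<^sup>2 + (sphm' r)\<^sup>2) + r ^ n * (2 * sphm r * sphm' r + 2 * sphm' r * m2 r)
   + (real n * (real (n - 1) * r ^ (n - 1 - 1)) * (sphm r * sphm' r) + real n * r ^ (n - 1) * (sphm' r * sphm' r + sphm r * m2 r))) = E' r"
   using r unfolding E'_def ode[OF r] q by (cases q) (simp_all add: field_simps power2_eq_square)
  finally show ?thesis .
 qed
 \<comment> \<open>From r >= 2n on, the cross term is at most a quarter of the main term, so E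
   controls m^2 + m'^2.\<close>
 define r0 where "r0 = 2 * real n"
 have r0: "r0 > 0" using n by (simp add: r0_def)
 have lower: "r ^ n * ((sphm r)\<^sup>2 + (sphm' r)\<^sup>2) <= 2 * E r" and E'_le: "\<bar>E' r\<bar> <= real n / r\<^sup>2 * E r" if r: "r >= r0" for r
 proof -
  have rp: "r > 0" using r r0 by simp
  let ?S = "(sphm r)\<^sup>2 + (sphm' r)\<^sup>2"
  have am: "\<bar>sphm r * sphm' r\<bar> <= ?S / 2"
   using sum_squares_bound[of "\<bar>sphm r\<bar>" "\<bar>sphm' r\<bar>"] by (simp add: abs_mult)
  have pw: "r ^ n = r * r ^ (n - 1)" using n by (cases n) auto
  have "\<bar>real n * r ^ (n - 1) * (sphm r * sphm' r)\<bar> = real n * r ^ (n - 1) * \<bar>sphm r * sphm' r\<bar>"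
   using rp by (simp add: abs_mult)
  also have "... <= (r / 2) * r ^ (n - 1) * (?S / 2)"
   using r rp am by (intro mult_mono) (auto simp: r0_def)
  also have "... = r ^ n * ?S / 4" unfolding pw by simp
  finally have 1: "\<bar>real n * r ^ (n - 1) * (sphm r * sphm' r)\<bar> <= r ^ n * ?S / 4" .
  moreover have "0 <= r ^ n * ?S" using rp by simp
  moreover have "X <= 2 * (X + A)" if "\<bar>A\<bar> <= X / 4" "0 <= X" for A X :: real
  proof -
   have "- A <= X / 4" using that(1) by (simp add: abs_le_iff)
   thus ?thesis using that(2) by simp
  qed
  ultimately show 2: "r ^ n * ?S <= 2 * E r" unfolding E_def by blast
  have "\<bar>E' r\<bar> = real n / r\<^sup>2 * (r ^ n * \<bar>sphm r * sphm' r\<bar>)"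
   using rp by (simp add: E'_def abs_mult)
  also have "... <= real n / r\<^sup>2 * (r ^ n * (?S / 2))"
   using rp am by (intro mult_left_mono) auto
  also have "... <= real n / r\<^sup>2 * E r"
   using 2 by (intro mult_left_mono) auto
  finally show "\<bar>E' r\<bar> <= real n / r\<^sup>2 * E r" .
 qed
 \<comment> \<open>An integrating factor: exp (n/r) decreases at the relative rate n/r^2, which
   outweighs the growth of E.\<close>
 define G where "G r = E r * exp (real n / r)" for r
 have G: "G r <= G r0" if r: "r >= r0" for r
 proof (rule DERIV_nonpos_imp_nonincreasing[OF r])
  fix x assume x: "r0 <= x" "x <= r"
  hence xp: "x > 0" using r0 by simp
  have "(G has_real_derivative (E' x - real n / x\<^sup>2 * E x) * exp (real n / x)) (at x)"
   unfolding G_def[abs_def] using xp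
   by (auto intro!: derivative_eq_intros dE simp: field_simps power2_eq_square)
  moreover have "(E' x - real n / x\<^sup>2 * E x) * exp (real n / x) <= 0"
   using E'_le[OF x(1)] by (simp add: mult_le_0_iff)
  ultimately show "\<exists>y. (G has_real_derivative y) (at x) & y <= 0" by blast
 qed
 have "(sphm r)\<^sup>2 * r ^ n <= 2 * \<bar>G r0\<bar> + r0 ^ n" if r: "r > 0" for r
 proof (cases "r >= r0")
  case True
  have Ep: "E r >= 0"
   using lower[OF True] r by (smt (verit) mult_nonneg_nonneg zero_le_power zero_le_power2)
  have "(sphm r)\<^sup>2 * r ^ n <= r ^ n * ((sphm r)\<^sup>2 + (sphm' r)\<^sup>2)"
   using r by (simp add: distrib_left)
  also have "... <= 2 * E r" by (rule lower) fact
  also have "... <= 2 * G r"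
   unfolding G_def using Ep r by (simp add: mult_left_le one_le_exp_iff mult_le_cancel_left1)
  also have "... <= 2 * G r0" using G[OF True] by simp
  finally show ?thesis using r0 by (smt (verit) zero_le_power)
 next
  case False
  have "(sphm r)\<^sup>2 * r ^ n <= 1 * r0 ^ n"
   using False r abs_sphm_le_1[of r] by (intro mult_mono power_mono) (auto simp: abs_square_le_1)
  thus ?thesis by simp
 qed
 thus ?thesis
  using r0 by (intro that[of "2 * \<bar>G r0\<bar> + r0 ^ n"]) (auto simp: n_def intro: add_nonneg_pos)
qed

lemma nn_integral_rotate:
 assumes Q: "orthogonal_matrix Q" and [measurable]: "F \<in> Bor"
 shows "(HN R. F (Q *v (R *v w))) = (HN R. F (R *v w))"
 using nn_integral_left_mult[OF Q, of "%R. F (R *v w)"] by (simp add: matrix_vector_mul_assoc)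

lemma norm_orthogonal_mult: "orthogonal_matrix R ==> norm (R *v w) = norm (w :: real^'n)"
 using orthogonal_transformation_norm[of "(*v) R" w]
 by (simp add: orthogonal_transformation_matrix matrix_of_matrix_vector_mul)

end

section \<open>Size of a sphere thickened by a Gaussian\<close>

lemma gdens_shift_le:
 fixes z z' :: "'a::euclidean_space"
 assumes s: "s > 0" and zz: "norm (z - z') <= s"
 shows "gdens s z <= 2 ^ DIM('a) * exp (1/4) * gdens (2 * s) z'"
proof -
 \<comment> \<open>The square of |z'| is at most twice that of |z| plus 2 s^2, so a Gaussian of
   double width absorbs a shift by s at the cost of a constant.\<close>
 have "norm z' <= norm z + s" using zz norm_triangle_sub[of z' z] by (simp add: norm_minus_commute)
 hence "(norm z')\<^sup>2 <= (norm z + s)\<^sup>2" by (intro power_mono) auto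
 also have "... <= 2 * (norm z)\<^sup>2 + 2 * s\<^sup>2"
  using sum_squares_bound[of "norm z" s] by (simp add: power2_sum)
 finally have "- (norm z)\<^sup>2 / (2 * s\<^sup>2) <= 1/4 + - (norm z')\<^sup>2 / (2 * (2 * s)\<^sup>2)"
 proof -
  assume M: "(norm z')\<^sup>2 <= 2 * (norm z)\<^sup>2 + 2 * s\<^sup>2"
  have "(norm z')\<^sup>2 / (8 * s\<^sup>2) <= (2 * (norm z)\<^sup>2 + 2 * s\<^sup>2) / (8 * s\<^sup>2)"
   by (rule divide_right_mono[OF M]) simp
  also have "... = (norm z)\<^sup>2 / (4 * s\<^sup>2) + 1/4" using s by (simp add: field_simps)
  also have "(norm z)\<^sup>2 / (4 * s\<^sup>2) <= (norm z)\<^sup>2 / (2 * s\<^sup>2)" using s by (intro divide_left_mono) auto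
  finally show ?thesis by (simp add: power_mult_distrib)
 qed
 hence "exp (- (norm z)\<^sup>2 / (2 * s\<^sup>2)) <= exp (1/4) * exp (- (norm z')\<^sup>2 / (2 * (2 * s)\<^sup>2))"
  by (simp flip: exp_add)
 hence "(1 / (sqrt (2 * pi) * s)) ^ DIM('a) * exp (- (norm z)\<^sup>2 / (2 * s\<^sup>2))
  <= (1 / (sqrt (2 * pi) * s)) ^ DIM('a) * (exp (1/4) * exp (- (norm z')\<^sup>2 / (2 * (2 * s)\<^sup>2)))"
  using s by (intro mult_left_mono) auto
 also have "... = 2 ^ DIM('a) * exp (1/4) * gdens (2 * s) z'"
  using s by (simp add: gdens_eq power_divide power_mult_distrib)
 finally show ?thesis using s by (simp add: gdens_eq)
qed

text \<open>From (1 + y/k)^k <= exp y with y = x^2/8.\<close>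

lemma power_exp_bound:
 fixes x :: real
 assumes x: "x >= 1"
 shows "x ^ k * exp (- (x\<^sup>2 / 8)) <= (8 * real k) ^ k"
proof (cases "k = 0")
 case False
 have "x ^ k <= (x\<^sup>2) ^ k"
  using x by (intro power_mono) (auto simp: power2_eq_square)
 also have "... = (8 * real k) ^ k * ((x\<^sup>2 / 8) / real k) ^ k"
  using False by (simp add: power_mult_distrib power_divide)
 also have "... <= (8 * real k) ^ k * exp (x\<^sup>2 / 8)"
 proof (rule mult_left_mono)
  have "((x\<^sup>2 / 8) / real k) ^ k <= (1 + (x\<^sup>2 / 8) / real k) ^ k"
   by (intro power_mono) auto
  also have "... <= exp (x\<^sup>2 / 8)"
   using False by (intro exp_ge_one_plus_x_over_n_power_n) (auto intro: order_trans[of _ 0])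
  finally show "((x\<^sup>2 / 8) / real k) ^ k <= exp (x\<^sup>2 / 8)" .
 qed simp
 finally show ?thesis by (simp add: exp_minus field_simps)
qed simp

context haar_orthogonal
begin

text \<open>Let t = |w|. If |x| >= t/2: the thickened density is radial, so its value at x is
  dominated, after doubling the width, by its values on the whole shell between |x| and |x| + s. The
  shell has volume at least of order s t^(d-1), while the total mass is 1. If |x| < t/2, only the
  Gaussian tail is seen.\<close>

lemma gdens_sph_bound:
 obtains C where "C > 0"
  "!!s w x. 0 < s ==> s <= norm w ==> (HN R. gdens s (x - R *v w)) <= ennreal (C / (s * norm w ^ (CARD('n) - 1)))"
proof -
 define d where "d = CARD('n)"
 have dS: "d = Suc (d - 1)" by (simp add: d_def)
 define V where "V = unit_ball_vol (real d)"
 have V: "V > 0" unfolding V_def by (rule unit_ball_vol_pos) simp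
 define C1 where "C1 = 2 ^ d * exp (1/4::real)"
 have C1: "C1 > 0" by (simp add: C1_def)
 define C2 where "C2 = (1 / sqrt (2 * pi)) ^ d * (8 * real (d - 1)) ^ (d - 1)"
 have C2: "C2 >= 0" by (simp add: C2_def)
 define C where "C = C1 * 2 ^ (d - 1) / V + C2 + 1"
 have C: "C > 0" using C1 C2 V by (simp add: C_def add_nonneg_pos)
 let ?h = "%s w x. (HN R. gdens s (x - R *v w))"
 have main: "?h s w x <= ennreal (C / (s * norm w ^ (d - 1)))" if s: "0 < s" and sw: "s <= norm w" for s w x
 proof -
  define t where "t = norm w"
  have t: "t > 0" using less_le_trans[OF s sw] by (simp add: t_def)
  have st: "s * t ^ (d - 1) > 0" using s t by simp
  have inv: "?h \<sigma> w y = ?h \<sigma> w y'" if ny: "norm y = norm y'" and sg: "\<sigma> > 0" for y y' \<sigma>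
  proof -
   obtain f where f: "orthogonal_transformation f" "f y = y'"
    using orthogonal_transformation_exists[OF ny] by metis
   let ?Q = "matrix f"
   have Q: "orthogonal_matrix ?Q" "?Q *v y = y'"
    using f by (auto simp: orthogonal_transformation_matrix)
   have gn: "gdens \<sigma> (?Q *v z) = gdens \<sigma> z" for z
    using sg norm_orthogonal_mult[OF Q(1)] by (simp add: gdens_eq)
   have "?h \<sigma> w y' = (HN R. gdens \<sigma> (?Q *v y - ?Q *v (R *v w)))"
    unfolding Q(2) by (rule nn_integral_rotate[symmetric, OF Q(1), of "%z. gdens \<sigma> (y' - z)"]) measurable
   also have "... = ?h \<sigma> w y"
    by (simp add: matrix_vector_mult_diff_distrib[symmetric] gn)
   finally show ?thesis ..
  qed
  show ?thesis
  proof (cases "norm x >= t / 2")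
   case True
   define a where "a = norm x"
   have a: "a >= t / 2" "a > 0" using True t by (auto simp: a_def)
   let ?A = "ball (0::real^'n) (a + s) - ball 0 a"
   define m where "m = V * (s * (t / 2) ^ (d - 1))"
   have m: "m > 0" using V s t by (simp add: m_def)
   have "ennreal m <= evol ?A"
   proof -
    have "evol ?A = evol (ball (0::real^'n) (a + s)) - evol (ball (0::real^'n) a)"
     using s emeasure_lborel_ball_finite[of "0::real^'n" a] by (intro emeasure_Diff) (auto simp: subset_ball)
    also have "... = ennreal (V * (a + s) ^ d - V * a ^ d)"
     using a s V by (simp add: emeasure_ball V_def d_def ennreal_minus)
    finally have eq: "evol ?A = ennreal (V * (a + s) ^ d - V * a ^ d)" .
    have "m <= V * (a + s) ^ d - V * a ^ d"
    proof -
     have "s * (t / 2) ^ (d - 1) <= s * a ^ (d - 1)"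
      using a s t by (intro mult_left_mono power_mono) auto
     also have "... = a ^ (d - 1) * (a + s) - a ^ d"
      using dS by (metis add_diff_cancel_left' distrib_left mult.commute power_Suc)
     also have "... <= (a + s) ^ (d - 1) * (a + s) - a ^ d"
      using a s by (intro diff_right_mono mult_right_mono power_mono) auto
     also have "... = (a + s) ^ d - a ^ d" using dS by (metis power_Suc2)
     finally show ?thesis using V by (simp add: m_def right_diff_distrib[symmetric])
    qed
    thus ?thesis unfolding eq by (rule ennreal_leI)
   qed
   hence "?h s w x * ennreal m <= ?h s w x * evol ?A" by (rule mult_left_mono) simp
   also have "... = (LN y. ?h s w x * indicator ?A y)"
    by (simp add: nn_integral_cmult_indicator)
   also have "... <= (LN y. ennreal C1 * ?h (2 * s) w y)"
   proof (rule nn_integral_mono)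
    fix y :: "real^'n"
    show "?h s w x * indicator ?A y <= ennreal C1 * ?h (2 * s) w y"
    proof (cases "y \<in> ?A")
     case yA: True
     \<comment> \<open>The radial projection of x to the sphere through y: it is within s of x and,
       by invariance, sees the same density as y.\<close>
     define x' where "x' = (norm y / a) *\<^sub>R x"
     have nx': "norm x' = norm y" using a by (simp add: x'_def a_def)
     have "x - x' = (1 - norm y / a) *\<^sub>R x" by (simp add: x'_def scaleR_left_diff_distrib)
     hence "norm (x - x') = \<bar>1 - norm y / a\<bar> * a" by (simp add: a_def)
     also have "... = \<bar>a - norm y\<bar>" using a by (simp add: abs_if field_simps)
     finally have xx': "norm (x - x') <= s" using yA by auto
     have "?h s w x <= (HN R. ennreal C1 * ennreal (gdens (2 * s) (x' - R *v w)))"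
     proof (rule nn_integral_mono)
      fix R
      have "gdens s (x - R *v w) <= C1 * gdens (2 * s) (x' - R *v w)"
       using gdens_shift_le[OF s, of "x - R *v w" "x' - R *v w"] xx' by (simp add: C1_def d_def)
      thus "ennreal (gdens s (x - R *v w)) <= ennreal C1 * ennreal (gdens (2 * s) (x' - R *v w))"
       using C1 by (subst ennreal_mult[symmetric]) (auto intro: ennreal_leI)
     qed
     also have "... = ennreal C1 * ?h (2 * s) w x'"
      by (rule nn_integral_cmult) measurable
     also have "?h (2 * s) w x' = ?h (2 * s) w y" using inv[OF nx'] s by simp
     finally show ?thesis using yA by simp
    qed simp
   qed
   also have "... = ennreal C1 * (LN y. ?h (2 * s) w y)"
    by (rule nn_integral_cmult) measurable
   also have "(LN y. ?h (2 * s) w y) = (HN R. (LN y. gdens (2 * s) (y + - (R *v w))))"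
   proof -
    interpret LH: pair_sigma_finite "lborel :: (real^'n) measure" H
     by (intro pair_sigma_finite.intro sigma_finite_lborel sigma_finite_measure_axioms)
    show ?thesis by (subst LH.Fubini') simp_all
   qed
   also have "... = 1"
    using s by (subst lborel_nn_integral_shift) (auto simp: integral_gdens_eq_1 emeasure_space_1)
   finally have "?h s w x * ennreal m <= ennreal C1" by simp
   hence "?h s w x * ennreal m * ennreal (1 / m) <= ennreal C1 * ennreal (1 / m)"
    by (rule mult_right_mono) simp
   also have "?h s w x * ennreal m * ennreal (1 / m) = ?h s w x"
    using m by (simp add: mult.assoc ennreal_mult[symmetric])
   also have "ennreal C1 * ennreal (1 / m) = ennreal (C1 * 2 ^ (d - 1) / V / (s * t ^ (d - 1)))"
    using C1 m by (simp add: ennreal_mult[symmetric] m_def power_divide field_simps)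
   also have "... <= ennreal (C / (s * t ^ (d - 1)))"
    using C2 st by (intro ennreal_leI divide_right_mono) (auto simp: C_def)
   finally show ?thesis by (simp add: t_def)
  next
   case False
   have "?h s w x <= (HN R. ennreal (C2 / (s * t ^ (d - 1))))"
   proof (rule nn_integral_mono, rule ennreal_leI)
    fix R assume "R \<in> space H"
    hence "norm (R *v w) = t" by (simp add: space_H norm_orthogonal_mult t_def)
    hence z: "t / 2 <= norm (x - R *v w)"
     using False norm_triangle_ineq2[of "R *v w" x] by (simp add: norm_minus_commute)
    have z2: "(t / s)\<^sup>2 / 8 <= (norm (x - R *v w))\<^sup>2 / (2 * s\<^sup>2)"
     using power_mono[OF z, of 2] s t by (simp add: power_divide field_simps)
    have "gdens s (x - R *v w) <= (1 / (sqrt (2 * pi) * s)) ^ d * exp (- ((t / s)\<^sup>2 / 8))"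
     unfolding gdens_eq[OF s] using s z2 by (simp add: d_def mult_left_mono)
    also have "... = (1 / sqrt (2 * pi)) ^ d * ((t / s) ^ (d - 1) * exp (- ((t / s)\<^sup>2 / 8))) * (1 / (s * t ^ (d - 1)))"
     using s t by (subst (1 2) dS) (simp add: power_divide field_simps)
    also have "... <= (1 / sqrt (2 * pi)) ^ d * (8 * real (d - 1)) ^ (d - 1) * (1 / (s * t ^ (d - 1)))"
     using s t sw by (intro mult_right_mono mult_left_mono power_exp_bound) (auto simp: t_def)
    finally show "gdens s (x - R *v w) <= C2 / (s * t ^ (d - 1))" by (simp add: C2_def)
   qed
   also have "... = ennreal (C2 / (s * t ^ (d - 1)))" by (simp add: emeasure_space_1)
   also have "... <= ennreal (C / (s * t ^ (d - 1)))"
    using C1 V st by (intro ennreal_leI divide_right_mono) (auto simp: C_def)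
   finally show ?thesis by (simp add: t_def)
  qed
 qed
 show ?thesis
  by (rule that[OF C]) (use main in \<open>simp add: d_def\<close>)
qed

end

section \<open>Averages over points of a circle\<close>

text \<open>Quantitative mean zero at scale \<open>h\<close>, as for a function whose integrals over
  cubes of diameter at most h vanish. Testing against Lipschitz functions removes the cubes from the
  notion.\<close>

definition cancels :: "real => ('a::euclidean_space => real) => bool" where
 "cancels h b \<longleftrightarrow> (\<forall>L \<phi>. (\<forall>x y. \<bar>\<phi> x - \<phi> y\<bar> <= L * norm (x - y)) --> bounded (range \<phi>) -->
  \<bar>(LI x. b x * \<phi> x)\<bar> <= L * h * (LI x. \<bar>b x\<bar>))"

lemma exp_neg_sq_lipschitz: "\<bar>exp (- (p\<^sup>2 / 2)) - exp (- (q\<^sup>2 / 2))\<bar> <= \<bar>p - q\<bar>" for p q :: real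
proof -
 have 1: "((%p. exp (- (p\<^sup>2 / 2))) has_field_derivative - z * exp (- (z\<^sup>2 / 2))) (at z within UNIV)" for z :: real
  by (auto intro!: derivative_eq_intros)
 have 2: "norm (- z * exp (- (z\<^sup>2 / 2))) <= 1" for z :: real
 proof -
  have "\<bar>z\<bar> <= 1 + z\<^sup>2 / 2"
   using sum_squares_bound[of "\<bar>z\<bar>" 1] by simp
  also have "... <= exp (z\<^sup>2 / 2)" by (rule exp_ge_add_one_self)
  finally show ?thesis
   by (simp add: abs_mult exp_minus field_simps)
 qed
 show ?thesis
  using field_differentiable_bound[of UNIV "%p. exp (- (p\<^sup>2 / 2))" "%z. - z * exp (- (z\<^sup>2 / 2))" 1 p q] 1 2 by simp
qed

lemma gdens_lipschitz:
 fixes x y :: "'a::euclidean_space"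
 assumes s: "s > 0"
 shows "\<bar>gdens s x - gdens s y\<bar> <= (1 / s) ^ (DIM('a) + 1) * norm (x - y)"
proof -
 have pw: "(1 / (sqrt (2 * pi) * s)) ^ DIM('a) <= (1 / s) ^ DIM('a)"
 proof (rule power_mono)
  have "1 <= sqrt (2 * pi)" using pi_gt3 by simp
  thus "1 / (sqrt (2 * pi) * s) <= 1 / s" using s by (simp add: field_simps)
 qed (use s in simp)
 have e: "exp (- (norm z)\<^sup>2 / (2 * s\<^sup>2)) = exp (- ((norm z / s)\<^sup>2 / 2))" for z :: 'a
  by (simp add: power_divide)
 have "\<bar>gdens s x - gdens s y\<bar> = (1 / (sqrt (2 * pi) * s)) ^ DIM('a) * \<bar>exp (- ((norm x / s)\<^sup>2 / 2)) - exp (- ((norm y / s)\<^sup>2 / 2))\<bar>"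
  unfolding gdens_eq[OF s] e right_diff_distrib[symmetric] abs_mult using s by simp
 also have "... <= (1 / s) ^ DIM('a) * \<bar>norm x / s - norm y / s\<bar>"
  using s pw by (intro mult_mono exp_neg_sq_lipschitz) auto
 also have "... = (1 / s) ^ (DIM('a) + 1) * \<bar>norm x - norm y\<bar>"
  using s by (simp add: diff_divide_distrib[symmetric])
 also have "... <= (1 / s) ^ (DIM('a) + 1) * norm (x - y)"
  using s by (intro mult_left_mono norm_triangle_ineq3) auto
 finally show ?thesis .
qed

lemma gdens_le: "s > 0 ==> gdens s (x::'a::euclidean_space) <= (1 / (sqrt (2 * pi) * s)) ^ DIM('a)"
 by (simp add: gdens_eq mult_left_le)

text \<open>The Gaussian centred at x is a test function with Lipschitz constant s^-(d+1), so the
  low frequencies of \<open>b\<close> gain the factor h.\<close>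

lemma conv_form_gauss_cancels:
 fixes b :: "'a::euclidean_space => real"
 assumes s: "s > 0" and b: "integrable lborel b" and canc: "cancels h b"
 shows "conv_form (gauss s) b b <= (1 / s) ^ (DIM('a) + 1) * h * (LI x. \<bar>b x\<bar>)\<^sup>2"
proof -
 have [measurable]: "b \<in> Bor" using b by auto
 let ?L = "(1 / s) ^ (DIM('a) + 1)" and ?I = "(LI x. \<bar>b x\<bar>)"
 have inner: "\<bar>\<integral>z. b x * b (x + z) \<partial>gauss s\<bar> <= \<bar>b x\<bar> * (?L * h * ?I)" for x
 proof -
  have "(\<integral>z. b x * b (x + z) \<partial>gauss s) = b x * (LI z. b (z + x) * gdens s ((z + x) - x))"
   unfolding gauss_def by (subst integral_density) (auto simp: mult_ac add_ac)
  also have "(LI z. b (z + x) * gdens s ((z + x) - x)) = (LI y. b y * gdens s (y - x))"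
   by (rule lborel_integral_shift[of "%y. b y * gdens s (y - x)"]) measurable
  finally have "\<bar>\<integral>z. b x * b (x + z) \<partial>gauss s\<bar> = \<bar>b x\<bar> * \<bar>(LI y. b y * gdens s (y - x))\<bar>"
   by (metis abs_mult)
  also have "\<bar>(LI y. b y * gdens s (y - x))\<bar> <= ?L * h * ?I"
  proof -
   have "\<forall>y z. \<bar>gdens s (y - x) - gdens s (z - x)\<bar> <= ?L * norm (y - z)"
    using gdens_lipschitz[OF s] by (metis diff_diff_eq2 diff_add_cancel)
   moreover have "bounded (range (%y. gdens s (y - x)))"
    by (rule boundedI[of _ "(1 / (sqrt (2 * pi) * s)) ^ DIM('a)"]) (use gdens_le[OF s] in auto)
   ultimately show ?thesis
    using canc[unfolded cancels_def, THEN spec[of _ ?L], THEN spec[of _ "%y. gdens s (y - x)"]] by blast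
  qed
  finally show ?thesis by (simp add: mult_left_mono)
 qed
 have "conv_form (gauss s) b b <= (LI x. \<bar>b x\<bar> * (?L * h * ?I))"
  unfolding conv_form_def
 proof (rule integral_mono')
  show "integrable lborel (%x. \<bar>b x\<bar> * (?L * h * ?I))" using b by simp
  show "(\<integral>z. b x * b (x + z) \<partial>gauss s) <= \<bar>b x\<bar> * (?L * h * ?I)" for x
   using inner[of x] by linarith
  show "0 <= \<bar>b x\<bar> * (?L * h * ?I)" for x
   using inner[of x] by (rule order_trans[OF abs_ge_zero])
 qed
 also have "... = ?L * h * ?I\<^sup>2" by (simp add: power2_eq_square mult_ac)
 finally show ?thesis .
qed

text \<open>The functions for which the Gaussian weight can be removed; step functions on finitely
  many dyadic cubes are the intended members.\<close>

definition tame :: "('a::euclidean_space => real) => bool" where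
 "tame b \<longleftrightarrow> integrable lborel b & (\<exists>B. \<forall>x. \<bar>b x\<bar> <= B) & (\<exists>N\<in>null_sets lborel. \<forall>y. y \<notin> N --> isCont b y)"

lemma tame_measurable: "tame b ==> b \<in> Bor"
 unfolding tame_def by auto

context haar_orthogonal
begin

text \<open>Frequencies beyond C / (eps^2 |w|) meet a multiplier of size at most eps. The lower ones
  are dominated by a Gaussian of width s = |w| eps^2 / C, against which \<open>b\<close>
  cancels.\<close>

lemma conv_form_sph_decay:
 assumes d: "CARD('n) >= 2"
 obtains C where "C > 0"
  "!!b h A w eps. tame b ==> cancels h b ==> (LI x. \<bar>b x\<bar>)\<^sup>2 <= A * (LI x. (b x)\<^sup>2) ==> h >= 0 ==>
   0 < eps ==> eps <= 1 ==> w ~= 0 ==>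
   \<bar>conv_form (sph w) b b\<bar> <= (eps + 2 * h * A * (C / (norm w * eps\<^sup>2)) ^ (CARD('n) + 1)) * (LI x. (b x)\<^sup>2)"
proof -
 obtain C0 where C0: "C0 > 0" "!!r. r > 0 ==> (sphm r)\<^sup>2 * r ^ (CARD('n) - 1) <= C0"
  using sphm_decay[OF d] by blast
 define C where "C = C0 + 1"
 have C: "C > 0" using C0 by (simp add: C_def)
 show ?thesis
 proof (rule that[OF C])
  fix b :: "real^'n => real" and h A eps :: real and w :: "real^'n"
  assume b: "tame b" and canc: "cancels h b" and A: "(LI x. \<bar>b x\<bar>)\<^sup>2 <= A * (LI x. (b x)\<^sup>2)"
   and h: "h >= 0" and e: "0 < eps" "eps <= 1" and w: "w ~= 0"
  obtain B N where B: "!!x. \<bar>b x\<bar> <= B" and N: "N \<in> null_sets lborel" "!!y. y \<notin> N ==> isCont b y"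
   and bi: "integrable lborel b"
   using b unfolding tame_def by blast
  \<comment> \<open>Only m(r)^2 <= C / r for r >= 1 is used, which holds in every dimension d >= 2;
    hence the square of eps.\<close>
  define \<rho> where "\<rho> = C / eps\<^sup>2"
  have rho: "\<rho> >= 1" using e C0 by (simp add: \<rho>_def C_def field_simps power_le_one add_increasing)
  define s where "s = norm w / \<rho>"
  have s: "s > 0" using rho w by (simp add: s_def)
  have mbound: "\<bar>sphm r\<bar> <= eps" if r: "r >= \<rho>" for r
  proof -
   have r1: "r >= 1" using r rho by simp
   have "r ^ 1 <= r ^ (CARD('n) - 1)" using r1 d by (intro power_increasing) auto
   hence "(sphm r)\<^sup>2 * r <= C0"
    using C0(2)[of r] r1 by (smt (verit) mult_left_mono power_one_right zero_le_power2)
   hence "(sphm r)\<^sup>2 * \<rho> <= C0" using r by (smt (verit) mult_left_mono zero_le_power2)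
   also have "... <= C" by (simp add: C_def)
   finally have "(sphm r)\<^sup>2 <= eps\<^sup>2" using C e by (simp add: \<rho>_def field_simps)
   thus ?thesis using e by (simp add: abs_le_square_iff[symmetric])
  qed
  \<comment> \<open>Where |w| |xi| is below the threshold, s |xi| <= 1; the Gaussian is then at
    least 1/2, and twice it dominates the trivial bound 1.\<close>
  have mult: "cmod (\<Sum>i\<in>{()}. of_real 1 * charf (sph w) \<xi>) <= eps + 2 * exp (- (s\<^sup>2 * (norm \<xi>)\<^sup>2) / 2)" for \<xi>
  proof (cases "norm w * norm \<xi> >= \<rho>")
   case True
   thus ?thesis using mbound[OF True] by (simp add: charf_sph add_increasing2)
  next
   case False
   hence "s * norm \<xi> <= 1" using rho by (simp add: s_def field_simps)
   hence "(s * norm \<xi>)\<^sup>2 <= 1" using s by (simp add: power_le_one)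
   hence "1 - 1/2 <= exp (- (s\<^sup>2 * (norm \<xi>)\<^sup>2) / 2)"
    using exp_ge_add_one_self[of "- (s\<^sup>2 * (norm \<xi>)\<^sup>2) / 2"] by (simp add: power_mult_distrib)
   moreover have "cmod (charf (sph w) \<xi>) <= 1" by (rule cmod_charf_le_1[OF prob_space_sph])
   ultimately show ?thesis using e by simp
  qed
  have "\<bar>\<Sum>i\<in>{()}. 1 * conv_form (sph w) b b\<bar> <=
   eps * (1 * (LI x. (b x)\<^sup>2) + (LI x. (b x)\<^sup>2) / 1) / 2
  + 2 * (1 * conv_form (gauss s) b b + conv_form (gauss s) b b / 1) / 2"
   by (rule conv_form_multiplier_le[OF bi bi B B N N _ _ _ _ s _ mult]) (use e in \<open>auto intro: prob_space_sph\<close>)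
  hence "\<bar>conv_form (sph w) b b\<bar> <= eps * (LI x. (b x)\<^sup>2) + 2 * conv_form (gauss s) b b" by simp
  also have "conv_form (gauss s) b b <= (1 / s) ^ (CARD('n) + 1) * h * (LI x. \<bar>b x\<bar>)\<^sup>2"
   using conv_form_gauss_cancels[OF s bi canc] by simp
  also have "... <= (1 / s) ^ (CARD('n) + 1) * h * (A * (LI x. (b x)\<^sup>2))"
   using s h by (intro mult_left_mono A) auto
  also have "1 / s = C / (norm w * eps\<^sup>2)" by (simp add: s_def \<rho>_def mult.commute)
  finally show "\<bar>conv_form (sph w) b b\<bar> <= (eps + 2 * h * A * (C / (norm w * eps\<^sup>2)) ^ (CARD('n) + 1)) * (LI x. (b x)\<^sup>2)"
   by (simp add: algebra_simps)
 qed
qed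

section \<open>Means over N rotated points\<close>

definition point_avg :: "(nat => real^'n) => nat => real => (real^'n => real) => real^'n => real^'n^'n => real" where
 "point_avg us N t b x R = (\<Sum>j<N. b (x - t *\<^sub>R (R *v us j))) / real N"

text \<open>Translating x by t R a leaves a correlation at the lag t R (a - a'), whose law under
  \<open>H\<close> is a spherical measure.\<close>

lemma pair_form_eq:
 assumes b: "tame b"
 shows "integrable (lborel \<Otimes>\<^sub>M H) (%p. b (fst p - t *\<^sub>R (snd p *v a)) * b (fst p - t *\<^sub>R (snd p *v a')))" (is ?I)
  and "(\<integral>p. b (fst p - t *\<^sub>R (snd p *v a)) * b (fst p - t *\<^sub>R (snd p *v a')) \<partial>(lborel \<Otimes>\<^sub>M H)) =
   conv_form (sph (t *\<^sub>R (a - a'))) b b" (is ?E)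
proof -
 obtain B where B: "!!x. \<bar>b x\<bar> <= B" and bi: "integrable lborel b"
  using b unfolding tame_def by blast
 note tame_measurable[OF b, measurable]
 interpret LH: pair_sigma_finite "lborel :: (real^'n) measure" H
  by (intro pair_sigma_finite.intro sigma_finite_lborel sigma_finite_measure_axioms)
 have B0: "B >= 0" using B[of 0] by linarith
 let ?w = "t *\<^sub>R (a - a')"
 show I: ?I
 proof (rule integrableI_bounded)
  show "(%p. b (fst p - t *\<^sub>R (snd p *v a)) * b (fst p - t *\<^sub>R (snd p *v a'))) \<in> borel_measurable (lborel \<Otimes>\<^sub>M H)"
   by measurable
  have "(\<integral>\<^sup>+p. ennreal (norm (b (fst p - t *\<^sub>R (snd p *v a)) * b (fst p - t *\<^sub>R (snd p *v a')))) \<partial>(lborel \<Otimes>\<^sub>M H))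
   <= (\<integral>\<^sup>+p. ennreal B * ennreal \<bar>b (fst p - t *\<^sub>R (snd p *v a))\<bar> \<partial>(lborel \<Otimes>\<^sub>M H))"
  proof (rule nn_integral_mono)
   fix p
   have "\<bar>b (fst p - t *\<^sub>R (snd p *v a)) * b (fst p - t *\<^sub>R (snd p *v a'))\<bar> <= \<bar>b (fst p - t *\<^sub>R (snd p *v a))\<bar> * B"
    unfolding abs_mult by (intro mult_left_mono B) auto
   thus "ennreal (norm (b (fst p - t *\<^sub>R (snd p *v a)) * b (fst p - t *\<^sub>R (snd p *v a')))) <= ennreal B * ennreal \<bar>b (fst p - t *\<^sub>R (snd p *v a))\<bar>"
    using B0 by (subst ennreal_mult[symmetric]) (auto simp: mult.commute intro!: ennreal_leI)
  qed
  also have "... = (HN R. (LN x. ennreal B * ennreal \<bar>b (x + - (t *\<^sub>R (R *v a)))\<bar>))"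
   by (subst LH.nn_integral_snd[symmetric]) (simp_all)
  also have "... = (HN R. ennreal B * (LN x. ennreal \<bar>b x\<bar>))"
   by (subst nn_integral_cmult, measurable, subst lborel_nn_integral_shift[of "%x. ennreal \<bar>b x\<bar>"]) simp_all
  also have "... < \<infinity>"
   using bi by (simp add: emeasure_space_1 integrable_iff_bounded ennreal_mult_less_top)
  finally show "(\<integral>\<^sup>+p. ennreal (norm (b (fst p - t *\<^sub>R (snd p *v a)) * b (fst p - t *\<^sub>R (snd p *v a')))) \<partial>(lborel \<Otimes>\<^sub>M H)) < \<infinity>" .
 qed
 have J: "integrable (lborel \<Otimes>\<^sub>M H) (%p. b (fst p) * b (fst p + snd p *v ?w))"
 proof (rule Bochner_Integration.integrable_bound)
  show "integrable (lborel \<Otimes>\<^sub>M H) (%p. b (fst p) * (%_. B) (snd p))"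
   by (rule integral_mult_pair(1)[OF sigma_finite_lborel sigma_finite_measure_axioms bi]) simp
  show "AE p in lborel \<Otimes>\<^sub>M H. norm (b (fst p) * b (fst p + snd p *v ?w)) <= norm (b (fst p) * (%_. B) (snd p))"
   using B by (auto simp: abs_mult intro!: mult_left_mono order_trans[OF B abs_ge_self])
 qed measurable
 have "(\<integral>p. b (fst p - t *\<^sub>R (snd p *v a)) * b (fst p - t *\<^sub>R (snd p *v a')) \<partial>(lborel \<Otimes>\<^sub>M H)) =
  (HI R. (LI x. b (x - t *\<^sub>R (R *v a)) * b (x - t *\<^sub>R (R *v a'))))"
  using LH.integral_snd[of "%x R. b (x - t *\<^sub>R (R *v a)) * b (x - t *\<^sub>R (R *v a'))"] I by (simp add: case_prod_beta')
 also have "... = (HI R. (LI x. b x * b (x + R *v ?w)))"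
 proof (rule Bochner_Integration.integral_cong[OF refl])
  fix R
  have "(LI x. b x * b (x + R *v ?w)) = (LI x. b (x + - (t *\<^sub>R (R *v a))) * b (x + - (t *\<^sub>R (R *v a)) + R *v ?w))"
   by (rule lborel_integral_shift[symmetric, of "%x. b x * b (x + R *v ?w)"]) measurable
  also have "... = (LI x. b (x - t *\<^sub>R (R *v a)) * b (x - t *\<^sub>R (R *v a')))"
   by (simp add: matrix_vector_mult_scaleR matrix_vector_mult_diff_distrib algebra_simps)
  finally show "(LI x. b (x - t *\<^sub>R (R *v a)) * b (x - t *\<^sub>R (R *v a'))) = (LI x. b x * b (x + R *v ?w))" ..
 qed
 also have "... = (LI x. (HI R. b x * b (x + R *v ?w)))"
  using LH.Fubini_integral[of "%x R. b x * b (x + R *v ?w)"] J by (simp add: case_prod_beta')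
 also have "... = conv_form (sph ?w) b b"
  unfolding conv_form_def sph_def by (subst integral_distr) auto
 finally show ?E .
qed

lemma point_avg_L2:
 assumes b: "tame b" and N: "N >= 1"
 shows "(LN x. (HN R. ennreal ((point_avg us N t b x R)\<^sup>2))) =
  ennreal ((\<Sum>j<N. \<Sum>k<N. conv_form (sph (t *\<^sub>R (us j - us k))) b b) / (real N)\<^sup>2)"
proof -
 note tame_measurable[OF b, measurable]
 interpret LH: pair_sigma_finite "lborel :: (real^'n) measure" H
  by (intro pair_sigma_finite.intro sigma_finite_lborel sigma_finite_measure_axioms)
 have sq: "(point_avg us N t b x R)\<^sup>2 = (\<Sum>j<N. \<Sum>k<N. b (x - t *\<^sub>R (R *v us j)) * b (x - t *\<^sub>R (R *v us k))) / (real N)\<^sup>2" for x R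
  unfolding point_avg_def power_divide by (simp add: power2_eq_square sum_product)
 have int: "integrable (lborel \<Otimes>\<^sub>M H) (%p. (point_avg us N t b (fst p) (snd p))\<^sup>2)"
  unfolding sq by (intro integrable_divide Bochner_Integration.integrable_sum pair_form_eq(1) b)
 have [measurable]: "(%p. point_avg us N t b (fst p) (snd p)) \<in> borel_measurable (lborel \<Otimes>\<^sub>M H)"
  unfolding point_avg_def by measurable
 have "(LN x. (HN R. ennreal ((point_avg us N t b x R)\<^sup>2))) =
   (\<integral>\<^sup>+p. ennreal ((point_avg us N t b (fst p) (snd p))\<^sup>2) \<partial>(lborel \<Otimes>\<^sub>M H))"
  by (subst nn_integral_fst[symmetric]) simp_all
 also have "... = ennreal (\<integral>p. (point_avg us N t b (fst p) (snd p))\<^sup>2 \<partial>(lborel \<Otimes>\<^sub>M H))"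
  by (rule nn_integral_eq_integral[OF int]) simp
 also have "(\<integral>p. (point_avg us N t b (fst p) (snd p))\<^sup>2 \<partial>(lborel \<Otimes>\<^sub>M H)) =
  (\<Sum>j<N. \<Sum>k<N. conv_form (sph (t *\<^sub>R (us j - us k))) b b) / (real N)\<^sup>2"
  unfolding sq
  by (simp add: Bochner_Integration.integral_sum Bochner_Integration.integrable_sum pair_form_eq[OF b])
 finally show ?thesis .
qed

lemma conv_form_sph_0:
 assumes b: "tame b"
 shows "conv_form (sph 0) b b = (LI x. (b x)\<^sup>2)"
proof -
 note tame_measurable[OF b, measurable]
 have "conv_form (sph 0) b b = (LI x. (HI R. b x * b (x + R *v 0)))"
  unfolding conv_form_def sph_def by (subst integral_distr) auto
 thus ?thesis by (simp add: prob_space power2_eq_square)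
qed

text \<open>The diagonal pairs contribute 1/N of the squared norm. An off-diagonal pair has lag at
  least ct/N; the decay estimate with eps = 1/N bounds it by 1/N + K (h/t) N^(3e), one power N^3 for
  each factor C / (|w| eps^2).\<close>

lemma point_avg_decay:
 assumes d: "CARD('n) >= 2" and c: "c > 0"
  and sep: "!!N j k. j < N ==> k < N ==> j ~= k ==> norm (us N j - us N k :: real^'n) >= c / real N"
 obtains C dl where "C > 0" "dl > 0"
  "!!b h t. tame b ==> cancels h b ==> (LI x. \<bar>b x\<bar>)\<^sup>2 <= (3 * t) ^ CARD('n) * (LI x. (b x)\<^sup>2) ==> h > 0 ==> t > 0 ==>
   \<exists>N\<ge>1. (LN x. (HN R. ennreal ((point_avg (us N) N t b x R)\<^sup>2))) <= ennreal (C * (h / t) powr dl * (LI x. (b x)\<^sup>2))"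
proof -
 obtain C0 where C0: "C0 > 0"
  "!!b h A w eps. tame b ==> cancels h b ==> (LI x. \<bar>b x\<bar>)\<^sup>2 <= A * (LI x. (b x)\<^sup>2) ==> h >= 0 ==>
   0 < eps ==> eps <= 1 ==> w ~= 0 ==>
   \<bar>conv_form (sph w) b b\<bar> <= (eps + 2 * h * A * (C0 / (norm w * eps\<^sup>2)) ^ (CARD('n) + 1)) * (LI x. (b x)\<^sup>2)"
  using conv_form_sph_decay[OF d] by blast
 define e where "e = CARD('n) + 1"
 define K where "K = 2 * 3 ^ CARD('n) * (C0 / c) ^ e"
 have K: "K > 0" using C0 c by (simp add: K_def)
 \<comment> \<open>For N of size (h/t)^(-dl) the terms 1/N and (h/t) N^(3e) are of equal order
   exactly for this value.\<close>
 define dl where "dl = 1 / (3 * real e + 1)"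
 have dl: "dl > 0" by (simp add: dl_def add_nonneg_pos)
 define C where "C = 2 + K * 2 ^ (3 * e)"
 have C: "C > 0" using K by (simp add: C_def add_pos_nonneg)
 show ?thesis
 proof (rule that[OF C dl])
  fix b :: "real^'n => real" and h t :: real
  assume b: "tame b" and canc: "cancels h b" and A: "(LI x. \<bar>b x\<bar>)\<^sup>2 <= (3 * t) ^ CARD('n) * (LI x. (b x)\<^sup>2)"
   and h: "h > 0" and t: "t > 0"
  let ?I = "(LI x. (b x)\<^sup>2)"
  have I0: "?I >= 0" by simp
  define \<theta> where "\<theta> = h / t"
  have \<theta>: "\<theta> > 0" using h t by (simp add: \<theta>_def)
  have bound: "(LN x. (HN R. ennreal ((point_avg (us N) N t b x R)\<^sup>2))) <= ennreal ((2 / real N + K * \<theta> * real N ^ (3 * e)) * ?I)"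
   if N: "N >= 1" for N
  proof -
   have off: "conv_form (sph (t *\<^sub>R (us N j - us N k))) b b <= (if j = k then ?I else 0) + (1 / real N + K * \<theta> * real N ^ (3 * e)) * ?I"
    if jk: "j < N" "k < N" for j k
   proof (cases "j = k")
    case True
    thus ?thesis using conv_form_sph_0[OF b] K \<theta> I0 by simp
   next
    case False
    have nw: "norm (t *\<^sub>R (us N j - us N k)) >= t * (c / real N)"
     using mult_left_mono[OF sep[OF jk False], of t] t by simp
    have pos: "t * (c / real N) > 0" using t c N by simp
    have nwp: "0 < t * norm (us N j - us N k)"
     using less_le_trans[OF pos mult_left_mono[OF sep[OF jk False], of t]] t by simp
    have "conv_form (sph (t *\<^sub>R (us N j - us N k))) b b <= (1 / real N + 2 * h * (3 * t) ^ CARD('n) * (C0 / (norm (t *\<^sub>R (us N j - us N k)) * (1 / real N)\<^sup>2)) ^ (CARD('n) + 1)) * ?I"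
     by (rule order_trans[OF abs_ge_self C0(2)[OF b canc A]]) (use h N nw pos in auto)
    also have "... <= (1 / real N + 2 * h * (3 * t) ^ CARD('n) * (C0 / (t * (c / real N) * (1 / real N)\<^sup>2)) ^ e) * ?I"
     unfolding e_def using h t C0(1) N nw pos c nwp
     by (intro mult_right_mono add_left_mono mult_left_mono power_mono divide_left_mono mult_pos_pos) auto
    also have "C0 / (t * (c / real N) * (1 / real N)\<^sup>2) = (C0 / c) * (1 / t) * real N ^ 3"
     using N by (simp add: power2_eq_square power3_eq_cube mult_ac)
    also have "2 * h * (3 * t) ^ CARD('n) * ((C0 / c) * (1 / t) * real N ^ 3) ^ e = K * \<theta> * real N ^ (3 * e)"
    proof -
     have pe: "(real N ^ 3) ^ e = real N ^ (3 * e)" by (simp add: power_mult)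
     have pt: "t ^ CARD('n) * (1 / t) ^ e = 1 / t"
      using t by (simp add: e_def power_divide)
     have "2 * h * (3 * t) ^ CARD('n) * ((C0 / c) * (1 / t) * real N ^ 3) ^ e
      = 2 * h * 3 ^ CARD('n) * (t ^ CARD('n) * (1 / t) ^ e) * ((C0 / c) ^ e * real N ^ (3 * e))"
      unfolding power_mult_distrib pe by simp
     thus ?thesis unfolding pt by (simp add: K_def \<theta>_def)
    qed
    finally show ?thesis using False by simp
   qed
   have "(\<Sum>j<N. \<Sum>k<N. conv_form (sph (t *\<^sub>R (us N j - us N k))) b b) <= (\<Sum>j<N. \<Sum>k<N. (if j = k then ?I else 0) + (1 / real N + K * \<theta> * real N ^ (3 * e)) * ?I)"
    by (intro sum_mono off) auto
   also have "... = real N * ?I + (real N)\<^sup>2 * ((1 / real N + K * \<theta> * real N ^ (3 * e)) * ?I)"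
    by (simp add: sum.distrib power2_eq_square algebra_simps)
   finally have "(\<Sum>j<N. \<Sum>k<N. conv_form (sph (t *\<^sub>R (us N j - us N k))) b b) / (real N)\<^sup>2 <= (real N * ?I + (real N)\<^sup>2 * ((1 / real N + K * \<theta> * real N ^ (3 * e)) * ?I)) / (real N)\<^sup>2"
    by (rule divide_right_mono) simp
   also have "... = (2 / real N + K * \<theta> * real N ^ (3 * e)) * ?I"
    using N by (simp add: field_simps power2_eq_square)
   finally show ?thesis unfolding point_avg_L2[OF b N] by (rule ennreal_leI)
  qed
  show "\<exists>N\<ge>1. (LN x. (HN R. ennreal ((point_avg (us N) N t b x R)\<^sup>2))) <= ennreal (C * (h / t) powr dl * ?I)"
  proof (cases "\<theta> <= 1")
   case True
   define y where "y = \<theta> powr (- dl)"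
   have y1: "y >= 1" using True \<theta> dl by (simp add: y_def ge_one_powr_ge_zero powr_minus one_le_inverse powr_le1)
   define N where "N = nat \<lceil>y\<rceil>"
   have N: "N >= 1" "y <= real N" "real N <= 2 * y"
    using y1 unfolding N_def by linarith+
   have "2 / real N + K * \<theta> * real N ^ (3 * e) <= 2 / y + K * \<theta> * (2 * y) ^ (3 * e)"
    using N y1 K \<theta> by (intro add_mono mult_left_mono power_mono divide_left_mono) auto
   also have "2 / y = 2 * \<theta> powr dl" by (simp add: y_def powr_minus field_simps)
   also have "\<theta> * (2 * y) ^ (3 * e) = 2 ^ (3 * e) * \<theta> powr dl"
   proof -
    have "y ^ (3 * e) = \<theta> powr (- dl * real (3 * e))"
     using \<theta> by (simp add: y_def powr_powr powr_realpow[symmetric])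
    hence "\<theta> * y ^ (3 * e) = \<theta> powr (1 - dl * real (3 * e))"
     using \<theta> by (simp add: powr_diff powr_minus field_simps)
    also have "1 - dl * real (3 * e) = dl" by (simp add: dl_def field_simps)
    finally show ?thesis by (simp add: power_mult_distrib)
   qed
   hence "K * \<theta> * (2 * y) ^ (3 * e) = K * (2 ^ (3 * e) * \<theta> powr dl)" by (simp add: mult.assoc)
   finally have "2 / real N + K * \<theta> * real N ^ (3 * e) <= C * \<theta> powr dl" by (simp add: C_def algebra_simps)
   hence "ennreal ((2 / real N + K * \<theta> * real N ^ (3 * e)) * ?I) <= ennreal (C * (h / t) powr dl * ?I)"
    using I0 by (intro ennreal_leI mult_right_mono) (auto simp: \<theta>_def)
   with bound[OF N(1)] N(1) show ?thesis by (meson order_trans)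
  next
   case False
   \<comment> \<open>For h > t a single point suffices, as (h/t)^dl exceeds 1.\<close>
   have "(LN x. (HN R. ennreal ((point_avg (us 1) 1 t b x R)\<^sup>2))) = ennreal ?I"
    by (subst point_avg_L2[OF b]) (auto simp: conv_form_sph_0[OF b])
   also have "... <= ennreal (C * (h / t) powr dl * ?I)"
   proof (rule ennreal_leI)
    have "1 * 1 <= C * (h / t) powr dl"
     using False dl K by (intro mult_mono ge_one_powr_ge_zero) (auto simp: C_def \<theta>_def)
     hence "1 <= C * (h / t) powr dl" by simp
     hence "1 * ?I <= (C * (h / t) powr dl) * ?I" by (rule mult_right_mono[OF _ I0])
     thus "?I <= C * (h / t) powr dl * ?I" by (simp only: mult_1_left)
   qed
   finally show ?thesis by (intro exI[of _ 1]) simp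
  qed
 qed
qed

end

section \<open>The restricted estimate for a single average\<close>

lemma conv_form_nn_integral:
 fixes f g :: "'a::euclidean_space => real"
 assumes f: "integrable lborel f" "!!x. f x >= 0" and g[measurable]: "g \<in> Bor"
  and B: "!!x. 0 <= g x" "!!x. g x <= B" and M: "prob_space M" "sets M = sets borel"
 shows "ennreal (conv_form M f g) = (LN x. (\<integral>\<^sup>+z. ennreal (f x * g (x + z)) \<partial>M))"
  and "conv_form M f g >= 0"
proof -
 interpret M: prob_space M by fact
 note M(2) [measurable_cong]
 have [measurable]: "f \<in> Bor" using f by auto
 have i: "integrable M (%z. f x * g (x + z))" for x
  by (rule M.integrable_const_bound[of _ "f x * B"]) (auto simp: abs_mult f B intro!: mult_left_mono)
 have j: "integrable lborel (%x. \<integral>z. f x * g (x + z) \<partial>M)"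
 proof (rule Bochner_Integration.integrable_bound)
  show "integrable lborel (%x. f x * B)" using f by simp
  show "AE x in lborel. norm (\<integral>z. f x * g (x + z) \<partial>M) <= norm (f x * B)"
  proof (rule AE_I2)
   fix x
   have "norm (\<integral>z. f x * g (x + z) \<partial>M) <= (\<integral>z. norm (f x * g (x + z)) \<partial>M)"
    by (rule integral_norm_bound)
   also have "... <= (\<integral>z. f x * B \<partial>M)"
    by (rule integral_mono) (use i f B in \<open>auto simp: abs_mult intro!: mult_left_mono\<close>)
   finally show "norm (\<integral>z. f x * g (x + z) \<partial>M) <= norm (f x * B)" by (simp add: M.prob_space)
  qed
 qed measurable
 have "(LN x. (\<integral>\<^sup>+z. ennreal (f x * g (x + z)) \<partial>M)) = (LN x. ennreal (\<integral>z. f x * g (x + z) \<partial>M))"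
  using i f B by (intro nn_integral_cong nn_integral_eq_integral) auto
 also have "... = ennreal (conv_form M f g)"
  unfolding conv_form_def using j f B by (intro nn_integral_eq_integral) (auto intro!: AE_I2 integral_nonneg_AE)
 finally show "ennreal (conv_form M f g) = (LN x. (\<integral>\<^sup>+z. ennreal (f x * g (x + z)) \<partial>M))" ..
 show "conv_form M f g >= 0"
  unfolding conv_form_def using f B by (intro integral_nonneg_AE AE_I2) auto
qed

text \<open>With y = s^2 |xi|^2 / 2 this expands the high-pass filter (1 - Gaussian)^n into
  Gaussians whose variances are multiples of s^2, so that the filter acts through finitely many
  probability measures.\<close>

lemma binomial_gauss_sum:
 "(\<Sum>k\<le>n. (-1) ^ k * real (n choose k) * exp (- (real k * y))) = (1 - exp (- y)) ^ n"
proof -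
 have "(1 - exp (- y)) ^ n = (- exp (- y) + 1) ^ n" by (simp add: add.commute)
 also have "... = (\<Sum>k\<le>n. real (n choose k) * (- exp (- y)) ^ k * 1 ^ (n - k))" by (rule binomial_ring)
 also have "... = (\<Sum>k\<le>n. (-1) ^ k * real (n choose k) * exp (- (real k * y)))"
 proof (intro sum.cong refl)
  fix k
  have "(- exp (- y)) ^ k = (-1) ^ k * exp (- y) ^ k" by (simp add: power_minus')
  also have "exp (- y) ^ k = exp (- (real k * y))" by (simp add: exp_of_nat_mult[symmetric])
  finally show "real (n choose k) * (- exp (- y)) ^ k * 1 ^ (n - k) = (-1) ^ k * real (n choose k) * exp (- (real k * y))" by simp
 qed
 finally show ?thesis ..
qed

section \<open>Spherical measures convolved with Gaussians\<close>

context haar_orthogonal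
begin

definition gsph :: "real^'n => real => (real^'n) measure" where
 "gsph w s = distr (H \<Otimes>\<^sub>M gauss s) borel (%p. fst p *v w + snd p)"

lemma sets_gsph [simp, measurable_cong]: "sets (gsph w s) = sets borel"
 by (simp add: gsph_def)

lemma prob_space_gsph:
 assumes "s > 0" shows "prob_space (gsph w s)"
proof -
 interpret G: prob_space "gauss s :: (real^'n) measure" by (rule prob_space_gauss) fact
 interpret HG: pair_prob_space H "gauss s :: (real^'n) measure" ..
 show ?thesis unfolding gsph_def by (rule HG.P.prob_space_distr) measurable
qed

lemma charf_gsph:
 assumes s: "s > 0"
 shows "charf (gsph w s) \<xi> = of_real (sphm (norm w * norm \<xi>) * exp (- (s\<^sup>2 * (norm \<xi>)\<^sup>2) / 2))"
proof -
 interpret G: prob_space "gauss s :: (real^'n) measure" by (rule prob_space_gauss) fact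
 have 1: "integrable H (%R. cis (\<xi> \<bullet> (R *v w)))"
 proof -
  have "(%R. cis (\<xi> \<bullet> (R *v w))) \<in> borel_measurable H" by measurable
  thus ?thesis by (intro integrable_const_bound[of _ 1]) simp_all
 qed
 have 2: "integrable (gauss s) (%z. cis (\<xi> \<bullet> z))"
 proof -
  have "(%z. cis (\<xi> \<bullet> z)) \<in> borel_measurable (gauss s)" by measurable
  thus ?thesis by (intro G.integrable_const_bound[of _ 1]) simp_all
 qed
 have "charf (gsph w s) \<xi> = (\<integral>p. cis (\<xi> \<bullet> (fst p *v w + snd p)) \<partial>(H \<Otimes>\<^sub>M gauss s))"
  unfolding charf_def gsph_def by (subst integral_distr) auto
 also have "... = (\<integral>p. cis (\<xi> \<bullet> (fst p *v w)) * cis (\<xi> \<bullet> snd p) \<partial>(H \<Otimes>\<^sub>M gauss s))"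
  by (simp add: inner_add_right cis_mult)
 also have "... = (HI R. cis (\<xi> \<bullet> (R *v w))) * (\<integral>z. cis (\<xi> \<bullet> z) \<partial>gauss s)"
  by (rule integral_mult_pair(2)[OF sigma_finite_measure_axioms G.sigma_finite_measure_axioms 1 2])
 also have "(HI R. cis (\<xi> \<bullet> (R *v w))) = charf (sph w) \<xi>"
  unfolding charf_def sph_def by (subst integral_distr) auto
 also have "(\<integral>z. cis (\<xi> \<bullet> z) \<partial>gauss s) = charf (gauss s) \<xi>"
  by (simp add: charf_def)
 finally show ?thesis using s by (simp add: charf_sph charf_gauss)
qed

lemma tame_indicator_measure:
 assumes "tame (indicat_real E :: real^'n => real)"
 shows "E \<in> sets borel" "evol E < \<infinity>" "evol E = ennreal (vol E)"
  "integrable lborel (indicat_real E)" "(LI x. indicat_real E x) = vol E"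
  "(LI x. (indicat_real E x)\<^sup>2) = vol E"
proof -
 show i: "integrable lborel (indicat_real E)" using assms by (simp add: tame_def)
 hence "indicat_real E \<in> borel_measurable lborel" by auto
 hence "indicat_real E -` {1} \<inter> space lborel \<in> sets lborel" by (rule measurable_sets) simp
 moreover have "indicat_real E -` {1} \<inter> space lborel = E" by (auto simp: indicator_def)
 ultimately show E: "E \<in> sets borel" by simp
 thus f: "evol E < \<infinity>" using i by (simp add: integrable_indicator_iff)
 thus "evol E = ennreal (vol E)" by (intro emeasure_eq_ennreal_measure) auto
 show "(LI x. indicat_real E x) = vol E" by simp
 have "(indicat_real E x)\<^sup>2 = indicat_real E x" for x by (simp add: indicator_def)
 thus "(LI x. (indicat_real E x)\<^sup>2) = vol E" by simp
qed

lemma conv_form_le_measure: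
 assumes E: "tame (indicat_real E :: real^'n => real)" and F: "tame (indicat_real F :: real^'n => real)"
 shows "conv_form (sph w) (indicat_real E) (indicat_real F) <= vol E"
  and "conv_form (sph w) (indicat_real E) (indicat_real F) <= vol F"
  and "0 <= conv_form (sph w) (indicat_real E) (indicat_real F)"
proof -
 note e = tame_indicator_measure[OF E] and f = tame_indicator_measure[OF F]
 note e(1)[measurable] f(1)[measurable]
 interpret S: prob_space "sph w" by (rule prob_space_sph)
 interpret LS: pair_sigma_finite "lborel :: (real^'n) measure" "sph w"
  by (intro pair_sigma_finite.intro sigma_finite_lborel S.sigma_finite_measure_axioms)
 note nn = conv_form_nn_integral[OF e(4) _ _ _ _ prob_space_sph sets_sph, of "indicat_real F" 1 w]
 show "0 <= conv_form (sph w) (indicat_real E) (indicat_real F)" by (rule nn(2)) auto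
 have eq: "ennreal (conv_form (sph w) (indicat_real E) (indicat_real F)) = (LN x. (\<integral>\<^sup>+z. ennreal (indicat_real E x * indicat_real F (x + z)) \<partial>sph w))"
  by (rule nn(1)) auto
 have "... <= (LN x. (\<integral>\<^sup>+z. indicator E x \<partial>sph w))"
  by (intro nn_integral_mono) (simp add: indicator_def)
 also have "... = ennreal (vol E)"
  using e by (simp add: S.emeasure_space_1)
 finally show "conv_form (sph w) (indicat_real E) (indicat_real F) <= vol E"
  unfolding eq[symmetric] by simp
 have "(LN x. (\<integral>\<^sup>+z. ennreal (indicat_real E x * indicat_real F (x + z)) \<partial>sph w)) <= (LN x. (\<integral>\<^sup>+z. indicator F (x + z) \<partial>sph w))"
  by (intro nn_integral_mono) (simp add: indicator_def)
 also have "... = (\<integral>\<^sup>+z. (LN x. indicator F (x + z)) \<partial>sph w)"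
  by (rule LS.Fubini'[symmetric]) measurable
 also have "... = ennreal (vol F)"
  by (subst lborel_nn_integral_shift) (use f in \<open>auto simp: S.emeasure_space_1\<close>)
 finally show "conv_form (sph w) (indicat_real E) (indicat_real F) <= vol F"
  unfolding eq[symmetric] by simp
qed

text \<open>The thickened sphere has density at most C / (s |w|^(d-1)), and this bound is integrated
  over all pairs of points of E and F.\<close>

lemma conv_form_gsph_le:
 obtains C where "C > 0"
  "!!E F s w. tame (indicat_real E :: real^'n => real) ==> tame (indicat_real F :: real^'n => real) ==> 0 < s ==> s <= norm w ==>
   \<bar>conv_form (gsph w s) (indicat_real E) (indicat_real F)\<bar> <= C / (s * norm w ^ (CARD('n) - 1)) * (vol E * vol F)"
proof -
 obtain C where C: "C > 0"
  "!!s w x. 0 < s ==> s <= norm w ==> (HN R. gdens s (x - R *v w)) <= ennreal (C / (s * norm w ^ (CARD('n) - 1)))"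
  using gdens_sph_bound by blast
 show ?thesis
 proof (rule that[OF C(1)])
  fix E F :: "(real^'n) set" and s and w :: "real^'n"
  assume E: "tame (indicat_real E)" and F: "tame (indicat_real F)" and s: "0 < s" "s <= norm w"
  note e = tame_indicator_measure[OF E] and f = tame_indicator_measure[OF F]
  note e(1)[measurable] f(1)[measurable]
  interpret G: prob_space "gauss s :: (real^'n) measure" by (rule prob_space_gauss) fact
  interpret HG: pair_prob_space H "gauss s :: (real^'n) measure" ..
  interpret LH: pair_sigma_finite H "lborel :: (real^'n) measure"
   by (intro pair_sigma_finite.intro sigma_finite_lborel sigma_finite_measure_axioms)
  let ?c = "C / (s * norm w ^ (CARD('n) - 1))"
  have c: "?c > 0" using C s by (auto intro!: divide_pos_pos mult_pos_pos zero_less_power)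
  note nn = conv_form_nn_integral[OF e(4) _ _ _ _ prob_space_gsph[OF s(1)] sets_gsph, of "indicat_real F" 1 w]
  have pos: "0 <= conv_form (gsph w s) (indicat_real E) (indicat_real F)" by (rule nn(2)) auto
  have "ennreal (conv_form (gsph w s) (indicat_real E) (indicat_real F)) = (LN x. (\<integral>\<^sup>+z. ennreal (indicat_real E x * indicat_real F (x + z)) \<partial>gsph w s))"
   by (rule nn(1)) auto
  also have "... = (LN x. indicator E x * (\<integral>\<^sup>+z. indicator F (x + z) \<partial>gsph w s))"
   by (subst nn_integral_cmult[symmetric]) (auto intro!: nn_integral_cong simp: indicator_def)
  also have "... <= (LN x. indicator E x * ennreal (?c * vol F))"
  proof (intro nn_integral_mono mult_left_mono)
   fix x :: "real^'n"
   have "(\<integral>\<^sup>+z. indicator F (x + z) \<partial>gsph w s) = (HN R. (\<integral>\<^sup>+z. indicator F (x + (R *v w + z)) \<partial>gauss s))"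
    unfolding gsph_def by (subst nn_integral_distr, measurable, subst G.nn_integral_fst[symmetric]) (simp_all, measurable)
   also have "... = (HN R. (LN y. ennreal (gdens s ((y - x) - R *v w)) * indicator F y))"
   proof (rule nn_integral_cong)
    fix R
    have "(\<integral>\<^sup>+z. indicator F (x + (R *v w + z)) \<partial>gauss s) = (LN z. ennreal (gdens s (((z + (x + R *v w)) - x) - R *v w)) * indicator F (z + (x + R *v w)))"
     unfolding gauss_def by (subst nn_integral_density) (auto simp: add_ac)
    also have "... = (LN y. ennreal (gdens s ((y - x) - R *v w)) * indicator F y)"
     by (rule lborel_nn_integral_shift[of "%y. ennreal (gdens s ((y - x) - R *v w)) * indicator F y"]) measurable
    finally show "(\<integral>\<^sup>+z. indicator F (x + (R *v w + z)) \<partial>gauss s) = (LN y. ennreal (gdens s ((y - x) - R *v w)) * indicator F y)" .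
   qed
   also have "... = (LN y. (HN R. ennreal (gdens s ((y - x) - R *v w)) * indicator F y))"
    by (rule LH.Fubini'[symmetric]) measurable
   also have "... = (LN y. (HN R. gdens s ((y - x) - R *v w)) * indicator F y)"
    by (intro nn_integral_cong nn_integral_multc) measurable
   also have "... <= (LN y. ennreal ?c * indicator F y)"
    by (intro nn_integral_mono mult_right_mono C(2) s) auto
   also have "... = ennreal (?c * vol F)"
   proof -
    have "(LN y. ennreal ?c * indicator F y) = ennreal ?c * evol F"
     by (rule nn_integral_cmult_indicator) simp
    also have "... = ennreal (?c * vol F)"
     unfolding f(3) by (rule ennreal_mult[symmetric]) (use c in auto)
    finally show ?thesis .
   qed
   finally show "(\<integral>\<^sup>+z. indicator F (x + z) \<partial>gsph w s) <= ennreal (?c * vol F)" .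
  qed auto
  also have "... = ennreal (?c * vol F) * evol E"
   by (subst mult.commute) (simp add: nn_integral_cmult_indicator)
  also have "... = ennreal (?c * (vol E * vol F))"
  proof -
   have "ennreal (?c * vol F) * evol E = ennreal ((?c * vol F) * vol E)"
    unfolding e(3) by (rule ennreal_mult[symmetric]) (intro mult_nonneg_nonneg less_imp_le[OF c] measure_nonneg)+
   thus ?thesis by (simp add: mult_ac)
  qed
  finally have "conv_form (gsph w s) (indicat_real E) (indicat_real F) <= ?c * (vol E * vol F)"
   by (subst (asm) ennreal_le_iff) (intro mult_nonneg_nonneg less_imp_le[OF c] measure_nonneg)+
  thus "\<bar>conv_form (gsph w s) (indicat_real E) (indicat_real F)\<bar> <= ?c * (vol E * vol F)"
   by (simp only: abs_of_nonneg[OF pos])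
 qed
qed

text \<open>Optimising the width \<open>s\<close> of the mollifier balances the smooth part, which is bounded by
 \<open>1 / s\<close>, against the remainder, whose \<open>L\<^sup>2\<close> norm decays like \<open>s\<close> to the power \<open>(d - 1) / 2\<close>;
 the iterated difference \<open>(1 - gauss)\<close> to the power \<open>d\<close> kills the low frequencies of the remainder.\<close>

lemma restricted_endpoint:
 assumes d: "CARD('n) >= 2"
 obtains C where "C > 0"
  "!!E F w. tame (indicat_real E :: real^'n => real) ==> tame (indicat_real F :: real^'n => real) ==> w ~= 0 ==>
   conv_form (sph w) (indicat_real E) (indicat_real F) <=
    C * norm w ^ CARD('n) * ((vol E * vol F) / norm w ^ (2 * CARD('n))) powr (real CARD('n) / (real CARD('n) + 1))"
proof -
 define d where "d = CARD('n)"
 have d2: "d >= 2" using d by (simp add: d_def)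
 obtain C0 where C0: "C0 > 0" "!!r. r > 0 ==> (sphm r)\<^sup>2 * r ^ (d - 1) <= C0"
  using sphm_decay[OF d] unfolding d_def by blast
 obtain C1 where C1: "C1 > 0"
  "!!E F s w. tame (indicat_real E :: real^'n => real) ==> tame (indicat_real F :: real^'n => real) ==> 0 < s ==> s <= norm w ==>
   \<bar>conv_form (gsph w s) (indicat_real E) (indicat_real F)\<bar> <= C1 / (s * norm w ^ (d - 1)) * (vol E * vol F)"
  using conv_form_gsph_le unfolding d_def by blast
 define C where "C = sqrt C0 + 2 ^ d * C1 * real d + 1"
 have C: "C > 0" using C0 C1 by (auto simp: C_def intro!: add_nonneg_pos)
 \<comment> \<open>The decay exponent of the multiplier itself, since \<open>sphm_decay\<close>
   controls its square.\<close>
 define a where "a = (real d - 1) / 2"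
 have a: "a > 0" using d2 by (simp add: a_def)
 define kp where "kp = real d / (real d + 1)"
 show ?thesis
 proof (rule that[OF C])
  fix E F :: "(real^'n) set" and w :: "real^'n"
  assume E: "tame (indicat_real E)" and F: "tame (indicat_real F)" and w: "w ~= 0"
  define t where "t = norm w"
  have t: "t > 0" using w by (simp add: t_def)
  let ?e = "vol E" and ?f = "vol F"
  let ?cf = "%M. conv_form M (indicat_real E) (indicat_real F)"
  define P where "P = ?e * ?f"
  define Q where "Q = P / t ^ (2 * d)"
  have triv: "?cf (sph w) <= ?e" "?cf (sph w) <= ?f" "0 <= ?cf (sph w)"
   using conv_form_le_measure[OF E F] by auto
  have sqP: "sqrt P = t ^ d * sqrt Q"
   using t by (simp add: Q_def real_sqrt_divide power_mult mult.commute[of 2] real_sqrt_mult)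
  have "?cf (sph w) <= C * t ^ d * Q powr kp"
  proof (cases "?e = 0 | ?f = 0")
   case True
   hence "?cf (sph w) = 0" using triv by auto
   thus ?thesis using C t by simp
  next
   case False
   hence ef: "?e > 0" "?f > 0" by (simp_all add: zero_less_measure_iff)
   have P: "P > 0" and Q: "Q > 0" using ef t by (simp_all add: P_def Q_def)
   show ?thesis
   proof (cases "Q > 1")
    case True
    \<comment> \<open>For Q > 1 the geometric mean of the two trivial bounds is already better than
      the claim, because kp >= 1/2.\<close>
    have "(?cf (sph w))\<^sup>2 <= P" unfolding P_def power2_eq_square using triv by (intro mult_mono) auto
    hence "?cf (sph w) <= sqrt P" by (rule real_le_rsqrt)
    also have "... = 1 * t ^ d * Q powr (1/2)" using Q by (simp add: sqP powr_half_sqrt)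
    also have "... <= C * t ^ d * Q powr kp"
     using True t C0(1) C1(1) d2 by (intro mult_mono powr_mono) (auto simp: C_def kp_def field_simps)
    finally show ?thesis .
   next
    case False
    \<comment> \<open>Equalises the two contributions: up to the factor t^d, the remainder is of
      order \<eta>^a Q^(1/2) and the smooth part of order Q / \<eta>, and both become Q^kp.\<close>
    define \<eta> where "\<eta> = Q powr (1 / (real d + 1))"
    have eta: "\<eta> > 0" "\<eta> <= 1" using Q False by (auto simp: \<eta>_def powr_le1)
    \<comment> \<open>Division by d keeps every width sqrt k * s with k <= d below t, as
      \<open>conv_form_gsph_le\<close> requires.\<close>
    define s where "s = t * \<eta> / real d"
    have s: "s > 0" using t eta d2 by (simp add: s_def)
    \<comment> \<open>Variances add, so the k-th power of the Gaussian factor has width sqrt k *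
      s.\<close>
    define M where "M k = (if k = 0 then sph w else gsph w (sqrt (real k) * s))" for k :: nat
    have Mp: "prob_space (M k)" "sets (M k) = sets borel" for k
     using s by (auto simp: M_def prob_space_sph intro!: prob_space_gsph)
    define c where "c k = (-1) ^ k * real (d choose k)" for k
    have chM: "charf (M k) \<xi> = of_real (sphm (t * norm \<xi>) * exp (- (real k * (s\<^sup>2 * (norm \<xi>)\<^sup>2 / 2))))" for k \<xi>
     using s by (auto simp: M_def charf_sph charf_gsph t_def power_mult_distrib mult.assoc)
    have ch: "(\<Sum>k\<le>d. of_real (c k) * charf (M k) \<xi>) = of_real (sphm (t * norm \<xi>) * (1 - exp (- (s\<^sup>2 * (norm \<xi>)\<^sup>2 / 2))) ^ d)" for \<xi>
     unfolding chM binomial_gauss_sum[symmetric] c_def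
     by (simp add: sum_distrib_left mult_ac)
    define eps where "eps = sqrt C0 * (s / t) powr a"
    have e0: "eps >= 0" using C0 by (simp add: eps_def)
    have mb: "cmod (\<Sum>k\<le>d. of_real (c k) * charf (M k) \<xi>) <= eps + 0 * exp (- (1\<^sup>2 * (norm \<xi>)\<^sup>2) / 2)" for \<xi>
    proof (cases "\<xi> = 0")
     case True
     thus ?thesis unfolding ch using d2 e0 by (simp add: power_0_left)
    next
     case False
     define \<rho> where "\<rho> = norm \<xi>"
     have rho: "\<rho> > 0" using False by (simp add: \<rho>_def)
     define y where "y = 1 - exp (- (s\<^sup>2 * \<rho>\<^sup>2 / 2))"
     have y: "0 <= y" "y <= 1" "y <= (s * \<rho>)\<^sup>2"
     proof -
      show "0 <= y" "y <= 1" by (simp_all add: y_def)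
      have "y <= s\<^sup>2 * \<rho>\<^sup>2 / 2" unfolding y_def using exp_ge_add_one_self[of "- (s\<^sup>2 * \<rho>\<^sup>2 / 2)"] by simp
      thus "y <= (s * \<rho>)\<^sup>2" by (simp add: power_mult_distrib) (smt (verit) zero_le_mult_iff zero_le_power2)
     qed
     \<comment> \<open>y is at most 1 and at most (s rho)^2; the d-th power raises the order of
       vanishing at 0 to 2d, which is at least a.\<close>
     have yd: "y ^ d <= (s * \<rho>) powr a"
     proof (cases "s * \<rho> >= 1")
      case True
      have "y ^ d <= 1" using y by (simp add: power_le_one)
      also have "1 <= (s * \<rho>) powr a" using True a by (simp add: ge_one_powr_ge_zero)
      finally show ?thesis .
     next
      case False
      have sr: "0 < s * \<rho>" using s rho by simp
      have "y ^ d <= ((s * \<rho>)\<^sup>2) ^ d" using y by (intro power_mono) auto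
      also have "... = (s * \<rho>) powr real (2 * d)" using sr by (simp only: powr_realpow power_mult)
      also have "... <= (s * \<rho>) powr a" using sr False d2 by (intro powr_mono') (auto simp: a_def)
      finally show ?thesis .
     qed
     have tr: "t * \<rho> > 0" using t rho by simp
     have "(sphm (t * \<rho>) * (t * \<rho>) powr a)\<^sup>2 = (sphm (t * \<rho>))\<^sup>2 * (t * \<rho>) ^ (d - 1)"
     proof -
      have "((t * \<rho>) powr a)\<^sup>2 = (t * \<rho>) powr real (d - 1)"
       using tr d2 by (simp add: power2_eq_square powr_add[symmetric] a_def of_nat_diff)
      thus ?thesis using tr by (simp add: power_mult_distrib powr_realpow)
     qed
     also have "... <= C0" by (rule C0(2)[OF tr])
     finally have "(\<bar>sphm (t * \<rho>)\<bar> * (t * \<rho>) powr a)\<^sup>2 <= C0" by (simp add: power_mult_distrib)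
     hence m: "\<bar>sphm (t * \<rho>)\<bar> * (t * \<rho>) powr a <= sqrt C0" by (rule real_le_rsqrt)
     have "\<bar>sphm (t * \<rho>)\<bar> * y ^ d <= \<bar>sphm (t * \<rho>)\<bar> * ((t * \<rho>) powr a * (s / t) powr a)"
      using yd t s rho by (intro mult_left_mono) (auto simp: powr_mult[symmetric] mult.commute)
     also have "... <= eps"
      using mult_right_mono[OF m, of "(s / t) powr a"] by (simp add: eps_def mult.assoc)
     finally show ?thesis unfolding ch by (simp add: abs_mult norm_mult \<rho>_def y_def norm_power flip: of_real_power of_real_mult of_real_diff)
    qed
    obtain BE NE where E': "NE \<in> null_sets lborel" "!!y. y \<notin> NE ==> isCont (indicat_real E) y"
     using E unfolding tame_def by blast
    obtain BF NF where F': "NF \<in> null_sets lborel" "!!y. y \<notin> NF ==> isCont (indicat_real F) y"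
     using F unfolding tame_def by blast
    note me = tame_indicator_measure[OF E] and mf = tame_indicator_measure[OF F]
    \<comment> \<open>Balances the two squared norms, so that the weighted arithmetic mean equals
      sqrt P.\<close>
    define \<sigma> where "\<sigma> = sqrt (?f / ?e)"
    have sg: "\<sigma> > 0" using ef by (simp add: \<sigma>_def)
    have "\<bar>\<Sum>k\<le>d. c k * ?cf (M k)\<bar> <= eps * (\<sigma> * (LI x. (indicat_real E x)\<^sup>2) + (LI x. (indicat_real F x)\<^sup>2) / \<sigma>) / 2
     + 0 * (\<sigma> * conv_form (gauss 1) (indicat_real E) (indicat_real E) + conv_form (gauss 1) (indicat_real F) (indicat_real F) / \<sigma>) / 2"
     by (rule conv_form_multiplier_le[OF me(4) mf(4) _ _ E' F' _ Mp sg _ _ mb e0, where Bf=1 and Bg=1])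
      (auto simp: indicator_def)
    also have "... = eps * sqrt P"
    proof -
     have "\<sigma> * ?e = sqrt P" "?f / \<sigma> = sqrt P"
      using ef by (simp_all add: \<sigma>_def P_def real_sqrt_mult real_sqrt_divide field_simps)
     thus ?thesis using me mf by simp
    qed
    finally have 1: "\<bar>\<Sum>k\<le>d. c k * ?cf (M k)\<bar> <= eps * sqrt P" .
    have 2: "\<bar>c k * ?cf (M k)\<bar> <= real (d choose k) * (C1 / (s * t ^ (d - 1)) * P)" if k: "k \<in> {1..d}" for k
    proof -
     have sk: "sqrt (real k) * s <= t"
     proof -
      have "real k <= (real d)\<^sup>2" using k d2 self_le_power[of "real d" 2] by simp
      hence "sqrt (real k) <= real d" by (intro real_le_lsqrt) auto
      hence "sqrt (real k) * s <= real d * s" using s by (intro mult_right_mono) auto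
      also have "... <= t" using d2 eta t by (simp add: s_def mult_left_le)
      finally show ?thesis .
     qed
     have k1: "1 <= sqrt (real k)" using k by simp
     have "\<bar>?cf (M k)\<bar> <= C1 / ((sqrt (real k) * s) * t ^ (d - 1)) * P"
      using C1(2)[OF E F, of "sqrt (real k) * s" w] k sk s unfolding P_def t_def by (auto simp: M_def)
     also have "... <= C1 / (s * t ^ (d - 1)) * P"
     proof -
      have A: "s * t ^ (d - 1) <= (sqrt (real k) * s) * t ^ (d - 1)"
       using mult_right_mono[OF k1, of s] s t by (intro mult_right_mono) auto
      have B: "0 < (sqrt (real k) * s) * t ^ (d - 1) * (s * t ^ (d - 1))"
       using s t k1 by (intro mult_pos_pos) auto
      show ?thesis
       by (rule mult_right_mono[OF divide_left_mono[OF A _ B]]) (use C1 P in auto)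
     qed
     finally have "real (d choose k) * \<bar>?cf (M k)\<bar> <= real (d choose k) * (C1 / (s * t ^ (d - 1)) * P)"
      by (rule mult_left_mono) simp
     moreover have "\<bar>c k * ?cf (M k)\<bar> = real (d choose k) * \<bar>?cf (M k)\<bar>"
      by (simp add: c_def abs_mult)
     ultimately show ?thesis by simp
    qed
    have "(\<Sum>k\<le>d. c k * ?cf (M k)) = ?cf (sph w) + (\<Sum>k\<in>{1..d}. c k * ?cf (M k))"
    proof -
     have "{..d} = insert 0 {1..d}" by auto
     thus ?thesis by (simp add: c_def M_def)
    qed
    moreover have "\<bar>\<Sum>k\<in>{1..d}. c k * ?cf (M k)\<bar> <= (\<Sum>k\<in>{1..d}. real (d choose k) * (C1 / (s * t ^ (d - 1)) * P))"
     by (rule order_trans[OF sum_abs sum_mono[OF 2]])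
    moreover have "(\<Sum>k\<in>{1..d}. real (d choose k) * (C1 / (s * t ^ (d - 1)) * P)) <= 2 ^ d * (C1 / (s * t ^ (d - 1)) * P)"
    proof -
     have "(\<Sum>k\<in>{1..d}. real (d choose k)) <= (\<Sum>k\<le>d. real (d choose k))"
      by (rule sum_mono2) auto
     also have "... = 2 ^ d" using choose_row_sum[of d] by (metis of_nat_sum of_nat_power of_nat_numeral)
     finally show ?thesis
      unfolding sum_distrib_right[symmetric] using C1(1) s t P by (intro mult_right_mono) auto
    qed
    ultimately have "?cf (sph w) <= eps * sqrt P + 2 ^ d * (C1 / (s * t ^ (d - 1)) * P)"
     using 1 by linarith
    also have "eps * sqrt P <= sqrt C0 * t ^ d * Q powr kp"
    proof -
     have "s / t <= \<eta>" using t eta d2 by (simp add: s_def field_simps mult_left_le)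
     hence "(s / t) powr a <= \<eta> powr a" using s t a by (intro powr_mono2) auto
     also have "... = Q powr (a / (real d + 1))" by (simp add: \<eta>_def powr_powr)
     finally have "(s / t) powr a * sqrt Q <= Q powr (a / (real d + 1)) * Q powr (1/2)"
      using Q by (simp add: powr_half_sqrt mult_right_mono)
     also have "... = Q powr kp"
      unfolding powr_add[symmetric] by (rule arg_cong[of _ _ "(powr) Q"]) (simp add: a_def kp_def field_simps)
     finally have "(s / t) powr a * sqrt Q <= Q powr kp" .
     hence "sqrt C0 * t ^ d * ((s / t) powr a * sqrt Q) <= sqrt C0 * t ^ d * Q powr kp"
      using C0 t by (intro mult_left_mono) auto
     thus ?thesis by (simp add: eps_def sqP mult_ac)
    qed
    also have "2 ^ d * (C1 / (s * t ^ (d - 1)) * P) = 2 ^ d * C1 * real d * t ^ d * Q powr kp"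
    proof -
     have "t ^ d = t * t ^ (d - 1)" using d2 by (cases d) auto
     hence "2 ^ d * (C1 / (s * t ^ (d - 1)) * P) = 2 ^ d * C1 * real d * t ^ d * (Q / \<eta>)"
      using t d2 eta by (simp add: s_def Q_def power_mult power2_eq_square mult_2 power_add field_simps)
     also have "Q / \<eta> = Q powr kp"
     proof -
      have "Q / \<eta> = Q powr (1 - 1 / (real d + 1))" using Q by (simp add: \<eta>_def powr_diff)
      also have "1 - 1 / (real d + 1) = kp" by (simp add: kp_def field_simps)
      finally show ?thesis .
     qed
     finally show ?thesis .
    qed
    finally have "?cf (sph w) <= (sqrt C0 + 2 ^ d * C1 * real d) * t ^ d * Q powr kp" by (simp add: algebra_simps)
    also have "... <= C * t ^ d * Q powr kp"
     using t by (intro mult_right_mono) (auto simp: C_def)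
    finally show ?thesis .
   qed
  qed
  thus "?cf (sph w) <= C * norm w ^ CARD('n) * ((?e * ?f) / norm w ^ (2 * CARD('n))) powr (real CARD('n) / (real CARD('n) + 1))"
   by (simp add: t_def d_def P_def Q_def kp_def)
 qed
qed

end

section \<open>Calderon-Zygmund decomposition of dyadic sets\<close>

text \<open>The half-open dyadic cube of side 2^k containing x, encoded by its lower corner in units
  of 2^k. Larger \<open>k\<close> means coarser, and equality of grid values means lying in the same
  cube.\<close>

definition grid :: "int => real^'n => int^'n" where
 "grid k x = (\<chi> i. \<lfloor>x $ i / 2 powi k\<rfloor>)"

definition step :: "int => (real^'n => 'b) => bool" where
 "step k f \<longleftrightarrow> (\<forall>x y. grid k x = grid k y --> f x = f y)"

definition near :: "int^'n => int^'n => bool" where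
 "near m n \<longleftrightarrow> (\<forall>i. \<bar>m $ i - n $ i\<bar> <= 1)"

lemma grid_Suc: "grid (k + 1) x $ i = grid k x $ i div 2"
proof -
 have "x $ i / 2 powi (k + 1) = (x $ i / 2 powi k) / real_of_int 2"
  by (simp add: power_int_add)
 thus ?thesis
  unfolding grid_def vec_lambda_beta by (simp only: floor_divide_real_eq_div)
qed

lemma grid_mono_eq:
 assumes "k <= l" "grid k x = grid k y"
 shows "grid l x = grid l y"
 using assms by (induction l rule: int_ge_induct) (auto simp: vec_eq_iff grid_Suc)

lemma step_mono: "step l f ==> k <= l ==> step k f"
 unfolding step_def using grid_mono_eq by blast

lemma step_comp: "step k f ==> step k (%x. F (f x))"
 unfolding step_def by metis

lemma step_comp2: "step k f ==> step k g ==> step k (%x. F (f x) (g x))"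
 unfolding step_def by metis

lemma step_indicator: "step k (%x. x \<in> A) ==> step k (indicat_real A)"
 unfolding indicator_def[abs_def] by (rule step_comp)

lemma step_Int: "step k (%x. x \<in> A) ==> step k (%x. x \<in> B) ==> step k (%x. x \<in> A \<inter> B)"
 unfolding Int_iff by (rule step_comp2)

lemma grid_measurable [measurable]: "grid k \<in> borel \<rightarrow>\<^sub>M count_space UNIV"
proof -
 have "{x. grid k x = n} \<in> sets borel" for n :: "int^'n"
 proof -
  have "{x. grid k x = n} = {x::real^'n. \<forall>i\<in>UNIV. \<lfloor>x $ i / 2 powi k\<rfloor> = n $ i}"
   by (auto simp: grid_def vec_eq_iff)
  also have "... \<in> sets borel" by measurable
  finally show ?thesis .
 qed
 thus ?thesis
  by (subst measurable_count_space_eq_countable) (auto simp: vimage_def)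
qed

lemma step_measurable:
 assumes "step k (f :: real^'n => 'b::topological_space)"
 shows "f \<in> Bor"
proof -
 have "f = (%n. f (SOME y. grid k y = n)) \<circ> grid k"
 proof
  fix x :: "real^'n"
  have "grid k (SOME y. grid k y = grid k x) = grid k x" by (rule someI[of _ x]) simp
  hence "f (SOME y. grid k y = grid k x) = f x" using assms unfolding step_def by blast
  thus "f x = ((%n. f (SOME y. grid k y = n)) \<circ> grid k) x" by (simp only: comp_def)
 qed
 also have "... \<in> Bor" unfolding comp_def by measurable
 finally show ?thesis .
qed

lemma grid_between: "grid k x $ i * 2 powi k <= x $ i" "x $ i < (grid k x $ i + 1) * 2 powi k"
proof -
 have p: "(2::real) powi k > 0" by simp
 have "real_of_int (grid k x $ i) <= x $ i / 2 powi k" "x $ i / 2 powi k < real_of_int (grid k x $ i) + 1"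
  unfolding grid_def vec_lambda_beta by linarith+
 thus "grid k x $ i * 2 powi k <= x $ i" "x $ i < (grid k x $ i + 1) * 2 powi k"
  using p by (simp_all add: field_simps)
qed

lemma grid_eq_iff: "grid k x = n \<longleftrightarrow> (\<forall>i. n $ i * 2 powi k <= x $ i & x $ i < (n $ i + 1) * 2 powi k)"
proof -
 have p: "(2::real) powi k > 0" by simp
 have "\<lfloor>x $ i / 2 powi k\<rfloor> = n $ i \<longleftrightarrow> n $ i * 2 powi k <= x $ i & x $ i < (n $ i + 1) * 2 powi k" for i
  unfolding floor_eq_iff using p by (auto simp: field_simps)
 thus ?thesis by (simp add: grid_def vec_eq_iff)
qed

lemma grid_cell_measure:
 "evol {x::real^'n. grid k x = n} = ennreal ((2 powi k) ^ CARD('n))"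
proof (rule antisym)
 let ?a = "(\<chi> i. n $ i * 2 powi k) :: real^'n" and ?b = "(\<chi> i. (n $ i + 1) * 2 powi k) :: real^'n"
 have p: "(2::real) powi k > 0" by simp
 have le: "?a \<bullet> b <= ?b \<bullet> b" if "b \<in> Basis" for b
  using that p by (auto simp: Basis_vec_def inner_axis)
 have pr: "(\<Prod>b\<in>Basis. (?b - ?a) \<bullet> b) = (2 powi k) ^ CARD('n)"
 proof -
  have "(\<Prod>b\<in>Basis. (?b - ?a) \<bullet> b) = (\<Prod>b\<in>(Basis::(real^'n) set). 2 powi k)"
   by (rule prod.cong) (auto simp: Basis_vec_def inner_axis algebra_simps)
  thus ?thesis by simp
 qed
 have "evol {x. grid k x = n} <= evol (cbox ?a ?b)"
  by (rule emeasure_mono) (auto simp: grid_eq_iff mem_box_cart less_imp_le)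
 thus "evol {x. grid k x = n} <= ennreal ((2 powi k) ^ CARD('n))"
  using le pr by (simp add: emeasure_lborel_cbox)
 have "evol (box ?a ?b) <= evol {x. grid k x = n}"
  by (rule emeasure_mono) (auto simp: grid_eq_iff mem_box_cart less_imp_le)
 thus "ennreal ((2 powi k) ^ CARD('n)) <= evol {x. grid k x = n}"
  using le pr by (simp add: emeasure_lborel_box)
qed

definition grid_faces :: "int => (real^'n) set" where
 "grid_faces k = (\<Union>i. \<Union>m::int. {x. x $ i = m * 2 powi k})"

lemma grid_faces_null: "grid_faces k \<in> null_sets lborel"
proof -
 have "{x::real^'n. x $ i = m * 2 powi k} \<in> null_sets lborel" for i and m :: int
 proof -
  have "negligible {x::real^'n. x \<bullet> axis i 1 = m * 2 powi k}"
   by (rule negligible_standard_hyperplane) (auto simp: Basis_vec_def)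
  hence "{x::real^'n. x $ i = m * 2 powi k} \<in> null_sets lebesgue"
   by (simp add: inner_axis negligible_iff_null_sets)
  moreover have "{x::real^'n. x $ i = m * 2 powi k} \<in> sets lborel" by simp
  ultimately show ?thesis by (simp add: null_sets_completion_iff)
 qed
 thus ?thesis unfolding grid_faces_def by (intro null_sets_UN') auto
qed

text \<open>Supplies the almost everywhere continuity that the removal of the Gaussian weight asks
  for.\<close>

lemma step_isCont:
 fixes f :: "real^'n => 'b::topological_space"
 assumes f: "step k f" and y: "y \<notin> grid_faces k"
 shows "isCont f y"
proof -
 have p: "(2::real) powi k > 0" by simp
 have 1: "grid k y $ i * 2 powi k < y $ i" for i
 proof -
  have "y $ i ~= grid k y $ i * 2 powi k" using y unfolding grid_faces_def by blast
  thus ?thesis using grid_between(1)[of k y i] by linarith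
 qed
 let ?U = "{x::real^'n. \<forall>i. grid k y $ i * 2 powi k < x $ i & x $ i < (grid k y $ i + 1) * 2 powi k}"
 have "open ?U"
  unfolding Collect_all_eq by (intro open_INT finite ballI open_Collect_conj open_Collect_less continuous_intros)
 moreover have "y \<in> ?U" using 1 grid_between(2)[of y _ k] by auto
 moreover have "f x = f y" if "x \<in> ?U" for x
 proof -
  have "grid k x = grid k y"
   by (rule grid_eq_iff[THEN iffD2]) (use that in \<open>auto intro: less_imp_le\<close>)
  thus ?thesis using f unfolding step_def by blast
 qed
 ultimately have "eventually (%x. f x = f y) (nhds y)"
  unfolding eventually_nhds by (intro exI[of _ ?U]) blast
 hence "eventually (%x. f x = f y) (at y)"
  unfolding eventually_at_filter by (rule eventually_mono) simp
 thus ?thesis unfolding isCont_def by (rule tendsto_eventually)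
qed

lemma finite_near: "finite {m::int^'n. near m n}"
proof -
 have "{m::int^'n. near m n} \<subseteq> vec_lambda ` (PiE UNIV (%i. {n $ i - 1 .. n $ i + 1}))"
 proof
  fix m :: "int^'n" assume "m \<in> {m. near m n}"
  hence "vec_nth m \<in> PiE UNIV (%i. {n $ i - 1 .. n $ i + 1})" by (auto simp: near_def abs_le_iff algebra_simps)
  thus "m \<in> vec_lambda ` (PiE UNIV (%i. {n $ i - 1 .. n $ i + 1}))"
   by (intro image_eqI[of _ _ "vec_nth m"]) (simp_all only: vec_nth_inverse)
 qed
 thus ?thesis by (rule finite_subset) (intro finite_imageI finite_PiE; simp)
qed

definition near_count :: "'n::finite itself => nat" where
 "near_count _ = card {m::int^'n. near m 0}"

lemma card_near: "card {m::int^'n. near m n} = near_count TYPE('n)"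
proof -
 have "{m. near m n} = (%m. m + n) ` {m::int^'n. near m 0}"
 proof (intro set_eqI iffI)
  fix m :: "int^'n" assume "m \<in> {m. near m n}"
  thus "m \<in> (%m. m + n) ` {m. near m 0}"
   by (intro image_eqI[of _ _ "m - n"]) (auto simp: near_def)
 qed (auto simp: near_def)
 thus ?thesis unfolding near_count_def by (simp add: card_image inj_on_def)
qed

lemma near_sym: "near m n = near n m"
 by (auto simp: near_def abs_minus_commute)

lemma near_grid:
 assumes "norm (x - y) <= 2 powi k"
 shows "near (grid k x) (grid k y)"
 unfolding near_def
proof
 fix i
 have p: "(2::real) powi k > 0" by simp
 have "\<bar>x $ i - y $ i\<bar> <= 2 powi k"
  using component_le_norm_cart[of "x - y" i] assms by simp
 hence "\<bar>x $ i / 2 powi k - y $ i / 2 powi k\<bar> <= 1"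
  using p by (simp add: diff_divide_distrib[symmetric] abs_divide)
 thus "\<bar>grid k x $ i - grid k y $ i\<bar> <= 1"
  unfolding grid_def vec_lambda_beta by linarith
qed

lemma sum_over_cells:
 fixes f :: "real^'n => real"
 assumes f: "integrable lborel f" and J: "finite J" and z: "!!x. grid k x \<notin> J ==> f x = 0"
 shows "(LI x. f x) = (\<Sum>n\<in>J. (LI x. indicat_real {x. grid k x = n} x * f x))"
proof -
 have i: "integrable lborel (%x. indicat_real {x. grid k x = n} x * f x)" for n
  using integrable_mult_indicator[OF _ f, of "{x. grid k x = n}"] by simp
 have "f x = (\<Sum>n\<in>J. indicat_real {x. grid k x = n} x * f x)" for x
 proof (cases "grid k x \<in> J")
  case True
  thus ?thesis using J by (simp add: indicator_def sum.delta if_distrib[of "%a. a * _"] cong: if_cong)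
 qed (use z in \<open>simp\<close>)
 hence "(LI x. f x) = (LI x. (\<Sum>n\<in>J. indicat_real {x. grid k x = n} x * f x))" by simp
 also have "... = (\<Sum>n\<in>J. (LI x. indicat_real {x. grid k x = n} x * f x))"
  using i by (rule Bochner_Integration.integral_sum)
 finally show ?thesis .
qed

definition cells :: "int => (int^'n) set => (real^'n) set" where
 "cells k J = {x. grid k x \<in> J}"

lemma cells_measurable [measurable]: "cells k J \<in> sets borel"
proof -
 have "cells k J = grid k -` J \<inter> space borel" by (auto simp: cells_def)
 thus ?thesis by (simp only: measurable_sets[OF grid_measurable] sets_count_space Pow_UNIV UNIV_I)
qed

lemma step_set: "step k (%x. x \<in> A) ==> A = cells k (grid k ` A)"
 unfolding step_def cells_def by blast

lemma emeasure_cells: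
 assumes "finite J"
 shows "evol (cells k J :: (real^'n) set) = ennreal (real (card J) * (2 powi k) ^ CARD('n))"
proof -
 have "cells k J = (\<Union>n\<in>J. {x::real^'n. grid k x = n})" by (auto simp: cells_def)
 hence "evol (cells k J :: (real^'n) set) = (\<Sum>n\<in>J. evol {x::real^'n. grid k x = n})"
  using assms by (simp only:) (rule sum_emeasure[symmetric], auto simp: disjoint_family_on_def)
 also have "... = ennreal (real (card J) * (2 powi k) ^ CARD('n))"
  by (simp add: grid_cell_measure ennreal_mult ennreal_of_nat_eq_real_of_nat)
 finally show ?thesis .
qed

lemma measure_cells: "finite J ==> vol (cells k J :: (real^'n) set) = real (card J) * (2 powi k) ^ CARD('n)"
 by (simp add: measure_def emeasure_cells)

lemma bounded_finite_cells:
 fixes f :: "real^'n => real"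
 assumes [measurable]: "f \<in> Bor" and B: "!!x. \<bar>f x\<bar> <= B"
  and J: "finite J" and z: "!!x. grid k x \<notin> J ==> f x = 0"
 shows "integrable lborel f"
proof (rule Bochner_Integration.integrable_bound)
 show "integrable lborel (%x. B * indicat_real (cells k J) x)"
  using J by (intro integrable_mult_right integrable_real_indicator) (auto simp: emeasure_cells)
 show "AE x in lborel. norm (f x) <= norm (B * indicat_real (cells k J) x)"
  using z by (auto simp: cells_def indicator_def intro!: order_trans[OF B abs_ge_self])
qed simp

lemma tame_step:
 fixes f :: "real^'n => real"
 assumes f: "step k f" and B: "!!x. \<bar>f x\<bar> <= B" and J: "finite J" and z: "!!x. grid l x \<notin> J ==> f x = 0"
 shows "tame f"
 unfolding tame_def
 using bounded_finite_cells[OF step_measurable[OF f] B J z] B grid_faces_null step_isCont[OF f] by blast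

text \<open>For \<open>al >= 1\<close> all the stopping sets are empty and the good part is the
 indicator itself.\<close>

locale cz_set =
 fixes E :: "(real^'n) set" and I0 :: "(int^'n) set" and k0 :: int and al :: real
 assumes I0: "finite I0" and E: "E = cells k0 I0" and alpha: "al > 0"
begin

lemma E_borel [measurable]: "E \<in> sets borel"
 by (simp add: E)

lemma E_fin: "evol E < \<infinity>"
 unfolding E using I0 by (simp add: emeasure_cells)

lemma E_fmeas: "E \<in> fmeasurable lborel"
 using E_fin by (intro fmeasurableI) auto

section \<open>Stopping cubes, good and bad parts\<close>

definition dens :: "int => real^'n => real" where
 "dens k x = vol (E \<inter> {y. grid k y = grid k x}) / (2 powi k) ^ CARD('n)"

text \<open>The union of the maximal dyadic cubes of side 2^k on which the density of E exceeds
  \<open>al\<close>.\<close>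

definition stop :: "int => (real^'n) set" where
 "stop k = {x. dens k x > al & (\<forall>l>k. dens l x <= al)}"

definition bad :: "int => real^'n => real" where
 "bad k x = (indicator E x - dens k x) * indicator (stop k) x"

lemma dens_step: "step k (dens k)"
 by (simp add: step_def dens_def)

lemma dens_bounds: "0 <= dens k x" "dens k x <= 1"
proof -
 show "0 <= dens k x" by (simp add: dens_def)
 have "vol (E \<inter> {y. grid k y = grid k x}) <= vol {y. grid k y = grid k x}"
  by (rule measure_mono_fmeasurable) (auto intro!: fmeasurableI simp: grid_cell_measure)
 also have "... = (2 powi k) ^ CARD('n)" by (simp add: measure_def grid_cell_measure)
 finally show "dens k x <= 1" by (simp add: dens_def)
qed

lemma dens_parent: "dens k x <= 2 ^ CARD('n) * dens (k + 1) x"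
proof -
 have "vol (E \<inter> {y. grid k y = grid k x}) <= vol (E \<inter> {y. grid (k+1) y = grid (k+1) x})"
  by (rule measure_mono_fmeasurable) (auto intro!: fmeasurable_Int_fmeasurable E_fmeas grid_mono_eq[of k "k+1"])
 hence "dens k x <= vol (E \<inter> {y. grid (k+1) y = grid (k+1) x}) / (2 powi k) ^ CARD('n)"
  unfolding dens_def by (rule divide_right_mono) simp
 also have "... = 2 ^ CARD('n) * dens (k + 1) x"
  by (simp add: dens_def power_int_add power_mult_distrib)
 finally show ?thesis .
qed

lemma stop_step: "step k (%x. x \<in> stop k)"
 unfolding step_def stop_def
proof (intro allI impI)
 fix x y :: "real^'n" assume xy: "grid k x = grid k y"
 have "dens l x = dens l y" if "l >= k" for l
  by (simp only: dens_def grid_mono_eq[OF that xy])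
 thus "(x \<in> {x. dens k x > al & (\<forall>l>k. dens l x <= al)}) = (y \<in> {x. dens k x > al & (\<forall>l>k. dens l x <= al)})"
  unfolding mem_Collect_eq by (metis order_less_imp_le order_refl)
qed

lemma stop_measurable [measurable]: "stop k \<in> sets borel"
 using step_set[OF stop_step] cells_measurable by metis

lemma stop_disjoint:
 assumes "x \<in> stop k" "x \<in> stop l" shows "k = l"
proof (rule linorder_cases[of k l])
 assume "k < l" thus ?thesis using assms by (force simp: stop_def)
next
 assume "l < k" thus ?thesis using assms by (force simp: stop_def)
qed

lemma dens_eq_1: "x \<in> E ==> k <= k0 ==> dens k x = 1"
proof -
 assume x: "x \<in> E" "k <= k0"
 have "y \<in> E" if "grid k y = grid k x" for y
  using grid_mono_eq[OF x(2) that] x(1) by (simp only: E cells_def mem_Collect_eq)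
 hence "E \<inter> {y. grid k y = grid k x} = {y. grid k y = grid k x}" by blast
 thus ?thesis by (simp add: dens_def measure_def grid_cell_measure)
qed

text \<open>A cube finer than level k0 lies inside E or outside it; if its density is positive, its
  ancestor at level k0 has density 1 and contradicts maximality.\<close>

lemma stop_ge: assumes "x \<in> stop k" shows "k0 <= k"
proof (rule ccontr)
 assume "~ k0 <= k"
 hence k: "k < k0" by simp
 have a: "dens k x > al" "dens k0 x <= al" using assms k by (auto simp: stop_def)
 hence "vol (E \<inter> {y. grid k y = grid k x}) ~= 0" using alpha by (auto simp: dens_def)
 hence "E \<inter> {y. grid k y = grid k x} ~= {}" by (metis measure_empty)
 then obtain y where y: "y \<in> E" "grid k y = grid k x" by blast
 have "dens k0 x = dens k0 y" using grid_mono_eq[OF less_imp_le[OF k] y(2)] by (simp add: dens_def)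
 also have "... = 1" using y by (intro dens_eq_1) auto
 finally show False using a dens_bounds(2)[of k x] by simp
qed

lemma dens_small: obtains k1 where "k1 >= k0" "!!k x. k > k1 ==> dens k x <= al"
proof -
 obtain m :: nat where m: "vol E / al < 2 ^ m" using real_arch_pow[of 2] by auto
 define k1 where "k1 = max k0 (int m)"
 show ?thesis
 proof (rule that[of k1])
  show "k0 <= k1" by (simp add: k1_def)
  fix k x assume k: "k > k1"
  hence n: "k = int (nat k)" "nat k >= m" unfolding k1_def by linarith+
  then obtain n :: nat where n: "k = int n" "n >= m" by blast
  have "vol E <= al * 2 ^ m" using m alpha by (simp add: field_simps)
  also have "... <= al * (2 ^ n) ^ 1" using n alpha by (simp add: power_increasing)
  also have "... <= al * (2 ^ n) ^ CARD('n)"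
   using alpha by (intro mult_left_mono power_increasing) (auto simp: Suc_le_eq)
  finally have "vol E / (2 powi k) ^ CARD('n) <= al" using n by (simp add: field_simps)
  moreover have "dens k x <= vol E / (2 powi k) ^ CARD('n)"
   unfolding dens_def by (intro divide_right_mono measure_mono_fmeasurable E_fmeas) auto
  ultimately show "dens k x <= al" by simp
 qed
qed

definition K :: "int set" where "K = {k. stop k ~= {}}"

lemma finite_K: "finite K"
proof -
 obtain k1 where k1: "k1 >= k0" "!!k x. k > k1 ==> dens k x <= al" by (rule dens_small) blast
 have "K \<subseteq> {k0..k1}"
 proof
  fix k assume "k \<in> K"
  then obtain x where x: "x \<in> stop k" by (auto simp: K_def)
  hence "~ k > k1" using k1(2)[of k x] by (auto simp: stop_def)
  thus "k \<in> {k0..k1}" using stop_ge[OF x] by simp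
 qed
 thus ?thesis by (rule finite_subset) simp
qed

lemma E_covered:
 assumes x: "x \<in> E" and a: "al < 1"
 obtains k where "x \<in> stop k"
proof -
 obtain k1 where k1: "k1 >= k0" "!!k x. k > k1 ==> dens k x <= al" by (rule dens_small) blast
 define S where "S = {k\<in>{k0..k1}. dens k x > al}"
 have S: "finite S" "k0 \<in> S"
  using k1 x a by (auto simp: S_def dens_eq_1 intro!: finite_subset[of _ "{k0..k1}"])
 hence "Max S \<in> S" by (intro Max_in) auto
 moreover have "dens l x <= al" if "l > Max S" for l
 proof (rule ccontr)
  assume "~ dens l x <= al"
  hence "l <= k1" using k1(2)[of l x] by (meson not_less)
  hence "l \<in> S" using that \<open>Max S \<in> S\<close> \<open>~ dens l x <= al\<close> by (auto simp: S_def)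
  thus False using Max_ge[OF S(1)] that by fastforce
 qed
 ultimately have "x \<in> stop (Max S)" by (auto simp: stop_def S_def)
 thus ?thesis by (rule that)
qed

definition good :: "real^'n => real" where
 "good x = (if \<exists>k. x \<in> stop k then dens (THE k. x \<in> stop k) x else indicator E x)"

lemma good_stop: "x \<in> stop k ==> good x = dens k x"
proof -
 assume x: "x \<in> stop k"
 hence "(THE k. x \<in> stop k) = k" using stop_disjoint by blast
 thus ?thesis using x by (auto simp: good_def)
qed

lemma decomposition: "indicat_real E x = good x + (\<Sum>k\<in>K. bad k x)"
proof (cases "\<exists>k. x \<in> stop k")
 case True
 then obtain k where k: "x \<in> stop k" by blast
 have "(\<Sum>k\<in>K. bad k x) = (\<Sum>l\<in>K. if l = k then bad k x else 0)"
  by (rule sum.cong[OF refl]) (use k stop_disjoint in \<open>auto simp: bad_def indicator_def\<close>)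
 also have "... = bad k x" using finite_K k by (auto simp: K_def)
 finally show ?thesis using k by (simp add: good_stop bad_def)
next
 case False
 hence "(\<Sum>k\<in>K. bad k x) = 0" by (intro sum.neutral) (auto simp: bad_def)
 thus ?thesis using False by (simp add: good_def)
qed

text \<open>The parent of a stopping cube has density at most \<open>al\<close>, and passing to the
  child costs 2^d. Off the stopping cubes there are no points of E when al < 1, since such points
  have density 1 at level k0.\<close>

lemma good_bounds: "0 <= good x" "good x <= 2 ^ CARD('n) * min 1 al"
proof -
 have one: "(1::real) <= 2 ^ CARD('n)" by simp
 show "0 <= good x" using dens_bounds by (auto simp: good_def)
 show "good x <= 2 ^ CARD('n) * min 1 al"
 proof (cases "\<exists>k. x \<in> stop k")
  case True
  then obtain k where k: "x \<in> stop k" by blast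
  have "dens (k + 1) x <= al" using k by (simp add: stop_def)
  hence "dens k x <= 2 ^ CARD('n) * al"
   using dens_parent[of k x] by (smt (verit) mult_left_mono zero_le_power)
  moreover have "dens k x <= 2 ^ CARD('n) * 1" using dens_bounds(2)[of k x] one by linarith
  ultimately show ?thesis using k by (simp add: good_stop min_def)
 next
  case False
  show ?thesis
  proof (cases "x \<in> E")
   case True
   hence "al >= 1" using False E_covered by (metis not_le)
   thus ?thesis using False one by (simp add: good_def min_def indicator_def)
  qed (use False alpha in \<open>auto simp: good_def min_def\<close>)
 qed
qed

lemma E_step: "k <= k0 ==> step k (%x. x \<in> E)"
 by (rule step_mono[of k0]) (auto simp: step_def E cells_def)

lemma finite_grid_E: "k >= k0 ==> finite (grid k ` E)"
proof -
 assume k: "k >= k0"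
 have "grid k ` E \<subseteq> (%n. grid k (SOME y. grid k0 y = n)) ` I0"
 proof
  fix m assume "m \<in> grid k ` E"
  then obtain x where x: "x \<in> E" "m = grid k x" by blast
  have "grid k0 (SOME y. grid k0 y = grid k0 x) = grid k0 x" by (rule someI[of _ x]) simp
  from grid_mono_eq[OF k this] show "m \<in> (%n. grid k (SOME y. grid k0 y = n)) ` I0"
   using x by (intro image_eqI[of _ _ "grid k0 x"]) (simp_all add: E cells_def)
 qed
 thus ?thesis by (rule finite_subset) (use I0 in simp)
qed

lemma stop_meets_E:
 assumes "x \<in> stop k"
 obtains y where "y \<in> E" "grid k y = grid k x"
proof -
 have "vol (E \<inter> {y. grid k y = grid k x}) ~= 0"
  using assms alpha by (auto simp: stop_def dens_def)
 hence "E \<inter> {y. grid k y = grid k x} ~= {}" by (metis measure_empty)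
 thus ?thesis using that by blast
qed

lemma finite_grid_stop: "finite (grid k ` stop k)"
proof (cases "stop k = {}")
 case False
 hence k: "k >= k0" using stop_ge by blast
 have "grid k ` stop k \<subseteq> grid k ` E"
 proof
  fix m assume "m \<in> grid k ` stop k"
  then obtain x where x: "x \<in> stop k" "m = grid k x" by blast
  then obtain y where "y \<in> E" "grid k y = grid k x" using stop_meets_E by metis
  with x(2) show "m \<in> grid k ` E" by (metis image_eqI)
 qed
 thus ?thesis by (rule finite_subset[OF _ finite_grid_E[OF k]])
qed simp

lemma stop_cells: "stop k = cells k (grid k ` stop k)"
 by (rule step_set[OF stop_step])

lemma stop_fmeas: "stop k \<in> fmeasurable lborel"
 using emeasure_cells[OF finite_grid_stop, of k k] stop_cells[of k] by (intro fmeasurableI) auto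

lemma bad_abs_le: "\<bar>bad k x\<bar> <= 1"
 using dens_bounds[of k x] by (auto simp: bad_def indicator_def)

lemma bad_measurable [measurable]: "bad k \<in> Bor"
proof -
 have [measurable]: "dens k \<in> Bor" by (rule step_measurable[OF dens_step])
 show ?thesis unfolding bad_def by measurable
qed

lemma bad_outside: "grid k x \<notin> grid k ` stop k ==> bad k x = 0"
 by (auto simp: bad_def indicator_def)

text \<open>On a single stopping cube both the test function and the density are constant, and the
  density is the mean of the indicator of E over that cube.\<close>

lemma bad_mean_zero:
 fixes \<psi> :: "real^'n => real"
 assumes \<psi>: "step k \<psi>" and B: "!!x. \<bar>\<psi> x\<bar> <= B"
 shows "(LI x. bad k x * \<psi> x) = 0"
proof -
 have [measurable]: "\<psi> \<in> Bor" by (rule step_measurable[OF \<psi>])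
 have "integrable lborel (%x. bad k x * \<psi> x)"
 proof (rule bounded_finite_cells[where k=k, OF _ _ finite_grid_stop[of k]])
  show "\<bar>bad k x * \<psi> x\<bar> <= 1 * B" for x
   unfolding abs_mult by (intro mult_mono bad_abs_le B) auto
 qed (auto simp: bad_outside)
 hence "(LI x. bad k x * \<psi> x) = (\<Sum>n\<in>grid k ` stop k. (LI x. indicat_real {x. grid k x = n} x * (bad k x * \<psi> x)))"
  by (rule sum_over_cells[OF _ finite_grid_stop]) (simp add: bad_outside)
 also have "... = 0"
 proof (rule sum.neutral, rule ballI)
  fix n assume "n \<in> grid k ` stop k"
  then obtain y where y: "y \<in> stop k" "n = grid k y" by blast
  let ?c = "{x. grid k x = n}"
  have eq: "indicat_real ?c x * (bad k x * \<psi> x) = \<psi> y * (indicat_real (E \<inter> ?c) x - dens k y * indicat_real ?c x)" for x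
  proof (cases "grid k x = n")
   case True
   hence "x \<in> stop k" "dens k x = dens k y" "\<psi> x = \<psi> y"
    using y stop_step[of k] dens_step[of k] \<psi> unfolding step_def by metis+
   thus ?thesis using True by (auto simp: bad_def indicator_def)
  qed (simp add: indicator_def)
  have cf: "evol (E \<inter> ?c) < \<infinity>"
   by (rule le_less_trans[OF emeasure_mono[of _ E] E_fin]) auto
  have "(LI x. indicat_real ?c x * (bad k x * \<psi> x)) = \<psi> y * (vol (E \<inter> ?c) - dens k y * vol ?c)"
   unfolding eq
   by (subst integral_mult_right_zero, subst Bochner_Integration.integral_diff)
    (use cf in \<open>auto intro!: integrable_real_indicator integrable_mult_right simp: grid_cell_measure\<close>)
  also have "... = 0"
   using y by (simp add: dens_def measure_def grid_cell_measure)
  finally show "(LI x. indicat_real ?c x * (bad k x * \<psi> x)) = 0" .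
 qed
 finally show ?thesis .
qed

section \<open>The bad part localised to a union of cubes\<close>

context
 fixes k :: int and U :: "(real^'n) set"
 assumes U: "step k (%x. x \<in> U)"
begin

text \<open>Truncation to \<open>U\<close> preserves the mean zero property because a union of
  level-k cubes never cuts a stopping cube of that level.\<close>

definition badU :: "real^'n => real" where "badU x = bad k x * indicator U x"

lemma U_ind_step: "step k (indicat_real U)"
 by (rule step_indicator[OF U])

lemma U_measurable [measurable]: "U \<in> sets borel"
 using step_set[OF U] cells_measurable by metis

lemma badU_measurable [measurable]: "badU \<in> Bor"
 unfolding badU_def by measurable

lemma tame_badU: "tame badU"
proof (cases "stop k = {}")
 case True
 hence "badU = (%x. 0)" by (auto simp: badU_def bad_def)
 thus ?thesis by (auto simp: tame_def intro!: bexI[of _ "{}"])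
next
 case False
 hence k: "k0 <= k" using stop_ge by blast
 \<comment> \<open>Inside a stopping cube the function still follows E, so it is constant only on
   the finer cubes of level k0.\<close>
 have "step k0 badU"
 proof -
  note st = step_indicator[OF E_step[OF order_refl]] step_mono[OF dens_step k]
   step_indicator[OF step_mono[OF stop_step k]] step_indicator[OF step_mono[OF U k]]
  have "step k0 (%x. indicat_real E x - dens k x)" by (rule step_comp2[OF st(1,2)])
  hence "step k0 (bad k)" unfolding bad_def[abs_def] by (rule step_comp2[OF _ st(3)])
  thus ?thesis unfolding badU_def[abs_def] by (rule step_comp2[OF _ st(4)])
 qed
 thus ?thesis
  by (rule tame_step[of k0 _ 1 "grid k ` stop k" k])
   (use bad_abs_le finite_grid_stop in \<open>auto simp: badU_def indicator_def bad_outside\<close>)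
qed

lemma tame_EU: "tame (indicat_real (E \<inter> stop k \<inter> U))"
proof (cases "stop k = {}")
 case True
 hence "indicat_real (E \<inter> stop k \<inter> U) = (%x. 0)" by auto
 thus ?thesis by (auto simp: tame_def intro!: bexI[of _ "{}"])
next
 case False
 hence k: "k0 <= k" using stop_ge by blast
 have "step k0 (indicat_real (E \<inter> stop k \<inter> U))"
  by (intro step_indicator step_Int E_step order_refl step_mono[OF stop_step k] step_mono[OF U k])
 thus ?thesis
  by (rule tame_step[of k0 _ 1 "grid k ` stop k" k])
   (use finite_grid_stop in \<open>auto simp: indicator_def\<close>)
qed

lemma tame_stopU: "tame (indicat_real (stop k \<inter> U))"
 by (rule tame_step[of k _ 1 "grid k ` stop k" k])
  (use finite_grid_stop in \<open>auto simp: indicator_def intro!: step_indicator step_Int stop_step U\<close>)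

lemma integrable_parts:
 "integrable lborel badU" "integrable lborel (indicat_real (E \<inter> stop k \<inter> U))"
 "integrable lborel (%x. dens k x * indicat_real (stop k \<inter> U) x)" "integrable lborel (indicat_real (stop k \<inter> U))"
proof -
 show "integrable lborel badU" using tame_badU by (simp add: tame_def)
 show "integrable lborel (indicat_real (E \<inter> stop k \<inter> U))" using tame_EU by (simp add: tame_def)
 show i: "integrable lborel (indicat_real (stop k \<inter> U))" using tame_stopU by (simp add: tame_def)
 have [measurable]: "dens k \<in> Bor" by (rule step_measurable[OF dens_step])
 show "integrable lborel (%x. dens k x * indicat_real (stop k \<inter> U) x)"
  by (rule Bochner_Integration.integrable_bound[OF i]) (use dens_bounds in \<open>auto simp: indicator_def\<close>)
qed

lemma integral_dens: "(LI x. dens k x * indicat_real (stop k \<inter> U) x) = vol (E \<inter> stop k \<inter> U)"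
proof -
 have "0 = (LI x. bad k x * indicat_real U x)"
  by (rule bad_mean_zero[symmetric, OF U_ind_step, of 1]) (auto simp: indicator_def)
 also have "... = (LI x. indicat_real (E \<inter> stop k \<inter> U) x - dens k x * indicat_real (stop k \<inter> U) x)"
  by (intro Bochner_Integration.integral_cong refl) (auto simp: bad_def indicator_def)
 also have "... = vol (E \<inter> stop k \<inter> U) - (LI x. dens k x * indicat_real (stop k \<inter> U) x)"
  using integrable_parts by (subst Bochner_Integration.integral_diff) auto
 finally show ?thesis by simp
qed

lemma stopU_measure_le: "al * vol (stop k \<inter> U) <= vol (E \<inter> stop k \<inter> U)"
proof -
 have "al * vol (stop k \<inter> U) = (LI x. al * indicat_real (stop k \<inter> U) x)" by simp
 also have "... <= (LI x. dens k x * indicat_real (stop k \<inter> U) x)"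
  by (rule integral_mono[OF integrable_mult_right[OF integrable_parts(4)] integrable_parts(3)])
   (auto simp: indicator_def stop_def)
 finally show ?thesis by (simp add: integral_dens)
qed

lemma badU_L1: "(LI x. \<bar>badU x\<bar>) <= 2 * vol (E \<inter> stop k \<inter> U)"
proof -
 have "(LI x. \<bar>badU x\<bar>) <= (LI x. indicat_real (E \<inter> stop k \<inter> U) x + dens k x * indicat_real (stop k \<inter> U) x)"
  by (rule integral_mono[OF integrable_abs[OF integrable_parts(1)] Bochner_Integration.integrable_add[OF integrable_parts(2,3)]])
   (use dens_bounds in \<open>auto simp: badU_def bad_def indicator_def\<close>)
 also have "... = 2 * vol (E \<inter> stop k \<inter> U)"
  using integrable_parts by (subst Bochner_Integration.integral_add) (auto simp: integral_dens)
 finally show ?thesis .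
qed

text \<open>The density times the indicator of U is constant on cubes and hence orthogonal to the
  bad part. What remains is the integral of the bad part over E, where it is at most 1.\<close>

lemma badU_L2: "(LI x. (badU x)\<^sup>2) <= vol (E \<inter> stop k \<inter> U)"
proof -
 have "0 = (LI x. bad k x * (dens k x * indicat_real U x))"
  by (rule bad_mean_zero[symmetric, where B=1, OF step_comp2[OF dens_step U_ind_step]])
   (use dens_bounds in \<open>auto simp: indicator_def\<close>)
 hence z: "(LI x. badU x * dens k x) = 0" by (simp add: badU_def mult_ac)
 have [measurable]: "dens k \<in> Bor" by (rule step_measurable[OF dens_step])
 have i1: "integrable lborel (%x. badU x * dens k x)"
  by (rule Bochner_Integration.integrable_bound[OF integrable_parts(1)])
   (use dens_bounds in \<open>auto simp: abs_mult mult_left_le\<close>)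
 have i2: "integrable lborel (%x. badU x * indicat_real E x)"
  by (rule Bochner_Integration.integrable_bound[OF integrable_parts(1)]) (auto simp: abs_mult indicator_def)
 have "(LI x. (badU x)\<^sup>2) = (LI x. badU x * indicat_real E x - badU x * dens k x)"
  by (intro Bochner_Integration.integral_cong refl) (auto simp: badU_def bad_def indicator_def power2_eq_square algebra_simps)
 also have "... = (LI x. badU x * indicat_real E x)"
  using i1 i2 z by simp
 also have "... <= (LI x. indicat_real (E \<inter> stop k \<inter> U) x)"
  by (rule integral_mono[OF i2 integrable_parts(2)]) (use dens_bounds in \<open>auto simp: badU_def bad_def indicator_def\<close>)
 finally show ?thesis using integrable_parts(2) by simp
qed

text \<open>A majorant made of indicators, so that the restricted endpoint estimate becomes
  applicable to bad parts.\<close>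

lemma badU_abs_le:
 "\<bar>badU x\<bar> <= indicat_real (E \<inter> stop k \<inter> U) x + 2 ^ CARD('n) * al * indicat_real (stop k \<inter> U) x"
proof (cases "x \<in> stop k \<inter> U")
 case True
 hence "good x = dens k x" by (simp add: good_stop)
 hence "dens k x <= 2 ^ CARD('n) * al"
  using good_bounds(2)[of x] by (smt (verit) min.cobounded2 mult_left_mono zero_le_power)
 thus ?thesis using True dens_bounds[of k x] by (auto simp: badU_def bad_def indicator_def)
qed (auto simp: badU_def bad_def indicator_def)

lemma badU_cancels: "cancels (real CARD('n) * 2 powi k) badU"
 unfolding cancels_def
proof (intro allI impI)
 fix L and \<phi> :: "real^'n => real"
 assume lip: "\<forall>x y. \<bar>\<phi> x - \<phi> y\<bar> <= L * norm (x - y)" and bd: "bounded (range \<phi>)"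
 obtain B where B: "!!x. \<bar>\<phi> x\<bar> <= B" using bd by (auto simp: bounded_iff)
 \<comment> \<open>The lower corner of the cube of x: the function phi (r x) is constant on cubes,
   so it may be subtracted, and r x is within the claimed scale of x.\<close>
 define r where "r x = (\<chi> i. real_of_int (grid k x $ i) * 2 powi k)" for x :: "real^'n"
 let ?h = "real CARD('n) * 2 powi k"
 have L0: "L >= 0"
  using order_trans[OF abs_ge_zero lip[rule_format, of "axis undefined 1" 0]] by simp
 have close: "norm (x - r x) <= ?h" for x
 proof -
  have "norm (x - r x) <= (\<Sum>i\<in>UNIV. \<bar>(x - r x) $ i\<bar>)" by (rule norm_le_l1_cart)
  also have "... <= (\<Sum>i\<in>(UNIV::'n set). 2 powi k)"
   using grid_between(1)[of k x] grid_between(2)[of x _ k] by (intro sum_mono) (auto simp: r_def abs_le_iff algebra_simps less_imp_le)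
  finally show ?thesis by simp
 qed
 have [measurable]: "\<phi> \<in> Bor"
 proof -
  have "L-lipschitz_on UNIV \<phi>" using lip L0 by (auto simp: lipschitz_on_def dist_norm)
  thus ?thesis by (intro borel_measurable_continuous_onI lipschitz_on_continuous_on)
 qed
 have rs: "step k (%x. \<phi> (r x))" by (simp add: step_def r_def)
 have [measurable]: "(%x. \<phi> (r x)) \<in> Bor" by (rule step_measurable[OF rs])
 have z: "(LI x. badU x * \<phi> (r x)) = 0"
 proof -
  have "(LI x. bad k x * (\<phi> (r x) * indicat_real U x)) = 0"
   by (rule bad_mean_zero[where B=B, OF step_comp2[OF rs U_ind_step]])
    (use B in \<open>auto simp: indicator_def intro: order_trans[OF abs_ge_zero B]\<close>)
  thus ?thesis by (simp add: badU_def mult_ac)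
 qed
 have i: "integrable lborel (%x. badU x * \<psi> x)" if "!!x. \<bar>\<psi> x\<bar> <= B" "\<psi> \<in> Bor" for \<psi>
 proof (rule Bochner_Integration.integrable_bound)
  show "integrable lborel (%x. badU x * B)" using integrable_parts by simp
  show "AE x in lborel. norm (badU x * \<psi> x) <= norm (badU x * B)"
   using that by (auto simp: abs_mult intro!: mult_left_mono order_trans[OF that(1) abs_ge_self])
 qed (use that in measurable)
 have "(LI x. badU x * \<phi> x) = (LI x. badU x * \<phi> x - badU x * \<phi> (r x))"
  using i[of \<phi>] i[of "%x. \<phi> (r x)"] B z by simp
 hence "\<bar>(LI x. badU x * \<phi> x)\<bar> <= (LI x. \<bar>badU x * \<phi> x - badU x * \<phi> (r x)\<bar>)"
  by (simp only: integral_abs_bound)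
 also have "... <= (LI x. L * ?h * \<bar>badU x\<bar>)"
 proof (rule integral_mono)
  show "integrable lborel (%x. \<bar>badU x * \<phi> x - badU x * \<phi> (r x)\<bar>)"
   using i[of \<phi>] i[of "%x. \<phi> (r x)"] B by simp
  show "integrable lborel (%x. L * ?h * \<bar>badU x\<bar>)" using integrable_parts by simp
  fix x
  have "\<bar>\<phi> x - \<phi> (r x)\<bar> <= L * ?h"
   using lip close[of x] L0 by (meson mult_left_mono order_trans)
  hence "\<bar>badU x\<bar> * \<bar>\<phi> x - \<phi> (r x)\<bar> <= \<bar>badU x\<bar> * (L * ?h)" by (rule mult_left_mono) simp
  thus "\<bar>badU x * \<phi> x - badU x * \<phi> (r x)\<bar> <= L * ?h * \<bar>badU x\<bar>"
   unfolding right_diff_distrib[symmetric] abs_mult by (simp only: mult_ac)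
 qed
 finally show "\<bar>(LI x. badU x * \<phi> x)\<bar> <= L * ?h * (LI x. \<bar>badU x\<bar>)" by simp
qed

end

text \<open>Maximality of the stopping cubes. This sparseness at coarser scales later converts
  measures into powers of \<open>al\<close>.\<close>

lemma cell_density:
 assumes l: "k < l"
 shows "vol (E \<inter> stop k \<inter> {y. grid l y = n}) <= al * (2 powi l) ^ CARD('n)"
proof (cases "E \<inter> stop k \<inter> {y. grid l y = n} = {}")
 case False
 then obtain y where y: "y \<in> stop k" "grid l y = n" by blast
 hence "dens l y <= al" using l by (simp add: stop_def)
 hence "vol (E \<inter> {x. grid l x = n}) <= al * (2 powi l) ^ CARD('n)"
  using y by (simp add: dens_def field_simps)
 moreover have "vol (E \<inter> stop k \<inter> {x. grid l x = n}) <= vol (E \<inter> {x. grid l x = n})"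
  by (rule measure_mono_fmeasurable) (auto intro!: fmeasurable_Int_fmeasurable E_fmeas)
 ultimately show ?thesis by simp
qed (use alpha in simp)

lemma near_density:
 assumes l: "k < l"
 shows "vol (E \<inter> stop k \<inter> {y. near (grid l y) n}) <= near_count TYPE('n) * (al * (2 powi l) ^ CARD('n))"
proof -
 have "E \<inter> stop k \<inter> {y. near (grid l y) n} = (\<Union>m\<in>{m. near m n}. E \<inter> stop k \<inter> {y. grid l y = m})" by auto
 hence "vol (E \<inter> stop k \<inter> {y. near (grid l y) n}) <= (\<Sum>m\<in>{m. near m n}. vol (E \<inter> stop k \<inter> {y. grid l y = m}))"
  by (simp only:) (intro measure_UNION_le finite_near; auto)
 also have "... <= (\<Sum>m\<in>{m::int^'n. near m n}. al * (2 powi l) ^ CARD('n))"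
  by (intro sum_mono cell_density l)
 also have "... = near_count TYPE('n) * (al * (2 powi l) ^ CARD('n))" by (simp add: card_near)
 finally show ?thesis .
qed

lemma sum_E_stop: "(\<Sum>k\<in>K. vol (E \<inter> stop k)) <= vol E"
proof -
 have "(\<Sum>k\<in>K. vol (E \<inter> stop k)) = vol (\<Union>k\<in>K. E \<inter> stop k)"
  using stop_disjoint E_fin
  by (intro measure_finite_Union[symmetric] finite_K)
   (auto simp: disjoint_family_on_def, metis Int_lower1 E_borel emeasure_mono sets_lborel top.not_eq_extremum top.extremum_uniqueI infinity_ennreal_def)
 also have "... <= vol E"
  by (rule measure_mono_fmeasurable) (use finite_K E_fmeas in auto)
 finally show ?thesis .
qed

text \<open>The stopping cubes together with their neighbours of equal size, the usual enlarged
  cubes.\<close>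

definition exc :: "(real^'n) set" where
 "exc = (\<Union>k\<in>K. {x. \<exists>y\<in>stop k. near (grid k y) (grid k x)})"

text \<open>As a finite union of lattice translates of \<open>stop k\<close>, the set is measurable
  and has measure at most the number of translates times that of \<open>stop k\<close>.\<close>

lemma exc_eq: "{x. \<exists>y\<in>stop k. near (grid k y) (grid k x)} = (\<Union>m\<in>{m. near m 0}. cells k ((%n. n - m) ` grid k ` stop k))"
proof (intro set_eqI iffI)
 fix x assume "x \<in> {x. \<exists>y\<in>stop k. near (grid k y) (grid k x)}"
 then obtain y where y: "y \<in> stop k" "near (grid k y) (grid k x)" by blast
 hence "near (grid k y - grid k x) 0" by (simp add: near_def)
 moreover have "x \<in> cells k ((%n. n - (grid k y - grid k x)) ` grid k ` stop k)"
  using y by (auto simp: cells_def intro!: image_eqI[of _ _ "grid k y"])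
 ultimately show "x \<in> (\<Union>m\<in>{m. near m 0}. cells k ((%n. n - m) ` grid k ` stop k))" by blast
next
 fix x assume "x \<in> (\<Union>m\<in>{m. near m 0}. cells k ((%n. n - m) ` grid k ` stop k))"
 then obtain m y where "near m 0" "y \<in> stop k" "grid k x = grid k y - m" by (auto simp: cells_def)
 thus "x \<in> {x. \<exists>y\<in>stop k. near (grid k y) (grid k x)}" by (auto simp: near_def intro!: bexI[of _ y])
qed

lemma exc_borel [measurable]: "exc \<in> sets borel"
 unfolding exc_def exc_eq using finite_K finite_near by (intro sets.finite_UN) auto

lemma exc_measure: "evol exc <= ennreal (near_count TYPE('n) * (vol E / al))"
proof -
 have st: "evol (stop k) = ennreal (real (card (grid k ` stop k)) * (2 powi k) ^ CARD('n))" for k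
  using emeasure_cells[OF finite_grid_stop, of k k] stop_cells[of k] by simp
 have one: "evol {x. \<exists>y\<in>stop k. near (grid k y) (grid k x)} <= ennreal (near_count TYPE('n) * vol (stop k))" for k
 proof -
  have "evol {x. \<exists>y\<in>stop k. near (grid k y) (grid k x)} <= (\<Sum>m\<in>{m::int^'n. near m 0}. evol (cells k ((%n. n - m) ` grid k ` stop k)))"
   unfolding exc_eq by (rule emeasure_subadditive_finite) (auto simp: finite_near)
  also have "... = (\<Sum>m\<in>{m::int^'n. near m 0}. evol (stop k))"
   by (intro sum.cong refl) (simp add: emeasure_cells finite_grid_stop st card_image inj_on_def)
  also have "... = ennreal (near_count TYPE('n) * vol (stop k))"
   using emeasure_eq_ennreal_measure[of lborel "stop k"] stop_fmeas[of k]
   by (simp add: card_near ennreal_mult ennreal_of_nat_eq_real_of_nat fmeasurable_def)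
  finally show ?thesis .
 qed
 have "evol exc <= (\<Sum>k\<in>K. evol {x. \<exists>y\<in>stop k. near (grid k y) (grid k x)})"
  unfolding exc_def by (rule emeasure_subadditive_finite[OF finite_K])
   (unfold exc_eq, auto intro!: sets.finite_UN finite_near)
 also have "... <= (\<Sum>k\<in>K. ennreal (near_count TYPE('n) * vol (stop k)))" by (rule sum_mono[OF one])
 also have "... = ennreal (near_count TYPE('n) * (\<Sum>k\<in>K. vol (stop k)))"
  by (subst sum_ennreal) (auto simp: sum_distrib_left)
 also have "... <= ennreal (near_count TYPE('n) * (vol E / al))"
 proof (intro ennreal_leI mult_left_mono)
  have "al * (\<Sum>k\<in>K. vol (stop k)) <= (\<Sum>k\<in>K. vol (E \<inter> stop k))"
   unfolding sum_distrib_left using stopU_measure_le[of _ UNIV] by (intro sum_mono) (simp add: step_def)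
  also note sum_E_stop
  finally show "(\<Sum>k\<in>K. vol (stop k)) <= vol E / al"
   using alpha by (simp add: field_simps)
 qed simp
 finally show ?thesis .
qed

lemma bad_near_exc: "x \<notin> exc ==> near (grid k y) (grid k x) ==> bad k y = 0"
 unfolding exc_def K_def by (auto simp: bad_def indicator_def)

end

section \<open>Congruent triangles and localisation\<close>

text \<open>The reflection in the hyperplane orthogonal to u - u' exchanges the two vectors; equal
  inner products place v in that hyperplane.\<close>

lemma exists_reflection:
 fixes u u' v :: "'a::euclidean_space"
 assumes n: "norm u = norm u'" and v: "u \<bullet> v = u' \<bullet> v"
 obtains f where "orthogonal_transformation f" "f u = u'" "f v = v"
proof (cases "u = u'")
 case True
 thus ?thesis by (intro that[of "%x. x"]) (auto simp: orthogonal_transformation_def linear_id[unfolded id_def])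
next
 case False
 define a where "a = u - u'"
 have aa: "a \<bullet> a > 0" using False by (simp add: a_def)
 have uu: "u \<bullet> u = u' \<bullet> u'" using n by (simp add: norm_eq_sqrt_inner)
 hence ua: "2 * (u \<bullet> a) = a \<bullet> a"
  by (simp add: a_def inner_diff_left inner_diff_right inner_commute)
 have va: "v \<bullet> a = 0" using v by (simp add: a_def inner_diff_right inner_commute)
 define f where "f x = x - (2 * (x \<bullet> a) / (a \<bullet> a)) *\<^sub>R a" for x
 show ?thesis
 proof (rule that)
  have "linear f"
   by (rule linearI)
    (simp_all add: f_def inner_add_left distrib_left add_divide_distrib scaleR_left_distrib scaleR_right_diff_distrib mult.left_commute)
  moreover have "f x \<bullet> f y = x \<bullet> y" for x y
  proof -
   define p q where "p = 2 * (x \<bullet> a) / (a \<bullet> a)" and "q = 2 * (y \<bullet> a) / (a \<bullet> a)"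
   have "f x \<bullet> f y = x \<bullet> y - q * (x \<bullet> a) - p * (y \<bullet> a) + p * q * (a \<bullet> a)"
    by (simp add: f_def p_def[symmetric] q_def[symmetric] inner_diff_left inner_diff_right inner_commute[of a x] inner_commute[of a y] right_diff_distrib)
   also have "... = x \<bullet> y" using aa by (simp add: p_def q_def)
   finally show ?thesis .
  qed
  ultimately show "orthogonal_transformation f" by (simp add: orthogonal_transformation_def)
  show "f u = u'" using ua aa by (simp add: f_def a_def)
  show "f v = v" using va by (simp add: f_def)
 qed
qed

text \<open>The first hypothesis says that u - w is orthogonal to w. The circle around
  \<open>w\<close> in the plane of u - w and e therefore keeps both the norm and the inner product
  with w; for w = 0 it is a great circle.\<close>

lemma exists_circle_points:
 fixes u v :: "'a::euclidean_space"
 assumes w: "u \<bullet> w = w \<bullet> w" "u ~= w" and ev: "e \<bullet> u = 0" "e \<bullet> w = 0" "norm e = 1"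
 obtains us where
  "!!N j. norm (us N j) = norm u" "!!N j. us N j \<bullet> w = u \<bullet> w"
  "!!N j z. z \<bullet> (u - w) = 0 ==> z \<bullet> e = 0 ==> us N j \<bullet> z = u \<bullet> z"
  "!!N j k. j < N ==> k < N ==> j ~= k ==> norm (us N j - us N k) >= (norm (u - w) / 2) / real N"
proof -
 define r where "r = norm (u - w)"
 have r: "r > 0" using w by (simp add: r_def)
 \<comment> \<open>The angles j/N stay within [0, 1] radians, where the sine has derivative at least
   1/2; its increments, read off along e, separate the points.\<close>
 define us where "us N j = w + cos (real j / real N) *\<^sub>R (u - w) + (r * sin (real j / real N)) *\<^sub>R e" for N j :: nat
 have e1: "e \<bullet> e = 1" using ev by (simp add: norm_eq_1)
 have we: "w \<bullet> e = 0" "u \<bullet> e = 0" using ev by (simp_all add: inner_commute)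
 have ww: "w \<bullet> u = w \<bullet> w" using w by (simp add: inner_commute)
 have rr: "r\<^sup>2 = u \<bullet> u - w \<bullet> w"
  unfolding r_def power2_norm_eq_inner using w ww by (simp add: inner_diff_left inner_diff_right)
 show ?thesis
 proof (rule that[of us])
  fix N j
  define a where "a = u - w"
  have o: "w \<bullet> a = 0" "a \<bullet> w = 0" "a \<bullet> e = 0" "e \<bullet> a = 0" "a \<bullet> a = r\<^sup>2" "w \<bullet> e = 0" "e \<bullet> w = 0" "e \<bullet> e = 1"
   using w ww we ev e1 by (simp_all add: a_def inner_diff_left inner_diff_right r_def power2_norm_eq_inner)
  have "us N j \<bullet> us N j = w \<bullet> w + (cos (real j / real N))\<^sup>2 * r\<^sup>2 + r\<^sup>2 * (sin (real j / real N))\<^sup>2"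
   unfolding us_def a_def[symmetric]
   by (simp add: inner_add_left inner_add_right o) (simp add: power2_eq_square mult_ac)
  also have "... = w \<bullet> w + r\<^sup>2 * ((cos (real j / real N))\<^sup>2 + (sin (real j / real N))\<^sup>2)"
   by (simp only: distrib_left mult.commute[of "(cos _)\<^sup>2"] add.assoc)
  also have "... = u \<bullet> u" by (simp add: rr)
  finally show "norm (us N j) = norm u" by (simp add: norm_eq_sqrt_inner)
  show "us N j \<bullet> w = u \<bullet> w"
   using w ev by (simp add: us_def inner_add_left inner_diff_left)
  fix z assume z: "z \<bullet> (u - w) = 0" "z \<bullet> e = 0"
  hence "(u - w) \<bullet> z = 0" "e \<bullet> z = 0" "w \<bullet> z = u \<bullet> z" by (simp_all add: inner_commute inner_diff_right)
  thus "us N j \<bullet> z = u \<bullet> z" by (simp add: us_def inner_add_left)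
 next
  fix N j k :: nat assume jk: "j < N" "k < N" "j ~= k"
  have N: "real N > 0" using jk by simp
  have sin_diff: "sin b - sin a >= (b - a) / 2" if "0 <= a" "a <= b" "b <= 1" for a b :: real
  proof (cases "a = b")
   case False
   hence "a < b" using that by simp
   from MVT2[OF this, of sin cos] obtain z where z: "a < z" "z < b" "sin b - sin a = (b - a) * cos z"
    by (auto intro: derivative_eq_intros)
   have "cos z >= cos (pi / 3)"
    using z that pi_gt3 by (intro cos_monotone_0_pi_le) auto
   hence "cos z >= 1 / 2" by (simp add: cos_60)
   hence "(b - a) * cos z >= (b - a) * (1 / 2)" using that by (intro mult_left_mono) auto
   thus ?thesis using z by simp
  qed simp
  have key: "norm (us N j - us N k) >= (r / 2) / real N" if jk: "j < k" "k < N" for j k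
  proof -
   have ab: "0 <= real j / real N" "real j / real N <= real k / real N" "real k / real N <= 1"
    using jk by (auto simp: divide_right_mono)
   have "1 / real N <= real k / real N - real j / real N"
    using jk by (simp add: diff_divide_distrib[symmetric] divide_right_mono)
   hence "(1 / real N) / 2 <= (real k / real N - real j / real N) / 2"
    by (rule divide_right_mono) simp
   also note sin_diff[OF ab]
   finally have "(1 / real N) / 2 <= sin (real k / real N) - sin (real j / real N)" .
   hence "r * ((1 / real N) / 2) <= r * (sin (real k / real N) - sin (real j / real N))"
    using r by (intro mult_left_mono) auto
   also have "... = (us N k - us N j) \<bullet> e"
    using we e1 by (simp add: us_def inner_add_left inner_diff_left algebra_simps)
   also have "... <= norm (us N k - us N j) * norm e" by (rule norm_cauchy_schwarz)
   finally show ?thesis using ev by (simp add: norm_minus_commute)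
  qed
  show "norm (us N j - us N k) >= (norm (u - w) / 2) / real N"
   using key[of j k] key[of k j] jk by (metis linorder_neqE_nat norm_minus_commute r_def)
 qed
qed

lemma near_count_le: "near_count TYPE('n::finite) <= 3 ^ CARD('n)"
proof -
 have "{m::int^'n. near m 0} \<subseteq> vec_lambda ` (PiE UNIV (%i. {-1 .. 1}))"
 proof
  fix m :: "int^'n" assume "m \<in> {m. near m 0}"
  hence "vec_nth m \<in> PiE UNIV (%i. {-1 .. 1})" by (auto simp: near_def abs_le_iff)
  thus "m \<in> vec_lambda ` (PiE UNIV (%i. {-1 .. 1}))"
   by (intro image_eqI[of _ _ "vec_nth m"]) (simp_all only: vec_nth_inverse)
 qed
 hence "near_count TYPE('n) <= card (vec_lambda ` (PiE (UNIV::'n set) (%i. {-1 .. 1::int})))"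
  unfolding near_count_def by (intro card_mono finite_imageI finite_PiE) auto
 also have "... <= card (PiE (UNIV::'n set) (%i. {-1 .. 1::int}))" by (intro card_image_le finite_PiE) auto
 also have "... = 3 ^ CARD('n)" by (simp add: card_PiE)
 finally show ?thesis .
qed

text \<open>Localisation: averages at scale 2^l from points of one cube see only the neighbouring
  cubes. Local estimates may therefore be added up, each point of the right-hand side being counted
  \<open>near_count\<close> times.\<close>

lemma nn_integral_cells:
 fixes F \<omega> :: "real^'n => ennreal"
 assumes [measurable]: "F \<in> Bor" "\<omega> \<in> Bor"
  and le: "!!n. (LN x. F x * indicator {x. grid l x = n} x) <= (LN x. \<omega> x * indicator {x. near (grid l x) n} x)"
 shows "(LN x. F x) <= of_nat (near_count TYPE('n)) * (LN x. \<omega> x)"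
proof -
 have "{x. near (grid l x) n} = cells l {m. near m n}" for n by (auto simp: cells_def)
 hence [measurable]: "{x::real^'n. near (grid l x) n} \<in> sets borel" for n by simp
 have cnt: "countable (UNIV :: (int^'n) set)" by simp
 have "(LN x. F x) = (LN x. (\<integral>\<^sup>+n. F x * indicator {x. grid l x = n} x \<partial>count_space UNIV))"
 proof (rule nn_integral_cong)
  fix x
  have "(\<integral>\<^sup>+n. F x * indicator {x. grid l x = n} x \<partial>count_space UNIV) = (\<integral>\<^sup>+n. F x * indicator {grid l x} n \<partial>count_space UNIV)"
   by (rule nn_integral_cong) (auto simp: indicator_def)
  also have "... = F x" by (simp add: nn_integral_cmult_indicator)
  finally show "F x = (\<integral>\<^sup>+n. F x * indicator {x. grid l x = n} x \<partial>count_space UNIV)" ..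
 qed
 also have "... = (\<integral>\<^sup>+n. (LN x. F x * indicator {x. grid l x = n} x) \<partial>count_space UNIV)"
  by (rule nn_integral_count_space_nn_integral[OF cnt]) measurable
 also have "... <= (\<integral>\<^sup>+n. (LN x. \<omega> x * indicator {x. near (grid l x) n} x) \<partial>count_space UNIV)"
  by (rule nn_integral_mono) (rule le)
 also have "... = (LN x. (\<integral>\<^sup>+n. \<omega> x * indicator {x. near (grid l x) n} x \<partial>count_space UNIV))"
  by (rule nn_integral_count_space_nn_integral[OF cnt, symmetric]) measurable
 also have "... = (LN x. of_nat (near_count TYPE('n)) * \<omega> x)"
 proof (rule nn_integral_cong)
  fix x
  have "(\<integral>\<^sup>+n. \<omega> x * indicator {x. near (grid l x) n} x \<partial>count_space UNIV) = (\<integral>\<^sup>+n. \<omega> x * indicator {n. near n (grid l x)} n \<partial>count_space UNIV)"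
   by (rule nn_integral_cong) (auto simp: indicator_def near_sym)
  also have "... = \<omega> x * of_nat (near_count TYPE('n))"
   using finite_near[of "grid l x"] by (simp add: nn_integral_cmult_indicator emeasure_count_space card_near)
  finally show "(\<integral>\<^sup>+n. \<omega> x * indicator {x. near (grid l x) n} x \<partial>count_space UNIV) = of_nat (near_count TYPE('n)) * \<omega> x"
   by (simp add: mult.commute)
 qed
 finally show ?thesis by (simp add: nn_integral_cmult)
qed

definition bdd :: "('a::euclidean_space => real) => bool" where
 "bdd f \<longleftrightarrow> f \<in> Bor & (\<exists>B. \<forall>x. \<bar>f x\<bar> <= B)"

lemma bdd_measurable: "bdd f ==> f \<in> Bor"
 by (simp add: bdd_def)

lemma tame_bdd: "tame f ==> bdd f"
 by (auto simp: bdd_def tame_def)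

lemma bddI: "f \<in> Bor ==> (!!x. \<bar>f x\<bar> <= B) ==> bdd f"
 unfolding bdd_def by blast

section \<open>The bilinear average of bounded functions\<close>

context haar_orthogonal
begin

definition tri :: "real^'n => real^'n => real => (real^'n => real) => (real^'n => real) => real^'n => real" where
 "tri u v t f g x = (HI R. f (x - t *\<^sub>R (R *v u)) * g (x - t *\<^sub>R (R *v v)))"

lemma tri_integrable:
 assumes "bdd f" "bdd g"
 shows "integrable H (%R. f (x - t *\<^sub>R (R *v u)) * g (x - t *\<^sub>R (R *v v)))"
proof -
 note bdd_measurable[OF assms(1), measurable] bdd_measurable[OF assms(2), measurable]
 obtain A B where "!!x. \<bar>f x\<bar> <= A" "!!x. \<bar>g x\<bar> <= B" using assms by (auto simp: bdd_def)
 hence "\<bar>f y * g z\<bar> <= A * B" for y z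
  unfolding abs_mult by (intro mult_mono) (auto intro: order_trans[OF abs_ge_zero])
 thus ?thesis by (intro integrable_const_bound[of _ "A * B"]) auto
qed

lemma tri_measurable:
 assumes "bdd f" "bdd g"
 shows "tri u v t f g \<in> Bor"
proof -
 note bdd_measurable[OF assms(1), measurable] bdd_measurable[OF assms(2), measurable]
 show ?thesis unfolding tri_def by measurable
qed

lemma tri_commute: "tri u v t f g = tri v u t g f"
 by (intro ext) (simp add: tri_def mult.commute)

lemma tri_add_left:
 assumes "bdd f" "bdd f'" "bdd g"
 shows "tri u v t (%y. f y + f' y) g x = tri u v t f g x + tri u v t f' g x"
 unfolding tri_def using tri_integrable[OF assms(1,3)] tri_integrable[OF assms(2,3)]
 by (simp add: distrib_right)

lemma tri_sum_left:
 assumes "finite K" "!!k. k \<in> K ==> bdd (f k)" "bdd g"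
 shows "tri u v t (%y. \<Sum>k\<in>K. f k y) g x = (\<Sum>k\<in>K. tri u v t (f k) g x)"
 unfolding tri_def sum_distrib_right
 by (rule Bochner_Integration.integral_sum) (use tri_integrable assms in auto)

lemma tri_abs: "\<bar>tri u v t f g x\<bar> <= (HI R. \<bar>f (x - t *\<^sub>R (R *v u))\<bar> * \<bar>g (x - t *\<^sub>R (R *v v))\<bar>)"
 unfolding tri_def using integral_abs_bound[of H "%R. f (x - t *\<^sub>R (R *v u)) * g (x - t *\<^sub>R (R *v v))"] by (simp add: abs_mult)

lemma tri_abs_le:
 assumes "!!y. \<bar>f y\<bar> <= A" "!!y. \<bar>g y\<bar> <= B" "bdd f" "bdd g"
 shows "\<bar>tri u v t f g x\<bar> <= A * B"
proof -
 have AB: "A >= 0" "B >= 0" using assms(1,2) by (auto intro: order_trans[OF abs_ge_zero])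
 note tri_abs[of u v t f g x]
 also have "(HI R. \<bar>f (x - t *\<^sub>R (R *v u))\<bar> * \<bar>g (x - t *\<^sub>R (R *v v))\<bar>) <= (HI R. A * B)"
  using integrable_abs[OF tri_integrable[OF assms(3,4)]] AB assms(1,2)
  by (intro integral_mono mult_mono) (auto simp: abs_mult)
 finally show ?thesis by (simp add: prob_space)
qed

lemma tri_cong:
 assumes "norm u = 1" "norm v = 1" "t >= 0"
  and "!!y. norm (x - y) <= t ==> f y = f' y" "!!y. norm (x - y) <= t ==> g y = g' y"
 shows "tri u v t f g x = tri u v t f' g' x"
 unfolding tri_def
proof (rule Bochner_Integration.integral_cong[OF refl])
 fix R assume "R \<in> space H"
 hence "norm (t *\<^sub>R (R *v u)) = t" "norm (t *\<^sub>R (R *v v)) = t"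
  using assms(1-3) by (simp_all add: space_H norm_orthogonal_mult)
 thus "f (x - t *\<^sub>R (R *v u)) * g (x - t *\<^sub>R (R *v v)) = f' (x - t *\<^sub>R (R *v u)) * g' (x - t *\<^sub>R (R *v v))"
  using assms(4)[of "x - t *\<^sub>R (R *v u)"] assms(5)[of "x - t *\<^sub>R (R *v v)"] by simp
qed

lemma tri_nn_le:
 assumes "bdd f" "bdd g"
 shows "ennreal \<bar>tri u v t f g x\<bar> <= (HN R. ennreal (\<bar>f (x - t *\<^sub>R (R *v u))\<bar> * \<bar>g (x - t *\<^sub>R (R *v v))\<bar>))"
 unfolding tri_def
 using integral_norm_bound_ennreal[OF tri_integrable[OF assms, of x t u v]] by (simp add: abs_mult)

lemma nn_integral_shift_H:
 fixes f :: "real^'n => ennreal"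
 assumes [measurable]: "f \<in> Bor"
 shows "(LN x. (HN R. f (x - t *\<^sub>R (R *v u)))) = (LN x. f x)"
proof -
 interpret LH: pair_sigma_finite H "lborel :: (real^'n) measure"
  by (intro pair_sigma_finite.intro sigma_finite_lborel sigma_finite_measure_axioms)
 have "(LN x. (HN R. f (x - t *\<^sub>R (R *v u)))) = (HN R. (LN x. f (x + - (t *\<^sub>R (R *v u)))))"
  by (subst LH.Fubini') simp_all
 also have "... = (HN R. (LN x. f x))"
  by (intro nn_integral_cong lborel_nn_integral_shift) simp
 finally show ?thesis by (simp add: emeasure_space_1)
qed

lemma tri_L1:
 assumes f: "bdd f" and g: "bdd g" and G: "!!y. \<bar>g y\<bar> <= G"
 shows "(LN x. ennreal \<bar>tri u v t f g x\<bar>) <= ennreal G * (LN x. ennreal \<bar>f x\<bar>)"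
proof -
 note bdd_measurable[OF f, measurable]
 have G0: "G >= 0" using G by (auto intro: order_trans[OF abs_ge_zero])
 have "(LN x. ennreal \<bar>tri u v t f g x\<bar>) <= (LN x. (HN R. ennreal G * ennreal \<bar>f (x - t *\<^sub>R (R *v u))\<bar>))"
 proof (rule nn_integral_mono, rule order_trans[OF tri_nn_le[OF f g]], rule nn_integral_mono)
  fix x R
  show "ennreal (\<bar>f (x - t *\<^sub>R (R *v u))\<bar> * \<bar>g (x - t *\<^sub>R (R *v v))\<bar>) <= ennreal G * ennreal \<bar>f (x - t *\<^sub>R (R *v u))\<bar>"
   using G0 mult_left_mono[OF G abs_ge_zero] by (subst ennreal_mult[symmetric]) (auto simp: mult.commute[of G] intro!: ennreal_leI)
 qed
 also have "... = ennreal G * (LN x. (HN R. ennreal \<bar>f (x - t *\<^sub>R (R *v u))\<bar>))"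
  by (subst nn_integral_cmult, measurable, subst nn_integral_cmult, measurable)
 also have "... = ennreal G * (LN x. ennreal \<bar>f x\<bar>)"
  by (subst nn_integral_shift_H[of "%x. ennreal \<bar>f x\<bar>"]) simp_all
 finally show ?thesis .
qed

text \<open>The first argument may be averaged over points \<open>us N j\<close> obtained from \<open>u\<close> by isometries that
 preserve the rest of the configuration.\<close>

definition averaging :: "(nat => nat => real^'n) => real^'n => real^'n => (real^'n => real) => bool" where
 "averaging us u v g \<longleftrightarrow> (\<forall>N\<ge>1. \<forall>t b x. bdd b -->
  tri u v t b g x = (HI R. point_avg (us N) N t b x R * g (x - t *\<^sub>R (R *v v))))"

text \<open>Right multiplication by S moves u to a point \<open>us N j\<close>. The constant
  \<open>c\<close> merges two situations: if g is constantly c, the isometry may move v as well;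
  otherwise it has to fix v.\<close>

lemma averagingI:
 assumes g: "bdd g" and S: "!!N j. \<exists>S. orthogonal_matrix S & S *v u = us N j & (\<forall>x. g x = c | S *v v = v)"
 shows "averaging us u v g"
 unfolding averaging_def
proof (intro allI impI)
 fix N :: nat and t :: real and b :: "real^'n => real" and x assume N: "1 <= N" and b: "bdd b"
 note bdd_measurable[OF b, measurable] bdd_measurable[OF g, measurable]
 have eq: "tri u v t b g x = (HI R. b (x - t *\<^sub>R (R *v us N j)) * g (x - t *\<^sub>R (R *v v)))" for j
 proof -
  obtain S where S': "orthogonal_matrix S" "S *v u = us N j" "\<forall>x. g x = c | S *v v = v" using S by blast
  have "tri u v t b g x = (HI R. b (x - t *\<^sub>R ((R ** S) *v u)) * g (x - t *\<^sub>R ((R ** S) *v v)))"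
   unfolding tri_def by (rule integral_right_mult[symmetric, OF S'(1)]) measurable
  also have "... = (HI R. b (x - t *\<^sub>R (R *v us N j)) * g (x - t *\<^sub>R (R *v v)))"
   using S'(3) by (intro Bochner_Integration.integral_cong refl) (metis S'(2) matrix_vector_mul_assoc)
  finally show ?thesis .
 qed
 have "(HI R. point_avg (us N) N t b x R * g (x - t *\<^sub>R (R *v v)))
  = (HI R. (\<Sum>j<N. b (x - t *\<^sub>R (R *v us N j)) * g (x - t *\<^sub>R (R *v v))) / real N)"
  by (simp add: point_avg_def sum_distrib_right)
 also have "... = (\<Sum>j<N. tri u v t b g x) / real N"
  by (subst integral_divide_zero, subst Bochner_Integration.integral_sum)
   (auto intro: tri_integrable b g simp: eq[symmetric] simp del: sum_constant)
 finally show "tri u v t b g x = (HI R. point_avg (us N) N t b x R * g (x - t *\<^sub>R (R *v v)))"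
  using N by simp
qed

lemma point_avg_bdd:
 assumes b: "bdd b" and N: "N >= 1" 
 obtains B where "!!x R. \<bar>point_avg us N t b x R\<bar> <= B"
  "(%p. point_avg us N t b (fst p) (snd p)) \<in> borel_measurable (borel \<Otimes>\<^sub>M H)"
  "!!x. point_avg us N t b x \<in> borel_measurable H"
proof -
 note bdd_measurable[OF b, measurable]
 obtain B where B: "!!x. \<bar>b x\<bar> <= B" using b by (auto simp: bdd_def)
 show ?thesis
 proof (rule that[of B])
  fix x R
  have "\<bar>\<Sum>j<N. b (x - t *\<^sub>R (R *v us j))\<bar> <= (\<Sum>j<N. B)"
   by (rule order_trans[OF sum_abs sum_mono]) (rule B)
  thus "\<bar>point_avg us N t b x R\<bar> <= B" using N by (simp add: point_avg_def field_simps)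
 qed (unfold point_avg_def, measurable)
qed

lemma tri_L2:
 assumes av: "averaging us u v g" and b: "bdd b" and g: "bdd g" and G: "!!y. \<bar>g y\<bar> <= G" and N: "N >= 1"
 shows "(LN x. ennreal ((tri u v t b g x)\<^sup>2)) <= ennreal (G\<^sup>2) * (LN x. (HN R. ennreal ((point_avg (us N) N t b x R)\<^sup>2)))"
proof -
 note bdd_measurable[OF b, measurable] bdd_measurable[OF g, measurable]
 obtain B where B: "!!x R. \<bar>point_avg (us N) N t b x R\<bar> <= B"
  and [measurable]: "(%p. point_avg (us N) N t b (fst p) (snd p)) \<in> borel_measurable (borel \<Otimes>\<^sub>M H)"
   "!!x. point_avg (us N) N t b x \<in> borel_measurable H"
  by (rule point_avg_bdd[OF b N, where us="us N" and t=t]) blast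
 have G0: "G >= 0" using G by (auto intro: order_trans[OF abs_ge_zero])
 have ip: "integrable H (%R. \<bar>point_avg (us N) N t b x R\<bar>)" for x
  by (rule integrable_const_bound[of _ B]) (auto simp: B)
 have ip2: "integrable H (%R. (point_avg (us N) N t b x R)\<^sup>2)" for x
 proof (rule integrable_const_bound[of _ "B\<^sup>2"])
  show "AE R in H. norm ((point_avg (us N) N t b x R)\<^sup>2) <= B\<^sup>2"
   using power_mono[OF B abs_ge_zero, of _ _ 2] by simp
 qed measurable
 have pt: "ennreal ((tri u v t b g x)\<^sup>2) <= ennreal (G\<^sup>2) * (HN R. ennreal ((point_avg (us N) N t b x R)\<^sup>2))" for x
 proof -
  let ?p = "%R. point_avg (us N) N t b x R"
  have "\<bar>tri u v t b g x\<bar> = \<bar>(HI R. ?p R * g (x - t *\<^sub>R (R *v v)))\<bar>"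
   using av N b by (simp add: averaging_def)
  also have "... <= (HI R. \<bar>?p R * g (x - t *\<^sub>R (R *v v))\<bar>)" by (rule integral_abs_bound)
  also have "... <= (HI R. G * \<bar>?p R\<bar>)"
  proof (rule integral_mono_AE')
   show "integrable H (%R. G * \<bar>?p R\<bar>)" using ip by simp
   show "AE R in H. \<bar>?p R * g (x - t *\<^sub>R (R *v v))\<bar> <= G * \<bar>?p R\<bar>"
    by (auto simp: abs_mult mult.commute[of G] intro!: mult_left_mono G)
  qed (use G0 in auto)
  also have "... = G * (HI R. \<bar>?p R\<bar>)" by simp
  finally have "(tri u v t b g x)\<^sup>2 <= (G * (HI R. \<bar>?p R\<bar>))\<^sup>2"
   by (metis abs_ge_zero power2_abs power_mono)
  also have "... <= G\<^sup>2 * (HI R. (?p R)\<^sup>2)"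
  proof -
   \<comment> \<open>Cauchy-Schwarz in the form that a variance is nonnegative.\<close>
   have "(HI R. \<bar>?p R\<bar>)\<^sup>2 <= (HI R. \<bar>?p R\<bar>\<^sup>2)"
    using ip ip2 variance_positive[of "%R. \<bar>?p R\<bar>"] variance_eq[of "%R. \<bar>?p R\<bar>"] by simp
   thus ?thesis by (simp add: power_mult_distrib mult_left_mono)
  qed
  finally have "ennreal ((tri u v t b g x)\<^sup>2) <= ennreal (G\<^sup>2 * (HI R. (?p R)\<^sup>2))" by (rule ennreal_leI)
  also have "... = ennreal (G\<^sup>2) * (HN R. ennreal ((?p R)\<^sup>2))"
   by (simp add: ennreal_mult nn_integral_eq_integral[OF ip2])
  finally show ?thesis .
 qed
 have "(LN x. ennreal ((tri u v t b g x)\<^sup>2)) <= (LN x. ennreal (G\<^sup>2) * (HN R. ennreal ((point_avg (us N) N t b x R)\<^sup>2)))"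
  by (rule nn_integral_mono) (rule pt)
 also have "... = ennreal (G\<^sup>2) * (LN x. (HN R. ennreal ((point_avg (us N) N t b x R)\<^sup>2)))"
  by (rule nn_integral_cmult) measurable
 finally show ?thesis .
qed

end

section \<open>One function with cancellation\<close>

text \<open>Cauchy-Schwarz from the nonnegativity of a quadratic polynomial in \<open>c\<close>,
  evaluated at its minimum.\<close>

lemma L1_squared_le:
 fixes f :: "'a => real"
 assumes f: "integrable M f" and f2: "integrable M (%x. (f x)\<^sup>2)" and A: "A \<in> fmeasurable M"
  and z: "!!x. x \<notin> A ==> f x = 0"
 shows "(\<integral>x. \<bar>f x\<bar> \<partial>M)\<^sup>2 <= measure M A * (\<integral>x. (f x)\<^sup>2 \<partial>M)"
proof -
 let ?I = "\<integral>x. \<bar>f x\<bar> \<partial>M" and ?J = "\<integral>x. (f x)\<^sup>2 \<partial>M"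
 have iA: "integrable M (indicat_real A)" using A by (auto simp: fmeasurable_def)
 have q: "0 <= ?J - 2 * c * ?I + c\<^sup>2 * measure M A" for c
 proof -
  have "0 <= (\<integral>x. (\<bar>f x\<bar> - c * indicator A x)\<^sup>2 \<partial>M)" by simp
  also have "... = (\<integral>x. (f x)\<^sup>2 - 2 * c * \<bar>f x\<bar> + c\<^sup>2 * indicator A x \<partial>M)"
   by (intro Bochner_Integration.integral_cong refl)
    (auto simp: indicator_def power2_diff z)
  also have "... = ?J - 2 * c * ?I + c\<^sup>2 * measure M A"
   using f f2 iA A by (simp add: fmeasurable_def)
  finally show ?thesis .
 qed
 show ?thesis
 proof (cases "measure M A = 0")
  case True
  have "?I = 0"
  proof (rule ccontr)
   assume "?I ~= 0"
   \<comment> \<open>If A is null the polynomial is affine in c, and this choice of c would give it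
     the value -1.\<close>
   hence "2 * ((?J + 1) / (2 * ?I)) * ?I = ?J + 1" by simp
   thus False using q[of "(?J + 1) / (2 * ?I)"] True by simp
  qed
  thus ?thesis using True by simp
 next
  case False
  hence m: "measure M A > 0" by (simp add: zero_less_measure_iff)
  have "0 <= ?J - 2 * (?I / measure M A) * ?I + (?I / measure M A)\<^sup>2 * measure M A" by (rule q)
  also have "... = ?J - ?I\<^sup>2 / measure M A"
   using m by (simp add: power2_eq_square field_simps)
  finally show ?thesis using m by (simp add: field_simps)
 qed
qed

lemma geometric_sum_int:
 fixes \<zeta> :: real
 assumes L: "finite L" and z: "\<zeta> > 0"
 shows "(\<Sum>l\<in>{l\<in>L. k < l}. 2 powr (- \<zeta> * real_of_int (l - k))) <= 1 / (2 powr \<zeta> - 1)"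
proof -
 define q where "q = 2 powr (- \<zeta>)"
 have q: "0 < q" "q < 1" using z by (auto simp: q_def powr_less_one)
 have "(\<Sum>l\<in>{l\<in>L. k < l}. 2 powr (- \<zeta> * real_of_int (l - k))) = (\<Sum>i\<in>(%l. nat (l - k - 1)) ` {l\<in>L. k < l}. q ^ i * q)"
 proof (subst sum.reindex)
  show "inj_on (%l. nat (l - k - 1)) {l\<in>L. k < l}" by (auto simp: inj_on_def nat_eq_iff)
  show "(\<Sum>l\<in>{l\<in>L. k < l}. 2 powr (- \<zeta> * real_of_int (l - k))) = sum ((%i. q ^ i * q) \<circ> (%l. nat (l - k - 1))) {l\<in>L. k < l}"
  proof (rule sum.cong[OF refl])
   fix l assume "l \<in> {l\<in>L. k < l}"
   hence l: "real_of_int (l - k) = real (Suc (nat (l - k - 1)))" by simp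
   have "2 powr (- \<zeta> * real (Suc m)) = q ^ m * q" for m
    by (subst powr_powr[symmetric], subst powr_realpow) (auto simp: q_def mult.commute)
   thus "2 powr (- \<zeta> * real_of_int (l - k)) = ((%i. q ^ i * q) \<circ> (%l. nat (l - k - 1))) l"
    unfolding l comp_def .
  qed
 qed
 also have "... <= (\<Sum>i. q ^ i * q)"
  using q L by (intro sum_le_suminf summable_mult2 summable_geometric) auto
 also have "... = q / (1 - q)"
  using q by (simp add: suminf_mult2[symmetric] summable_geometric suminf_geometric)
 also have "... = 1 / (2 powr \<zeta> - 1)"
 proof -
  have eq: "2 powr \<zeta> = 1 / q" by (simp add: q_def powr_minus_divide)
  show ?thesis unfolding eq using q by (simp add: field_simps)
 qed
 finally show ?thesis .
qed

lemma geometric_mean_le: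
 fixes x a b :: real
 assumes "0 <= x" "x <= a" "x <= b" "p >= 0" "q >= 0" "p + q = 1"
 shows "x <= a powr p * b powr q"
proof (cases "x = 0")
 case False
 hence "x = x powr p * x powr q" using assms by (simp add: powr_add[symmetric])
 also have "... <= a powr p * b powr q" using assms by (intro mult_mono powr_mono2) auto
 finally show ?thesis .
qed simp

lemma emeasure_gt_le:
 assumes [measurable]: "f \<in> borel_measurable M" and "\<mu> > 0" and A: "(\<integral>\<^sup>+x. ennreal \<bar>f x\<bar> \<partial>M) <= ennreal A" "A >= 0"
 shows "emeasure M {x\<in>space M. \<bar>f x\<bar> > \<mu>} <= ennreal (A / \<mu>)"
proof -
 have "emeasure M {x\<in>space M. \<bar>f x\<bar> > \<mu>} <= emeasure M {x\<in>space M. 1 <= ennreal (1 / \<mu>) * ennreal \<bar>f x\<bar>}"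
  using assms(2) by (intro emeasure_mono) (auto simp: ennreal_mult[symmetric] field_simps ennreal_1[symmetric] simp del: ennreal_1)
 also have "... <= ennreal (1 / \<mu>) * (\<integral>\<^sup>+x. ennreal \<bar>f x\<bar> * indicator (space M) x \<partial>M)"
  by (rule nn_integral_Markov_inequality) auto
 also have "... <= ennreal (1 / \<mu>) * ennreal A"
  using A(1) by (intro mult_left_mono) (auto intro: order_trans[OF nn_integral_mono])
 also have "... = ennreal (A / \<mu>)" using assms(2) A by (simp add: ennreal_mult[symmetric])
 finally show ?thesis .
qed

context cz_set
begin

lemma near_cells: "{y::real^'n. near (grid l y) n} = cells l {m. near m n}"
 by (auto simp: cells_def)

lemma step_near: "k <= l ==> step k (%x. x \<in> {y. near (grid l y) n})"
 by (rule step_mono[of l]) (auto simp: step_def)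

lemma step_UNIV: "step k (%x. x \<in> UNIV)"
 by (simp add: step_def)

lemma badU_UNIV: "badU k UNIV = bad k"
 by (rule ext) (simp add: badU_def[OF step_UNIV])

text \<open>Supplies the support hypothesis of \<open>point_avg_decay\<close> for t = 2^l: a cube
  and its neighbours fill a cube of side 3 * 2^l.\<close>

lemma badU_L1_squared:
 assumes "k <= l"
 shows "(LI x. \<bar>badU k {y. near (grid l y) n} x\<bar>)\<^sup>2
  <= (3 * 2 powi l) ^ CARD('n) * (LI x. (badU k {y. near (grid l y) n} x)\<^sup>2)"
proof -
 let ?U = "{y. near (grid l y) n}"
 note U = step_near[OF assms, of n]
 have m: "?U \<in> fmeasurable lborel"
  unfolding near_cells by (intro fmeasurableI) (auto simp: emeasure_cells[OF finite_near])
 have "(LI x. \<bar>badU k ?U x\<bar>)\<^sup>2 <= vol ?U * (LI x. (badU k ?U x)\<^sup>2)"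
 proof (rule L1_squared_le[OF integrable_parts(1)[OF U] _ m])
  show "integrable lborel (%x. (badU k ?U x)\<^sup>2)"
  proof (rule integrable_power2_of_bounded[OF integrable_parts(1)[OF U], of 1])
   show "\<bar>badU k ?U x\<bar> <= 1" for x
    using bad_abs_le[of k x] by (auto simp: badU_def[OF U] indicator_def)
  qed
 qed (simp add: badU_def[OF U])
 also have "vol ?U <= (3 * 2 powi l) ^ CARD('n)"
 proof -
  have "real (near_count TYPE('n)) <= 3 ^ CARD('n)"
   using near_count_le[where 'n='n] by (metis of_nat_le_iff of_nat_numeral of_nat_power)
  thus ?thesis
   unfolding near_cells by (simp add: measure_cells finite_near card_near power_mult_distrib mult_right_mono)
 qed
 finally show ?thesis by (simp add: mult_right_mono)
qed

end

section \<open>Gain in the ratio of scales for a bad part\<close>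

context haar_orthogonal
begin

lemma badU_point_avg_decay:
 assumes d: "CARD('n) >= 2" and c: "c > 0"
  and sep: "!!N j k. j < N ==> k < N ==> j ~= k ==> norm (us N j - us N k :: real^'n) >= c / real N"
 obtains C dl where "C > 0" "dl > 0"
  "!!E I0 k0 al k l n. cz_set E I0 k0 al ==> k < l ==>
   \<exists>N\<ge>1. (LN x. (HN R. ennreal ((point_avg (us N) N (2 powi l) (cz_set.badU E al k {y. near (grid l y) n}) x R)\<^sup>2)))
     <= ennreal (C * 2 powr (- dl * real_of_int (l - k)) * vol (E \<inter> cz_set.stop E al k \<inter> {y. near (grid l y) n}))"
proof -
 obtain C dl where C: "C > 0" "dl > 0"
  "!!b h t. tame b ==> cancels h b ==> (LI x. \<bar>b x\<bar>)\<^sup>2 <= (3 * t) ^ CARD('n) * (LI x. (b x)\<^sup>2) ==> h > 0 ==> t > 0 ==>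
   \<exists>N\<ge>1. (LN x. (HN R. ennreal ((point_avg (us N) N t b x R)\<^sup>2))) <= ennreal (C * (h / t) powr dl * (LI x. (b x)\<^sup>2))"
  by (rule point_avg_decay[where us=us, OF d c sep]) blast+
 let ?C = "C * real CARD('n) powr dl"
 show ?thesis
 proof (rule that[of ?C dl])
  show "?C > 0" using C(1) by simp
  fix E :: "(real^'n) set" and I0 k0 al and k l :: int and n :: "int^'n"
  assume "cz_set E I0 k0 al" and kl: "k < l"
  interpret cz_set E I0 k0 al by fact
  let ?U = "{y::real^'n. near (grid l y) n}"
  note U = step_near[OF less_imp_le[OF kl], of n]
  have "\<exists>N\<ge>1. (LN x. (HN R. ennreal ((point_avg (us N) N (2 powi l) (badU k ?U) x R)\<^sup>2)))
    <= ennreal (C * (real CARD('n) * 2 powi k / 2 powi l) powr dl * (LI x. (badU k ?U x)\<^sup>2))"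
   by (rule C(3)[OF tame_badU[OF U] badU_cancels[OF U] badU_L1_squared[OF less_imp_le[OF kl]]]) auto
  moreover have "C * (real CARD('n) * 2 powi k / 2 powi l) powr dl * (LI x. (badU k ?U x)\<^sup>2)
   <= ?C * 2 powr (- dl * real_of_int (l - k)) * vol (E \<inter> stop k \<inter> ?U)"
  proof -
   have "(2::real) powi k / 2 powi l = 2 powr (- real_of_int (l - k))"
    by (simp add: powr_real_of_int'[symmetric] powr_diff[symmetric])
   hence "(real CARD('n) * 2 powi k / 2 powi l) powr dl = (real CARD('n) * 2 powr (- real_of_int (l - k))) powr dl"
    by (metis times_divide_eq_right)
   also have "... = real CARD('n) powr dl * 2 powr (- dl * real_of_int (l - k))"
    by (simp add: powr_mult powr_powr mult.commute, simp add: algebra_simps)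
   finally have eq: "(real CARD('n) * 2 powi k / 2 powi l) powr dl = real CARD('n) powr dl * 2 powr (- dl * real_of_int (l - k))" .
   show ?thesis unfolding eq mult.assoc[symmetric]
    using C(1) badU_L2[OF U] by (intro mult_left_mono) auto
  qed
  ultimately show "\<exists>N\<ge>1. (LN x. (HN R. ennreal ((point_avg (us N) N (2 powi l) (badU k ?U) x R)\<^sup>2)))
     <= ennreal (?C * 2 powr (- dl * real_of_int (l - k)) * vol (E \<inter> stop k \<inter> ?U))"
   by (meson ennreal_leI order_trans)
 qed (use C in simp)
qed

lemma tri_bad_local:
 assumes "cz_set E I0 k0 al" and u: "norm u = 1" "norm v = 1" and x: "grid l x = n" and kl: "k < l"
 shows "tri u v (2 powi l) (cz_set.bad E al k) g x = tri u v (2 powi l) (cz_set.badU E al k {y. near (grid l y) n}) g x"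
proof -
 interpret cz_set E I0 k0 al by fact
 show ?thesis
 proof (rule tri_cong[OF u])
  fix y assume "norm (x - y) <= 2 powi l"
  from near_grid[OF this] have "near (grid l y) n" using x near_sym by metis
  thus "bad k y = badU k {y. near (grid l y) n} y" by (simp add: badU_def[OF step_near] kl less_imp_le)
 qed auto
qed

text \<open>The decay estimate pays for the volume of the support, so it is applied on the
  neighbourhood of each cube of side 2^l, and the pieces are recombined by
  \<open>nn_integral_cells\<close>.\<close>

lemma tri_bad_L2:
 assumes d: "CARD('n) >= 2" and c: "c > 0"
  and sep: "!!N j k. j < N ==> k < N ==> j ~= k ==> norm (us N j - us N k :: real^'n) >= c / real N"
  and u: "norm u = 1" "norm v = 1"
 obtains C dl where "C > 0" "dl > 0"
  "!!E I0 k0 al k l g G. cz_set E I0 k0 al ==> k < l ==> bdd g ==> (!!y. \<bar>g y\<bar> <= G) ==> averaging us u v g ==>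
   (LN x. ennreal ((tri u v (2 powi l) (cz_set.bad E al k) g x)\<^sup>2)) <=
     ennreal (C * G\<^sup>2 * 2 powr (- dl * real_of_int (l - k)) * vol (E \<inter> cz_set.stop E al k))"
proof -
 obtain C dl where C: "C > 0" "dl > 0"
  "!!E I0 k0 al k l n. cz_set E I0 k0 al ==> k < l ==>
   \<exists>N\<ge>1. (LN x. (HN R. ennreal ((point_avg (us N) N (2 powi l) (cz_set.badU E al k {y. near (grid l y) n}) x R)\<^sup>2)))
     <= ennreal (C * 2 powr (- dl * real_of_int (l - k)) * vol (E \<inter> cz_set.stop E al k \<inter> {y. near (grid l y) n}))"
  by (rule badU_point_avg_decay[where us=us, OF d c sep]) blast+
 have nc: "near_count TYPE('n) > 0"
  unfolding near_count_def using finite_near[of "0::int^'n"] by (auto simp: card_gt_0_iff near_def intro!: exI[of _ 0])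
 show ?thesis
 proof (rule that[of "near_count TYPE('n) * C" dl])
  show "real (near_count TYPE('n)) * C > 0" using C nc by simp
  fix E :: "(real^'n) set" and I0 k0 al and k l :: int and G :: real and g :: "real^'n => real"
  assume cz: "cz_set E I0 k0 al" and kl: "k < l" and g: "bdd g" and G: "!!y. \<bar>g y\<bar> <= G" and av: "averaging us u v g"
  interpret cz_set E I0 k0 al by fact
  have bb: "bdd (bad k)" by (rule bddI[OF bad_measurable bad_abs_le])
  note tri_measurable[OF bb g, measurable]
  define w where "w = C * G\<^sup>2 * 2 powr (- dl * real_of_int (l - k))"
  have w: "w >= 0" using C by (simp add: w_def)
  have "(LN x. ennreal ((tri u v (2 powi l) (bad k) g x)\<^sup>2))
   <= of_nat (near_count TYPE('n)) * (LN x. ennreal w * indicator (E \<inter> stop k) x)"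
  proof (rule nn_integral_cells[of _ _ l])
   fix n
   let ?U = "{y::real^'n. near (grid l y) n}"
   note U = step_near[OF less_imp_le[OF kl], of n]
   note U_measurable[OF U, measurable]
   have bU: "bdd (badU k ?U)" by (rule tame_bdd[OF tame_badU[OF U]])
   obtain N where N: "N >= 1" "(LN x. (HN R. ennreal ((point_avg (us N) N (2 powi l) (badU k ?U) x R)\<^sup>2)))
     <= ennreal (C * 2 powr (- dl * real_of_int (l - k)) * vol (E \<inter> stop k \<inter> ?U))"
    using C(3)[OF cz kl, of n] by blast
   have "(LN x. ennreal ((tri u v (2 powi l) (bad k) g x)\<^sup>2) * indicator {x. grid l x = n} x)
    <= (LN x. ennreal ((tri u v (2 powi l) (badU k ?U) g x)\<^sup>2))"
   proof (rule nn_integral_mono)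
    fix x show "ennreal ((tri u v (2 powi l) (bad k) g x)\<^sup>2) * indicator {x. grid l x = n} x <= ennreal ((tri u v (2 powi l) (badU k ?U) g x)\<^sup>2)"
     using tri_bad_local[OF cz u _ kl, of x n g] by (auto simp: indicator_def)
   qed
   also have "... <= ennreal (G\<^sup>2) * ennreal (C * 2 powr (- dl * real_of_int (l - k)) * vol (E \<inter> stop k \<inter> ?U))"
    by (rule order_trans[OF tri_L2[OF av bU g G N(1)] mult_left_mono[OF N(2)]]) simp
   also have "... = ennreal w * ennreal (vol (E \<inter> stop k \<inter> ?U))"
    using C by (simp add: ennreal_mult[symmetric] w_def mult_ac)
   also have "ennreal (vol (E \<inter> stop k \<inter> ?U)) = evol (E \<inter> stop k \<inter> ?U)"
    using tame_indicator_measure(3)[OF tame_EU[OF U]] by simp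
   also have "ennreal w * evol (E \<inter> stop k \<inter> ?U) = (LN x. ennreal w * indicator (E \<inter> stop k) x * indicator ?U x)"
    by (subst nn_integral_cmult_indicator[symmetric]) (auto intro!: nn_integral_cong simp: indicator_def)
   finally show "(LN x. ennreal ((tri u v (2 powi l) (bad k) g x)\<^sup>2) * indicator {x. grid l x = n} x) <= ..." .
  qed measurable
  also have "(LN x. ennreal w * indicator (E \<inter> stop k) x) = ennreal w * ennreal (vol (E \<inter> stop k))"
   using tame_indicator_measure(3)[OF tame_EU[OF step_UNIV]] by (simp add: nn_integral_cmult_indicator)
  also have "of_nat (near_count TYPE('n)) * (ennreal w * ennreal (vol (E \<inter> stop k))) =
   ennreal (near_count TYPE('n) * C * G\<^sup>2 * 2 powr (- dl * real_of_int (l - k)) * vol (E \<inter> stop k))"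
   using w by (simp add: ennreal_mult[symmetric] ennreal_of_nat_eq_real_of_nat) (simp add: w_def mult_ac)
  finally show "(LN x. ennreal ((tri u v (2 powi l) (bad k) g x)\<^sup>2)) <=
   ennreal (near_count TYPE('n) * C * G\<^sup>2 * 2 powr (- dl * real_of_int (l - k)) * vol (E \<inter> stop k))" .
 qed (use C in simp)
qed

text \<open>A point outside \<open>exc\<close> has distance more than 2^k from the stopping cubes of
  level k, beyond the reach of an average at scale 2^l <= 2^k.\<close>

lemma tri_bad_zero:
 assumes "cz_set E I0 k0 al" and u: "norm u = 1" "norm v = 1" and x: "x \<notin> cz_set.exc E al" and kl: "l <= k"
 shows "tri u v (2 powi l) (cz_set.bad E al k) g x = 0"
proof -
 interpret cz_set E I0 k0 al by fact
 have "tri u v (2 powi l) (bad k) g x = tri u v (2 powi l) (%y. 0) g x"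
 proof (rule tri_cong[OF u])
  fix y assume "norm (x - y) <= 2 powi l"
  hence "norm (x - y) <= 2 powi k" by (rule order_trans[OF _ power_int_increasing[OF kl]]) simp
  from near_grid[OF this] show "bad k y = 0" using bad_near_exc[OF x] near_sym by metis
 qed auto
 thus ?thesis by (simp add: tri_def)
qed

text \<open>Interpolating between the trivial \<open>L\<^sup>1\<close> bound and the decaying \<open>L\<^sup>2\<close> bound at the level of
 Chebyshev's inequality.\<close>

lemma one_bad:
 assumes d: "CARD('n) >= 2" and c: "c > 0"
  and sep: "!!N j k. j < N ==> k < N ==> j ~= k ==> norm (us N j - us N k :: real^'n) >= c / real N"
  and u: "norm u = 1" "norm v = 1" and s: "1 < s" "s <= 2"
 obtains C where "C > 0"
  "!!E I0 k0 al g G lam L. cz_set E I0 k0 al ==> bdd g ==> (!!y. \<bar>g y\<bar> <= G) ==> averaging us u v g ==> G > 0 ==> lam > 0 ==> finite L ==>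
   evol {x. x \<notin> cz_set.exc E al & (\<exists>l\<in>L. \<bar>\<Sum>k\<in>cz_set.K E al. tri u v (2 powi l) (cz_set.bad E al k) g x\<bar> > lam)}
    <= ennreal (C * (G / lam) powr s * vol E)"
proof -
 obtain C0 dl where C0: "C0 > 0" "dl > 0"
  "!!E I0 k0 al k l g G. cz_set E I0 k0 al ==> k < l ==> bdd g ==> (!!y. \<bar>g y\<bar> <= G) ==> averaging us u v g ==>
   (LN x. ennreal ((tri u v (2 powi l) (cz_set.bad E al k) g x)\<^sup>2)) <=
     ennreal (C0 * G\<^sup>2 * 2 powr (- dl * real_of_int (l - k)) * vol (E \<inter> cz_set.stop E al k))"
  by (rule tri_bad_L2[where us=us, OF d c sep u]) blast+
 \<comment> \<open>The thresholds below decay like 2^(-\<eta> i); their s-th power costs 2^(\<zeta>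
   i), which is half of the gain 2^(-2 \<zeta> i) that the L2 bound provides at exponent s -
   1.\<close>
 define \<eta> where "\<eta> = dl * (s - 1) / (2 * s)"
 have eta: "\<eta> > 0" using C0(2) s by (simp add: \<eta>_def)
 define \<zeta> where "\<zeta> = dl * (s - 1) / 2"
 have zeta: "\<zeta> > 0" using C0(2) s by (simp add: \<zeta>_def)
 \<comment> \<open>Normalises the thresholds so that their sum over all i >= 1 is at most
   lam.\<close>
 define q where "q = 2 powr \<eta> - 1"
 have q: "q > 0" using eta by (simp add: q_def)
 define C1 where "C1 = 2 powr (2 - s) * C0 powr (s - 1) * q powr (- s)"
 have C1: "C1 > 0" using C0(1) q by (simp add: C1_def)
 define C where "C = C1 / (2 powr \<zeta> - 1)"
 have C: "C > 0" using C1 zeta by (simp add: C_def)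
 show ?thesis
 proof (rule that[OF C])
  fix E :: "(real^'n) set" and I0 k0 al and G lam :: real and L :: "int set" and g :: "real^'n => real"
  assume cz: "cz_set E I0 k0 al" and g: "bdd g" and G: "!!y. \<bar>g y\<bar> <= G" and av: "averaging us u v g"
   and G0: "G > 0" and lam: "lam > 0" and L: "finite L"
  interpret cz_set E I0 k0 al by fact
  let ?S = "%l k x. tri u v (2 powi l) (bad k) g x"
  let ?e = "%k. vol (E \<inter> stop k)"
  have bb: "bdd (bad k)" for k by (rule bddI[OF bad_measurable bad_abs_le])
  have [measurable]: "?S l k \<in> Bor" for l k by (rule tri_measurable[OF bb g])
  define \<mu> where "\<mu> i = q * 2 powr (- \<eta> * real_of_int i) * lam" for i
  have mu: "\<mu> i > 0" for i using q lam by (simp add: \<mu>_def)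
  have pair: "evol {x. \<bar>?S l k x\<bar> > \<mu> (l - k)} <= ennreal (C1 * (G / lam) powr s * 2 powr (- \<zeta> * real_of_int (l - k)) * ?e k)"
   if kl: "k < l" for k l
  proof -
   have "(LN x. ennreal \<bar>?S l k x\<bar>) <= ennreal G * (LN x. ennreal \<bar>bad k x\<bar>)"
    by (rule tri_L1[OF bb g G])
   also have "... <= ennreal G * ennreal (2 * ?e k)"
    using badU_L1[OF step_UNIV, of k] integrable_parts(1)[OF step_UNIV, of k]
    by (intro mult_left_mono, subst nn_integral_eq_integral) (auto simp: badU_UNIV intro!: ennreal_leI)
   finally have 1: "(LN x. ennreal \<bar>?S l k x\<bar>) <= ennreal (2 * G * ?e k)"
    using G0 by (simp add: ennreal_mult[symmetric] mult.left_commute mult.assoc)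
   have m1: "evol {x. \<bar>?S l k x\<bar> > \<mu> (l - k)} <= ennreal (2 * G * ?e k / \<mu> (l - k))"
    using emeasure_gt_le[of "?S l k" lborel "\<mu> (l - k)", OF _ mu 1] G0 by simp
   have m2: "evol {x. \<bar>?S l k x\<bar> > \<mu> (l - k)} <= ennreal (C0 * G\<^sup>2 * 2 powr (- dl * real_of_int (l - k)) * ?e k / (\<mu> (l - k))\<^sup>2)"
   proof -
    have "{x. \<bar>?S l k x\<bar> > \<mu> (l - k)} = {x \<in> space lborel. \<bar>(?S l k x)\<^sup>2\<bar> > (\<mu> (l - k))\<^sup>2}"
     using mu[of "l - k"] abs_le_square_iff[of "?S l k _" "\<mu> (l - k)"] by (auto simp: not_le[symmetric])
    thus ?thesis
     using emeasure_gt_le[of "%x. (?S l k x)\<^sup>2" lborel "(\<mu> (l - k))\<^sup>2"] C0(3)[OF cz kl g G av] mu[of "l - k"] C0(1) by simp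
   qed
   obtain m where m: "evol {x. \<bar>?S l k x\<bar> > \<mu> (l - k)} = ennreal m" "m >= 0"
    using m1 by (cases "evol {x. \<bar>?S l k x\<bar> > \<mu> (l - k)}") (auto simp: top_unique)
   define e where "e = ?e k"
   define M where "M = \<mu> (l - k)"
   define i where "i = real_of_int (l - k)"
   have nn: "0 <= e" "M > 0" using mu by (simp_all add: e_def M_def)
   have mm: "m <= 2 * G * e / M" "m <= C0 * G\<^sup>2 * 2 powr (- dl * i) * e / M\<^sup>2"
    using m1[unfolded m] m2[unfolded m] G0 C0(1) nn unfolding e_def[symmetric] M_def[symmetric] i_def[symmetric] by (auto simp: ennreal_le_iff)
   have "m <= C1 * (G / lam) powr s * 2 powr (- \<zeta> * i) * e"
   proof (cases "e = 0")
    case True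
    thus ?thesis using mm by simp
   next
    case False
    hence e: "e > 0" using nn by simp
    \<comment> \<open>The exponents 2 - s and s - 1 combine the L1 and L2 bounds into the power s of
      G / M and a single power of e.\<close>
    have "m <= (2 * G * e / M) powr (2 - s) * (C0 * G\<^sup>2 * 2 powr (- dl * i) * e / M\<^sup>2) powr (s - 1)"
     by (rule geometric_mean_le[OF m(2) mm]) (use s in auto)
    also have "... = C1 * (G / lam) powr s * 2 powr (- \<zeta> * i) * e"
    proof -
     have sp: "s > 0" using s by simp
     have lnM: "ln M = ln q - \<eta> * i * ln 2 + ln lam"
      using q lam by (simp add: M_def \<mu>_def i_def ln_mult ln_powr)
     have se: "s * \<eta> = \<zeta>" using sp by (simp add: \<eta>_def \<zeta>_def)
     have "ln ((2 * G * e / M) powr (2 - s) * (C0 * G\<^sup>2 * 2 powr (- dl * i) * e / M\<^sup>2) powr (s - 1))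
      = (2 - s) * (ln 2 + ln G + ln e - ln M) + (s - 1) * (ln C0 + 2 * ln G - dl * i * ln 2 + ln e - 2 * ln M)"
      using G0 e nn C0(1) by (simp add: ln_mult ln_div ln_powr ln_realpow)
     also have "... = (2 - s) * ln 2 + (s - 1) * ln C0 + s * ln G - s * ln M + ln e - 2 * (\<zeta> * i * ln 2)"
      by (simp add: \<zeta>_def field_simps)
     also have "... = (2 - s) * ln 2 + (s - 1) * ln C0 - s * ln q + s * (ln G - ln lam) - \<zeta> * i * ln 2 + ln e"
      unfolding lnM by (simp add: algebra_simps se[symmetric])
     also have "... = ln (C1 * (G / lam) powr s * 2 powr (- \<zeta> * i) * e)"
      using G0 e lam C0(1) q by (simp add: C1_def ln_mult ln_div ln_powr)
     finally show ?thesis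
      by (subst (asm) ln_inj_iff) (use G0 e lam C0(1) q C1 nn in auto)
    qed
    finally show ?thesis .
   qed
   thus ?thesis unfolding m e_def i_def by (rule ennreal_leI)
  qed
  have incl: "{x. x \<notin> exc & (\<exists>l\<in>L. \<bar>\<Sum>k\<in>K. ?S l k x\<bar> > lam)} \<subseteq> (\<Union>k\<in>K. \<Union>l\<in>{l\<in>L. k < l}. {x. \<bar>?S l k x\<bar> > \<mu> (l - k)})"
  proof (rule subsetI, rule ccontr)
   fix x assume x: "x \<in> {x. x \<notin> exc & (\<exists>l\<in>L. \<bar>\<Sum>k\<in>K. ?S l k x\<bar> > lam)}"
    and no: "x \<notin> (\<Union>k\<in>K. \<Union>l\<in>{l\<in>L. k < l}. {x. \<bar>?S l k x\<bar> > \<mu> (l - k)})"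
   then obtain l where l: "l \<in> L" "\<bar>\<Sum>k\<in>K. ?S l k x\<bar> > lam" "x \<notin> exc" by blast
   have "(\<Sum>k\<in>K. ?S l k x) = (\<Sum>k\<in>{k\<in>K. k < l}. ?S l k x)"
    using tri_bad_zero[OF cz u l(3)] finite_K by (intro sum.mono_neutral_right) (auto simp: not_less)
   hence "\<bar>\<Sum>k\<in>K. ?S l k x\<bar> <= (\<Sum>k\<in>{k\<in>K. k < l}. \<mu> (l - k))"
    using no l(1) by (simp only:) (rule order_trans[OF sum_abs sum_mono], force simp: not_less)
   also have "... = q * lam * (\<Sum>k\<in>{k\<in>K. k < l}. 2 powr (- \<eta> * real_of_int (l - k)))"
    by (simp add: \<mu>_def sum_distrib_left mult_ac)
   also have "(\<Sum>k\<in>{k\<in>K. k < l}. 2 powr (- \<eta> * real_of_int (l - k))) = (\<Sum>j\<in>{j\<in>uminus ` K. - l < j}. 2 powr (- \<eta> * real_of_int (j - (- l))))"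
    by (rule sum.reindex_bij_witness[of _ uminus uminus]) auto
   also have "q * lam * ... <= q * lam * (1 / (2 powr \<eta> - 1))"
    using q lam finite_K by (intro mult_left_mono geometric_sum_int eta) auto
   also have "... = lam" using q eta by (simp add: q_def)
   finally show False using l(2) by simp
  qed
  have "evol {x. x \<notin> exc & (\<exists>l\<in>L. \<bar>\<Sum>k\<in>K. ?S l k x\<bar> > lam)} <= evol (\<Union>k\<in>K. \<Union>l\<in>{l\<in>L. k < l}. {x. \<bar>?S l k x\<bar> > \<mu> (l - k)})"
   by (rule emeasure_mono[OF incl]) (use finite_K L in \<open>auto intro!: sets.finite_UN\<close>)
  also have "... <= (\<Sum>k\<in>K. evol (\<Union>l\<in>{l\<in>L. k < l}. {x. \<bar>?S l k x\<bar> > \<mu> (l - k)}))"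
   by (rule emeasure_subadditive_finite) (use finite_K L in \<open>auto intro!: sets.finite_UN\<close>)
  also have "... <= (\<Sum>k\<in>K. \<Sum>l\<in>{l\<in>L. k < l}. evol {x. \<bar>?S l k x\<bar> > \<mu> (l - k)})"
   by (intro sum_mono emeasure_subadditive_finite) (use L in auto)
  also have "... <= (\<Sum>k\<in>K. \<Sum>l\<in>{l\<in>L. k < l}. ennreal (C1 * (G / lam) powr s * 2 powr (- \<zeta> * real_of_int (l - k)) * ?e k))"
   by (intro sum_mono pair) auto
  also have "... = ennreal (\<Sum>k\<in>K. \<Sum>l\<in>{l\<in>L. k < l}. C1 * (G / lam) powr s * 2 powr (- \<zeta> * real_of_int (l - k)) * ?e k)"
   using C1 by (simp add: sum_ennreal sum_nonneg)
  also have "... <= ennreal (C * (G / lam) powr s * vol E)"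
  proof (rule ennreal_leI)
   have "(\<Sum>k\<in>K. \<Sum>l\<in>{l\<in>L. k < l}. C1 * (G / lam) powr s * 2 powr (- \<zeta> * real_of_int (l - k)) * ?e k)
    = (\<Sum>k\<in>K. C1 * (G / lam) powr s * ?e k * (\<Sum>l\<in>{l\<in>L. k < l}. 2 powr (- \<zeta> * real_of_int (l - k))))"
    by (simp add: sum_distrib_left mult_ac)
   also have "... <= (\<Sum>k\<in>K. C1 * (G / lam) powr s * ?e k * (1 / (2 powr \<zeta> - 1)))"
    using C1 by (intro sum_mono mult_left_mono geometric_sum_int L zeta) auto
   also have "... = C * (G / lam) powr s * (\<Sum>k\<in>K. ?e k)"
    by (simp add: C_def sum_distrib_left sum_divide_distrib mult_ac)
   also have "... <= C * (G / lam) powr s * vol E"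
    using C by (intro mult_left_mono sum_E_stop) auto
   finally show "(\<Sum>k\<in>K. \<Sum>l\<in>{l\<in>L. k < l}. C1 * (G / lam) powr s * 2 powr (- \<zeta> * real_of_int (l - k)) * ?e k) <= C * (G / lam) powr s * vol E" .
  qed
  finally show "evol {x. x \<notin> exc & (\<exists>l\<in>L. \<bar>\<Sum>k\<in>K. ?S l k x\<bar> > lam)} <= ennreal (C * (G / lam) powr s * vol E)" .
 qed
qed

end

section \<open>Two functions with cancellation\<close>

text \<open>A weighted geometric mean of the five bounds, computed with logarithms. With M = max (e
  / al) (f / bt) the measures are replaced by al M and bt M. The total power of M is then 1 + c' (2
  kp - 1), and the excess over 1 is cancelled by the power of T because M <= c T.\<close>

lemma near_geometric_mean:
 fixes X e f T al bt C1 C2 C3 c p p' \<theta> a b c' kp x y :: real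
 assumes X: "X\<^sup>2 <= C1 * p * e * f" "X\<^sup>2 <= C2 * p' * e * f" "X <= 2 * e" "X <= 2 * f" "X <= C3 * T * ((e * f) / T\<^sup>2) powr kp"
  and ef: "e <= c * (al * T)" "f <= c * (bt * T)" "0 <= e" "0 <= f" "0 <= X"
  and pos: "C1 > 0" "C2 > 0" "C3 > 0" "c > 0" "T > 0" "al > 0" "bt > 0" "p > 0" "p' > 0"
  and w: "\<theta> >= 0" "a >= 0" "b >= 0" "c' >= 0" "\<theta> + a + b + c' = 1" "kp >= 1/2"
  and xy: "x = \<theta> / 2 + a + kp * c'" "y = \<theta> / 2 + b + kp * c'"
 shows "X <= C1 powr (\<theta>/4) * C2 powr (\<theta>/4) * 2 powr (a + b) * C3 powr c' * c powr (c' * (2 * kp - 1)) *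
  (p powr (\<theta>/4) * p' powr (\<theta>/4) * al powr x * bt powr y) * (e / al + f / bt)"
proof (cases "X = 0")
 case True
 thus ?thesis using ef pos by (auto intro!: mult_nonneg_nonneg add_nonneg_nonneg divide_nonneg_pos)
next
 case False
 hence X0: "X > 0" and e: "e > 0" and f: "f > 0" using ef X by (auto simp: order_less_le)
 define M where "M = max (e / al) (f / bt)"
 have M: "M > 0" using e pos by (simp add: M_def less_max_iff_disj)
 have "e / al <= M" "f / bt <= M" "M <= c * T"
  using pos ef by (auto simp: M_def pos_divide_le_eq mult_ac)
 hence "e <= M * al" "f <= M * bt" "M <= c * T"
  using pos by (auto simp: pos_divide_le_eq)
 hence "ln e <= ln (M * al)" "ln f <= ln (M * bt)" "ln M <= ln (c * T)"
  using e f M pos by (simp_all del: ln_mult)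
 hence m: "ln e <= ln M + ln al" "ln f <= ln M + ln bt" "ln M <= ln c + ln T"
  using M pos by (simp_all add: ln_mult)
 have "ln (X\<^sup>2) <= ln (C1 * p * e * f)" "ln (X\<^sup>2) <= ln (C2 * p' * e * f)" "ln X <= ln (2 * e)" "ln X <= ln (2 * f)"
  "ln X <= ln (C3 * T * ((e * f) / T\<^sup>2) powr kp)"
  using X X0 e f pos by (simp_all del: ln_mult ln_realpow)
 hence l: "ln X <= (ln C1 + ln p + ln e + ln f) / 2" "ln X <= (ln C2 + ln p' + ln e + ln f) / 2"
  "ln X <= ln 2 + ln e" "ln X <= ln 2 + ln f" "ln X <= ln C3 + ln T + kp * (ln e + ln f - 2 * ln T)"
  using X0 e f pos by (simp_all add: ln_mult ln_realpow ln_powr ln_div)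
 have xy0: "x >= 0" "y >= 0" using w by (auto simp: xy)
 have "ln X = \<theta>/2 * ln X + \<theta>/2 * ln X + a * ln X + b * ln X + c' * ln X"
  using w(5) by (metis (no_types, lifting) distrib_right field_sum_of_halves mult_1)
 also have "... <= \<theta>/2 * ((ln C1 + ln p + ln e + ln f) / 2) + \<theta>/2 * ((ln C2 + ln p' + ln e + ln f) / 2)
  + a * (ln 2 + ln e) + b * (ln 2 + ln f) + c' * (ln C3 + ln T + kp * (ln e + ln f - 2 * ln T))"
  using w l by (intro add_mono mult_left_mono) auto
 also have "... = \<theta>/4 * (ln C1 + ln p) + \<theta>/4 * (ln C2 + ln p') + (a + b) * ln 2 + c' * ln C3 + x * ln e + y * ln f - c' * (2 * kp - 1) * ln T"
  unfolding xy by (simp add: field_simps)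
 also have "... <= \<theta>/4 * (ln C1 + ln p) + \<theta>/4 * (ln C2 + ln p') + (a + b) * ln 2 + c' * ln C3 + x * (ln M + ln al) + y * (ln M + ln bt) - c' * (2 * kp - 1) * ln T"
  using w xy0 m by (intro diff_right_mono add_mono mult_left_mono) auto
 also have "... = \<theta>/4 * (ln C1 + ln p) + \<theta>/4 * (ln C2 + ln p') + (a + b) * ln 2 + c' * ln C3 + x * ln al + y * ln bt + ln M + c' * (2 * kp - 1) * (ln M - ln T)"
 proof -
  have "(x + y) * ln M = (1 + c' * (2 * kp - 1)) * ln M"
   using w(5) unfolding xy by (intro arg_cong[where f="%z. z * ln M"]) (simp add: algebra_simps)
  thus ?thesis by (simp add: algebra_simps)
 qed
 also have "... <= \<theta>/4 * (ln C1 + ln p) + \<theta>/4 * (ln C2 + ln p') + (a + b) * ln 2 + c' * ln C3 + x * ln al + y * ln bt + ln M + c' * (2 * kp - 1) * ln c"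
  using w xy0 m(3) by (intro add_mono mult_left_mono) auto
 also have "... = ln (C1 powr (\<theta>/4) * C2 powr (\<theta>/4) * 2 powr (a + b) * C3 powr c' * c powr (c' * (2 * kp - 1)) *
  (p powr (\<theta>/4) * p' powr (\<theta>/4) * al powr x * bt powr y) * M)"
  using pos M by (simp add: ln_mult ln_powr field_simps)
 finally have "X <= C1 powr (\<theta>/4) * C2 powr (\<theta>/4) * 2 powr (a + b) * C3 powr c' * c powr (c' * (2 * kp - 1)) *
  (p powr (\<theta>/4) * p' powr (\<theta>/4) * al powr x * bt powr y) * M"
  using X0 M pos by (subst (asm) ln_le_cancel_iff) auto
 also have "... <= C1 powr (\<theta>/4) * C2 powr (\<theta>/4) * 2 powr (a + b) * C3 powr c' * c powr (c' * (2 * kp - 1)) *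
  (p powr (\<theta>/4) * p' powr (\<theta>/4) * al powr x * bt powr y) * (e / al + f / bt)"
  using pos e f by (intro mult_left_mono) (auto simp: M_def)
 finally show ?thesis .
qed

context haar_orthogonal
begin

text \<open>Cauchy-Schwarz on the product of Lebesgue measure and \<open>H\<close>; by translation
  invariance the second factor is the L2 norm of g.\<close>

lemma tri_L1_averaging:
 assumes av: "averaging us u v g" and b: "bdd b" and g: "bdd g" and N: "N >= 1"
 shows "(LN x. ennreal \<bar>tri u v t b g x\<bar>)\<^sup>2 <=
  (LN x. (HN R. ennreal ((point_avg (us N) N t b x R)\<^sup>2))) * (LN x. ennreal ((g x)\<^sup>2))"
proof -
 note bdd_measurable[OF b, measurable] bdd_measurable[OF g, measurable]
 let ?p = "point_avg (us N) N t b"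
 obtain B where B: "!!x R. \<bar>?p x R\<bar> <= B"
  and [measurable]: "(%p. ?p (fst p) (snd p)) \<in> borel_measurable (borel \<Otimes>\<^sub>M H)" "!!x. ?p x \<in> borel_measurable H"
  by (rule point_avg_bdd[OF b N, where us="us N" and t=t]) blast
 obtain G where G: "!!x. \<bar>g x\<bar> <= G" using g by (auto simp: bdd_def)
 have [measurable]: "(%p. ?p (fst p) (snd p)) \<in> borel_measurable (lborel \<Otimes>\<^sub>M H)"
  by (simp add: measurable_cong_sets[OF sets_pair_measure_cong[OF sets_lborel refl] refl])
 have [measurable]: "(%p. g (fst p - t *\<^sub>R (snd p *v v))) \<in> borel_measurable (lborel \<Otimes>\<^sub>M H)"
  unfolding measurable_cong_sets[OF sets_pair_measure_cong[OF sets_lborel refl] refl] by measurable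
 have "(LN x. ennreal \<bar>tri u v t b g x\<bar>) <= (LN x. (HN R. ennreal \<bar>?p x R\<bar> * ennreal \<bar>g (x - t *\<^sub>R (R *v v))\<bar>))"
 proof (rule nn_integral_mono)
  fix x
  have "\<bar>?p x R * g (x - t *\<^sub>R (R *v v))\<bar> <= B * G" for R
   unfolding abs_mult by (rule mult_mono[OF B G]) (auto intro: order_trans[OF abs_ge_zero B])
  hence i: "integrable H (%R. ?p x R * g (x - t *\<^sub>R (R *v v)))"
   by (intro integrable_const_bound[of _ "B * G"]) auto
  have "tri u v t b g x = (HI R. ?p x R * g (x - t *\<^sub>R (R *v v)))"
   using av N b by (simp add: averaging_def)
  thus "ennreal \<bar>tri u v t b g x\<bar> <= (HN R. ennreal \<bar>?p x R\<bar> * ennreal \<bar>g (x - t *\<^sub>R (R *v v))\<bar>)"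
   using integral_norm_bound_ennreal[OF i] by (simp add: abs_mult ennreal_mult)
 qed
 also have "... = (\<integral>\<^sup>+p. ennreal \<bar>?p (fst p) (snd p)\<bar> * ennreal \<bar>g (fst p - t *\<^sub>R (snd p *v v))\<bar> \<partial>(lborel \<Otimes>\<^sub>M H))"
  by (subst nn_integral_fst[symmetric]) (auto intro!: measurable)
 finally have "(LN x. ennreal \<bar>tri u v t b g x\<bar>)\<^sup>2 <= (\<integral>\<^sup>+p. ennreal \<bar>?p (fst p) (snd p)\<bar> * ennreal \<bar>g (fst p - t *\<^sub>R (snd p *v v))\<bar> \<partial>(lborel \<Otimes>\<^sub>M H))\<^sup>2"
  by (rule power_mono) simp
 also have "... <= (\<integral>\<^sup>+p. (ennreal \<bar>?p (fst p) (snd p)\<bar>)\<^sup>2 \<partial>(lborel \<Otimes>\<^sub>M H)) * (\<integral>\<^sup>+p. (ennreal \<bar>g (fst p - t *\<^sub>R (snd p *v v))\<bar>)\<^sup>2 \<partial>(lborel \<Otimes>\<^sub>M H))"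
  by (rule Cauchy_Schwarz_nn_integral) measurable
 also have "(\<integral>\<^sup>+p. (ennreal \<bar>?p (fst p) (snd p)\<bar>)\<^sup>2 \<partial>(lborel \<Otimes>\<^sub>M H)) = (LN x. (HN R. ennreal ((?p x R)\<^sup>2)))"
  by (subst nn_integral_fst[symmetric]) (auto simp: ennreal_power)
 also have "(\<integral>\<^sup>+p. (ennreal \<bar>g (fst p - t *\<^sub>R (snd p *v v))\<bar>)\<^sup>2 \<partial>(lborel \<Otimes>\<^sub>M H)) = (LN x. (HN R. ennreal ((g (x - t *\<^sub>R (R *v v)))\<^sup>2)))"
  by (subst nn_integral_fst[symmetric]) (auto simp: ennreal_power)
 also have "... = (LN x. ennreal ((g x)\<^sup>2))"
  by (rule nn_integral_shift_H) measurable
 finally show ?thesis .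
qed

lemma endpoint_nn:
 assumes d: "CARD('n) >= 2"
 obtains C where "C > 0"
  "!!E F u v t. tame (indicat_real E :: real^'n => real) ==> tame (indicat_real F :: real^'n => real) ==> norm (u - v) = 1 ==> t > 0 ==>
   (LN x. (HN R. indicator E (x - t *\<^sub>R (R *v u)) * indicator F (x - t *\<^sub>R (R *v v)))) <=
    ennreal (C * t ^ CARD('n) * ((vol E * vol F) / t ^ (2 * CARD('n))) powr (real CARD('n) / (real CARD('n) + 1)))"
proof -
 obtain C where C: "C > 0"
  "!!E F w. tame (indicat_real E :: real^'n => real) ==> tame (indicat_real F :: real^'n => real) ==> w ~= 0 ==>
   conv_form (sph w) (indicat_real E) (indicat_real F) <=
    C * norm w ^ CARD('n) * ((vol E * vol F) / norm w ^ (2 * CARD('n))) powr (real CARD('n) / (real CARD('n) + 1))"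
  by (rule restricted_endpoint[OF d]) blast
 show ?thesis
 proof (rule that[OF C(1)])
  fix E F :: "(real^'n) set" and u v :: "real^'n" and t :: real
  assume E: "tame (indicat_real E)" and F: "tame (indicat_real F)" and uv: "norm (u - v) = 1" and t: "t > 0"
  note e = tame_indicator_measure[OF E] and f = tame_indicator_measure[OF F]
  note e(1)[measurable] f(1)[measurable]
  define w where "w = t *\<^sub>R (u - v)"
  have w: "norm w = t" "w ~= 0" using uv t by (auto simp: w_def)
  interpret LH: pair_sigma_finite H "lborel :: (real^'n) measure"
   by (intro pair_sigma_finite.intro sigma_finite_lborel sigma_finite_measure_axioms)
  have eq: "ennreal (conv_form (sph w) (indicat_real E) (indicat_real F)) = (LN x. (\<integral>\<^sup>+z. ennreal (indicat_real E x * indicat_real F (x + z)) \<partial>sph w))"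
   by (rule conv_form_nn_integral(1)[OF e(4) _ _ _ _ prob_space_sph sets_sph, of _ 1]) (auto simp: indicator_def)
  have "(LN x. (HN R. indicator E (x - t *\<^sub>R (R *v u)) * indicator F (x - t *\<^sub>R (R *v v))))
   = (HN R. (LN x. indicator E (x - t *\<^sub>R (R *v u)) * indicator F (x - t *\<^sub>R (R *v v))))"
   by (rule LH.Fubini') measurable
  also have "... = (HN R. (LN x. indicator E x * indicator F (x + R *v w)))"
  proof (rule nn_integral_cong)
   fix R
   have "(LN x. indicator E (x - t *\<^sub>R (R *v u)) * indicator F (x - t *\<^sub>R (R *v v)))
    = (LN x. (%x. indicator E x * indicator F (x + R *v w)) (x + - (t *\<^sub>R (R *v u))))"
    by (intro nn_integral_cong) (simp add: w_def matrix_vector_mult_scaleR matrix_vector_mult_diff_distrib scaleR_diff_right)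
   also have "... = (LN x. indicator E x * indicator F (x + R *v w))"
    by (rule lborel_nn_integral_shift) measurable
   finally show "(LN x. indicator E (x - t *\<^sub>R (R *v u)) * indicator F (x - t *\<^sub>R (R *v v)))
    = (LN x. indicator E x * indicator F (x + R *v w))" .
  qed
  also have "... = (LN x. (HN R. indicator E x * indicator F (x + R *v w)))"
   by (rule LH.Fubini'[symmetric]) measurable
  also have "... = (LN x. (\<integral>\<^sup>+z. ennreal (indicat_real E x * indicat_real F (x + z)) \<partial>sph w))"
   unfolding sph_def by (subst nn_integral_distr) (auto simp: ennreal_mult ennreal_indicator)
  also have "... <= ennreal (C * t ^ CARD('n) * ((vol E * vol F) / t ^ (2 * CARD('n))) powr (real CARD('n) / (real CARD('n) + 1)))"
   unfolding eq[symmetric] using C(2)[OF E F w(2)] w(1) by (intro ennreal_leI) simp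
  finally show "(LN x. (HN R. indicator E (x - t *\<^sub>R (R *v u)) * indicator F (x - t *\<^sub>R (R *v v)))) <=
   ennreal (C * t ^ CARD('n) * ((vol E * vol F) / t ^ (2 * CARD('n))) powr (real CARD('n) / (real CARD('n) + 1)))" .
 qed
qed

text \<open>Each bad part is dominated by the indicator of E0 = E within the stopping cubes, plus a
  multiple of al times the indicator of the cubes E1. Since al |E1| <= |E0| and both al and kp are
  at most 1, al |E1|^kp <= |E0|^kp; so all four pairs of indicators obey the bound of the pair (E0,
  F0), up to a constant.\<close>

lemma bad_pair_endpoint:
 assumes d: "CARD('n) >= 2"
 obtains C where "C > 0"
  "!!E I0 k0 al F J0 m0 bt k k' l n u v. cz_set E I0 k0 al ==> cz_set F J0 m0 bt ==> al <= 1 ==> bt <= 1 ==> k < l ==> k' < l ==> norm (u - v :: real^'n) = 1 ==>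
   (LN x. ennreal \<bar>tri u v (2 powi l) (cz_set.badU E al k {y. near (grid l y) n}) (cz_set.badU F bt k' {y. near (grid l y) n}) x\<bar>)
    <= ennreal (C * (2 powi l) ^ CARD('n) *
     ((vol (E \<inter> cz_set.stop E al k \<inter> {y. near (grid l y) n}) * vol (F \<inter> cz_set.stop F bt k' \<inter> {y. near (grid l y) n}))
       / (2 powi l) ^ (2 * CARD('n))) powr (real CARD('n) / (real CARD('n) + 1)))"
proof -
 define kp where "kp = real CARD('n) / (real CARD('n) + 1)"
 have k01: "0 < kp" "kp < 1" using d by (auto simp: kp_def)
 obtain C where C: "C > 0"
  "!!E F u v t. tame (indicat_real E :: real^'n => real) ==> tame (indicat_real F :: real^'n => real) ==> norm (u - v) = 1 ==> t > 0 ==>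
   (LN x. (HN R. indicator E (x - t *\<^sub>R (R *v u)) * indicator F (x - t *\<^sub>R (R *v v)))) <=
    ennreal (C * t ^ CARD('n) * ((vol E * vol F) / t ^ (2 * CARD('n))) powr kp)"
  unfolding kp_def by (rule endpoint_nn[OF d]) blast
 show ?thesis
 proof (rule that[of "C * (1 + 2 ^ CARD('n))\<^sup>2"])
  show "C * (1 + 2 ^ CARD('n))\<^sup>2 > 0" using C(1) by (intro mult_pos_pos zero_less_power add_pos_pos) auto
  fix E F :: "(real^'n) set" and I0 J0 k0 m0 al bt and k k' l :: int and n :: "int^'n" and u v :: "real^'n"
  assume "cz_set E I0 k0 al" "cz_set F J0 m0 bt" and ab: "al <= 1" "bt <= 1" and kl: "k < l" "k' < l" and uv: "norm (u - v) = 1"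
  interpret A: cz_set E I0 k0 al by fact
  interpret B: cz_set F J0 m0 bt by fact
  let ?U = "{y::real^'n. near (grid l y) n}"
  note U = A.step_near[OF less_imp_le[OF kl(1)], of n] and V = A.step_near[OF less_imp_le[OF kl(2)], of n]
  define t :: real where "t = 2 powi l"
  have t: "t > 0" by (simp add: t_def)
  define E0 E1 F0 F1 where ef: "E0 = E \<inter> A.stop k \<inter> ?U" "E1 = A.stop k \<inter> ?U" "F0 = F \<inter> B.stop k' \<inter> ?U" "F1 = B.stop k' \<inter> ?U"
  have tm: "tame (indicat_real E0)" "tame (indicat_real E1)" "tame (indicat_real F0)" "tame (indicat_real F1)"
   unfolding ef by (rule A.tame_EU[OF U] A.tame_stopU[OF U] B.tame_EU[OF V] B.tame_stopU[OF V])+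
  note [measurable] = tm[THEN tame_indicator_measure(1)]
  define D where "D = (2::real) ^ CARD('n)"
  define W where "W = C * t ^ CARD('n) * ((vol E0 * vol F0) / t ^ (2 * CARD('n))) powr kp"
  have W: "W >= 0" using C t by (simp add: W_def)
  have small: "a * x powr kp <= z powr kp" if "a * x <= z" "0 < a" "a <= 1" "0 <= x" for a x z :: real
  proof -
   have "a = a powr 1" using that by simp
   also have "... <= a powr kp" using that k01 by (intro powr_mono') auto
   finally have "a * x powr kp <= a powr kp * x powr kp" by (intro mult_right_mono) auto
   also have "... = (a * x) powr kp" using that by (simp add: powr_mult)
   also have "... <= z powr kp" using that k01 by (intro powr_mono2) auto
   finally show ?thesis .
  qed
  have sE: "al * vol E1 powr kp <= vol E0 powr kp"
   using A.stopU_measure_le[OF U] A.alpha ab by (intro small) (auto simp: ef)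
  have sF: "bt * vol F1 powr kp <= vol F0 powr kp"
   using B.stopU_measure_le[OF V] B.alpha ab by (intro small) (auto simp: ef)
  define I where "I P Q = (LN x. (HN R. indicator P (x - t *\<^sub>R (R *v u)) * indicator Q (x - t *\<^sub>R (R *v v))))" for P Q :: "(real^'n) set"
  have IW: "ennreal (a * b) * I P Q <= ennreal W"
   if "tame (indicat_real P)" "tame (indicat_real Q)" "a * vol P powr kp <= vol E0 powr kp"
    "b * vol Q powr kp <= vol F0 powr kp" "0 <= a" "0 <= b" for P Q a b
  proof -
   have "ennreal (a * b) * I P Q <= ennreal (a * b) * ennreal (C * t ^ CARD('n) * ((vol P * vol Q) / t ^ (2 * CARD('n))) powr kp)"
    unfolding I_def by (intro mult_left_mono C(2) that uv t) auto
   also have "... = ennreal (C * t ^ CARD('n) / (t ^ (2 * CARD('n))) powr kp * ((a * vol P powr kp) * (b * vol Q powr kp)))"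
    using that C t by (simp add: ennreal_mult[symmetric] powr_divide powr_mult field_simps)
   also have "... <= ennreal (C * t ^ CARD('n) / (t ^ (2 * CARD('n))) powr kp * (vol E0 powr kp * vol F0 powr kp))"
    using that C t by (intro ennreal_leI mult_left_mono mult_mono) auto
   also have "... = ennreal W" using t by (simp add: W_def powr_divide powr_mult)
   finally show ?thesis .
  qed
  have D: "D >= 0" by (simp add: D_def)
  have bA: "\<bar>A.badU k ?U y\<bar> <= indicat_real E0 y + D * al * indicat_real E1 y" for y
   using A.badU_abs_le[OF U] by (simp add: ef D_def)
  have bB: "\<bar>B.badU k' ?U y\<bar> <= indicat_real F0 y + D * bt * indicat_real F1 y" for y
   using B.badU_abs_le[OF V] by (simp add: ef D_def)
  have ab0: "al > 0" "bt > 0" by (rule A.alpha B.alpha)+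
  let ?i = "%P Q x. (HN R. indicator P (x - t *\<^sub>R (R *v u)) * indicator Q (x - t *\<^sub>R (R *v v)))"
  have "(LN x. ennreal \<bar>tri u v t (A.badU k ?U) (B.badU k' ?U) x\<bar>) <=
   (LN x. (?i E0 F0 x + ennreal (D * bt) * ?i E0 F1 x + ennreal (D * al) * ?i E1 F0 x + ennreal (D * al * (D * bt)) * ?i E1 F1 x))"
  proof (rule nn_integral_mono)
   fix x
   have "ennreal \<bar>tri u v t (A.badU k ?U) (B.badU k' ?U) x\<bar> <= (HN R. ennreal (\<bar>A.badU k ?U (x - t *\<^sub>R (R *v u))\<bar> * \<bar>B.badU k' ?U (x - t *\<^sub>R (R *v v))\<bar>))"
    by (rule tri_nn_le[OF tame_bdd[OF A.tame_badU[OF U]] tame_bdd[OF B.tame_badU[OF V]]])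
   also have "... <= (HN R. (indicator E0 (x - t *\<^sub>R (R *v u)) * indicator F0 (x - t *\<^sub>R (R *v v))
     + ennreal (D * bt) * (indicator E0 (x - t *\<^sub>R (R *v u)) * indicator F1 (x - t *\<^sub>R (R *v v)))
     + ennreal (D * al) * (indicator E1 (x - t *\<^sub>R (R *v u)) * indicator F0 (x - t *\<^sub>R (R *v v)))
     + ennreal (D * al * (D * bt)) * (indicator E1 (x - t *\<^sub>R (R *v u)) * indicator F1 (x - t *\<^sub>R (R *v v)))))"
   proof (rule nn_integral_mono)
    fix R
    let ?y = "x - t *\<^sub>R (R *v u)" and ?z = "x - t *\<^sub>R (R *v v)"
    have "\<bar>A.badU k ?U ?y\<bar> * \<bar>B.badU k' ?U ?z\<bar> <= (indicat_real E0 ?y + D * al * indicat_real E1 ?y) * (indicat_real F0 ?z + D * bt * indicat_real F1 ?z)"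
     by (rule mult_mono[OF bA bB]) (use D ab0 in auto)
    hence "ennreal (\<bar>A.badU k ?U ?y\<bar> * \<bar>B.badU k' ?U ?z\<bar>) <= ennreal ((indicat_real E0 ?y + D * al * indicat_real E1 ?y) * (indicat_real F0 ?z + D * bt * indicat_real F1 ?z))"
     by (rule ennreal_leI)
    also have "... = indicator E0 ?y * indicator F0 ?z + ennreal (D * bt) * (indicator E0 ?y * indicator F1 ?z)
     + ennreal (D * al) * (indicator E1 ?y * indicator F0 ?z) + ennreal (D * al * (D * bt)) * (indicator E1 ?y * indicator F1 ?z)"
    proof -
     have "ennreal ((indicat_real E0 ?y + p * indicat_real E1 ?y) * (indicat_real F0 ?z + q * indicat_real F1 ?z)) = indicator E0 ?y * indicator F0 ?z + ennreal q * (indicator E0 ?y * indicator F1 ?z)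
      + ennreal p * (indicator E1 ?y * indicator F0 ?z) + ennreal (p * q) * (indicator E1 ?y * indicator F1 ?z)" if "p >= 0" "q >= 0" for p q
      using that by (auto simp: indicator_def distrib_left distrib_right add_ac)
     thus ?thesis using D ab0 by simp
    qed
    finally show "ennreal (\<bar>A.badU k ?U ?y\<bar> * \<bar>B.badU k' ?U ?z\<bar>) <= ..." .
   qed
   also have "... = ?i E0 F0 x + ennreal (D * bt) * ?i E0 F1 x + ennreal (D * al) * ?i E1 F0 x + ennreal (D * al * (D * bt)) * ?i E1 F1 x"
    by (simp add: nn_integral_add nn_integral_cmult)
   finally show "ennreal \<bar>tri u v t (A.badU k ?U) (B.badU k' ?U) x\<bar> <= ..." .
  qed
  also have "... = I E0 F0 + ennreal (D * bt) * I E0 F1 + ennreal (D * al) * I E1 F0 + ennreal (D * al * (D * bt)) * I E1 F1"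
   unfolding I_def by (simp add: nn_integral_add nn_integral_cmult)
  also have "... = ennreal (1 * 1) * I E0 F0 + ennreal D * (ennreal (1 * bt) * I E0 F1) + ennreal D * (ennreal (al * 1) * I E1 F0) + ennreal (D * D) * (ennreal (al * bt) * I E1 F1)"
   using D ab0 by (simp add: ennreal_mult mult_ac)
  also have "... <= ennreal W + ennreal D * ennreal W + ennreal D * ennreal W + ennreal (D * D) * ennreal W"
   using sE sF ab0 by (intro add_mono mult_left_mono IW tm) auto
  also have "... = ennreal ((1 + D)\<^sup>2 * W)"
   using D W by (simp add: ennreal_mult[symmetric] ennreal_plus[symmetric] power2_eq_square algebra_simps del: ennreal_plus)
  finally show "(LN x. ennreal \<bar>tri u v (2 powi l) (A.badU k ?U) (B.badU k' ?U) x\<bar>)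
    <= ennreal (C * (1 + 2 ^ CARD('n))\<^sup>2 * (2 powi l) ^ CARD('n) *
     ((vol (E \<inter> A.stop k \<inter> ?U) * vol (F \<inter> B.stop k' \<inter> ?U)) / (2 powi l) ^ (2 * CARD('n))) powr (real CARD('n) / (real CARD('n) + 1)))"
   by (simp add: W_def ef D_def t_def kp_def mult_ac)
 qed
qed

text \<open>Five bounds for the L1 norm of one pair on one cube meet here: averaging over points in
  either argument, the two trivial bounds, and the endpoint. The positive weight on the first two
  makes the sum over the levels k, k' < l and over l converge; Chebyshev's inequality
  finishes.\<close>

lemma bad_bad:
 assumes d: "CARD('n) >= 2" and c: "c > 0" "c' > 0"
  and sep: "!!N j k. j < N ==> k < N ==> j ~= k ==> norm (us N j - us N k :: real^'n) >= c / real N"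
   "!!N j k. j < N ==> k < N ==> j ~= k ==> norm (vs N j - vs N k :: real^'n) >= c' / real N"
  and u: "norm u = 1" "norm v = 1" "norm (u - v) = 1"
  and av: "!!g. bdd g ==> averaging us u v g" "!!f. bdd f ==> averaging vs v u f"
  and w: "\<theta> > 0" "a >= 0" "b >= 0" "w >= 0" "\<theta> + a + b + w = 1"
  and xy: "x = \<theta> / 2 + a + real CARD('n) / (real CARD('n) + 1) * w" "y = \<theta> / 2 + b + real CARD('n) / (real CARD('n) + 1) * w"
 obtains C where "C > 0"
  "!!E I0 k0 al F J0 m0 bt lam L. cz_set E I0 k0 al ==> cz_set F J0 m0 bt ==> al <= 1 ==> bt <= 1 ==> lam > 0 ==> finite L ==>
   evol {z. \<exists>l\<in>L. \<bar>\<Sum>k\<in>{k\<in>cz_set.K E al. k < l}. \<Sum>k'\<in>{k'\<in>cz_set.K F bt. k' < l}.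
     tri u v (2 powi l) (cz_set.bad E al k) (cz_set.bad F bt k') z\<bar> > lam}
    <= ennreal (C * (al powr x * bt powr y / lam) * (vol E / al + vol F / bt))"
proof -
 obtain C1 dl where C1: "C1 > 0" "dl > 0"
  "!!E I0 k0 al k l n. cz_set E I0 k0 al ==> k < l ==>
   \<exists>N\<ge>1. (LN x. (HN R. ennreal ((point_avg (us N) N (2 powi l) (cz_set.badU E al k {y. near (grid l y) n}) x R)\<^sup>2)))
     <= ennreal (C1 * 2 powr (- dl * real_of_int (l - k)) * vol (E \<inter> cz_set.stop E al k \<inter> {y. near (grid l y) n}))"
  by (rule badU_point_avg_decay[where us=us, OF d c(1) sep(1)]) blast+
 obtain C2 dl' where C2: "C2 > 0" "dl' > 0"
  "!!E I0 k0 al k l n. cz_set E I0 k0 al ==> k < l ==>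
   \<exists>N\<ge>1. (LN x. (HN R. ennreal ((point_avg (vs N) N (2 powi l) (cz_set.badU E al k {y. near (grid l y) n}) x R)\<^sup>2)))
     <= ennreal (C2 * 2 powr (- dl' * real_of_int (l - k)) * vol (E \<inter> cz_set.stop E al k \<inter> {y. near (grid l y) n}))"
  by (rule badU_point_avg_decay[where us=vs, OF d c(2) sep(2)]) blast+
 define kp where "kp = real CARD('n) / (real CARD('n) + 1)"
 have kap: "1/2 <= kp" using d by (simp add: kp_def field_simps)
 obtain C3 where C3: "C3 > 0"
  "!!E I0 k0 al F J0 m0 bt k k' l n u v. cz_set E I0 k0 al ==> cz_set F J0 m0 bt ==> al <= 1 ==> bt <= 1 ==> k < l ==> k' < l ==> norm (u - v :: real^'n) = 1 ==>
   (LN x. ennreal \<bar>tri u v (2 powi l) (cz_set.badU E al k {y. near (grid l y) n}) (cz_set.badU F bt k' {y. near (grid l y) n}) x\<bar>)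
    <= ennreal (C3 * (2 powi l) ^ CARD('n) *
     ((vol (E \<inter> cz_set.stop E al k \<inter> {y. near (grid l y) n}) * vol (F \<inter> cz_set.stop F bt k' \<inter> {y. near (grid l y) n}))
       / (2 powi l) ^ (2 * CARD('n))) powr kp)"
  unfolding kp_def by (rule bad_pair_endpoint[OF d]) blast
 define nc where "nc = real (near_count TYPE('n))"
 have nc: "nc > 0"
  unfolding nc_def near_count_def using finite_near[of "0::int^'n"] by (auto simp: card_gt_0_iff near_def intro!: exI[of _ 0])
 define D where "D = C1 powr (\<theta>/4) * C2 powr (\<theta>/4) * 2 powr (a + b) * C3 powr w * nc powr (w * (2 * kp - 1))"
 have D: "D > 0" using C1 C2 C3 nc by (simp add: D_def)
 \<comment> \<open>Each averaging bound has weight \<theta> / 2 and controls the square of X, so a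
   quarter of \<theta> multiplies its decay exponent.\<close>
 define \<zeta> \<zeta>' where "\<zeta> = dl * \<theta> / 4" and "\<zeta>' = dl' * \<theta> / 4"
 have zeta: "\<zeta> > 0" "\<zeta>' > 0" using C1 C2 w by (auto simp: \<zeta>_def \<zeta>'_def)
 define Z where "Z = 1 / (2 powr \<zeta> - 1) * (1 / (2 powr \<zeta>' - 1))"
 have Z: "Z > 0" using zeta by (simp add: Z_def)
 show ?thesis
 proof (rule that[of "nc * D * Z"])
  show "nc * D * Z > 0" using nc D Z by simp
  fix E F :: "(real^'n) set" and I0 J0 k0 m0 al bt and lam :: real and L :: "int set"
  assume czA: "cz_set E I0 k0 al" and czB: "cz_set F J0 m0 bt" and ab: "al <= 1" "bt <= 1" and lam: "lam > 0" and L: "finite L"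
  interpret A: cz_set E I0 k0 al by fact
  interpret B: cz_set F J0 m0 bt by fact
  have ab0: "al > 0" "bt > 0" by (rule A.alpha B.alpha)+
  let ?S = "%l k k' z. tri u v (2 powi l) (A.bad k) (B.bad k') z"
  have bb: "bdd (A.bad k)" "bdd (B.bad k)" for k
   by (rule bddI[OF A.bad_measurable A.bad_abs_le] bddI[OF B.bad_measurable B.bad_abs_le])+
  have [measurable]: "?S l k k' \<in> Bor" for l k k' by (rule tri_measurable[OF bb])
  define e f where "e k = vol (E \<inter> A.stop k)" and "f k = vol (F \<inter> B.stop k)" for k
  have ef0: "e k >= 0" "f k >= 0" for k by (auto simp: e_def f_def)
  define W where "W l k k' = D * (al powr x * bt powr y) * (2 powr (- \<zeta> * real_of_int (l - k)) * 2 powr (- \<zeta>' * real_of_int (l - k')))" for l k k'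
  have W: "W l k k' >= 0" for l k k' using D by (simp add: W_def)
  have pair: "(LN z. ennreal \<bar>?S l k k' z\<bar>) <= ennreal (nc * W l k k' * (e k / al + f k' / bt))"
   if kl: "k < l" "k' < l" for l k k'
  proof -
   let ?\<omega> = "%z. ennreal (W l k k' / al) * indicator (E \<inter> A.stop k) z + ennreal (W l k k' / bt) * indicator (F \<inter> B.stop k') z"
   note tE = tame_indicator_measure[OF A.tame_EU[OF A.step_UNIV], of k, simplified]
   note tF = tame_indicator_measure[OF B.tame_EU[OF B.step_UNIV], of k', simplified]
   note tE(1)[measurable] tF(1)[measurable]
   have "(LN z. ennreal \<bar>?S l k k' z\<bar>) <= of_nat (near_count TYPE('n)) * (LN z. ?\<omega> z)"
   proof (rule nn_integral_cells[of _ _ l])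
    fix n
    let ?U = "{y::real^'n. near (grid l y) n}"
    note U = A.step_near[OF less_imp_le[OF kl(1)], of n] and V = A.step_near[OF less_imp_le[OF kl(2)], of n]
    note A.U_measurable[OF U, measurable]
    have bU: "bdd (A.badU k ?U)" "bdd (B.badU k' ?U)"
     by (rule tame_bdd[OF A.tame_badU[OF U]] tame_bdd[OF B.tame_badU[OF V]])+
    have b1: "\<bar>A.badU k ?U z\<bar> <= 1" "\<bar>B.badU k' ?U z\<bar> <= 1" for z
     using A.bad_abs_le[of k z] B.bad_abs_le[of k' z] by (auto simp: A.badU_def[OF U] B.badU_def[OF V] indicator_def)
    let ?e = "vol (E \<inter> A.stop k \<inter> ?U)" and ?f = "vol (F \<inter> B.stop k' \<inter> ?U)"
    note tEU = tame_indicator_measure[OF A.tame_EU[OF U]] and tFU = tame_indicator_measure[OF B.tame_EU[OF V]]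
    let ?X = "(LN z. ennreal \<bar>tri u v (2 powi l) (A.badU k ?U) (B.badU k' ?U) z\<bar>)"
    have l1: "(LN z. ennreal \<bar>A.badU k ?U z\<bar>) <= ennreal (2 * ?e)" "(LN z. ennreal \<bar>B.badU k' ?U z\<bar>) <= ennreal (2 * ?f)"
     using A.badU_L1[OF U] A.integrable_parts(1)[OF U] B.badU_L1[OF V] B.integrable_parts(1)[OF V]
     by (simp_all add: nn_integral_eq_integral ennreal_leI)
    have l2: "(LN z. ennreal ((A.badU k ?U z)\<^sup>2)) <= ennreal ?e" "(LN z. ennreal ((B.badU k' ?U z)\<^sup>2)) <= ennreal ?f"
     using A.badU_L2[OF U] integrable_power2_of_bounded[OF A.integrable_parts(1)[OF U] b1(1)]
      B.badU_L2[OF V] integrable_power2_of_bounded[OF B.integrable_parts(1)[OF V] b1(2)]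
     by (simp_all add: nn_integral_eq_integral ennreal_leI)
    have Xe: "?X <= ennreal (2 * ?e)"
     using order_trans[OF tri_L1[OF bU b1(2)]] l1(1) by simp
    have Xf: "?X <= ennreal (2 * ?f)"
     using order_trans[OF tri_L1[OF bU(2,1) b1(1)]] l1(2) by (subst tri_commute) simp
    obtain X where X: "?X = ennreal X" "X >= 0" using Xe by (cases ?X) (auto simp: top_unique)
    obtain N where N: "N >= 1" "(LN x. (HN R. ennreal ((point_avg (us N) N (2 powi l) (A.badU k ?U) x R)\<^sup>2)))
     <= ennreal (C1 * 2 powr (- dl * real_of_int (l - k)) * ?e)"
     using C1(3)[OF czA kl(1), of n] by blast
    obtain N' where N': "N' >= 1" "(LN x. (HN R. ennreal ((point_avg (vs N') N' (2 powi l) (B.badU k' ?U) x R)\<^sup>2)))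
     <= ennreal (C2 * 2 powr (- dl' * real_of_int (l - k')) * ?f)"
     using C2(3)[OF czB kl(2), of n] by blast
    have "?X\<^sup>2 <= ennreal (C1 * 2 powr (- dl * real_of_int (l - k)) * ?e) * ennreal ?f"
     by (rule order_trans[OF tri_L1_averaging[OF av(1)[OF bU(2)] bU N(1)] mult_mono[OF N(2) l2(2)]]) simp_all
    hence X1: "X\<^sup>2 <= C1 * 2 powr (- dl * real_of_int (l - k)) * ?e * ?f"
     using X(2) C1(1) unfolding X(1) by (simp add: ennreal_power ennreal_mult[symmetric] ennreal_le_iff)
    have "?X\<^sup>2 <= ennreal (C2 * 2 powr (- dl' * real_of_int (l - k')) * ?f) * ennreal ?e"
     by (subst tri_commute, rule order_trans[OF tri_L1_averaging[OF av(2)[OF bU(1)] bU(2,1) N'(1)] mult_mono[OF N'(2) l2(1)]]) simp_all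
    hence X2: "X\<^sup>2 <= C2 * 2 powr (- dl' * real_of_int (l - k')) * ?e * ?f"
     using X(2) C2(1) unfolding X(1) by (simp add: ennreal_power ennreal_mult[symmetric] ennreal_le_iff mult_ac)
    have X3: "X <= 2 * ?e" "X <= 2 * ?f" using Xe Xf X(2) unfolding X(1) by (simp_all add: ennreal_le_iff)
    have X4: "X <= C3 * (2 powi l) ^ CARD('n) * ((?e * ?f) / ((2 powi l) ^ CARD('n))\<^sup>2) powr kp"
     using C3(2)[OF czA czB ab kl u(3), of n] X(2) C3(1) unfolding X(1)
     by (simp add: ennreal_le_iff power_mult[symmetric] mult.commute[of 2])
    have "X <= D * ((2 powr (- dl * real_of_int (l - k))) powr (\<theta>/4) * (2 powr (- dl' * real_of_int (l - k'))) powr (\<theta>/4) * al powr x * bt powr y) * (?e / al + ?f / bt)"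
     unfolding D_def
     by (rule near_geometric_mean[OF X1 X2 X3 X4, where x=x and y=y])
      (use A.near_density[OF kl(1), of n] B.near_density[OF kl(2), of n] X(2) C1(1) C2(1) C3(1) nc ab0 w kap xy in \<open>auto simp: nc_def kp_def\<close>)
    also have "... = W l k k' * (?e / al + ?f / bt)"
    proof -
     have eq: "(2 powr (- dl * i)) powr (\<theta>/4) = 2 powr (- \<zeta> * i)" "(2 powr (- dl' * i)) powr (\<theta>/4) = 2 powr (- \<zeta>' * i)" for i
      by (simp_all add: powr_powr \<zeta>_def \<zeta>'_def mult_ac)
     show ?thesis unfolding W_def eq by (simp only: mult_ac)
    qed
    finally have XW: "X <= W l k k' * (?e / al + ?f / bt)" .
    have "(LN z. ennreal \<bar>?S l k k' z\<bar> * indicator {z. grid l z = n} z) <= ?X"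
    proof (rule nn_integral_mono)
     fix z
     have "?S l k k' z = tri u v (2 powi l) (A.badU k ?U) (B.badU k' ?U) z" if "grid l z = n"
      using tri_bad_local[OF czA u(1,2) that kl(1)] tri_bad_local[OF czB u(2,1) that kl(2)]
      by (metis tri_commute)
     thus "ennreal \<bar>?S l k k' z\<bar> * indicator {z. grid l z = n} z <= ennreal \<bar>tri u v (2 powi l) (A.badU k ?U) (B.badU k' ?U) z\<bar>"
      by (auto simp: indicator_def)
    qed
    also have "?X <= ennreal (W l k k' / al) * ennreal ?e + ennreal (W l k k' / bt) * ennreal ?f"
     unfolding X(1) using XW W[of l k k'] ab0
     by (simp add: ennreal_mult[symmetric] ennreal_plus[symmetric] distrib_left ennreal_leI del: ennreal_plus)
    also have "... = (LN z. ?\<omega> z * indicator ?U z)"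
    proof -
     have "(LN z. ?\<omega> z * indicator ?U z) = (LN z. ennreal (W l k k' / al) * indicator (E \<inter> A.stop k \<inter> ?U) z + ennreal (W l k k' / bt) * indicator (F \<inter> B.stop k' \<inter> ?U) z)"
      by (intro nn_integral_cong) (auto simp: indicator_def)
     also have "... = ennreal (W l k k' / al) * ennreal ?e + ennreal (W l k k' / bt) * ennreal ?f"
      using tEU(1,3) tFU(1,3) by (simp add: nn_integral_add nn_integral_cmult_indicator)
     finally show ?thesis by simp
    qed
    finally show "(LN z. ennreal \<bar>?S l k k' z\<bar> * indicator {z. grid l z = n} z) <= (LN z. ?\<omega> z * indicator ?U z)" .
   qed measurable
   also have "(LN z. ?\<omega> z) = ennreal (W l k k' / al) * ennreal (e k) + ennreal (W l k k' / bt) * ennreal (f k')"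
    using tE(1,3) tF(1,3) by (simp add: nn_integral_add nn_integral_cmult_indicator e_def f_def)
   also have "of_nat (near_count TYPE('n)) * ... = ennreal (nc * W l k k' * (e k / al + f k' / bt))"
    using W[of l k k'] ab0 ef0 nc
    by (simp add: ennreal_mult[symmetric] ennreal_plus[symmetric] ennreal_of_nat_eq_real_of_nat nc_def[symmetric] algebra_simps del: ennreal_plus)
   finally show ?thesis .
  qed
  let ?P = "%l. {k\<in>A.K. k < l}" and ?Q = "%l. {k\<in>B.K. k < l}"
  let ?T = "%z. \<Sum>l\<in>L. \<bar>\<Sum>k\<in>?P l. \<Sum>k'\<in>?Q l. ?S l k k' z\<bar>"
  have fin: "finite (?P l)" "finite (?Q l)" for l using A.finite_K B.finite_K by auto
  have "(LN z. ennreal \<bar>?T z\<bar>) <= (LN z. (\<Sum>l\<in>L. \<Sum>k\<in>?P l. \<Sum>k'\<in>?Q l. ennreal \<bar>?S l k k' z\<bar>))"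
  proof (rule nn_integral_mono)
   fix z
   have "?T z <= (\<Sum>l\<in>L. \<Sum>k\<in>?P l. \<Sum>k'\<in>?Q l. \<bar>?S l k k' z\<bar>)"
    by (intro sum_mono order_trans[OF sum_abs] sum_abs)
   thus "ennreal \<bar>?T z\<bar> <= (\<Sum>l\<in>L. \<Sum>k\<in>?P l. \<Sum>k'\<in>?Q l. ennreal \<bar>?S l k k' z\<bar>)"
    by (simp add: sum_ennreal sum_nonneg ennreal_leI)
  qed
  also have "... = (\<Sum>l\<in>L. \<Sum>k\<in>?P l. \<Sum>k'\<in>?Q l. (LN z. ennreal \<bar>?S l k k' z\<bar>))"
   by (simp add: nn_integral_sum del: sum_ennreal)
  also have "... <= (\<Sum>l\<in>L. \<Sum>k\<in>?P l. \<Sum>k'\<in>?Q l. ennreal (nc * W l k k' * (e k / al + f k' / bt)))"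
   by (intro sum_mono pair) auto
  also have "... = ennreal (\<Sum>l\<in>L. \<Sum>k\<in>?P l. \<Sum>k'\<in>?Q l. nc * W l k k' * (e k / al + f k' / bt))"
   using nc W ef0 ab0 by (simp add: sum_ennreal sum_nonneg)
  also have "... <= ennreal (nc * D * Z * (al powr x * bt powr y) * (vol E / al + vol F / bt))"
  proof (rule ennreal_leI)
   let ?p = "%l k. 2 powr (- \<zeta> * real_of_int (l - k))" and ?q = "%l k. 2 powr (- \<zeta>' * real_of_int (l - k))"
   \<comment> \<open>The level that \<open>h\<close> does not depend on is summed first, then l,
     then k. It is applied twice, with the roles of the two functions exchanged.\<close>
   have dbl: "(\<Sum>l\<in>L. \<Sum>k\<in>{k\<in>K. k < l}. \<Sum>k'\<in>{k\<in>K'. k < l}. 2 powr (- s * real_of_int (l - k)) * 2 powr (- s' * real_of_int (l - k')) * h k)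
     <= 1 / (2 powr s - 1) * (1 / (2 powr s' - 1)) * (\<Sum>k\<in>K. h k)"
    if K: "finite K" "finite K'" and h: "!!k. h k >= 0" and s: "s > 0" "s' > 0" for K K' :: "int set" and h :: "int => real" and s s' :: real
   proof -
    have inner: "(\<Sum>k'\<in>{k\<in>K'. k < l}. 2 powr (- s' * real_of_int (l - k'))) <= 1 / (2 powr s' - 1)" for l
    proof -
     have "(\<Sum>k'\<in>{k\<in>K'. k < l}. 2 powr (- s' * real_of_int (l - k'))) = (\<Sum>j\<in>{j\<in>uminus ` K'. - l < j}. 2 powr (- s' * real_of_int (j - (- l))))"
      by (rule sum.reindex_bij_witness[of _ uminus uminus]) auto
     thus ?thesis using geometric_sum_int[of "uminus ` K'" s' "- l"] K s by simp
    qed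
    have "(\<Sum>l\<in>L. \<Sum>k\<in>{k\<in>K. k < l}. \<Sum>k'\<in>{k\<in>K'. k < l}. 2 powr (- s * real_of_int (l - k)) * 2 powr (- s' * real_of_int (l - k')) * h k)
     = (\<Sum>l\<in>L. \<Sum>k\<in>{k\<in>K. k < l}. 2 powr (- s * real_of_int (l - k)) * h k * (\<Sum>k'\<in>{k\<in>K'. k < l}. 2 powr (- s' * real_of_int (l - k'))))"
     by (simp add: sum_distrib_left mult_ac)
    also have "... <= (\<Sum>l\<in>L. \<Sum>k\<in>{k\<in>K. k < l}. 2 powr (- s * real_of_int (l - k)) * h k * (1 / (2 powr s' - 1)))"
     using h by (intro sum_mono mult_left_mono inner) auto
    also have "... = (\<Sum>k\<in>K. \<Sum>l\<in>{l\<in>L. k < l}. 2 powr (- s * real_of_int (l - k)) * h k * (1 / (2 powr s' - 1)))"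
     by (rule sum.swap_restrict[OF L K(1)])
    also have "... = (\<Sum>k\<in>K. h k * (1 / (2 powr s' - 1)) * (\<Sum>l\<in>{l\<in>L. k < l}. 2 powr (- s * real_of_int (l - k))))"
     by (simp add: sum_distrib_left mult_ac)
    also have "... <= (\<Sum>k\<in>K. h k * (1 / (2 powr s' - 1)) * (1 / (2 powr s - 1)))"
     using h s by (intro sum_mono mult_left_mono geometric_sum_int L) (auto intro!: divide_nonneg_nonneg simp: ge_one_powr_ge_zero)
    also have "... = 1 / (2 powr s - 1) * (1 / (2 powr s' - 1)) * (\<Sum>k\<in>K. h k)"
     by (simp add: sum_divide_distrib mult_ac)
    finally show ?thesis .
   qed
   have "(\<Sum>l\<in>L. \<Sum>k\<in>?P l. \<Sum>k'\<in>?Q l. nc * W l k k' * (e k / al + f k' / bt)) =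
    nc * D * (al powr x * bt powr y) * ((\<Sum>l\<in>L. \<Sum>k\<in>?P l. \<Sum>k'\<in>?Q l. ?p l k * ?q l k' * (e k / al)) + (\<Sum>l\<in>L. \<Sum>k\<in>?P l. \<Sum>k'\<in>?Q l. ?p l k * ?q l k' * (f k' / bt)))"
    unfolding sum.distrib[symmetric] sum_distrib_left by (intro sum.cong refl) (simp add: W_def algebra_simps)
   also have "(\<Sum>l\<in>L. \<Sum>k\<in>?P l. \<Sum>k'\<in>?Q l. ?p l k * ?q l k' * (f k' / bt)) = (\<Sum>l\<in>L. \<Sum>k'\<in>?Q l. \<Sum>k\<in>?P l. ?q l k' * ?p l k * (f k' / bt))"
   proof (rule sum.cong[OF refl])
    fix l
    show "(\<Sum>k\<in>?P l. \<Sum>k'\<in>?Q l. ?p l k * ?q l k' * (f k' / bt)) = (\<Sum>k'\<in>?Q l. \<Sum>k\<in>?P l. ?q l k' * ?p l k * (f k' / bt))"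
     by (subst sum.swap) (simp only: mult.commute[of "?p l _"])
   qed
   also have "nc * D * (al powr x * bt powr y) * ((\<Sum>l\<in>L. \<Sum>k\<in>?P l. \<Sum>k'\<in>?Q l. ?p l k * ?q l k' * (e k / al)) + ...)
    <= nc * D * (al powr x * bt powr y) * (1 / (2 powr \<zeta> - 1) * (1 / (2 powr \<zeta>' - 1)) * (\<Sum>k\<in>A.K. e k / al) + 1 / (2 powr \<zeta>' - 1) * (1 / (2 powr \<zeta> - 1)) * (\<Sum>k\<in>B.K. f k / bt))"
    using nc D ef0 ab0 zeta A.finite_K B.finite_K by (intro mult_left_mono add_mono dbl) (auto intro: less_imp_le)
   also have "... = nc * D * Z * (al powr x * bt powr y) * ((\<Sum>k\<in>A.K. e k) / al + (\<Sum>k\<in>B.K. f k) / bt)"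
    unfolding sum_divide_distrib[symmetric] by (simp add: Z_def distrib_left mult_ac add_divide_distrib)
   also have "... <= nc * D * Z * (al powr x * bt powr y) * (vol E / al + vol F / bt)"
    using nc D Z ab0 A.sum_E_stop B.sum_E_stop unfolding e_def f_def
    by (intro mult_left_mono add_mono divide_right_mono) auto
   finally show "(\<Sum>l\<in>L. \<Sum>k\<in>?P l. \<Sum>k'\<in>?Q l. nc * W l k k' * (e k / al + f k' / bt)) <= ..." .
  qed
  finally have T: "(LN z. ennreal \<bar>?T z\<bar>) <= ennreal (nc * D * Z * (al powr x * bt powr y) * (vol E / al + vol F / bt))" .
  have "evol {z. \<exists>l\<in>L. \<bar>\<Sum>k\<in>?P l. \<Sum>k'\<in>?Q l. ?S l k k' z\<bar> > lam} <= evol {z\<in>space lborel. \<bar>?T z\<bar> > lam}"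
  proof (rule emeasure_mono)
   show "{z. \<exists>l\<in>L. \<bar>\<Sum>k\<in>?P l. \<Sum>k'\<in>?Q l. ?S l k k' z\<bar> > lam} \<subseteq> {z\<in>space lborel. \<bar>?T z\<bar> > lam}"
   proof (rule subsetI)
    fix z assume "z \<in> {z. \<exists>l\<in>L. \<bar>\<Sum>k\<in>?P l. \<Sum>k'\<in>?Q l. ?S l k k' z\<bar> > lam}"
    then obtain l where "l \<in> L" "\<bar>\<Sum>k\<in>?P l. \<Sum>k'\<in>?Q l. ?S l k k' z\<bar> > lam" by blast
    moreover have "\<bar>\<Sum>k\<in>?P l. \<Sum>k'\<in>?Q l. ?S l k k' z\<bar> <= ?T z" if "l \<in> L" for l
     using that by (rule member_le_sum[OF _ abs_ge_zero L])
    ultimately show "z \<in> {z\<in>space lborel. \<bar>?T z\<bar> > lam}" by fastforce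
   qed
  qed measurable
  also have "... <= ennreal (nc * D * Z * (al powr x * bt powr y) * (vol E / al + vol F / bt) / lam)"
   using nc D Z ab0 lam by (intro emeasure_gt_le T) auto
  finally show "evol {z. \<exists>l\<in>L. \<bar>\<Sum>k\<in>?P l. \<Sum>k'\<in>?Q l. ?S l k k' z\<bar> > lam}
   <= ennreal (nc * D * Z * (al powr x * bt powr y / lam) * (vol E / al + vol F / bt))"
   by (simp add: field_simps)
 qed
qed

end

section \<open>Restricted weak type bounds for dyadic sets\<close>

context cz_set
begin

lemma K_empty: "al >= 1 ==> K = {}"
 using dens_bounds by (auto simp: K_def stop_def dest: order_trans) (meson dens_bounds(2) dual_order.trans leD)

lemma good_measurable [measurable]: "good \<in> Bor"
proof -
 have "good = (%x. indicat_real E x - (\<Sum>k\<in>K. bad k x))" using decomposition by (intro ext) simp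
 thus ?thesis using bad_measurable by simp
qed

lemma bdd_good: "bdd good"
 by (rule bddI[OF good_measurable, of 1]) (use good_bounds in \<open>auto intro!: order_trans[OF good_bounds(2)] simp: good_def dens_bounds indicator_def\<close>)

lemma bdd_bad: "bdd (bad k)"
 by (rule bddI[OF bad_measurable bad_abs_le])

end

lemma bdd_sum: "finite K ==> (!!k. k \<in> K ==> bdd (f k)) ==> bdd (%y. \<Sum>k\<in>K. f k y)"
proof -
 assume K: "finite K" and f: "!!k. k \<in> K ==> bdd (f k)"
 have "\<forall>k. \<exists>B. k \<in> K --> (\<forall>x. \<bar>f k x\<bar> <= B)" using f by (auto simp: bdd_def)
 then obtain B where "!!k x. k \<in> K ==> \<bar>f k x\<bar> <= B k" by metis
 hence "\<bar>\<Sum>k\<in>K. f k x\<bar> <= (\<Sum>k\<in>K. B k)" for x by (intro order_trans[OF sum_abs] sum_mono)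
 moreover have "(%y. \<Sum>k\<in>K. f k y) \<in> Bor" using f by (intro borel_measurable_sum bdd_measurable)
 ultimately show ?thesis by (auto simp: bdd_def)
qed

lemma cells_pos:
 assumes "finite I" "vol (cells k I :: (real^'n) set) = 0"
 shows "cells k I = ({} :: (real^'n) set)"
proof -
 have "I = {}" using assms by (simp add: measure_cells) 
 thus ?thesis by (simp add: cells_def)
qed

lemma min_power_le:
 fixes b Q s :: real
 assumes "b > 0" "0 < Q" "Q < 1"
 shows "min 1 b <= b powr Q"
proof (cases "b <= 1")
 case True
 hence "b powr 1 <= b powr Q" using assms by (intro powr_mono') auto
 thus ?thesis using assms True by simp
next
 case False
 hence "1 powr Q <= b powr Q" using assms by (intro powr_mono2) auto
 thus ?thesis using False by simp
qed

context haar_orthogonal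
begin

text \<open>The Lebesgue exponent s of \<open>one_bad\<close> is taken with P s <= 1, so that for al
  < 1 the factor al^(-P s) is at most 1 / al; for al >= 1 there is no bad part.\<close>

lemma one_bad_level:
 assumes d: "CARD('n) >= 2" and c: "c > 0"
  and sep: "!!N j k. j < N ==> k < N ==> j ~= k ==> norm (us N j - us N k :: real^'n) >= c / real N"
  and u: "norm u = 1" "norm v = 1" and P: "0 < P" "P < 1"
 obtains C where "C > 0"
  "!!E I0 k0 al g G L. cz_set E I0 k0 al ==> bdd g ==> (!!y. \<bar>g y\<bar> <= 2 ^ CARD('n) * G) ==> averaging us u v g ==> G > 0 ==> finite L ==>
   evol {x. x \<notin> cz_set.exc E al & (\<exists>l\<in>L. \<bar>\<Sum>k\<in>cz_set.K E al. tri u v (2 powi l) (cz_set.bad E al k) g x\<bar> > al powr P * G)}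
    <= ennreal (C * (vol E / al))"
proof -
 define s where "s = min 2 (1 / P)"
 have s: "1 < s" "s <= 2" "P * s <= 1" using P by (auto simp: s_def min_def field_simps)
 obtain C where C: "C > 0"
  "!!E I0 k0 al g G lam L. cz_set E I0 k0 al ==> bdd g ==> (!!y. \<bar>g y\<bar> <= G) ==> averaging us u v g ==> G > 0 ==> lam > 0 ==> finite L ==>
   evol {x. x \<notin> cz_set.exc E al & (\<exists>l\<in>L. \<bar>\<Sum>k\<in>cz_set.K E al. tri u v (2 powi l) (cz_set.bad E al k) g x\<bar> > lam)}
    <= ennreal (C * (G / lam) powr s * vol E)"
  by (rule one_bad[where us=us, OF d c sep u s(1,2)]) blast+
 let ?D = "(2 ^ CARD('n)) powr s :: real"
 show ?thesis
 proof (rule that[of "C * ?D"])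
  show "C * ?D > 0" using C(1) by simp
  fix E :: "(real^'n) set" and I0 k0 al and G :: real and L :: "int set" and g :: "real^'n => real"
  assume cz: "cz_set E I0 k0 al" and g: "bdd g" and G: "!!y. \<bar>g y\<bar> <= 2 ^ CARD('n) * G" and av: "averaging us u v g" and G0: "G > 0" and L: "finite L"
  interpret cz_set E I0 k0 al by fact
  note a = alpha
  show "evol {x. x \<notin> exc & (\<exists>l\<in>L. \<bar>\<Sum>k\<in>K. tri u v (2 powi l) (bad k) g x\<bar> > al powr P * G)} <= ennreal (C * ?D * (vol E / al))"
  proof (cases "al >= 1")
   case True
   hence "K = {}" "~ al powr P * G < 0" using K_empty G0 by (auto simp: mult_less_0_iff not_less)
   thus ?thesis by simp
  next
   case False
   have "evol {x. x \<notin> exc & (\<exists>l\<in>L. \<bar>\<Sum>k\<in>K. tri u v (2 powi l) (bad k) g x\<bar> > al powr P * G)}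
    <= ennreal (C * (2 ^ CARD('n) * G / (al powr P * G)) powr s * vol E)"
    using G0 a by (intro C(2)[OF cz g G av _ _ L]) auto
   also have "... <= ennreal (C * ?D * (vol E / al))"
   proof (rule ennreal_leI)
    have "al powr 1 <= al powr (P * s)" using a False s by (intro powr_mono') auto
    hence "1 / al powr (P * s) <= 1 / al" using a by (intro divide_left_mono) auto
    hence "C * ?D * vol E * (1 / al powr (P * s)) <= C * ?D * vol E * (1 / al)"
     using C(1) by (intro mult_left_mono) auto
    moreover have "(2 ^ CARD('n) * G / (al powr P * G)) powr s = ?D * (1 / al powr (P * s))"
     using G0 a by (simp add: powr_divide powr_powr)
    ultimately show "C * (2 ^ CARD('n) * G / (al powr P * G)) powr s * vol E <= C * ?D * (vol E / al)"
     by (simp only:) (simp add: mult_ac)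
   qed
   finally show ?thesis .
  qed
 qed
qed

text \<open>At the height al = |E| / V both the exceptional set and the set where the bad part is
  large have measure O(|E| / al) = O(V), and the good part is at most a constant times al^P.\<close>

lemma restricted_weak_linear:
 assumes d: "CARD('n) >= 2" and c: "c > 0"
  and sep: "!!N j k. j < N ==> k < N ==> j ~= k ==> norm (us N j - us N k :: real^'n) >= c / real N"
  and av: "averaging us u v (%y. 1)" and u: "norm u = 1" "norm v = 1" and P: "0 < P" "P < 1"
 obtains C where "C > 0"
  "!!I0 k0 V L. finite I0 ==> V > 0 ==> finite L ==>
   evol {x. \<exists>l\<in>L. tri u v (2 powi l) (indicator (cells k0 I0)) (%y. 1) x > C * (vol (cells k0 I0) / V) powr P} <= ennreal (C * V)"
proof -
 obtain C where C: "C > 0"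
  "!!E I0 k0 al g G L. cz_set E I0 k0 al ==> bdd g ==> (!!y. \<bar>g y\<bar> <= 2 ^ CARD('n) * G) ==> averaging us u v g ==> G > 0 ==> finite L ==>
   evol {x. x \<notin> cz_set.exc E al & (\<exists>l\<in>L. \<bar>\<Sum>k\<in>cz_set.K E al. tri u v (2 powi l) (cz_set.bad E al k) g x\<bar> > al powr P * G)}
    <= ennreal (C * (vol E / al))"
  by (rule one_bad_level[where us=us, OF d c sep u P]) blast+
 let ?G = "2 ^ CARD('n) :: real" and ?nc = "real (near_count TYPE('n))"
 let ?C = "C + ?G + 1 + ?nc"
 have one: "bdd (%y::real^'n. 1)" by (auto simp: bdd_def)
 show ?thesis
 proof (rule that[of ?C])
  show "?C > 0" using C(1) by (simp add: add_pos_nonneg)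
  fix I0 :: "(int^'n) set" and k0 and V :: real and L :: "int set"
  assume I0: "finite I0" and V: "V > 0" and L: "finite L"
  define E where "E = (cells k0 I0 :: (real^'n) set)"
  define al where "al = vol E / V"
  show "evol {x. \<exists>l\<in>L. tri u v (2 powi l) (indicator (cells k0 I0)) (%y. 1) x > ?C * (vol (cells k0 I0) / V) powr P} <= ennreal (?C * V)"
   unfolding E_def[symmetric] al_def[symmetric]
  proof (cases "vol E = 0")
   case True
   hence "E = {}" unfolding E_def by (rule cells_pos[OF I0])
   thus "evol {x. \<exists>l\<in>L. tri u v (2 powi l) (indicator E) (%y. 1) x > ?C * al powr P} <= ennreal (?C * V)"
    by (simp add: tri_def al_def)
  next
   case False
   hence E0: "vol E > 0" by (simp add: zero_less_measure_iff)
   hence a: "al > 0" using V by (simp add: al_def)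
   have Ea: "vol E / al = V" using E0 V by (simp add: al_def)
   have cz: "cz_set E I0 k0 al" using I0 a by (simp add: cz_set_def E_def)
   interpret cz_set E I0 k0 al by fact
   let ?A = "{x. x \<notin> exc & (\<exists>l\<in>L. \<bar>\<Sum>k\<in>K. tri u v (2 powi l) (bad k) (%y. 1) x\<bar> > al powr P * 1)}"
   have [measurable]: "tri u v (2 powi l) (bad k) (%y. 1) \<in> Bor" for l k by (rule tri_measurable[OF bdd_bad one])
   have A: "?A \<in> sets borel" using exc_borel L by measurable
   have incl: "{x. \<exists>l\<in>L. tri u v (2 powi l) (indicator E) (%y. 1) x > ?C * al powr P} \<subseteq> exc \<union> ?A"
   proof (rule subsetI, rule ccontr)
    fix x assume "x \<in> {x. \<exists>l\<in>L. tri u v (2 powi l) (indicator E) (%y. 1) x > ?C * al powr P}" and no: "x \<notin> exc \<union> ?A"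
    then obtain l where l: "l \<in> L" "tri u v (2 powi l) (indicator E) (%y. 1) x > ?C * al powr P" by blast
    have "tri u v (2 powi l) (indicator E) (%y. 1) x = tri u v (2 powi l) (%y. good y + (\<Sum>k\<in>K. bad k y)) (%y. 1) x"
     by (simp add: decomposition[symmetric])
    also have "... = tri u v (2 powi l) good (%y. 1) x + (\<Sum>k\<in>K. tri u v (2 powi l) (bad k) (%y. 1) x)"
     using finite_K bdd_bad by (subst tri_add_left[OF bdd_good _ one]) (auto simp: tri_sum_left one intro!: bdd_sum)
    also have "tri u v (2 powi l) good (%y. 1) x <= ?G * min 1 al * 1"
     by (rule order_trans[OF abs_ge_self tri_abs_le]) (use good_bounds bdd_good one in auto)
    also have "... <= ?G * al powr P" using min_power_le[OF a P] by simp
    also have "(\<Sum>k\<in>K. tri u v (2 powi l) (bad k) (%y. 1) x) <= al powr P * 1" using no l(1) by (simp add: not_less) (metis abs_le_D1)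
    finally have "tri u v (2 powi l) (indicator E) (%y. 1) x <= (?G + 1) * al powr P" by (simp add: algebra_simps)
    also have "... <= ?C * al powr P" using C(1) by (intro mult_right_mono) auto
    finally show False using l(2) by simp
   qed
   have "evol {x. \<exists>l\<in>L. tri u v (2 powi l) (indicator E) (%y. 1) x > ?C * al powr P} <= evol (exc \<union> ?A)"
    by (rule emeasure_mono[OF incl]) (use A exc_borel in auto)
   also have "... <= evol exc + evol ?A"
    by (rule emeasure_subadditive) (use A exc_borel in auto)
   also have "... <= ennreal (?nc * V) + ennreal (C * V)"
    using exc_measure C(2)[OF cz one _ av, of 1 L] L by (intro add_mono) (auto simp: Ea)
   also have "... <= ennreal (?C * V)"
    using C(1) V by (subst ennreal_plus[symmetric]) (auto intro!: ennreal_leI simp: algebra_simps)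
   finally show "evol {x. \<exists>l\<in>L. tri u v (2 powi l) (indicator E) (%y. 1) x > ?C * al powr P} <= ennreal (?C * V)" .
  qed
 qed
qed

text \<open>Good-good is bounded pointwise; each mixed term pairs one bad part with a bounded
  function and falls under \<open>one_bad_level\<close>; for bad-bad, only the levels below l
  survive off the exceptional sets, which is the sum in \<open>bad_bad\<close>.\<close>

lemma restricted_weak_bilinear:
 assumes d: "CARD('n) >= 2" and c: "c > 0" "c' > 0"
  and sep: "!!N j k. j < N ==> k < N ==> j ~= k ==> norm (us N j - us N k :: real^'n) >= c / real N"
   "!!N j k. j < N ==> k < N ==> j ~= k ==> norm (vs N j - vs N k :: real^'n) >= c' / real N"
  and u: "norm u = 1" "norm v = 1" "norm (u - v) = 1"
  and av: "!!g. bdd g ==> averaging us u v g" "!!f. bdd f ==> averaging vs v u f"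
  and w: "\<theta> > 0" "a >= 0" "b >= 0" "w >= 0" "\<theta> + a + b + w = 1"
  and PQ: "0 < P" "P < 1" "0 < Q" "Q < 1"
  and xy: "P <= \<theta> / 2 + a + real CARD('n) / (real CARD('n) + 1) * w" "Q <= \<theta> / 2 + b + real CARD('n) / (real CARD('n) + 1) * w"
 obtains C where "C > 0"
  "!!I0 k0 J0 m0 V L. finite I0 ==> finite J0 ==> V > 0 ==> finite L ==>
   evol {x. \<exists>l\<in>L. tri u v (2 powi l) (indicator (cells k0 I0)) (indicator (cells m0 J0)) x
     > C * ((vol (cells k0 I0) / V) powr P * (vol (cells m0 J0) / V) powr Q)} <= ennreal (C * V)"
proof -
 obtain C1 where C1: "C1 > 0"
  "!!E I0 k0 al g G L. cz_set E I0 k0 al ==> bdd g ==> (!!y. \<bar>g y\<bar> <= 2 ^ CARD('n) * G) ==> averaging us u v g ==> G > 0 ==> finite L ==>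
   evol {x. x \<notin> cz_set.exc E al & (\<exists>l\<in>L. \<bar>\<Sum>k\<in>cz_set.K E al. tri u v (2 powi l) (cz_set.bad E al k) g x\<bar> > al powr P * G)}
    <= ennreal (C1 * (vol E / al))"
  by (rule one_bad_level[where us=us, OF d c(1) sep(1) u(1,2) PQ(1,2)]) blast+
 obtain C2 where C2: "C2 > 0"
  "!!E I0 k0 al g G L. cz_set E I0 k0 al ==> bdd g ==> (!!y. \<bar>g y\<bar> <= 2 ^ CARD('n) * G) ==> averaging vs v u g ==> G > 0 ==> finite L ==>
   evol {x. x \<notin> cz_set.exc E al & (\<exists>l\<in>L. \<bar>\<Sum>k\<in>cz_set.K E al. tri v u (2 powi l) (cz_set.bad E al k) g x\<bar> > al powr Q * G)}
    <= ennreal (C2 * (vol E / al))"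
  by (rule one_bad_level[where us=vs, OF d c(2) sep(2) u(2,1) PQ(3,4)]) blast+
 define x y where "x = \<theta> / 2 + a + real CARD('n) / (real CARD('n) + 1) * w" and "y = \<theta> / 2 + b + real CARD('n) / (real CARD('n) + 1) * w"
 obtain C3 where C3: "C3 > 0"
  "!!E I0 k0 al F J0 m0 bt lam L. cz_set E I0 k0 al ==> cz_set F J0 m0 bt ==> al <= 1 ==> bt <= 1 ==> lam > 0 ==> finite L ==>
   evol {z. \<exists>l\<in>L. \<bar>\<Sum>k\<in>{k\<in>cz_set.K E al. k < l}. \<Sum>k'\<in>{k'\<in>cz_set.K F bt. k' < l}.
     tri u v (2 powi l) (cz_set.bad E al k) (cz_set.bad F bt k') z\<bar> > lam}
    <= ennreal (C3 * (al powr x * bt powr y / lam) * (vol E / al + vol F / bt))"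
  by (rule bad_bad[where us=us and vs=vs, OF d c sep u av w x_def y_def]) blast+
 let ?G = "2 ^ CARD('n) :: real" and ?nc = "real (near_count TYPE('n))"
 \<comment> \<open>The square of 2^d comes from good-good, and 3 counts the other terms, each at
   most lam; the remaining summands bound the measures of the exceptional sets.\<close>
 let ?C = "?G\<^sup>2 + 3 + 2 * ?nc + C1 + C2 + 2 * C3"
 show ?thesis
 proof (rule that[of ?C])
  show "?C > 0" using C1(1) C2(1) C3(1) by (simp add: add_pos_nonneg add_nonneg_pos)
  fix I0 J0 :: "(int^'n) set" and k0 m0 and V :: real and L :: "int set"
  assume I0: "finite I0" and J0: "finite J0" and V: "V > 0" and L: "finite L"
  define E F where "E = (cells k0 I0 :: (real^'n) set)" and "F = (cells m0 J0 :: (real^'n) set)"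
  define al bt where "al = vol E / V" and "bt = vol F / V"
  show "evol {x. \<exists>l\<in>L. tri u v (2 powi l) (indicator (cells k0 I0)) (indicator (cells m0 J0)) x
     > ?C * ((vol (cells k0 I0) / V) powr P * (vol (cells m0 J0) / V) powr Q)} <= ennreal (?C * V)"
   unfolding E_def[symmetric] F_def[symmetric] al_def[symmetric] bt_def[symmetric]
  proof (cases "vol E = 0 | vol F = 0")
   case True
   hence "E = {} | F = {}" unfolding E_def F_def using cells_pos[OF I0] cells_pos[OF J0] by blast
   thus "evol {x. \<exists>l\<in>L. tri u v (2 powi l) (indicator E) (indicator F) x > ?C * (al powr P * bt powr Q)} <= ennreal (?C * V)"
    by (auto simp: tri_def al_def bt_def)
  next
   case False
   hence E0: "vol E > 0" "vol F > 0" by (auto simp: zero_less_measure_iff)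
   hence ab: "al > 0" "bt > 0" using V by (auto simp: al_def bt_def)
   have Va: "vol E / al = V" "vol F / bt = V" using E0 V by (auto simp: al_def bt_def)
   have cz: "cz_set E I0 k0 al" "cz_set F J0 m0 bt" using I0 J0 ab by (simp_all add: cz_set_def E_def F_def)
   interpret A: cz_set E I0 k0 al by fact
   interpret B: cz_set F J0 m0 bt by fact
   define lam where "lam = al powr P * bt powr Q"
   have lam: "lam > 0" using ab by (simp add: lam_def)
   let ?A = "{x. x \<notin> A.exc & (\<exists>l\<in>L. \<bar>\<Sum>k\<in>A.K. tri u v (2 powi l) (A.bad k) B.good x\<bar> > al powr P * bt powr Q)}"
   let ?B = "{x. x \<notin> B.exc & (\<exists>l\<in>L. \<bar>\<Sum>k\<in>B.K. tri v u (2 powi l) (B.bad k) A.good x\<bar> > bt powr Q * al powr P)}"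
   let ?D = "{z. \<exists>l\<in>L. \<bar>\<Sum>k\<in>{k\<in>A.K. k < l}. \<Sum>k'\<in>{k'\<in>B.K. k' < l}. tri u v (2 powi l) (A.bad k) (B.bad k') z\<bar> > lam}"
   note bd = A.bdd_bad B.bdd_bad A.bdd_good B.bdd_good
   have [measurable]: "tri u v (2 powi l) (A.bad k) B.good \<in> Bor" "tri v u (2 powi l) (B.bad k) A.good \<in> Bor"
    "tri u v (2 powi l) (A.bad k) (B.bad k') \<in> Bor" for l k k' by (rule tri_measurable; rule bd)+
   note [measurable] = A.exc_borel B.exc_borel
   have m: "?A \<in> sets borel" "?B \<in> sets borel" "?D \<in> sets borel" using L by measurable
   have gA: "\<bar>A.good y\<bar> <= ?G * min 1 al" "\<bar>A.good y\<bar> <= ?G * al powr P" for y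
    using A.good_bounds[of y] min_power_le[OF ab(1) PQ(1,2)] by (auto intro: order_trans)
   have gB: "\<bar>B.good y\<bar> <= ?G * min 1 bt" "\<bar>B.good y\<bar> <= ?G * bt powr Q" for y
    using B.good_bounds[of y] min_power_le[OF ab(2) PQ(3,4)] by (auto intro: order_trans)
   have incl: "{x. \<exists>l\<in>L. tri u v (2 powi l) (indicator E) (indicator F) x > ?C * lam} \<subseteq> (A.exc \<union> B.exc) \<union> (?A \<union> ?B) \<union> ?D"
   proof (rule subsetI, rule ccontr)
    fix z assume "z \<in> {x. \<exists>l\<in>L. tri u v (2 powi l) (indicator E) (indicator F) x > ?C * lam}" and no: "z \<notin> (A.exc \<union> B.exc) \<union> (?A \<union> ?B) \<union> ?D"
    then obtain l where l: "l \<in> L" "tri u v (2 powi l) (indicator E) (indicator F) z > ?C * lam" by blast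
    let ?T = "%f g. tri u v (2 powi l) f g z"
    have split: "tri u' v' t (indicator E) g z = tri u' v' t A.good g z + (\<Sum>k\<in>A.K. tri u' v' t (A.bad k) g z)" if "bdd g" for g u' v' t
    proof -
     have "tri u' v' t (indicator E) g z = tri u' v' t (%y. A.good y + (\<Sum>k\<in>A.K. A.bad k y)) g z"
      by (simp add: A.decomposition[symmetric])
     also have "... = tri u' v' t A.good g z + (\<Sum>k\<in>A.K. tri u' v' t (A.bad k) g z)"
      using A.finite_K bd that by (subst tri_add_left) (auto simp: tri_sum_left intro!: bdd_sum)
     finally show ?thesis .
    qed
    have split': "tri u' v' t (indicator F) g z = tri u' v' t B.good g z + (\<Sum>k\<in>B.K. tri u' v' t (B.bad k) g z)" if "bdd g" for g u' v' t
    proof -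
     have "tri u' v' t (indicator F) g z = tri u' v' t (%y. B.good y + (\<Sum>k\<in>B.K. B.bad k y)) g z"
      by (simp add: B.decomposition[symmetric])
     also have "... = tri u' v' t B.good g z + (\<Sum>k\<in>B.K. tri u' v' t (B.bad k) g z)"
      using B.finite_K bd that by (subst tri_add_left) (auto simp: tri_sum_left intro!: bdd_sum)
     finally show ?thesis .
    qed
    have bF: "bdd (indicat_real F)" using B.E_borel by (auto simp: bdd_def intro!: exI[of _ 1] simp: indicator_def)
    have sp: "?T f (indicator F) = ?T f B.good + (\<Sum>k\<in>B.K. ?T f (B.bad k))" if "bdd f" for f
     using split'[OF that, of v u] by (simp add: tri_commute[of v u])
    have "?T (indicator E) (indicator F) = ?T A.good (indicator F) + (\<Sum>k\<in>A.K. ?T (A.bad k) (indicator F))"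
     by (rule split[OF bF])
    also have "... = ?T A.good B.good + (\<Sum>k\<in>B.K. ?T A.good (B.bad k)) + ((\<Sum>k\<in>A.K. ?T (A.bad k) B.good) + (\<Sum>k\<in>A.K. \<Sum>k'\<in>B.K. ?T (A.bad k) (B.bad k')))"
     using bd by (simp add: sp sum.distrib)
    also have "?T A.good B.good <= (?G * al powr P) * (?G * bt powr Q)"
     by (rule order_trans[OF abs_ge_self tri_abs_le[OF gA(2) gB(2) bd(3,4)]])
    also have "... = ?G\<^sup>2 * lam" by (simp add: lam_def power2_eq_square mult_ac)
    also have "(\<Sum>k\<in>B.K. ?T A.good (B.bad k)) <= lam"
    proof -
     have "(\<Sum>k\<in>B.K. tri v u (2 powi l) (B.bad k) A.good z) <= bt powr Q * al powr P" using no l(1) by fastforce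
     thus ?thesis by (simp add: tri_commute[of u v] lam_def mult.commute)
    qed
    also have "(\<Sum>k\<in>A.K. ?T (A.bad k) B.good) <= lam" unfolding lam_def using no l(1) by fastforce
    also have "(\<Sum>k\<in>A.K. \<Sum>k'\<in>B.K. ?T (A.bad k) (B.bad k')) = (\<Sum>k\<in>{k\<in>A.K. k < l}. \<Sum>k'\<in>{k'\<in>B.K. k' < l}. ?T (A.bad k) (B.bad k'))"
    proof -
     have z1: "?T (A.bad k) g = 0" if "l <= k" for k g
      using tri_bad_zero[OF cz(1) u(1,2) _ that] no by blast
     have z2: "?T f (B.bad k) = 0" if "l <= k" for k f
      using tri_bad_zero[OF cz(2) u(2,1) _ that, of z f] no by (simp add: tri_commute[of u v])
     have "(\<Sum>k\<in>A.K. \<Sum>k'\<in>B.K. ?T (A.bad k) (B.bad k')) = (\<Sum>k\<in>{k\<in>A.K. k < l}. \<Sum>k'\<in>B.K. ?T (A.bad k) (B.bad k'))"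
      using A.finite_K z1 by (intro sum.mono_neutral_right) (auto simp: not_less)
     also have "... = (\<Sum>k\<in>{k\<in>A.K. k < l}. \<Sum>k'\<in>{k'\<in>B.K. k' < l}. ?T (A.bad k) (B.bad k'))"
      using B.finite_K z2 by (intro sum.cong refl sum.mono_neutral_right) (auto simp: not_less)
     finally show ?thesis .
    qed
    also have "... <= lam" using no l(1) by fastforce
    finally have "?T (indicator E) (indicator F) <= (?G\<^sup>2 + 3) * lam" by (simp add: algebra_simps)
    also have "... <= ?C * lam" using lam C1(1) C2(1) C3(1) by (intro mult_right_mono) auto
    finally show False using l(2) by simp
   qed
   have D: "evol ?D <= ennreal (2 * C3 * V)"
   proof (cases "al <= 1 & bt <= 1")
    case True
    \<comment> \<open>For heights at most 1 a smaller exponent gives a larger power, and P <= x, Q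
      <= y. In the other case one of the functions has no bad part.\<close>
    have "al powr x * bt powr y <= lam"
     unfolding lam_def using True ab xy by (intro mult_mono powr_mono') (auto simp: x_def y_def)
    hence "al powr x * bt powr y / lam <= 1" using lam by simp
    hence "C3 * (al powr x * bt powr y / lam) * (V + V) <= C3 * 1 * (V + V)"
     using V C3(1) by (intro mult_right_mono mult_left_mono) auto
    moreover have "evol ?D <= ennreal (C3 * (al powr x * bt powr y / lam) * (V + V))"
     using C3(2)[OF cz _ _ lam L] True unfolding Va by blast
    ultimately show ?thesis by (auto intro: order_trans ennreal_leI simp: mult_ac)
   next
    case False
    hence "A.K = {} | B.K = {}" using A.K_empty B.K_empty by (auto simp: not_le less_imp_le)
    hence "?D = {}" using lam by auto
    thus ?thesis by simp
   qed
   have "evol {x. \<exists>l\<in>L. tri u v (2 powi l) (indicator E) (indicator F) x > ?C * lam} <= evol ((A.exc \<union> B.exc) \<union> (?A \<union> ?B) \<union> ?D)"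
    by (rule emeasure_mono[OF incl]) (use m A.exc_borel B.exc_borel in auto)
   also have "... <= evol ((A.exc \<union> B.exc) \<union> (?A \<union> ?B)) + evol ?D"
    by (rule emeasure_subadditive) (use m A.exc_borel B.exc_borel in auto)
   also have "... <= (evol (A.exc \<union> B.exc) + evol (?A \<union> ?B)) + evol ?D"
    by (intro add_right_mono emeasure_subadditive) (use m A.exc_borel B.exc_borel in auto)
   also have "... <= ((evol A.exc + evol B.exc) + (evol ?A + evol ?B)) + evol ?D"
    by (intro add_right_mono add_mono emeasure_subadditive) (use m A.exc_borel B.exc_borel in auto)
   also have "... <= ((ennreal (?nc * V) + ennreal (?nc * V)) + (ennreal (C1 * V) + ennreal (C2 * V))) + ennreal (2 * C3 * V)"
    using A.exc_measure B.exc_measure D C1(2)[OF cz(1) bd(4) gB(2) av(1)[OF bd(4)] _ L] C2(2)[OF cz(2) bd(3) gA(2) av(2)[OF bd(3)] _ L] ab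
    by (intro add_mono) (auto simp: Va)
   also have "... <= ennreal (?C * V)"
    using C1(1) C2(1) C3(1) V by (simp add: ennreal_plus[symmetric] del: ennreal_plus) (auto intro!: ennreal_leI simp: algebra_simps)
   finally show "evol {x. \<exists>l\<in>L. tri u v (2 powi l) (indicator E) (indicator F) x > ?C * (al powr P * bt powr Q)} <= ennreal (?C * V)"
    unfolding lam_def .
  qed
 qed
qed

end

section \<open>Restricted weak type bounds for Borel sets\<close>

text \<open>The cubes of side 2^-j inside O', truncated to finitely many: indices up to 4^j reach
  coordinates of size 2^j, so the truncation box grows while the cubes shrink.\<close>

definition dyadic_inner :: "(real^'n) set => nat => (real^'n) set" where
 "dyadic_inner O' j = {x. {y. grid (- int j) y = grid (- int j) x} \<subseteq> O' & (\<forall>i. \<bar>grid (- int j) x $ i\<bar> <= 4 ^ j)}"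

lemma dyadic_inner_cells:
 obtains I where "finite I" "dyadic_inner O' j = cells (- int j) I"
proof (rule that[of "grid (- int j) ` dyadic_inner O' j"])
 show "dyadic_inner O' j = cells (- int j) (grid (- int j) ` dyadic_inner O' j)"
  by (rule step_set) (auto simp: step_def dyadic_inner_def)
 have "grid (- int j) ` dyadic_inner O' j \<subseteq> vec_lambda ` (PiE UNIV (%i. {- (4 ^ j) .. 4 ^ j}))"
 proof
  fix m assume "m \<in> grid (- int j) ` dyadic_inner O' j"
  hence "vec_nth m \<in> PiE UNIV (%i. {- (4 ^ j) .. 4 ^ j})" by (auto simp: dyadic_inner_def abs_le_iff) (smt (verit))
  thus "m \<in> vec_lambda ` (PiE UNIV (%i. {- (4 ^ j) .. 4 ^ j}))"
   by (intro image_eqI[of _ _ "vec_nth m"]) (simp_all only: vec_nth_inverse)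
 qed
 thus "finite (grid (- int j) ` dyadic_inner O' j)" by (rule finite_subset) (intro finite_imageI finite_PiE; simp)
qed

lemma dyadic_inner_subset: "dyadic_inner O' j \<subseteq> O'"
 by (auto simp: dyadic_inner_def)

lemma dyadic_inner_mono: "dyadic_inner O' j \<subseteq> dyadic_inner O' (Suc j)"
proof
 fix x assume x: "x \<in> dyadic_inner O' j"
 have eq: "- int j = - int (Suc j) + 1" by simp
 have "grid (- int j) y = grid (- int j) x" if "grid (- int (Suc j)) y = grid (- int (Suc j)) x" for y
  by (rule grid_mono_eq[OF _ that]) simp
 moreover have "\<bar>grid (- int (Suc j)) x $ i\<bar> <= 4 ^ Suc j" for i
 proof -
  have "\<bar>grid (- int (Suc j)) x $ i div 2\<bar> <= 4 ^ j" using x unfolding grid_Suc[of "- int (Suc j)" x i, symmetric] eq[symmetric] by (simp only: dyadic_inner_def mem_Collect_eq)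
  hence "\<bar>grid (- int (Suc j)) x $ i\<bar> <= 2 * 4 ^ j + 1" by linarith
  also have "... <= 4 ^ Suc j" using one_le_power[of "4::int" j] by (simp only: power_Suc) linarith
  finally show ?thesis .
 qed
 ultimately show "x \<in> dyadic_inner O' (Suc j)" using x unfolding dyadic_inner_def by blast
qed

lemma dyadic_inner_UN:
 assumes "open O'"
 shows "(\<Union>j. dyadic_inner O' j) = O'"
proof (intro equalityI subsetI)
 fix x assume "x \<in> O'"
 then obtain e where e: "e > 0" "ball x e \<subseteq> O'" using assms openE by blast
 obtain n1 where n1: "real CARD('a) / e < 2 ^ n1" using real_arch_pow[of 2 "real CARD('a) / e"] by auto
 obtain n2 where n2: "norm x + 1 < 2 ^ n2" using real_arch_pow[of 2 "norm x + 1"] by auto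
 define j where "j = max n1 n2"
 have j1: "real CARD('a) / e < 2 ^ j" using n1 by (rule order_less_le_trans) (auto simp: j_def intro: power_increasing)
 have j2: "norm x + 1 < 2 ^ j" using n2 by (rule order_less_le_trans) (auto simp: j_def intro: power_increasing)
 have p: "(2::real) powi (- int j) = 1 / 2 ^ j" by (simp add: power_int_minus divide_inverse)
 have "{y. grid (- int j) y = grid (- int j) x} \<subseteq> ball x e"
 proof
  fix y assume y: "y \<in> {y. grid (- int j) y = grid (- int j) x}"
  have "norm (x - y) <= (\<Sum>i\<in>UNIV. \<bar>(x - y) $ i\<bar>)" by (rule norm_le_l1_cart)
  also have "... <= (\<Sum>i\<in>(UNIV::'a set). 1 / 2 ^ j)"
  proof (rule sum_mono)
   fix i
   show "\<bar>(x - y) $ i\<bar> <= 1 / 2 ^ j"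
    using grid_between[where k="- int j" and x=x and i=i] grid_between[where k="- int j" and x=y and i=i] y unfolding p by (simp add: abs_le_iff add_divide_distrib)
  qed
  also have "... = real CARD('a) / 2 ^ j" by simp
  also have "... < e" using j1 e by (simp add: field_simps)
  finally show "y \<in> ball x e" by (simp add: dist_norm)
 qed
 moreover have "\<bar>grid (- int j) x $ i\<bar> <= 4 ^ j" for i
 proof -
  have "\<bar>x $ i\<bar> <= norm x" by (rule component_le_norm_cart)
  have "real_of_int \<bar>grid (- int j) x $ i\<bar> <= \<bar>x $ i\<bar> * 2 ^ j + 1"
   using abs_mult[of "x $ i" "2 ^ j"] unfolding grid_def vec_lambda_beta p by simp linarith
  also have "... <= \<bar>x $ i\<bar> * 2 ^ j + 2 ^ j" by simp
  also have "... = (\<bar>x $ i\<bar> + 1) * 2 ^ j" by (simp add: distrib_right)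
  also have "... <= 2 ^ j * 2 ^ j" using j2 \<open>\<bar>x $ i\<bar> <= norm x\<close> by (intro mult_right_mono) auto
  also have "... = real_of_int (4 ^ j)" by (simp add: power_mult_distrib[symmetric])
  finally show ?thesis by linarith
 qed
 ultimately have "x \<in> dyadic_inner O' j" using e unfolding dyadic_inner_def by blast
 thus "x \<in> (\<Union>j. dyadic_inner O' j)" by blast
qed (use dyadic_inner_subset in blast)

text \<open>Stated with the cardinality of the set so that u = v is allowed in dimension 2.\<close>

lemma orthogonal_unit_vector:
 fixes u v :: "'a::euclidean_space"
 assumes "card {u, v} < DIM('a)"
 obtains e where "e \<bullet> u = 0" "e \<bullet> v = 0" "norm e = 1"
proof -
 have "dim {u, v} < DIM('a)" using dim_le_card'[of "{u, v}"] assms by simp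
 then obtain x where x: "x ~= 0" "!!y. y \<in> span {u, v} ==> orthogonal x y"
  using orthogonal_to_subspace_exists by blast
 show ?thesis
  by (rule that[of "x /\<^sub>R norm x"]) (use x span_base[of _ "{u, v}"] in \<open>auto simp: orthogonal_def\<close>)
qed

context haar_orthogonal
begin

text \<open>With centre w = 0 the points run along a great circle; against a constant function the
  isometries need not fix v.\<close>

lemma averaging_const_exists:
 assumes d: "CARD('n) >= 2" and u: "norm (u :: real^'n) = 1"
 obtains us c where "c > 0" "!!N j k. j < N ==> k < N ==> j ~= k ==> norm (us N j - us N k :: real^'n) >= c / real N"
  "averaging us u v (%y. 1)"
proof -
 obtain e where e: "e \<bullet> u = 0" "e \<bullet> u = 0" "norm e = 1" using orthogonal_unit_vector[of u u] d by auto
 have u0: "u ~= 0" "u \<bullet> 0 = 0 \<bullet> (0::real^'n)" "e \<bullet> 0 = 0" using u by auto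
 show ?thesis
 proof (rule exists_circle_points[OF u0(2,1) e(1) u0(3) e(3)])
  fix us assume us: "!!N j. norm (us N j :: real^'n) = norm u"
   and us2: "!!N j k. j < N ==> k < N ==> j ~= k ==> norm (us N j - us N k) >= (norm (u - 0) / 2) / real N"
  show ?thesis
 proof (rule that[of "1/2" us])
  show "norm (us N j - us N k) >= (1/2) / real N" if "j < N" "k < N" "j ~= k" for N j k using us2[OF that] u by simp
  show "averaging us u v (%y. 1)"
  proof (rule averagingI[where c=1])
   show "bdd (%y::real^'n. 1)" by (auto simp: bdd_def)
   fix N j
   obtain f where f: "orthogonal_transformation f" "f u = us N j"
    by (rule exists_reflection[of u "us N j" 0]) (use us in auto)
   show "\<exists>S. orthogonal_matrix S & S *v u = us N j & (\<forall>x. (1::real) = 1 | S *v v = v)"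
    by (rule exI[of _ "matrix f"]) (use f in \<open>auto simp: orthogonal_transformation_matrix matrix_works\<close>)
  qed
 qed simp
 qed
qed

text \<open>The side lengths force the inner product 1/2, so w = v/2 is the foot of u on the line of
  v. The circle around it consists of third vertices of triangles congruent to the given
  one.\<close>

lemma averaging_exists:
 assumes d: "CARD('n) >= 3" and u: "norm (u :: real^'n) = 1" "norm v = 1" "norm (u - v) = 1"
 obtains us c where "c > 0" "!!N j k. j < N ==> k < N ==> j ~= k ==> norm (us N j - us N k :: real^'n) >= c / real N"
  "!!g. bdd g ==> averaging us u v g"
proof -
 have uu: "u \<bullet> u = 1" "v \<bullet> v = 1" using u by (simp_all add: norm_eq_1)
 have "(norm (u - v))\<^sup>2 = u \<bullet> u - 2 * (u \<bullet> v) + v \<bullet> v"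
  by (simp add: power2_norm_eq_inner inner_diff_left inner_diff_right inner_commute)
 hence uv: "u \<bullet> v = 1/2" using u uu by simp
 have c2: "card {u, v} <= 2" by (rule card_2_iff'[THEN iffD2, THEN eq_refl, OF _] card_insert_le_m1[THEN order_trans]) auto
 obtain e where e: "e \<bullet> u = 0" "e \<bullet> v = 0" "norm e = 1"
  using orthogonal_unit_vector[of u v] c2 d by auto
 define w where "w = (1/2) *\<^sub>R v"
 have uw: "u \<bullet> w = w \<bullet> w" "u ~= w" "e \<bullet> w = 0" using uv uu e by (auto simp: w_def)
 obtain us where us: "!!N j. norm (us N j) = norm u" "!!N j. us N j \<bullet> w = u \<bullet> w"
  "!!N j k. j < N ==> k < N ==> j ~= k ==> norm (us N j - us N k) >= (norm (u - w) / 2) / real N"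
  by (rule exists_circle_points[OF uw(1,2) e(1) uw(3) e(3)]) blast
 show ?thesis
 proof (rule that[of "norm (u - w) / 2" us])
  show "0 < norm (u - w) / 2" using uw by simp
  show "norm (us N j - us N k) >= (norm (u - w) / 2) / real N" if "j < N" "k < N" "j ~= k" for N j k by (rule us(3)[OF that])
  fix g :: "real^'n => real" assume g: "bdd g"
  show "averaging us u v g"
  proof (rule averagingI[OF g])
   fix N j
   obtain f where f: "orthogonal_transformation f" "f u = us N j" "f v = v"
    by (rule exists_reflection[of u "us N j" v]) (use us(1,2)[of N j] in \<open>auto simp: w_def\<close>)
   show "\<exists>S. orthogonal_matrix S & S *v u = us N j & (\<forall>x. g x = 0 | S *v v = v)"
    by (rule exI[of _ "matrix f"]) (use f in \<open>auto simp: orthogonal_transformation_matrix matrix_works\<close>)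
  qed
 qed
qed

section \<open>The lacunary maximal function on nonnegative functions\<close>

definition navg :: "real^'n => real^'n => real => (real^'n => ennreal) => (real^'n => ennreal) => real^'n => ennreal" where
 "navg u v t f g x = (HN R. f (x - t *\<^sub>R (R *v u)) * g (x - t *\<^sub>R (R *v v)))"

definition lac :: "real^'n => real^'n => (real^'n => ennreal) => (real^'n => ennreal) => real^'n => ennreal" where
 "lac u v f g x = (SUP l::int. navg u v (2 powi l) f g x)"

lemma navg_commute: "navg u v t f g = navg v u t g f"
 by (intro ext) (simp add: navg_def mult.commute)

lemma lac_commute: "lac u v f g = lac v u g f"
 unfolding lac_def by (subst navg_commute) simp

lemma navg_measurable [measurable]:
 assumes [measurable]: "f \<in> Bor" "g \<in> Bor"
 shows "navg u v t f g \<in> Bor"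
 unfolding navg_def by measurable

lemma lac_measurable [measurable]:
 assumes [measurable]: "f \<in> Bor" "g \<in> Bor"
 shows "lac u v f g \<in> Bor"
 unfolding lac_def by measurable

lemma navg_mono: "(!!x. f x <= f' x) ==> (!!x. g x <= g' x) ==> navg u v t f g x <= navg u v t f' g' x"
 unfolding navg_def by (intro nn_integral_mono mult_mono) auto

lemma lac_mono: "(!!x. f x <= f' x) ==> (!!x. g x <= g' x) ==> lac u v f g x <= lac u v f' g' x"
 unfolding lac_def by (intro SUP_mono) (auto intro: navg_mono)

lemma navg_indicator:
 assumes [measurable]: "E \<in> sets borel" "F \<in> sets borel"
 shows "navg u v t (indicator E) (indicator F) x = ennreal (tri u v t (indicator E) (indicator F) x)"
proof -
 have b: "bdd (indicat_real E)" "bdd (indicat_real F)" using assms by (auto simp: bdd_def indicator_def intro!: exI[of _ 1])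
 show ?thesis
  unfolding tri_def navg_def
  by (subst nn_integral_eq_integral[symmetric, OF tri_integrable[OF b]]) (auto simp: ennreal_mult ennreal_indicator)
qed

lemma lac_indicator_le_1: "lac u v (indicator E) (indicator F) x <= 1"
 unfolding lac_def
proof (rule SUP_least)
 fix l :: int
 have "navg u v (2 powi l) (indicator E) (indicator F) x <= (HN R. 1)"
  unfolding navg_def by (rule nn_integral_mono) (auto simp: indicator_def)
 thus "navg u v (2 powi l) (indicator E) (indicator F) x <= 1" by (simp add: emeasure_space_1)
qed

text \<open>The strict bound by \<open>A\<close> leaves room for an open superset of measure at most
  A. Dyadic sets exhaust it from inside, and monotone convergence applies, the finite ranges of
  scales growing along. Since \<open>g\<close> is any nonnegative Borel function, the lemma can be
  applied to one argument after the other.\<close>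

lemma weak_type_borel:
 assumes [measurable]: "g \<in> Bor" and k: "kp >= 0" "P > 0" "V > 0"
  and dy: "!!k I L. finite I ==> finite L ==>
   evol {x. \<exists>l\<in>L. navg u v (2 powi l) (indicator (cells k I)) g x > ennreal (kp * (vol (cells k I) / V) powr P)} <= W"
  and E[measurable]: "E \<in> sets borel" and A: "evol E < ennreal A"
 shows "evol {x. lac u v (indicator E) g x > ennreal (kp * (A / V) powr P)} <= W"
proof -
 obtain m where m: "evol E = ennreal m" "m >= 0" using A by (cases "evol E") auto
 hence mA: "m < A" using A by (simp add: ennreal_less_iff)
 obtain T where T: "open T" "E \<subseteq> T" "emeasure lebesgue (T - E) < ennreal (A - m)"
  by (rule sets_lebesgue_outer_open[of E "A - m"]) (use mA E in simp_all)
 have [measurable]: "T \<in> sets borel" using T by simp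
 have "evol T = evol E + evol (T - E)"
  using T(2) by (subst plus_emeasure) (auto intro!: arg_cong[where f="evol"])
 also have "evol (T - E) <= ennreal (A - m)" using T(3) by (simp add: emeasure_completion main_part_sets)
 also have "evol E + ennreal (A - m) = ennreal A" using m mA by (simp add: ennreal_plus[symmetric] del: ennreal_plus)
 finally have TA: "evol T <= ennreal A" by simp
 define lam where "lam = ennreal (kp * (A / V) powr P)"
 let ?S = "dyadic_inner T"
 have Sm[measurable]: "?S j \<in> sets borel" for j by (rule dyadic_inner_cells[of T j]) simp
 define X where "X j = {x. \<exists>l\<in>{- int j..int j}. navg u v (2 powi l) (indicator (?S j)) g x > lam}" for j
 have Xm[measurable]: "X j \<in> sets borel" for j unfolding X_def by measurable
 have Smono: "?S i \<subseteq> ?S j" if "i <= j" for i j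
  using that by (induction rule: dec_induct) (use dyadic_inner_mono in auto)
 have incX: "incseq X"
 proof (rule incseq_SucI, rule subsetI)
  fix j x assume "x \<in> X j"
  then obtain l where l: "l \<in> {- int j..int j}" "navg u v (2 powi l) (indicator (?S j)) g x > lam" by (auto simp: X_def)
  note l(2)
  also have "navg u v (2 powi l) (indicator (?S j)) g x <= navg u v (2 powi l) (indicator (?S (Suc j))) g x"
   using Smono[of j "Suc j"] by (intro navg_mono) (auto simp: indicator_def)
  finally show "x \<in> X (Suc j)" using l(1) by (auto simp: X_def intro!: bexI[of _ l])
 qed
 have incl: "{x. lac u v (indicator E) g x > lam} \<subseteq> (\<Union>j. X j)"
 proof
  fix x assume "x \<in> {x. lac u v (indicator E) g x > lam}"
  then obtain l where l: "navg u v (2 powi l) (indicator E) g x > lam" by (auto simp: lac_def less_SUP_iff)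
  have "navg u v (2 powi l) (indicator E) g x <= navg u v (2 powi l) (indicator T) g x"
   using T by (intro navg_mono) (auto simp: indicator_def)
  also have "... = (HN R. (SUP j. indicator (?S j) (x - 2 powi l *\<^sub>R (R *v u)) * g (x - 2 powi l *\<^sub>R (R *v v))))"
   unfolding navg_def
  proof (rule nn_integral_cong)
   fix R
   have "indicator T y = (SUP j. indicator (?S j) y :: ennreal)" for y
   proof (rule antisym)
    show "indicator T y <= (SUP j. indicator (?S j) y :: ennreal)"
    proof (cases "y \<in> T")
     case True
     then obtain j where "y \<in> ?S j" using dyadic_inner_UN[OF T(1)] by blast
     thus ?thesis by (intro SUP_upper2[of j]) (auto simp: indicator_def)
    qed simp
    show "(SUP j. indicator (?S j) y) <= (indicator T y :: ennreal)"
     using dyadic_inner_subset[of T] by (intro SUP_least) (auto simp: indicator_def)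
   qed
   thus "indicator T (x - 2 powi l *\<^sub>R (R *v u)) * g (x - 2 powi l *\<^sub>R (R *v v)) = (SUP j. indicator (?S j) (x - 2 powi l *\<^sub>R (R *v u)) * g (x - 2 powi l *\<^sub>R (R *v v)))"
    by (simp add: SUP_mult_right_ennreal)
  qed
  also have "... = (SUP j. navg u v (2 powi l) (indicator (?S j)) g x)"
   unfolding navg_def
   by (rule nn_integral_monotone_convergence_SUP) (auto intro!: incseq_SucI le_funI mult_right_mono simp: indicator_def dest: dyadic_inner_mono[THEN subsetD])
  finally have "lam < (SUP j. navg u v (2 powi l) (indicator (?S j)) g x)" using l by (rule order_less_le_trans[rotated])
  then obtain j where j: "navg u v (2 powi l) (indicator (?S j)) g x > lam" unfolding less_SUP_iff by blast
  define i where "i = max j (nat \<bar>l\<bar>)"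
  note j
  also have "navg u v (2 powi l) (indicator (?S j)) g x <= navg u v (2 powi l) (indicator (?S i)) g x"
   using Smono[of j i] by (intro navg_mono) (auto simp: indicator_def i_def)
  finally have "x \<in> X i" unfolding X_def by (auto simp: i_def intro!: bexI[of _ l])
  thus "x \<in> (\<Union>j. X j)" by blast
 qed
 have "evol {x. lac u v (indicator E) g x > lam} <= evol (\<Union>j. X j)"
  by (rule emeasure_mono[OF incl]) auto
 also have "... = (SUP j. evol (X j))"
  by (rule SUP_emeasure_incseq[symmetric]) (use incX in auto)
 also have "... <= W"
 proof (rule SUP_least)
  fix j
  obtain I where I: "finite I" "?S j = cells (- int j) I" by (rule dyadic_inner_cells)
  have "evol (?S j) <= ennreal A"
   by (rule order_trans[OF emeasure_mono TA]) (use dyadic_inner_subset in auto)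
  hence "vol (?S j) <= A" using m mA by (simp add: measure_def enn2real_leI)
  hence "ennreal (kp * (vol (?S j) / V) powr P) <= lam"
   unfolding lam_def using k by (intro ennreal_leI mult_left_mono powr_mono2 divide_right_mono) auto
  hence "X j \<subseteq> {x. \<exists>l\<in>{- int j..int j}. navg u v (2 powi l) (indicator (?S j)) g x > ennreal (kp * (vol (?S j) / V) powr P)}"
   unfolding X_def by (auto dest: order_le_less_trans)
  hence "evol (X j) <= evol {x. \<exists>l\<in>{- int j..int j}. navg u v (2 powi l) (indicator (?S j)) g x > ennreal (kp * (vol (?S j) / V) powr P)}"
   by (rule emeasure_mono) measurable
  also have "... <= W" unfolding I(2) by (rule dy) (use I in auto)
  finally show "evol (X j) <= W" .
 qed
 finally show ?thesis unfolding lam_def .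
qed

lemma weak_linear:
 assumes d: "CARD('n) >= 2" and u: "norm (u :: real^'n) = 1" "norm v = 1" and P: "0 < P" "P < 1"
 obtains C where "C > 0"
  "!!E A V. E \<in> sets borel ==> evol E < ennreal A ==> V > 0 ==>
   evol {x. lac u v (indicator E) (%y. 1) x > ennreal (C * (A / V) powr P)} <= ennreal (C * V)"
proof -
 obtain us c where us: "c > 0" "!!N j k. j < N ==> k < N ==> j ~= k ==> norm (us N j - us N k :: real^'n) >= c / real N"
  "averaging us u v (%y. 1)" by (rule averaging_const_exists[OF d u(1)]) blast
 obtain C where C: "C > 0"
  "!!I0 k0 V L. finite I0 ==> V > 0 ==> finite L ==>
   evol {x. \<exists>l\<in>L. tri u v (2 powi l) (indicator (cells k0 I0)) (%y. 1) x > C * (vol (cells k0 I0) / V) powr P} <= ennreal (C * V)"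
  by (rule restricted_weak_linear[where us=us, OF d us u P]) blast+
 show ?thesis
 proof (rule that[OF C(1)])
  fix E :: "(real^'n) set" and A V :: real assume E: "E \<in> sets borel" "evol E < ennreal A" and V: "V > 0"
  show "evol {x. lac u v (indicator E) (%y. 1) x > ennreal (C * (A / V) powr P)} <= ennreal (C * V)"
  proof (rule weak_type_borel[OF _ less_imp_le[OF C(1)] P(1) V _ E])
   fix k and I :: "(int^'n) set" and L :: "int set" assume I: "finite I" "finite L"
   have "navg u v t (indicator (cells k I)) (%y. 1) x = ennreal (tri u v t (indicator (cells k I)) (%y. 1) x)" for t x
    using navg_indicator[of "cells k I" UNIV u v t x] by simp
   thus "evol {x. \<exists>l\<in>L. navg u v (2 powi l) (indicator (cells k I)) (%y. 1) x > ennreal (C * (vol (cells k I) / V) powr P)} <= ennreal (C * V)"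
    using C(2)[OF I(1) V I(2), of k] C(1) by (simp add: ennreal_less_iff)
  qed simp
 qed
qed

lemma weak_bilinear:
 assumes d: "CARD('n) >= 3" and u: "norm (u :: real^'n) = 1" "norm v = 1" "norm (u - v) = 1"
  and w: "\<theta> > 0" "a >= 0" "b >= 0" "w >= 0" "\<theta> + a + b + w = 1"
  and PQ: "0 < P" "P < 1" "0 < Q" "Q < 1"
  and xy: "P <= \<theta> / 2 + a + real CARD('n) / (real CARD('n) + 1) * w" "Q <= \<theta> / 2 + b + real CARD('n) / (real CARD('n) + 1) * w"
 obtains C where "C > 0"
  "!!E F A B V. E \<in> sets borel ==> F \<in> sets borel ==> evol E < ennreal A ==> evol F < ennreal B ==> V > 0 ==>
   evol {x. lac u v (indicator E) (indicator F) x > ennreal (C * ((A / V) powr P * (B / V) powr Q))} <= ennreal (C * V)"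
proof -
 have d2: "CARD('n) >= 2" using d by simp
 obtain us c where us: "c > 0" "!!N j k. j < N ==> k < N ==> j ~= k ==> norm (us N j - us N k :: real^'n) >= c / real N"
  "!!g. bdd g ==> averaging us u v g" by (rule averaging_exists[OF d u]) blast
 have u': "norm (v - u) = 1" using u by (simp add: norm_minus_commute)
 obtain vs c' where vs: "c' > 0" "!!N j k. j < N ==> k < N ==> j ~= k ==> norm (vs N j - vs N k :: real^'n) >= c' / real N"
  "!!g. bdd g ==> averaging vs v u g" by (rule averaging_exists[OF d u(2,1) u']) blast
 obtain C where C: "C > 0"
  "!!I0 k0 J0 m0 V L. finite I0 ==> finite J0 ==> V > 0 ==> finite L ==>
   evol {x. \<exists>l\<in>L. tri u v (2 powi l) (indicator (cells k0 I0)) (indicator (cells m0 J0)) x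
     > C * ((vol (cells k0 I0) / V) powr P * (vol (cells m0 J0) / V) powr Q)} <= ennreal (C * V)"
  by (rule restricted_weak_bilinear[where us=us and vs=vs, OF d2 us(1) vs(1) us(2) vs(2) u us(3) vs(3) w PQ xy]) blast+
 show ?thesis
 proof (rule that[OF C(1)])
  fix E F :: "(real^'n) set" and A B V :: real
  assume E[measurable]: "E \<in> sets borel" and F: "F \<in> sets borel" and A: "evol E < ennreal A" and B: "evol F < ennreal B" and V: "V > 0"
  have "evol {x. lac v u (indicator F) (indicator E) x > ennreal (C * (A / V) powr P * (B / V) powr Q)} <= ennreal (C * V)"
  proof (rule weak_type_borel[OF _ _ PQ(3) V _ F B])
   fix k and J :: "(int^'n) set" and L :: "int set" assume J: "finite J" "finite L"
   let ?F = "cells k J :: (real^'n) set"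
   have le: "evol {x. lac u v (indicator E) (indicator ?F) x > ennreal (C * (vol ?F / V) powr Q * (A / V) powr P)} <= ennreal (C * V)"
   proof (rule weak_type_borel[OF _ _ PQ(1) V _ E A])
    fix m and I :: "(int^'n) set" and L :: "int set" assume I: "finite I" "finite L"
    show "evol {x. \<exists>l\<in>L. navg u v (2 powi l) (indicator (cells m I)) (indicator ?F) x > ennreal (C * (vol ?F / V) powr Q * (vol (cells m I) / V) powr P)} <= ennreal (C * V)"
     using C(2)[OF I(1) J(1) V I(2), of m k] C(1) by (simp add: navg_indicator ennreal_less_iff mult_ac)
   qed (use C(1) in auto)
   have sub: "{x. \<exists>l\<in>L. navg v u (2 powi l) (indicator ?F) (indicator E) x > ennreal (C * (A / V) powr P * (vol ?F / V) powr Q)}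
     \<subseteq> {x. lac u v (indicator E) (indicator ?F) x > ennreal (C * (vol ?F / V) powr Q * (A / V) powr P)}"
    by (auto simp: lac_def less_SUP_iff navg_commute[of v u] mult_ac)
   show "evol {x. \<exists>l\<in>L. navg v u (2 powi l) (indicator ?F) (indicator E) x > ennreal (C * (A / V) powr P * (vol ?F / V) powr Q)} <= ennreal (C * V)"
    by (rule order_trans[OF emeasure_mono[OF sub] le]) measurable
  qed (use C(1) in auto)
  thus "evol {x. lac u v (indicator E) (indicator F) x > ennreal (C * ((A / V) powr P * (B / V) powr Q))} <= ennreal (C * V)"
   by (simp add: lac_commute[of v u] mult.assoc)
 qed
qed

end

section \<open>Interpolation\<close>

lemma ennreal_power_ennreal [simp]: "0 <= x ==> epow (ennreal x) a = ennreal (x powr a)"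
 by (simp add: ennreal_power_def)

lemma ennreal_power_top [simp]: "epow \<top> a = \<top>"
 by (simp add: ennreal_power_def)

lemma ennreal_power_0 [simp]: "epow 0 a = 0"
 by (simp add: ennreal_power_def)

lemma ennreal_power_1 [simp]: "epow x 1 = x"
 by (cases x) auto

lemma ennreal_power_measurable [measurable]:
 assumes [measurable]: "f \<in> borel_measurable M"
 shows "(%x. epow (f x) a) \<in> borel_measurable M"
 unfolding ennreal_power_def by measurable

lemma ennreal_power_mono: "0 <= a ==> x <= y ==> epow x a <= epow y a"
 by (cases x; cases y) (auto simp: top_unique intro!: ennreal_leI powr_mono2)

lemma ennreal_power_cmult:
 assumes "c > 0"
 shows "epow (ennreal c * x) a = ennreal (c powr a) * epow x a"
 using assms by (cases x) (auto simp: ennreal_mult[symmetric] powr_mult ennreal_mult_top)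

lemma ennreal_power_power:
 assumes "a > 0" "b > 0"
 shows "epow (epow x a) b = epow x (a * b)"
 using assms by (cases x) (auto simp: powr_powr)

lemma term_le_suminf: "f i <= (\<Sum>i. f i :: ennreal)"
 using sum_le_suminf[of f "{i}"] by simp

text \<open>Let S be the sum of the a-th powers. Each term is at most S^(1/a), hence f i <= S^(1/a -
  1) times its a-th power; summing gives S^(1/a).\<close>

lemma ennreal_power_suminf:
 assumes a: "0 < a" "a <= 1"
 shows "epow (\<Sum>i. f i) a <= (\<Sum>i. epow (f i) a)"
proof (cases "\<Sum>i. epow (f i) a")
 case (real S)
 have le: "epow (f i) a <= ennreal S" for i using term_le_suminf[of "%i. epow (f i) a" i] real by simp
 have "f i <= ennreal (S powr (1 / a - 1)) * epow (f i) a" for i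
 proof (cases "f i")
  case (real y)
  hence y: "y powr a <= S" using le[of i] \<open>0 <= S\<close> by (simp add: ennreal_le_iff)
  have "y = (y powr a) powr ((1 / a - 1) + 1)" using real a by (simp add: powr_powr)
  also have "... = (y powr a) powr (1 / a - 1) * y powr a" using real by (cases "y = 0") (simp_all only: powr_add powr_one', simp_all)
  also have "... <= S powr (1 / a - 1) * y powr a" using y a by (intro mult_right_mono powr_mono2) auto
  finally show ?thesis using real by (simp add: ennreal_mult[symmetric] ennreal_leI)
 next
  case top
  thus ?thesis using le[of i] by (simp add: top_unique)
 qed
 hence "(\<Sum>i. f i) <= (\<Sum>i. ennreal (S powr (1 / a - 1)) * epow (f i) a)" by (intro suminf_le summableI)
 also have "... = ennreal (S powr (1 / a - 1)) * ennreal S" using real by (simp add: ennreal_suminf_cmult)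
 also have "... = ennreal (S powr (1 / a))" using \<open>0 <= S\<close> a by (cases "S = 0") (simp_all add: ennreal_mult[symmetric] powr_diff)
 finally have "epow (\<Sum>i. f i) a <= epow (ennreal (S powr (1 / a))) a" using a by (intro ennreal_power_mono) auto
 also have "... = ennreal S" using \<open>0 <= S\<close> a by (simp add: powr_powr)
 finally show ?thesis using real by simp
qed simp

text \<open>Sums over the integers are encoded as series through \<open>int_decode\<close>; for
  nonnegative terms, bounds on finite subsets suffice.\<close>

lemma suminf_int_le:
 fixes h :: "int => ennreal"
 assumes "!!M. finite M ==> (\<Sum>m\<in>M. h m) <= c"
 shows "(\<Sum>i. h (int_decode i)) <= c"
 unfolding suminf_eq_SUP
proof (rule SUP_least)
 fix n
 have "(\<Sum>i<n. h (int_decode i)) = (\<Sum>m\<in>int_decode ` {..<n}. h m)"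
  by (rule sum.reindex[symmetric, unfolded comp_def]) (use inj_int_decode inj_on_subset in blast)
 also have "... <= c" by (rule assms) simp
 finally show "(\<Sum>i<n. h (int_decode i)) <= c" .
qed

lemma geometric_sum_int_below:
 fixes \<zeta> :: real
 assumes "finite K" "\<zeta> > 0"
 shows "(\<Sum>k\<in>{k\<in>K. k < l}. 2 powr (- \<zeta> * real_of_int (l - k))) <= 1 / (2 powr \<zeta> - 1)"
proof -
 have "(\<Sum>k\<in>{k\<in>K. k < l}. 2 powr (- \<zeta> * real_of_int (l - k))) = (\<Sum>j\<in>{j\<in>uminus ` K. - l < j}. 2 powr (- \<zeta> * real_of_int (j - (- l))))"
  by (rule sum.reindex_bij_witness[of _ uminus uminus]) auto
 thus ?thesis using geometric_sum_int[of "uminus ` K" \<zeta> "- l"] assms by simp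
qed

lemma two_sided_geometric:
 fixes \<zeta> y :: real
 assumes z: "\<zeta> > 0"
 shows "(\<Sum>i. ennreal (2 powr (- \<zeta> * \<bar>y - real_of_int (int_decode i)\<bar>))) <= ennreal (2 * (2 powr \<zeta> / (2 powr \<zeta> - 1)))"
proof (rule suminf_int_le)
 fix M :: "int set" assume M: "finite M"
 define k where "k = \<lfloor>y\<rfloor>"
 have k: "real_of_int k <= y" "y < real_of_int k + 1" by (auto simp: k_def)
 have "(\<Sum>n\<in>M. 2 powr (- \<zeta> * \<bar>y - real_of_int n\<bar>)) = (\<Sum>n\<in>{n\<in>M. n < k + 1} \<union> {n\<in>M. k < n}. 2 powr (- \<zeta> * \<bar>y - real_of_int n\<bar>))"
  by (rule sum.cong) auto
 also have "... = (\<Sum>n\<in>{n\<in>M. n < k + 1}. 2 powr (- \<zeta> * \<bar>y - real_of_int n\<bar>)) + (\<Sum>n\<in>{n\<in>M. k < n}. 2 powr (- \<zeta> * \<bar>y - real_of_int n\<bar>))"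
  by (rule sum.union_disjoint) (use M in auto)
 also have "... <= (\<Sum>n\<in>{n\<in>M. n < k + 1}. 2 powr \<zeta> * 2 powr (- \<zeta> * real_of_int (k + 1 - n))) + (\<Sum>n\<in>{n\<in>M. k < n}. 2 powr \<zeta> * 2 powr (- \<zeta> * real_of_int (n - k)))"
 proof (intro add_mono sum_mono)
  fix n assume n: "n \<in> {n\<in>M. n < k + 1}"
  have "2 powr (- \<zeta> * \<bar>y - real_of_int n\<bar>) <= 2 powr (\<zeta> + - \<zeta> * real_of_int (k + 1 - n))"
  proof (rule powr_mono)
   have "\<zeta> * real_of_int (k - n) <= \<zeta> * \<bar>y - real_of_int n\<bar>" using z k n by (intro mult_left_mono) auto
   thus "- \<zeta> * \<bar>y - real_of_int n\<bar> <= \<zeta> + - \<zeta> * real_of_int (k + 1 - n)" by (simp add: algebra_simps)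
  qed simp
  thus "2 powr (- \<zeta> * \<bar>y - real_of_int n\<bar>) <= 2 powr \<zeta> * 2 powr (- \<zeta> * real_of_int (k + 1 - n))" by (simp only: powr_add)
 next
  fix n assume n: "n \<in> {n\<in>M. k < n}"
  hence n1: "real_of_int k + 1 <= real_of_int n" by auto
  have "2 powr (- \<zeta> * \<bar>y - real_of_int n\<bar>) <= 2 powr (\<zeta> + - \<zeta> * real_of_int (n - k))"
  proof (rule powr_mono)
   have "\<zeta> * (real_of_int n - real_of_int k - 1) <= \<zeta> * \<bar>y - real_of_int n\<bar>" using z k n1 by (intro mult_left_mono) auto
   thus "- \<zeta> * \<bar>y - real_of_int n\<bar> <= \<zeta> + - \<zeta> * real_of_int (n - k)" by (simp add: algebra_simps)
  qed simp
  thus "2 powr (- \<zeta> * \<bar>y - real_of_int n\<bar>) <= 2 powr \<zeta> * 2 powr (- \<zeta> * real_of_int (n - k))" by (simp only: powr_add)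
 qed
 also have "... <= 2 powr \<zeta> * (1 / (2 powr \<zeta> - 1)) + 2 powr \<zeta> * (1 / (2 powr \<zeta> - 1))"
  unfolding sum_distrib_left[symmetric]
  by (intro add_mono mult_left_mono geometric_sum_int geometric_sum_int_below M z) auto
 finally show "(\<Sum>n\<in>M. ennreal (2 powr (- \<zeta> * \<bar>y - real_of_int n\<bar>))) <= ennreal (2 * (2 powr \<zeta> / (2 powr \<zeta> - 1)))"
  by (simp add: ennreal_leI)
qed

lemma dyadic_level:
 assumes "z > 0"
 obtains m :: int where "2 powr real_of_int m < z" "z <= 2 powr (real_of_int m + 1)"
proof (rule that[of "\<lceil>log 2 z\<rceil> - 1"])
 have z: "2 powr log 2 z = z" using assms by simp
 have "2 powr real_of_int (\<lceil>log 2 z\<rceil> - 1) < 2 powr log 2 z" by (rule powr_less_mono) (simp_all, linarith)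
 thus "2 powr real_of_int (\<lceil>log 2 z\<rceil> - 1) < z" using z by simp
 have "2 powr log 2 z <= 2 powr (real_of_int (\<lceil>log 2 z\<rceil> - 1) + 1)" by (rule powr_mono) auto
 thus "z <= 2 powr (real_of_int (\<lceil>log 2 z\<rceil> - 1) + 1)" using z by simp
qed

text \<open>For finite y > 0 the layer with 2^m < y <= 2^(m+1) alone reaches y; if y is infinite,
  arbitrarily high layers contribute.\<close>

lemma dyadic_layers_ge:
 "y <= (\<Sum>i. ennreal (2 powr (real_of_int (int_decode i) + 1)) * indicator {z. ennreal (2 powr real_of_int (int_decode i)) < z} y)" (is "y <= ?S")
proof -
 have t: "ennreal (2 powr (real_of_int m + 1)) <= ?S" if "ennreal (2 powr real_of_int m) < y" for m
  using term_le_suminf[of "%i. ennreal (2 powr (real_of_int (int_decode i) + 1)) * indicator {z. ennreal (2 powr real_of_int (int_decode i)) < z} y" "int_encode m"] that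
  by simp
 show ?thesis
 proof (cases y)
  case (real z)
  show ?thesis
  proof (cases "z = 0")
   case False
   hence "z > 0" using real by simp
   then obtain m where m: "2 powr real_of_int m < z" "z <= 2 powr (real_of_int m + 1)" by (rule dyadic_level)
   thus ?thesis using t[of m] real by (auto simp: ennreal_less_iff intro: order_trans[OF ennreal_leI])
  qed (use real in simp)
 next
  case top
  have "?S = \<top>"
  proof (cases ?S)
   case (real r)
   obtain n where n: "r < 2 ^ n" using real_arch_pow[of 2 r] by auto
   have lt: "ennreal (2 powr real_of_int (int n)) < y" unfolding top by simp
   have "ennreal (2 powr (real_of_int (int n) + 1)) <= ennreal r" using t[OF lt] unfolding real(2) .
   hence "2 powr (real n + 1) <= r" using real by (simp add: ennreal_le_iff)
   moreover have "(2::real) ^ n <= 2 powr (real n + 1)" by (simp add: powr_add powr_realpow)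
   ultimately show ?thesis using n by simp
  qed
  thus ?thesis by simp
 qed
qed

lemma dyadic_layers_le:
 assumes p: "p > 0"
 shows "(\<Sum>i. ennreal (2 powr (real_of_int (int_decode i) * p)) * indicator {z. ennreal (2 powr real_of_int (int_decode i)) < z} y)
  <= ennreal (2 powr p / (2 powr p - 1)) * epow y p"
proof (rule suminf_int_le)
 fix M :: "int set" assume M: "finite M"
 have pp: "2 powr p - 1 > 0" using p by simp
 show "(\<Sum>m\<in>M. ennreal (2 powr (real_of_int m * p)) * indicator {z. ennreal (2 powr real_of_int m) < z} y) <= ennreal (2 powr p / (2 powr p - 1)) * epow y p"
 proof (cases y)
  case (real z)
  show ?thesis
  proof (cases "z = 0")
   case False
   hence z: "z > 0" using real by simp
   then obtain m where m: "2 powr real_of_int m < z" "z <= 2 powr (real_of_int m + 1)" by (rule dyadic_level)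
   have lt: "n < m + 1" if "2 powr real_of_int n < z" for n
   proof -
    have "2 powr real_of_int n < 2 powr (real_of_int m + 1)" using that m(2) by (rule order_less_le_trans)
    thus ?thesis by simp
   qed
   have "(\<Sum>n\<in>M. ennreal (2 powr (real_of_int n * p)) * indicator {z. ennreal (2 powr real_of_int n) < z} y) <= (\<Sum>n\<in>{n\<in>M. n < m + 1}. ennreal (2 powr (real_of_int n * p)))"
    unfolding sum.inter_filter[OF M] by (intro sum_mono) (use lt real in \<open>auto simp: indicator_def ennreal_less_iff\<close>)
   also have "... = ennreal (\<Sum>n\<in>{n\<in>M. n < m + 1}. 2 powr (real_of_int n * p))" by simp
   also have "... <= ennreal (2 powr p / (2 powr p - 1) * z powr p)"
   proof (rule ennreal_leI)
    have "(\<Sum>n\<in>{n\<in>M. n < m + 1}. 2 powr (real_of_int n * p)) = 2 powr (real_of_int (m + 1) * p) * (\<Sum>n\<in>{n\<in>M. n < m + 1}. 2 powr (- p * real_of_int (m + 1 - n)))"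
     unfolding sum_distrib_left powr_add[symmetric] by (intro sum.cong refl arg_cong2[where f="(powr)"]) (simp add: algebra_simps)
    also have "... <= 2 powr (real_of_int (m + 1) * p) * (1 / (2 powr p - 1))"
     by (intro mult_left_mono geometric_sum_int_below M p) auto
    also have "2 powr (real_of_int (m + 1) * p) = 2 powr p * (2 powr real_of_int m) powr p"
     by (simp add: powr_powr powr_add[symmetric] algebra_simps)
    also have "... * (1 / (2 powr p - 1)) <= 2 powr p * z powr p * (1 / (2 powr p - 1))"
     by (intro mult_right_mono mult_left_mono powr_mono2 divide_nonneg_nonneg) (use m p order_less_imp_le[OF pp] in \<open>simp_all only: order_less_imp_le powr_ge_zero zero_le_one\<close>)
    finally show "(\<Sum>n\<in>{n\<in>M. n < m + 1}. 2 powr (real_of_int n * p)) <= 2 powr p / (2 powr p - 1) * z powr p" by simp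
   qed
   also have "... = ennreal (2 powr p / (2 powr p - 1)) * epow y p"
    unfolding real(2) ennreal_power_ennreal[OF real(1)] by (rule ennreal_mult) (use pp ge_one_powr_ge_zero[of 2 p] p in auto)
   finally show ?thesis .
  qed (use real in simp)
 next
  case top
  have "2 powr p / (2 powr p - 1) > 0" using pp by (intro divide_pos_pos) auto
  hence "ennreal (2 powr p / (2 powr p - 1)) * \<top> = \<top>" unfolding ennreal_mult_top by (simp only: ennreal_eq_0_iff not_le[symmetric] if_False)
  thus ?thesis unfolding top ennreal_power_top by (simp only: top_greatest)
 qed
qed

lemma ennreal_suminf_swap: "(\<Sum>i. \<Sum>j. f i j) = (\<Sum>j. \<Sum>i. f i j :: ennreal)"
proof -
 have "(\<Sum>i. \<Sum>j. f i j) = (\<integral>\<^sup>+i. (\<Sum>j. f i j) \<partial>count_space UNIV)" by (simp add: nn_integral_count_space_nat)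
 also have "... = (\<Sum>j. \<integral>\<^sup>+i. f i j \<partial>count_space UNIV)" by (rule nn_integral_suminf) simp
 finally show ?thesis by (simp add: nn_integral_count_space_nat)
qed

text \<open>Covers the bilinear maximal function and the product of two linear ones. The assumption
  \<open>one\<close> acts as an endpoint bound at exponent infinity, which lets a single weak
  estimate be improved to a strong one.\<close>

locale bisublinear =
 fixes N :: "'a measure" and B :: "('a => ennreal) => ('a => ennreal) => 'a => ennreal"
 assumes meas [measurable]: "f \<in> borel_measurable N ==> g \<in> borel_measurable N ==> B f g \<in> borel_measurable N"
  and mono: "(!!x. f x <= f' x) ==> (!!x. g x <= g' x) ==> B f g x <= B f' g' x"
  and sub: "(!!i. fs i \<in> borel_measurable N) ==> (!!j. gs j \<in> borel_measurable N) ==>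
   B (%x. \<Sum>i::nat. fs i x) (%x. \<Sum>j::nat. gs j x) x <= (\<Sum>i. \<Sum>j. B (fs i) (gs j) x)"
  and scale: "f \<in> borel_measurable N ==> g \<in> borel_measurable N ==> c >= 0 ==> c' >= 0 ==>
   B (%x. ennreal c * f x) (%x. ennreal c' * g x) x = ennreal (c * c') * B f g x"
  and one: "B (indicator E) (indicator F) x <= 1"
  and space: "space N = UNIV"
begin

text \<open>Restricted weak type from exponents 1/P and 1/Q, with 1/r = P + Q: taking the threshold
  as the level and solving for V gives the customary inequality.\<close>

definition weak :: "real => real => bool" where
 "weak P Q \<longleftrightarrow> (\<exists>C>0. \<forall>E F A A' V. E \<in> sets N --> F \<in> sets N --> emeasure N E < ennreal A --> emeasure N F < ennreal A' --> V > 0 -->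
  emeasure N {x\<in>space N. B (indicator E) (indicator F) x > ennreal (C * ((A / V) powr P * (A' / V) powr Q))} <= ennreal (C * V))"

text \<open>The weak bound is given beyond (P, Q) on the ray from the origin, and \<open>one\<close>
  is the bound at the origin; integrating over levels interpolates along this ray.\<close>

lemma restricted_strong:
 assumes PQ: "P > 0" "Q > 0" "\<eta> > 0" and wk: "weak ((1 + \<eta>) * P) ((1 + \<eta>) * Q)"
 obtains C where "C > 0"
  "!!E F A A'. E \<in> sets N ==> F \<in> sets N ==> emeasure N E < ennreal A ==> emeasure N F < ennreal A' ==>
   (\<integral>\<^sup>+x. epow (B (indicator E) (indicator F) x) (1 / (P + Q)) \<partial>N) <= ennreal (C * (A powr P * A' powr Q) powr (1 / (P + Q)))"
proof -
 obtain C1 where C1: "C1 > 0" "!!E F A A' V. E \<in> sets N ==> F \<in> sets N ==> emeasure N E < ennreal A ==> emeasure N F < ennreal A' ==> V > 0 ==>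
  emeasure N {x\<in>space N. B (indicator E) (indicator F) x > ennreal (C1 * ((A / V) powr ((1 + \<eta>) * P) * (A' / V) powr ((1 + \<eta>) * Q)))} <= ennreal (C1 * V)"
  using wk unfolding weak_def by blast
 define C0 where "C0 = max C1 1"
 have C0: "C0 >= 1" "C1 <= C0" by (auto simp: C0_def)
 define r where "r = 1 / (P + Q)"
 have r: "r > 0" using PQ by (simp add: r_def)
 define kp where "kp = (1 + \<eta>) * (P + Q)"
 have kr: "kp * r = 1 + \<eta>" using PQ by (simp add: kp_def r_def)
 have k: "kp > 0" using PQ by (simp add: kp_def)
 define S where "S = (\<Sum>j. (2 powr (- \<eta>)) ^ j :: real)"
 have q: "2 powr (- \<eta>) < (1::real)" using PQ by (simp add: powr_less_one)
 have S: "S > 0" unfolding S_def using q by (simp add: suminf_geometric)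
 define C where "C = 2 * C0 powr r * C0 * S"
 show ?thesis
 proof (rule that[of C])
  show "C > 0" using C0 S by (simp add: C_def)
  fix E F A A' assume E: "E \<in> sets N" "F \<in> sets N" and A: "emeasure N E < ennreal A" "emeasure N F < ennreal A'"
  note E[measurable]
  have A0: "A > 0" "A' > 0" using A by (auto simp: ennreal_less_zero_iff dest: order_le_less_trans[OF zero_le])
  \<comment> \<open>The value of V at which the threshold of the weak bound is just its constant;
    higher levels need no attention because B is at most 1 on indicators.\<close>
  define V0 where "V0 = (A powr P * A' powr Q) powr r"
  have V0: "V0 > 0" using A0 by (simp add: V0_def)
  let ?X = "B (indicator E) (indicator F)"
  \<comment> \<open>The threshold for V = V0 2^j. As kp r = 1 + \<eta>, the r-th power of th j times
    2^j decays like 2^(-\<eta> j).\<close>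
  define th where "th j = C0 * 2 powr (- kp * real j)" for j :: nat
  have lev: "emeasure N {x\<in>space N. ?X x > ennreal (th (Suc j))} <= ennreal (C0 * (V0 * 2 ^ Suc j))" for j
  proof -
   let ?V = "V0 * 2 ^ Suc j"
   have V: "?V > 0" using V0 by simp
   have eq: "(A / ?V) powr ((1 + \<eta>) * P) * (A' / ?V) powr ((1 + \<eta>) * Q) = 2 powr (- kp * real (Suc j))"
   proof -
    have lV: "(P + Q) * ln V0 = P * ln A + Q * ln A'"
     using A0 PQ by (simp add: V0_def ln_powr ln_mult r_def)
    have "ln ((A / ?V) powr ((1 + \<eta>) * P) * (A' / ?V) powr ((1 + \<eta>) * Q)) = (1 + \<eta>) * P * (ln A - (ln V0 + real (Suc j) * ln 2)) + (1 + \<eta>) * Q * (ln A' - (ln V0 + real (Suc j) * ln 2))"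
     using A0 V0 by (simp add: ln_mult ln_powr ln_div ln_realpow del: power_Suc of_nat_Suc)
    also have "... = (1 + \<eta>) * ((P * ln A + Q * ln A') - (P + Q) * ln V0) - kp * real (Suc j) * ln 2"
     by (simp add: kp_def algebra_simps)
    also have "... = ln (2 powr (- kp * real (Suc j)))" unfolding lV by (simp add: ln_powr)
    finally show ?thesis by (subst (asm) ln_inj_iff) (use A0 V0 in \<open>auto intro!: mult_pos_pos\<close>)
   qed
   have "emeasure N {x\<in>space N. ?X x > ennreal (th (Suc j))} <= emeasure N {x\<in>space N. ?X x > ennreal (C1 * ((A / ?V) powr ((1 + \<eta>) * P) * (A' / ?V) powr ((1 + \<eta>) * Q)))}"
   proof (rule emeasure_mono)
    have "ennreal (C1 * ((A / ?V) powr ((1 + \<eta>) * P) * (A' / ?V) powr ((1 + \<eta>) * Q))) <= ennreal (th (Suc j))"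
     unfolding eq th_def using C0 by (intro ennreal_leI mult_right_mono) auto
    thus "{x\<in>space N. ?X x > ennreal (th (Suc j))} \<subseteq> {x\<in>space N. ?X x > ennreal (C1 * ((A / ?V) powr ((1 + \<eta>) * P) * (A' / ?V) powr ((1 + \<eta>) * Q)))}"
     by (auto dest: order_le_less_trans)
   qed measurable
   also have "... <= ennreal (C1 * ?V)" by (rule C1(2)[OF E A V])
   also have "... <= ennreal (C0 * ?V)" using C0 V by (intro ennreal_leI mult_right_mono) auto
   finally show ?thesis .
  qed
  have pt: "epow (?X x) r <= (\<Sum>j. ennreal (th j powr r) * indicator {x\<in>space N. ?X x > ennreal (th (Suc j))} x)" if x: "x \<in> space N" for x
  proof -
   obtain y where y: "?X x = ennreal y" "y >= 0" using one[of E F x] by (cases "?X x") (auto simp: top_unique)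
   have y1: "y <= 1" using one[of E F x] y by simp
   show ?thesis
   proof (cases "y = 0")
    case False
    have ex: "\<exists>j. th j < y"
    proof -
     have q2: "2 powr (- kp) < (1::real)" using k by (simp add: powr_less_one)
     obtain j where "(2 powr (- kp)) ^ j < y / C0" using real_arch_pow_inv[OF _ q2, of "y / C0"] y False C0 by auto
     moreover have "(2 powr (- kp)) ^ j = 2 powr (- kp * real j)" by (simp add: powr_powr powr_realpow[symmetric])
     ultimately show ?thesis using C0 by (auto simp: th_def field_simps)
    qed
    define n where "n = (LEAST j. th j < y)"
    have n: "th n < y" unfolding n_def by (rule LeastI_ex[OF ex])
    have "th 0 >= y" using C0 y1 by (simp add: th_def)
    then obtain j where j: "n = Suc j" using n by (cases n) auto
    have "~ th j < y" using not_less_Least[of j "%j. th j < y"] j by (simp add: n_def)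
    hence "y powr r <= th j powr r" using y r by (intro powr_mono2) auto
    hence "epow (?X x) r <= ennreal (th j powr r) * indicator {x\<in>space N. ?X x > ennreal (th (Suc j))} x"
     using y n j x by (simp add: ennreal_less_iff ennreal_leI th_def C0_def)
    also have "... <= (\<Sum>j. ennreal (th j powr r) * indicator {x\<in>space N. ?X x > ennreal (th (Suc j))} x)"
     by (rule term_le_suminf)
    finally show ?thesis .
   qed (use y in simp)
  qed
  have "(\<integral>\<^sup>+x. epow (?X x) r \<partial>N) <= (\<integral>\<^sup>+x. (\<Sum>j. ennreal (th j powr r) * indicator {x\<in>space N. ?X x > ennreal (th (Suc j))} x) \<partial>N)"
   by (rule nn_integral_mono) (rule pt)
  also have "... = (\<Sum>j. ennreal (th j powr r) * emeasure N {x\<in>space N. ?X x > ennreal (th (Suc j))})"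
   by (subst nn_integral_suminf) (auto simp: nn_integral_cmult_indicator)
  also have "... <= (\<Sum>j. ennreal (2 * C0 powr r * C0 * V0 * (2 powr (- \<eta>)) ^ j))"
  proof (intro suminf_le summableI)
   fix j
   have "ennreal (th j powr r) * emeasure N {x\<in>space N. ?X x > ennreal (th (Suc j))} <= ennreal (th j powr r) * ennreal (C0 * (V0 * 2 ^ Suc j))"
    by (intro mult_left_mono lev) auto
   also have "... = ennreal (th j powr r * (C0 * (V0 * 2 ^ Suc j)))" using C0 V0 by (simp add: ennreal_mult[symmetric])
   also have "th j powr r * (C0 * (V0 * 2 ^ Suc j)) = 2 * C0 powr r * C0 * V0 * (2 powr (- \<eta>)) ^ j"
   proof -
    have "th j powr r = C0 powr r * 2 powr (- (kp * r) * real j)" using C0 by (simp add: th_def powr_mult powr_powr mult_ac)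
    also have "2 powr (- (kp * r) * real j) = (2 powr (- \<eta>)) ^ j / 2 ^ j"
    proof -
     have "2 powr (- (kp * r) * real j) = 2 powr (- \<eta> * real j - real j)"
      unfolding kr by (rule arg_cong[where f="%z. 2 powr z"]) (simp add: algebra_simps)
     thus ?thesis by (simp add: powr_diff powr_realpow[symmetric] powr_powr)
    qed
    finally show ?thesis by simp
   qed
   finally show "ennreal (th j powr r) * emeasure N {x\<in>space N. ?X x > ennreal (th (Suc j))} <= ennreal (2 * C0 powr r * C0 * V0 * (2 powr (- \<eta>)) ^ j)" .
  qed
  also have "... = ennreal (\<Sum>j. 2 * C0 powr r * C0 * V0 * (2 powr (- \<eta>)) ^ j)"
   using C0 V0 q by (intro suminf_ennreal2 summable_mult summable_geometric) auto
  also have "... = ennreal (C * V0)"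
   using q by (subst suminf_mult) (auto simp: C_def S_def summable_geometric mult_ac)
  finally show "(\<integral>\<^sup>+x. epow (?X x) (1 / (P + Q)) \<partial>N) <= ennreal (C * (A powr P * A' powr Q) powr (1 / (P + Q)))"
   by (simp add: r_def V0_def)
 qed
qed

end

text \<open>In logarithms the heights 2^m, 2^n cancel against the unperturbed exponents, and the
  perturbation dl leaves the off-diagonal factor. The remaining geometric mean of a and b has total
  exponent r (P + Q) = 1 and is at most a + b.\<close>

lemma layer_term_le:
 fixes a b m n P Q dl C :: real
 assumes ab: "a > 0" "b > 0" "C > 0" and PQ: "P > 0" "Q > 0" "\<bar>dl\<bar> < P" "\<bar>dl\<bar> < Q" and r: "r = 1 / (P + Q)"
 shows "(2 powr (m + 1) * 2 powr (n + 1)) powr r * (C * ((a * 2 powr (- (m / P))) powr (P + dl) * (b * 2 powr (- (n / Q))) powr (Q - dl)) powr r)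
  <= 4 powr r * C * ((a + b) * 2 powr (- (m / P - n / Q) * dl * r))" (is "?L <= ?R")
proof -
 have r0: "r > 0" "r * (P + Q) = 1" using PQ r by auto
 have l4: "ln 4 = 2 * ln (2::real)" using ln_realpow[of 2 2] by simp
 have "ln ?L = r * ((m + 1) * ln 2 + (n + 1) * ln 2) + (ln C + r * ((P + dl) * (ln a - m / P * ln 2) + (Q - dl) * (ln b - n / Q * ln 2)))"
  using ab by (simp add: ln_mult ln_powr)
 also have "... = r * ln 4 + ln C + r * ((P + dl) * ln a + (Q - dl) * ln b) + (- (m / P - n / Q) * dl * r) * ln 2"
  unfolding l4 using PQ by (simp add: field_simps)
 also have "r * ((P + dl) * ln a + (Q - dl) * ln b) <= r * ((P + dl) * ln (a + b) + (Q - dl) * ln (a + b))"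
  using PQ ab r0 by (intro mult_left_mono add_mono) auto
 also have "... = r * (P + Q) * ln (a + b)" by (simp add: algebra_simps)
 also have "... = ln (a + b)" using r0 by simp
 finally have "ln ?L <= r * ln 4 + ln C + ln (a + b) + (- (m / P - n / Q) * dl * r) * ln 2" by simp
 also have "... = ln ?R" using ab by (simp add: ln_mult ln_powr)
 finally show ?thesis by (subst (asm) ln_le_cancel_iff) (use ab in auto)
qed

context bisublinear
begin

text \<open>The layer cake sum for the norm of f. Adding 2^(-|m|) makes the normalised measures
  positive and the inequalities strict, as \<open>layer_term_le\<close> and \<open>weak\<close>
  demand; these additions sum to at most 4.\<close>

lemma level_sets:
 assumes [measurable]: "f \<in> borel_measurable N" and P: "P > 0" and f: "(\<integral>\<^sup>+x. epow (f x) (1 / P) \<partial>N) <= 1"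
 obtains a K where "!!i. a i > 0" "K >= 0" "(\<Sum>i. ennreal (a i)) <= ennreal K"
  "!!i. emeasure N {x\<in>space N. ennreal (2 powr real_of_int (int_decode i)) < f x} < ennreal (a i * 2 powr (- (real_of_int (int_decode i) / P)))"
  "K = 2 powr (1/P) / (2 powr (1/P) - 1) + 4"
proof -
 define m where "m i = real_of_int (int_decode i)" for i
 let ?E = "%i. {x\<in>space N. ennreal (2 powr m i) < f x}"
 define al where "al i = ennreal (2 powr (m i * (1/P))) * emeasure N (?E i)" for i
 let ?K = "2 powr (1/P) / (2 powr (1/P) - 1) :: real"
 have K: "?K >= 0" using P by (intro divide_nonneg_nonneg) (auto simp: ge_one_powr_ge_zero)
 have "(\<Sum>i. al i) = (\<integral>\<^sup>+x. (\<Sum>i. ennreal (2 powr (m i * (1/P))) * indicator (?E i) x) \<partial>N)"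
  by (subst nn_integral_suminf) (auto simp: al_def[abs_def] nn_integral_cmult_indicator)
 also have "... <= (\<integral>\<^sup>+x. ennreal ?K * epow (f x) (1/P) \<partial>N)"
 proof (rule nn_integral_mono)
  fix x assume x: "x \<in> space N"
  have "(\<Sum>i. ennreal (2 powr (m i * (1/P))) * indicator (?E i) x) = (\<Sum>i. ennreal (2 powr (real_of_int (int_decode i) * (1/P))) * indicator {z. ennreal (2 powr real_of_int (int_decode i)) < z} (f x))"
   using x by (intro suminf_cong) (simp add: m_def indicator_def)
  also have "... <= ennreal ?K * epow (f x) (1/P)" using P by (intro dyadic_layers_le) auto
  finally show "(\<Sum>i. ennreal (2 powr (m i * (1/P))) * indicator (?E i) x) <= ennreal ?K * epow (f x) (1/P)" .
 qed
 also have "... = ennreal ?K * (\<integral>\<^sup>+x. epow (f x) (1/P) \<partial>N)" by (rule nn_integral_cmult) measurable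
 also have "... <= ennreal ?K * 1" by (intro mult_left_mono f) auto
 finally have sa: "(\<Sum>i. al i) <= ennreal ?K" by simp
 have fin: "al i = ennreal (enn2real (al i))" for i
  using order_trans[OF term_le_suminf[of al i] sa] by (cases "al i") (auto simp: top_unique)
 define a where "a i = enn2real (al i) + 2 powr (- \<bar>m i\<bar>)" for i
 show ?thesis
 proof (rule that[of a "?K + 4"])
  show "a i > 0" for i by (simp add: a_def add_nonneg_pos)
  show "?K + 4 >= 0" using K by simp
  have "(\<Sum>i. ennreal (a i)) = (\<Sum>i. al i + ennreal (2 powr (- 1 * \<bar>0 - real_of_int (int_decode i)\<bar>)))"
   by (intro suminf_cong) (subst fin, simp add: a_def m_def ennreal_plus)
  also have "... = (\<Sum>i. al i) + (\<Sum>i. ennreal (2 powr (- 1 * \<bar>0 - real_of_int (int_decode i)\<bar>)))"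
   by (intro suminf_add[symmetric] summableI)
  also have "... <= ennreal ?K + ennreal (2 * (2 powr 1 / (2 powr 1 - 1)))"
   by (intro add_mono sa two_sided_geometric) simp
  also have "... = ennreal (?K + 4)" using K by (subst ennreal_plus[symmetric]) auto
  finally show "(\<Sum>i. ennreal (a i)) <= ennreal (?K + 4)" .
  show "emeasure N {x\<in>space N. ennreal (2 powr real_of_int (int_decode i)) < f x} < ennreal (a i * 2 powr (- (real_of_int (int_decode i) / P)))" for i
  proof -
   have "ennreal (2 powr (- (m i / P))) * al i = emeasure N (?E i)"
    by (simp add: al_def mult.assoc[symmetric] ennreal_mult[symmetric] powr_add[symmetric])
   hence "emeasure N (?E i) = ennreal (2 powr (- (m i / P)) * enn2real (al i))"
    using fin[of i] by (simp add: ennreal_mult)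
   also have "... < ennreal (a i * 2 powr (- (m i / P)))"
    by (subst ennreal_less_iff) (auto simp: a_def distrib_left mult.commute)
   finally show ?thesis by (simp add: m_def)
  qed
 qed simp
qed

text \<open>Both functions are cut into dyadic layers. P + Q >= 1 makes the r-th power countably
  subadditive, so the layers are estimated pair by pair. Shifting (P, Q) by eps along the line of
  constant P + Q, in the direction given by the sign of m/P - n/Q, yields geometric decay away from
  the diagonal, after which only the summable a i and b j are left.\<close>

theorem strong:
 assumes PQ: "P > 0" "Q > 0" "P + Q >= 1" and e: "0 < eps" "eps < P" "eps < Q" "\<eta> > 0"
  and wk: "weak ((1 + \<eta>) * (P + eps)) ((1 + \<eta>) * (Q - eps))" "weak ((1 + \<eta>) * (P - eps)) ((1 + \<eta>) * (Q + eps))"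
 obtains C where "C > 0"
  "!!f g. f \<in> borel_measurable N ==> g \<in> borel_measurable N ==> (\<integral>\<^sup>+x. epow (f x) (1 / P) \<partial>N) <= 1 ==> (\<integral>\<^sup>+x. epow (g x) (1 / Q) \<partial>N) <= 1 ==>
   (\<integral>\<^sup>+x. epow (B f g x) (1 / (P + Q)) \<partial>N) <= ennreal C"
proof -
 define r where "r = 1 / (P + Q)"
 have r: "0 < r" "r <= 1" using PQ by (auto simp: r_def)
 have eqs: "(P + eps) + (Q - eps) = P + Q" "(P - eps) + (Q + eps) = P + Q" by simp_all
 obtain C1 where C1: "C1 > 0" "!!E F A A'. E \<in> sets N ==> F \<in> sets N ==> emeasure N E < ennreal A ==> emeasure N F < ennreal A' ==>
   (\<integral>\<^sup>+x. epow (B (indicator E) (indicator F) x) r \<partial>N) <= ennreal (C1 * (A powr (P + eps) * A' powr (Q - eps)) powr r)"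
  by (rule restricted_strong[of "P + eps" "Q - eps" \<eta>]) (use PQ e wk in \<open>simp_all add: r_def\<close>)
 obtain C2 where C2: "C2 > 0" "!!E F A A'. E \<in> sets N ==> F \<in> sets N ==> emeasure N E < ennreal A ==> emeasure N F < ennreal A' ==>
   (\<integral>\<^sup>+x. epow (B (indicator E) (indicator F) x) r \<partial>N) <= ennreal (C2 * (A powr (P - eps) * A' powr (Q + eps)) powr r)"
  by (rule restricted_strong[of "P - eps" "Q + eps" \<eta>]) (use PQ e wk in \<open>simp_all add: r_def\<close>)
 define C0 where "C0 = max C1 C2"
 have C0: "C0 > 0" "C1 <= C0" "C2 <= C0" using C1 by (auto simp: C0_def)
 define D where "D = 4 powr r * C0"
 have D: "D > 0" using C0 by (simp add: D_def)
 define W where "W \<zeta> = 2 * (2 powr \<zeta> / (2 powr \<zeta> - 1))" for \<zeta> :: real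
 have W: "W \<zeta> >= 0" if "\<zeta> > 0" for \<zeta> using that by (auto simp: W_def ge_one_powr_ge_zero intro!: divide_nonneg_nonneg)
 define \<zeta>1 \<zeta>2 where "\<zeta>1 = eps * r / Q" and "\<zeta>2 = eps * r / P"
 have z: "\<zeta>1 > 0" "\<zeta>2 > 0" using e r PQ by (auto simp: \<zeta>1_def \<zeta>2_def)
 define K where "K P = 2 powr (1/P) / (2 powr (1/P) - 1) + 4" for P :: real
 have K: "K P >= 0" if "P > 0" for P using that by (auto simp: K_def ge_one_powr_ge_zero intro!: add_nonneg_nonneg divide_nonneg_nonneg)
 define C where "C = D * (K P * W \<zeta>1 + K Q * W \<zeta>2) + 1"
 show ?thesis
 proof (rule that[of C])
  show "C > 0" using D K PQ W z unfolding C_def by (intro add_nonneg_pos mult_nonneg_nonneg add_nonneg_nonneg) auto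
  fix f g assume f[measurable]: "f \<in> borel_measurable N" and g[measurable]: "g \<in> borel_measurable N"
   and fn: "(\<integral>\<^sup>+x. epow (f x) (1 / P) \<partial>N) <= 1" and gn: "(\<integral>\<^sup>+x. epow (g x) (1 / Q) \<partial>N) <= 1"
  define m where "m i = real_of_int (int_decode i)" for i
  define E where "E i = {x\<in>space N. ennreal (2 powr m i) < f x}" for i
  define F where "F i = {x\<in>space N. ennreal (2 powr m i) < g x}" for i
  have EF[measurable]: "E i \<in> sets N" "F i \<in> sets N" for i by (simp_all add: E_def F_def)
  obtain a where a: "!!i. a i > 0" "(\<Sum>i. ennreal (a i)) <= ennreal (K P)" "!!i. emeasure N (E i) < ennreal (a i * 2 powr (- (m i / P)))"
   unfolding K_def m_def E_def by (rule level_sets[OF f PQ(1) fn]) blast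
  obtain b where b: "!!i. b i > 0" "(\<Sum>i. ennreal (b i)) <= ennreal (K Q)" "!!i. emeasure N (F i) < ennreal (b i * 2 powr (- (m i / Q)))"
   unfolding K_def m_def F_def by (rule level_sets[OF g PQ(2) gn]) blast
  let ?T = "%i j x. ennreal (2 powr (m i + 1) * 2 powr (m j + 1)) * B (indicator (E i)) (indicator (F j)) x"
  define w where "w i j = 2 powr (- \<bar>m i / P - m j / Q\<bar> * eps * r)" for i j
  have T: "(\<integral>\<^sup>+x. epow (?T i j x) r \<partial>N) <= ennreal (D * ((a i + b j) * w i j))" for i j
  proof -
   let ?A = "a i * 2 powr (- (m i / P))" and ?B = "b j * 2 powr (- (m j / Q))"
   define s where "s = (2 powr (m i + 1) * 2 powr (m j + 1)) powr r"
   have s: "s >= 0" by (simp add: s_def)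
   have main: "(\<integral>\<^sup>+x. epow (?T i j x) r \<partial>N) <= ennreal (s * (C0 * (?A powr (P + dl) * ?B powr (Q - dl)) powr r))" if "dl = eps | dl = - eps" for dl
   proof -
    have "(\<integral>\<^sup>+x. epow (B (indicator (E i)) (indicator (F j)) x) r \<partial>N) <= ennreal (C0 * (?A powr (P + dl) * ?B powr (Q - dl)) powr r)"
     using that
    proof
     assume "dl = eps"
     thus ?thesis using C0 by (intro order_trans[OF C1(2)[OF EF a(3) b(3)]]) (auto intro!: ennreal_leI mult_right_mono)
    next
     assume "dl = - eps"
     thus ?thesis using C0 by (intro order_trans[OF C2(2)[OF EF a(3) b(3)]]) (auto intro!: ennreal_leI mult_right_mono)
    qed
    hence "ennreal s * (\<integral>\<^sup>+x. epow (B (indicator (E i)) (indicator (F j)) x) r \<partial>N) <= ennreal s * ennreal (C0 * (?A powr (P + dl) * ?B powr (Q - dl)) powr r)"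
     by (rule mult_left_mono) simp
    moreover have "(\<integral>\<^sup>+x. epow (?T i j x) r \<partial>N) = ennreal s * (\<integral>\<^sup>+x. epow (B (indicator (E i)) (indicator (F j)) x) r \<partial>N)"
     unfolding s_def by (subst ennreal_power_cmult) (auto intro!: nn_integral_cmult)
    ultimately show ?thesis using s C0 by (simp add: ennreal_mult)
   qed
   define dl where "dl = (if m i / P - m j / Q >= 0 then eps else - eps)"
   have "s * (C0 * (?A powr (P + dl) * ?B powr (Q - dl)) powr r) <= 4 powr r * C0 * ((a i + b j) * 2 powr (- (m i / P - m j / Q) * dl * r))"
    unfolding s_def by (rule layer_term_le) (use a(1) b(1) C0(1) PQ e in \<open>auto simp: dl_def r_def\<close>)
   also have "(m i / P - m j / Q) * dl = \<bar>m i / P - m j / Q\<bar> * eps" by (auto simp: dl_def abs_if algebra_simps)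
   hence "4 powr r * C0 * ((a i + b j) * 2 powr (- (m i / P - m j / Q) * dl * r)) = D * ((a i + b j) * w i j)"
    unfolding w_def D_def mult_minus_left by (simp only: mult.assoc)
   finally have le: "s * (C0 * (?A powr (P + dl) * ?B powr (Q - dl)) powr r) <= D * ((a i + b j) * w i j)" .
   have "dl = eps | dl = - eps" by (simp add: dl_def)
   from order_trans[OF main[OF this] ennreal_leI[OF le]] show ?thesis .
  qed
  have pt: "epow (B f g x) r <= (\<Sum>i. \<Sum>j. epow (?T i j x) r)" for x
  proof -
   let ?f = "%i x. ennreal (2 powr (m i + 1)) * indicator (E i) x" and ?g = "%i x. ennreal (2 powr (m i + 1)) * indicator (F i) x"
   have "B f g x <= B (%x. \<Sum>i. ?f i x) (%x. \<Sum>i. ?g i x) x"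
   proof (rule mono)
    fix y
    show "f y <= (\<Sum>i. ?f i y)"
     using dyadic_layers_ge[of "f y"] by (simp add: E_def m_def indicator_def space)
    show "g y <= (\<Sum>i. ?g i y)"
     using dyadic_layers_ge[of "g y"] by (simp add: F_def m_def indicator_def space)
   qed
   also have "... <= (\<Sum>i. \<Sum>j. B (?f i) (?g j) x)" by (rule sub) measurable
   also have "... = (\<Sum>i. \<Sum>j. ?T i j x)" by (subst scale) auto
   finally have "epow (B f g x) r <= epow (\<Sum>i. \<Sum>j. ?T i j x) r"
    using r by (intro ennreal_power_mono) auto
   also have "... <= (\<Sum>i. epow (\<Sum>j. ?T i j x) r)" by (rule ennreal_power_suminf[OF r])
   also have "... <= (\<Sum>i. \<Sum>j. epow (?T i j x) r)" by (intro suminf_le summableI ennreal_power_suminf[OF r])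
   finally show ?thesis .
  qed
  have "(\<integral>\<^sup>+x. epow (B f g x) r \<partial>N) <= (\<integral>\<^sup>+x. (\<Sum>i. \<Sum>j. epow (?T i j x) r) \<partial>N)"
   by (rule nn_integral_mono) (rule pt)
  also have "... = (\<Sum>i. \<Sum>j. \<integral>\<^sup>+x. epow (?T i j x) r \<partial>N)"
   by (simp add: nn_integral_suminf)
  also have "... <= (\<Sum>i. \<Sum>j. ennreal (D * ((a i + b j) * w i j)))" by (intro suminf_le summableI T)
  also have "... = (\<Sum>i. \<Sum>j. ennreal D * (ennreal (a i) * ennreal (w i j)) + ennreal D * (ennreal (b j) * ennreal (w i j)))"
   using D a(1) b(1) by (intro suminf_cong) (simp add: ennreal_mult[symmetric] ennreal_plus[symmetric] w_def algebra_simps less_imp_le del: ennreal_plus)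
  also have "... = (\<Sum>i. ennreal D * (ennreal (a i) * (\<Sum>j. ennreal (w i j)))) + (\<Sum>i. \<Sum>j. ennreal D * (ennreal (b j) * ennreal (w i j)))"
   by (simp add: suminf_add[OF summableI summableI, symmetric] ennreal_suminf_cmult)
  also have "(\<Sum>i. \<Sum>j. ennreal D * (ennreal (b j) * ennreal (w i j))) = (\<Sum>j. ennreal D * (ennreal (b j) * (\<Sum>i. ennreal (w i j))))"
   by (subst ennreal_suminf_swap) (simp add: ennreal_suminf_cmult)
  also have "(\<Sum>i. ennreal D * (ennreal (a i) * (\<Sum>j. ennreal (w i j)))) + ... <= (\<Sum>i. ennreal D * (ennreal (a i) * ennreal (W \<zeta>1))) + (\<Sum>j. ennreal D * (ennreal (b j) * ennreal (W \<zeta>2)))"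
  proof (intro add_mono suminf_le summableI mult_left_mono)
   fix i
   have "w i j = 2 powr (- \<zeta>1 * \<bar>m i * Q / P - real_of_int (int_decode j)\<bar>)" for j
   proof -
    have "\<bar>m i / P - m j / Q\<bar> = \<bar>(m i * Q / P - m j) / Q\<bar>" using PQ by (simp add: diff_divide_distrib)
    also have "... = \<bar>m i * Q / P - m j\<bar> / Q" using PQ by simp
    finally show ?thesis by (simp add: w_def \<zeta>1_def m_def mult_ac)
   qed
   thus "(\<Sum>j. ennreal (w i j)) <= ennreal (W \<zeta>1)" unfolding W_def using two_sided_geometric[OF z(1)] by simp
  next
   fix j
   have "w i j = 2 powr (- \<zeta>2 * \<bar>m j * P / Q - real_of_int (int_decode i)\<bar>)" for i
   proof -
    have "\<bar>m i / P - m j / Q\<bar> = \<bar>(m j * P / Q - m i) / P\<bar>" using PQ by (simp add: diff_divide_distrib abs_minus_commute)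
    also have "... = \<bar>m j * P / Q - m i\<bar> / P" using PQ by simp
    finally show ?thesis by (simp add: w_def \<zeta>2_def m_def mult_ac)
   qed
   thus "(\<Sum>i. ennreal (w i j)) <= ennreal (W \<zeta>2)" unfolding W_def using two_sided_geometric[OF z(2)] by simp
  qed simp_all
  also have "... = ennreal D * ((\<Sum>i. ennreal (a i)) * ennreal (W \<zeta>1)) + ennreal D * ((\<Sum>j. ennreal (b j)) * ennreal (W \<zeta>2))"
   by (simp add: ennreal_suminf_cmult ennreal_suminf_multc)
  also have "... <= ennreal D * (ennreal (K P) * ennreal (W \<zeta>1)) + ennreal D * (ennreal (K Q) * ennreal (W \<zeta>2))"
   by (intro add_mono mult_left_mono mult_right_mono a b) auto
  also have "... = ennreal (D * (K P * W \<zeta>1 + K Q * W \<zeta>2))"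
   using D K PQ W z by (simp add: ennreal_mult[symmetric] ennreal_plus[symmetric] distrib_left less_imp_le del: ennreal_plus)
  also have "... <= ennreal C" by (intro ennreal_leI) (simp add: C_def)
  finally show "(\<integral>\<^sup>+x. epow (B f g x) (1 / (P + Q)) \<partial>N) <= ennreal C" unfolding r_def .
 qed
qed

end

section \<open>Strong type bounds\<close>

lemma ennreal_power_mult:
 assumes "a > 0"
 shows "epow (x * y) a = epow x a * epow y a"
 using assms by (cases x; cases y) (auto simp: ennreal_mult[symmetric] powr_mult ennreal_mult_top ennreal_top_mult)

text \<open>The tangent at \<open>a\<close> of the k-th power lies below it, by convexity. Jensen's
  inequality follows by integrating and letting a be the mean.\<close>

lemma ennreal_power_young:
 assumes k: "k >= 1" and a: "a > 0"
 shows "ennreal (k * a powr (k - 1)) * h <= epow h k + ennreal ((k - 1) * a powr k)"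
proof (cases h)
 case (real y)
 have "k * a powr (k - 1) * y <= y powr k + (k - 1) * a powr k"
 proof (cases "y = 0")
  case False
  hence y: "y > 0" using real by simp
  have "(y powr k) powr (1 / k) * (a powr k) powr (1 - 1 / k) <= 1 / k * y powr k + (1 - 1 / k) * a powr k"
   using k y a by (intro Youngs_inequality_0) (auto simp: field_simps)
  hence "y * a powr (k - 1) <= 1 / k * y powr k + (1 - 1 / k) * a powr k"
   using k y by (simp add: powr_powr right_diff_distrib)
  from this have "k * (y * a powr (k - 1)) <= k * (1 / k * y powr k + (1 - 1 / k) * a powr k)"
   using k by (intro mult_left_mono) auto
  also have "k * (1 / k * y powr k + (1 - 1 / k) * a powr k) = y powr k + (k - 1) * a powr k" using k by (simp add: field_simps)
  finally show ?thesis by (simp add: mult_ac)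
 qed (use k in simp)
 thus ?thesis using real k by (simp add: ennreal_mult[symmetric] ennreal_plus[symmetric] ennreal_leI del: ennreal_plus)
qed simp

lemma (in prob_space) ennreal_power_nn_integral_le:
 assumes [measurable]: "h \<in> borel_measurable M" and k: "k >= 1"
 shows "epow (\<integral>\<^sup>+x. h x \<partial>M) k <= (\<integral>\<^sup>+x. epow (h x) k \<partial>M)"
proof -
 have yo: "ennreal (k * a powr (k - 1)) * (\<integral>\<^sup>+x. h x \<partial>M) <= (\<integral>\<^sup>+x. epow (h x) k \<partial>M) + ennreal ((k - 1) * a powr k)" if "a > 0" for a
 proof -
  have "ennreal (k * a powr (k - 1)) * (\<integral>\<^sup>+x. h x \<partial>M) = (\<integral>\<^sup>+x. ennreal (k * a powr (k - 1)) * h x \<partial>M)"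
   by (rule nn_integral_cmult[symmetric]) simp
  also have "... <= (\<integral>\<^sup>+x. epow (h x) k + ennreal ((k - 1) * a powr k) \<partial>M)"
   by (intro nn_integral_mono ennreal_power_young k that)
  also have "... = (\<integral>\<^sup>+x. epow (h x) k \<partial>M) + ennreal ((k - 1) * a powr k)"
   by (subst nn_integral_add) (auto simp: emeasure_space_1)
  finally show ?thesis .
 qed
 show ?thesis
 proof (cases "\<integral>\<^sup>+x. h x \<partial>M")
  case (real I)
  show ?thesis
  proof (cases "\<integral>\<^sup>+x. epow (h x) k \<partial>M")
   case J: (real J)
   show ?thesis
   proof (cases "I = 0")
    case False
    hence I: "I > 0" using real by simp
    have "k * I powr (k - 1) * I <= J + (k - 1) * I powr k"
     using yo[OF I] real J k by (simp add: ennreal_mult[symmetric] ennreal_plus[symmetric] ennreal_le_iff del: ennreal_plus)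
    moreover have "I powr (k - 1) * I = I powr k" using I by (simp add: powr_diff)
    ultimately have "k * I powr k <= J + (k - 1) * I powr k" by (simp add: mult.assoc)
    hence "I powr k <= J" by (simp add: algebra_simps)
    thus ?thesis using real J by (simp add: ennreal_leI)
   qed (use real in simp)
  qed simp
 next
  case top
  hence "\<top> <= (\<integral>\<^sup>+x. epow (h x) k \<partial>M) + ennreal ((k - 1) * 1 powr k)"
   using yo[of 1] k by (simp add: ennreal_mult_top)
  thus ?thesis by (simp add: top_unique)
 qed
qed

text \<open>(P, Q) is dominated by a convex combination of (1/2, 1/2), (1, 0), (0, 1) and the vertex
  (d/(d+1), d/(d+1)), the exponents of the bounds combined in \<open>bad_bad\<close>. The point
  (1/2, 1/2) carries the decay and needs positive weight.\<close>

definition rw_admissible :: "nat => real => real => bool" where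
 "rw_admissible d P Q \<longleftrightarrow> 0 < P & P < 1 & 0 < Q & Q < 1 &
  (\<exists>\<theta> a b w. \<theta> > 0 & a >= 0 & b >= 0 & w >= 0 & \<theta> + a + b + w = 1 &
    P <= \<theta> / 2 + a + real d / (real d + 1) * w & Q <= \<theta> / 2 + b + real d / (real d + 1) * w)"

lemma region_R1_weights:
 assumes "(x, y) \<in> region_R1 d"
 obtains z s t w where "z >= 0" "s >= 0" "t >= 0" "w >= 0" "z + s + t + w = 1"
  "x = t + real d / (real d + 1) * w" "y = s + real d / (real d + 1) * w"
proof -
 let ?kp = "real d / (real d + 1)"
 have X: "(x, y) \<in> convex hull insert (0, 0) (insert (0, 1) (insert (1, 0) {(?kp, ?kp)}))"
  using assms by (simp add: region_R1_def)
 have hull: "\<exists>t y. 0 <= t & t <= 1 & y \<in> convex hull S & X = (1 - t) *\<^sub>R a + t *\<^sub>R y"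
  if "X \<in> convex hull insert a S" "S ~= {}" for X a :: "real \<times> real" and S
  using that by (auto simp: convex_hull_insert_alt)
 obtain z p1 where z: "0 <= z" "z <= 1" "p1 \<in> convex hull insert (0, 1) (insert (1, 0) {(?kp, ?kp)})" "(x, y) = (1 - z) *\<^sub>R (0, 0) + z *\<^sub>R p1"
  using hull[OF X] by blast
 obtain s p2 where s: "0 <= s" "s <= 1" "p2 \<in> convex hull insert (1, 0) {(?kp, ?kp)}" "p1 = (1 - s) *\<^sub>R (0, 1) + s *\<^sub>R p2"
  using hull[OF z(3)] by blast
 obtain t where t: "0 <= t" "t <= 1" "p2 = (1 - t) *\<^sub>R (1, 0) + t *\<^sub>R (?kp, ?kp)"
  using hull[OF s(3)] by auto
 have xy: "x = z * (s * ((1 - t) + t * ?kp))" "y = z * ((1 - s) + s * (t * ?kp))"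
  using z(4) unfolding s(4) t(3) by simp_all
 show ?thesis
 proof (rule that[of "1 - z" "z * (1 - s)" "z * s * (1 - t)" "z * s * t"])
  show "1 - z >= 0" "z * (1 - s) >= 0" "z * s * (1 - t) >= 0" "z * s * t >= 0" using z(1,2) s(1,2) t(1,2) by auto
 qed (simp_all add: xy algebra_simps)
qed

text \<open>The weight of the origin and a fraction \<eta> of all weights go to (1/2, 1/2). Scaling
  by 1 - \<eta> loses at most \<eta> in a coordinate that does not exceed 1, which the added \<eta>
  covers.\<close>

lemma rw_admissibleI:
 assumes xy: "(P + \<eta>, Q + \<eta>) \<in> region_R1 d" and e: "0 < \<eta>" "\<eta> <= 1" and PQ: "P > 0" "Q > 0"
 shows "rw_admissible d P Q"
proof -
 let ?kp = "real d / (real d + 1)"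
 obtain z s t w where w: "z >= 0" "s >= 0" "t >= 0" "w >= 0" "z + s + t + w = 1"
  "P + \<eta> = t + ?kp * w" "Q + \<eta> = s + ?kp * w" by (rule region_R1_weights[OF xy])
 have k: "0 <= ?kp" "?kp <= 1" by (auto simp: field_simps)
 have kw: "?kp * w <= w" "0 <= ?kp * w" using k w mult_left_le_one_le[of w ?kp] by auto
 have le1: "P + \<eta> <= 1" "Q + \<eta> <= 1" using w kw by linarith+
 have key: "x <= ((1 - \<eta>) * z + \<eta>) / 2 + (1 - \<eta>) * t' + ?kp * ((1 - \<eta>) * w)" if "x + \<eta> = t' + ?kp * w" "x + \<eta> <= 1" for x t'
 proof -
  have "((1 - \<eta>) * z + \<eta>) / 2 + (1 - \<eta>) * t' + ?kp * ((1 - \<eta>) * w) = ((1 - \<eta>) * z + \<eta>) / 2 + (1 - \<eta>) * (x + \<eta>)"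
   unfolding that(1) by (simp add: algebra_simps)
  also have "... >= (1 - \<eta>) * (x + \<eta>)" using e w by simp
  also have "(1 - \<eta>) * (x + \<eta>) = x + \<eta> * (1 - (x + \<eta>))" by (simp add: algebra_simps)
  also have "... >= x" using e that(2) by simp
  finally show ?thesis .
 qed
 show ?thesis
  unfolding rw_admissible_def
 proof (intro conjI exI)
  show "(1 - \<eta>) * z + \<eta> > 0" using e w by (simp add: add_nonneg_pos)
  show "(1 - \<eta>) * t >= 0" "(1 - \<eta>) * s >= 0" "(1 - \<eta>) * w >= 0" using e w by auto
  have "((1 - \<eta>) * z + \<eta>) + (1 - \<eta>) * t + (1 - \<eta>) * s + (1 - \<eta>) * w = (1 - \<eta>) * (z + s + t + w) + \<eta>" by (simp add: algebra_simps)
  thus "((1 - \<eta>) * z + \<eta>) + (1 - \<eta>) * t + (1 - \<eta>) * s + (1 - \<eta>) * w = 1" by (simp add: w(5))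
  show "P <= ((1 - \<eta>) * z + \<eta>) / 2 + (1 - \<eta>) * t + ?kp * ((1 - \<eta>) * w)" by (rule key[OF w(6) le1(1)])
  show "Q <= ((1 - \<eta>) * z + \<eta>) / 2 + (1 - \<eta>) * s + ?kp * ((1 - \<eta>) * w)" by (rule key[OF w(7) le1(2)])
 qed (use e le1 PQ in auto)
qed

text \<open>For d >= 2 the vertex lies beyond the line P + Q = 1. A weight \<mu>/4 on it pays for
  the factor 1 + \<eta>, which dictates \<eta> = (2 kp - 1) \<mu>/4; the same weight goes to (1/2,
  1/2) and the rest to (1, 0) and (0, 1).\<close>

lemma rw_admissible_diagonal:
 assumes d: "d >= 2" and PQ: "P > 0" "Q > 0" "P + Q = 1"
 obtains eps \<eta> where "0 < eps" "eps < P" "eps < Q" "\<eta> > 0"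
  "rw_admissible d ((1 + \<eta>) * (P + eps)) ((1 + \<eta>) * (Q - eps))" "rw_admissible d ((1 + \<eta>) * (P - eps)) ((1 + \<eta>) * (Q + eps))"
proof -
 define \<mu> where "\<mu> = min P Q"
 have mu: "\<mu> > 0" "\<mu> <= P" "\<mu> <= Q" using PQ by (auto simp: \<mu>_def)
 define kp where "kp = real d / (real d + 1)"
 have k: "1/2 < kp" "kp <= 1" using d by (auto simp: kp_def field_simps)
 define \<eta> where "\<eta> = (2 * kp - 1) * (\<mu> / 4)"
 have e: "\<eta> > 0" "\<eta> <= \<mu> / 4" using k mu by (auto simp: \<eta>_def intro!: mult_left_le_one_le)
 have adm: "rw_admissible d x y" if xy: "x + y = 1 + \<eta>" "x >= 3 * \<mu> / 4" "y >= 3 * \<mu> / 4" for x y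
 proof -
  have km: "kp * (\<mu> / 4) <= \<mu> / 4" using k mu by (intro mult_left_le_one_le) auto
  have f: "x - \<mu> / 8 - kp * (\<mu> / 4) >= 0" "y - \<mu> / 8 - kp * (\<mu> / 4) >= 0" using km xy mu by linarith+
  have g: "\<mu> / 4 + (x - \<mu> / 8 - kp * (\<mu> / 4)) + (y - \<mu> / 8 - kp * (\<mu> / 4)) + \<mu> / 4 = 1"
   using xy(1) by (simp add: \<eta>_def algebra_simps)
  have "\<exists>\<theta> a b w. \<theta> > 0 & a >= 0 & b >= 0 & w >= 0 & \<theta> + a + b + w = 1 & x <= \<theta> / 2 + a + kp * w & y <= \<theta> / 2 + b + kp * w"
   by (rule exI[of _ "\<mu> / 4"], rule exI[of _ "x - \<mu> / 8 - kp * (\<mu> / 4)"], rule exI[of _ "y - \<mu> / 8 - kp * (\<mu> / 4)"], rule exI[of _ "\<mu> / 4"], intro conjI)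
    (rule f g | use mu in simp)+
  thus ?thesis
   unfolding rw_admissible_def kp_def[symmetric] using xy mu e by auto
 qed
 show ?thesis
 proof (rule that[of "\<mu> / 4" \<eta>])
  show "\<mu> / 4 < P" "\<mu> / 4 < Q" using mu by linarith+
  have up: "x <= (1 + \<eta>) * x" if "x > 0" for x using e that by simp
  have s1: "(1 + \<eta>) * (P + \<mu> / 4) + (1 + \<eta>) * (Q - \<mu> / 4) = 1 + \<eta>" "(1 + \<eta>) * (P - \<mu> / 4) + (1 + \<eta>) * (Q + \<mu> / 4) = 1 + \<eta>"
   unfolding distrib_left[symmetric] using PQ(3) by (simp_all add: algebra_simps)
  show "rw_admissible d ((1 + \<eta>) * (P + \<mu> / 4)) ((1 + \<eta>) * (Q - \<mu> / 4))"
   by (rule adm[OF s1(1)]) (rule order_trans[OF _ up]; use mu in linarith)+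
  show "rw_admissible d ((1 + \<eta>) * (P - \<mu> / 4)) ((1 + \<eta>) * (Q + \<mu> / 4))"
   by (rule adm[OF s1(2)]) (rule order_trans[OF _ up]; use mu in linarith)+
 qed (use mu e in auto)
qed

lemma rw_admissible_interior:
 assumes PQ: "(P, Q) \<in> interior (region_R1 d)"
 obtains eps \<eta> where "0 < eps" "eps < P" "eps < Q" "\<eta> > 0"
  "rw_admissible d ((1 + \<eta>) * (P + eps)) ((1 + \<eta>) * (Q - eps))" "rw_admissible d ((1 + \<eta>) * (P - eps)) ((1 + \<eta>) * (Q + eps))"
proof -
 obtain e where e: "e > 0" "ball (P, Q) e \<subseteq> region_R1 d" using PQ by (auto simp: mem_interior)
 have inR: "(x, y) \<in> region_R1 d" if "\<bar>x - P\<bar> + \<bar>y - Q\<bar> < e" for x y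
 proof -
  have "dist (P, Q) (x, y) <= \<bar>P - x\<bar> + \<bar>Q - y\<bar>"
   unfolding dist_Pair_Pair dist_real_def using sqrt_sum_squares_le_sum_abs[of "P - x" "Q - y"] by simp
  hence "(x, y) \<in> ball (P, Q) e" using that by (simp add: abs_minus_commute)
  thus ?thesis using e by blast
 qed
 have bd: "0 <= x & 0 <= y & x <= 1 & y <= 1" if xy: "(x, y) \<in> region_R1 d" for x y
 proof (rule region_R1_weights[OF xy])
  fix z s t w :: real assume w: "z >= 0" "s >= 0" "t >= 0" "w >= 0" "z + s + t + w = 1"
   "x = t + real d / (real d + 1) * w" "y = s + real d / (real d + 1) * w"
  have "real d / (real d + 1) * w <= w" "0 <= real d / (real d + 1) * w"
   using w mult_left_le_one_le[of w "real d / (real d + 1)"] by (auto simp: field_simps)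
  thus ?thesis using w by linarith
 qed
 have "(P - e / 4, Q - e / 4) \<in> region_R1 d" "(P, Q) \<in> region_R1 d" by (rule inR; use e in simp)+
 from bd[OF this(1)] bd[OF this(2)] e have P: "P > 0" "Q > 0" "P <= 1" "Q <= 1" by linarith+
 \<comment> \<open>Perturbing by eps, scaling by 1 + eps and adding eps moves each coordinate by at
   most 4 eps, which stays inside the ball.\<close>
 define eps where "eps = Min {e / 16, P / 2, Q / 2, 1 / 2}"
 have ep: "eps > 0" "eps <= e / 16" "eps <= P / 2" "eps <= Q / 2" "eps <= 1 / 2" using e P by (auto simp: eps_def)
 have adm: "rw_admissible d ((1 + eps) * x) ((1 + eps) * y)" if xy: "\<bar>x - P\<bar> <= eps" "\<bar>y - Q\<bar> <= eps" for x y
 proof (rule rw_admissibleI[of _ eps])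
  have x: "0 < x" "x <= 2" "0 < y" "y <= 2" using xy ep P by linarith+
  have m: "0 <= eps * x" "eps * x <= eps * 2" "0 <= eps * y" "eps * y <= eps * 2" using x ep by (auto intro: mult_left_mono)
  show "((1 + eps) * x + eps, (1 + eps) * y + eps) \<in> region_R1 d"
  proof (rule inR)
   have "(1 + eps) * x = x + eps * x" "(1 + eps) * y = y + eps * y" by (simp_all add: algebra_simps)
   thus "\<bar>(1 + eps) * x + eps - P\<bar> + \<bar>(1 + eps) * y + eps - Q\<bar> < e" using m xy ep e(1) by linarith
  qed
  show "(1 + eps) * x > 0" "(1 + eps) * y > 0" using x ep by auto
 qed (use ep in auto)
 show ?thesis
  by (rule that[of eps eps]) (use ep P adm in auto)
qed

section \<open>The maximal functions as bisublinear operators\<close>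

context haar_orthogonal
begin

lemma navg_suminf:
 assumes [measurable]: "!!i. fs i \<in> Bor" "g \<in> Bor"
 shows "navg u v t (%x. \<Sum>i. fs i x) g x = (\<Sum>i. navg u v t (fs i) g x)"
 unfolding navg_def ennreal_suminf_multc[symmetric] by (rule nn_integral_suminf) measurable

lemma navg_cmult:
 assumes [measurable]: "f \<in> Bor" "g \<in> Bor"
 shows "navg u v t (%x. c * f x) g x = c * navg u v t f g x"
 unfolding navg_def mult.assoc by (rule nn_integral_cmult) measurable

lemma lac_cmult:
 assumes "f \<in> Bor" "g \<in> Bor"
 shows "lac u v (%x. c * f x) g x = c * lac u v f g x"
 unfolding lac_def navg_cmult[OF assms] by (rule SUP_mult_left_ennreal[symmetric])

lemma lac_cmult2:
 assumes "f \<in> Bor" "g \<in> Bor"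
 shows "lac u v (%x. c * f x) (%x. c' * g x) x = c * (c' * lac u v f g x)"
proof -
 have "lac u v (%x. c * f x) (%x. c' * g x) x = c * lac u v f (%x. c' * g x) x"
  using assms by (intro lac_cmult) auto
 also have "lac u v f (%x. c' * g x) x = c' * lac u v f g x"
  using lac_cmult[OF assms(2,1), of v u c' x] by (simp add: lac_commute[of u v])
 finally show ?thesis .
qed

lemma lac_suminf_le:
 assumes [measurable]: "!!i. fs i \<in> Bor" "g \<in> Bor"
 shows "lac u v (%x. \<Sum>i. fs i x) g x <= (\<Sum>i. lac u v (fs i) g x)"
 unfolding lac_def
proof (rule SUP_least)
 fix l :: int
 show "navg u v (2 powi l) (%x. \<Sum>i. fs i x) g x <= (\<Sum>i. SUP l::int. navg u v (2 powi l) (fs i) g x)"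
  unfolding navg_suminf[OF assms] by (intro suminf_le summableI SUP_upper) auto
qed

lemma bisublinear_lac: "bisublinear lborel (lac u v)"
proof (unfold_locales, goal_cases)
 case (3 fs gs x)
 hence m[measurable]: "!!i. fs i \<in> Bor" "!!i. gs i \<in> Bor" by simp_all
 have "lac u v (%x. \<Sum>i. fs i x) (%x. \<Sum>j. gs j x) x <= (\<Sum>i. lac u v (fs i) (%x. \<Sum>j. gs j x) x)"
  by (rule lac_suminf_le) measurable
 also have "... <= (\<Sum>i. \<Sum>j. lac u v (fs i) (gs j) x)"
 proof (intro suminf_le summableI)
  fix i show "lac u v (fs i) (%x. \<Sum>j. gs j x) x <= (\<Sum>j. lac u v (fs i) (gs j) x)"
   using lac_suminf_le[of gs "fs i" v u x] m by (simp add: lac_commute[of u v])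
 qed
 finally show ?case .
next
 case (4 f g c c' x)
 thus ?case by (simp add: lac_cmult2 ennreal_mult mult.assoc)
qed (auto intro: lac_mono lac_indicator_le_1)

text \<open>With f = g an estimate of this product in the exponent q/2 is an estimate of the linear
  maximal function in the exponent q, so the bilinear interpolation serves the linear case
  too.\<close>

lemma bisublinear_lac_product: "bisublinear lborel (%f g x. lac u v f (%y. 1) x * lac u v g (%y. 1) x)"
proof (unfold_locales, goal_cases)
 case (2 f f' g g' x)
 thus ?case by (intro mult_mono lac_mono) auto
next
 case (3 fs gs x)
 hence m[measurable]: "!!i. fs i \<in> Bor" "!!i. gs i \<in> Bor" by simp_all
 have "lac u v (%x. \<Sum>i. fs i x) (%y. 1) x * lac u v (%x. \<Sum>j. gs j x) (%y. 1) x
  <= (\<Sum>i. lac u v (fs i) (%y. 1) x) * (\<Sum>j. lac u v (gs j) (%y. 1) x)"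
  by (intro mult_mono lac_suminf_le) auto
 thus ?case by (simp add: ennreal_suminf_cmult ennreal_suminf_multc)
next
 case (4 f g c c' x)
 thus ?case by (simp add: lac_cmult ennreal_mult mult_ac)
next
 case (5 E F x)
 have "lac u v (indicator E) (%y. 1) x <= 1" for E using lac_indicator_le_1[of u v E UNIV x] by simp
 from mult_mono[OF this this] show ?case by simp
qed auto

lemma weak_lac:
 assumes d: "CARD('n) >= 3" and u: "norm (u :: real^'n) = 1" "norm v = 1" "norm (u - v) = 1" and a: "rw_admissible CARD('n) P Q"
 shows "bisublinear.weak lborel (lac u v) P Q"
proof -
 interpret bisublinear lborel "lac u v" by (rule bisublinear_lac)
 obtain \<theta> a b w where w: "\<theta> > 0" "a >= 0" "b >= 0" "w >= 0" "\<theta> + a + b + w = 1"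
  "P <= \<theta> / 2 + a + real CARD('n) / (real CARD('n) + 1) * w" "Q <= \<theta> / 2 + b + real CARD('n) / (real CARD('n) + 1) * w"
  and PQ: "0 < P" "P < 1" "0 < Q" "Q < 1" using a unfolding rw_admissible_def by blast
 obtain C where "C > 0" "!!E F A B V. E \<in> sets borel ==> F \<in> sets borel ==> evol E < ennreal A ==> evol F < ennreal B ==> V > 0 ==>
   evol {x. lac u v (indicator E) (indicator F) x > ennreal (C * ((A / V) powr P * (B / V) powr Q))} <= ennreal (C * V)"
  by (rule weak_bilinear[OF d u w(1-5) PQ w(6,7)]) blast
 thus ?thesis unfolding weak_def by (intro exI[of _ C]) simp
qed

text \<open>The product exceeds the product of the two levels only where one factor exceeds its own
  level.\<close>

lemma weak_lac_product:
 assumes d: "CARD('n) >= 2" and u: "norm (u :: real^'n) = 1" "norm v = 1" and PQ: "0 < P" "P < 1" "0 < Q" "Q < 1"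
 shows "bisublinear.weak lborel (%f g x. lac u v f (%y. 1) x * lac u v g (%y. 1) x) P Q"
proof -
 interpret bisublinear lborel "%f g x. lac u v f (%y. 1) x * lac u v g (%y. 1) x" by (rule bisublinear_lac_product)
 obtain C1 where C1: "C1 > 0" "!!E A V. E \<in> sets borel ==> evol E < ennreal A ==> V > 0 ==>
   evol {x. lac u v (indicator E) (%y. 1) x > ennreal (C1 * (A / V) powr P)} <= ennreal (C1 * V)"
  by (rule weak_linear[OF d u PQ(1,2)]) blast
 obtain C2 where C2: "C2 > 0" "!!E A V. E \<in> sets borel ==> evol E < ennreal A ==> V > 0 ==>
   evol {x. lac u v (indicator E) (%y. 1) x > ennreal (C2 * (A / V) powr Q)} <= ennreal (C2 * V)"
  by (rule weak_linear[OF d u PQ(3,4)]) blast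
 show ?thesis
  unfolding weak_def
 proof (intro exI[of _ "C1 * C2 + (C1 + C2)"] conjI allI impI)
  show "C1 * C2 + (C1 + C2) > 0" using C1(1) C2(1) by (simp add: add_pos_pos)
  fix E F :: "(real^'n) set" and A B V :: real
  assume E: "E \<in> sets lborel" "F \<in> sets lborel" and A: "evol E < ennreal A" "evol F < ennreal B" and V: "V > 0"
  have [measurable]: "E \<in> sets borel" "F \<in> sets borel" using E by simp_all
  let ?X = "{x. lac u v (indicator E) (%y. 1) x > ennreal (C1 * (A / V) powr P)}" and ?Y = "{x. lac u v (indicator F) (%y. 1) x > ennreal (C2 * (B / V) powr Q)}"
  have "{x \<in> space lborel. lac u v (indicator E) (%y. 1) x * lac u v (indicator F) (%y. 1) x > ennreal ((C1 * C2 + (C1 + C2)) * ((A / V) powr P * (B / V) powr Q))} \<subseteq> ?X \<union> ?Y"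
  proof (rule subsetI, rule ccontr)
   fix x assume x: "x \<in> {x \<in> space lborel. lac u v (indicator E) (%y. 1) x * lac u v (indicator F) (%y. 1) x > ennreal ((C1 * C2 + (C1 + C2)) * ((A / V) powr P * (B / V) powr Q))}"
    and "x \<notin> ?X \<union> ?Y"
   hence "lac u v (indicator E) (%y. 1) x * lac u v (indicator F) (%y. 1) x <= ennreal (C1 * (A / V) powr P) * ennreal (C2 * (B / V) powr Q)"
    by (intro mult_mono) (auto simp: not_less)
   also have "... = ennreal (C1 * C2 * ((A / V) powr P * (B / V) powr Q))"
    using C1(1) C2(1) by (simp add: ennreal_mult[symmetric] mult_ac)
   also have "... <= ennreal ((C1 * C2 + (C1 + C2)) * ((A / V) powr P * (B / V) powr Q))"
    using C1(1) C2(1) by (intro ennreal_leI mult_right_mono) auto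
   finally show False using x by (simp add: not_less[symmetric])
  qed
  hence "evol {x \<in> space lborel. lac u v (indicator E) (%y. 1) x * lac u v (indicator F) (%y. 1) x > ennreal ((C1 * C2 + (C1 + C2)) * ((A / V) powr P * (B / V) powr Q))} <= evol (?X \<union> ?Y)"
   by (rule emeasure_mono) measurable
  also have "... <= evol ?X + evol ?Y" by (rule emeasure_subadditive) measurable
  also have "... <= ennreal (C1 * V) + ennreal (C2 * V)" using E by (intro add_mono C1(2) C2(2) A V) simp_all
  also have "... = ennreal ((C1 + C2) * V)" using C1(1) C2(1) V by (simp add: ennreal_plus[symmetric] distrib_right del: ennreal_plus)
  also have "... <= ennreal ((C1 * C2 + (C1 + C2)) * V)" using C1(1) C2(1) V by (intro ennreal_leI mult_right_mono) auto
  finally show "evol {x \<in> space lborel. lac u v (indicator E) (%y. 1) x * lac u v (indicator F) (%y. 1) x > ennreal ((C1 * C2 + (C1 + C2)) * ((A / V) powr P * (B / V) powr Q))} <= ennreal ((C1 * C2 + (C1 + C2)) * V)" .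
 qed
qed

text \<open>Jensen's inequality for every single average; taking k-th roots moves the power past the
  supremum.\<close>

lemma lac_power_le:
 assumes [measurable]: "f \<in> Bor" "g \<in> Bor" and k: "k >= 1"
 shows "epow (lac u v f g x) k <= lac u v (%x. epow (f x) k) (%x. epow (g x) k) x" (is "_ <= ?M")
proof -
 have "lac u v f g x <= epow ?M (1 / k)"
  unfolding lac_def[of u v f]
 proof (rule SUP_least)
  fix l :: int
  have "epow (navg u v (2 powi l) f g x) k <= navg u v (2 powi l) (%x. epow (f x) k) (%x. epow (g x) k) x"
   unfolding navg_def using k by (subst ennreal_power_mult[symmetric]) (auto intro!: ennreal_power_nn_integral_le)
  also have "... <= ?M" unfolding lac_def by (rule SUP_upper) simp
  finally have "epow (epow (navg u v (2 powi l) f g x) k) (1 / k) <= epow ?M (1 / k)"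
   using k by (intro ennreal_power_mono) auto
  thus "navg u v (2 powi l) f g x <= epow ?M (1 / k)" using k by (simp add: ennreal_power_power)
 qed
 hence "epow (lac u v f g x) k <= epow (epow ?M (1 / k)) k"
  using k by (intro ennreal_power_mono) auto
 thus ?thesis using k by (simp add: ennreal_power_power)
qed

lemma normalize_power:
 fixes f :: "'b => ennreal"
 assumes [measurable]: "f \<in> borel_measurable M" and a: "a > 0" and f: "(\<integral>\<^sup>+x. epow (f x) p \<partial>M) <= ennreal (a powr p)"
 shows "(\<integral>\<^sup>+x. epow (ennreal (1 / a) * f x) p \<partial>M) <= 1"
proof -
 have "(\<integral>\<^sup>+x. epow (ennreal (1 / a) * f x) p \<partial>M) = ennreal ((1 / a) powr p) * (\<integral>\<^sup>+x. epow (f x) p \<partial>M)"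
  using a by (simp add: ennreal_power_cmult nn_integral_cmult del: ennreal_divide_numeral)
 also have "... <= ennreal ((1 / a) powr p) * ennreal (a powr p)" by (intro mult_left_mono f) simp
 also have "... = 1" using a by (simp add: ennreal_mult[symmetric] powr_mult[symmetric])
 finally show ?thesis .
qed

lemma bilinear_strong:
 assumes d: "CARD('n) >= 3" and u: "norm (u :: real^'n) = 1" "norm v = 1" "norm (u - v) = 1"
  and pq: "(1 / p, 1 / q) \<in> interior (region_R1 CARD('n))" and r: "r > 0" "1 / r = 1 / p + 1 / q"
 obtains C where "C > 0" "p > 0" "q > 0"
  "!!f g a b. f \<in> Bor ==> g \<in> Bor ==> a > 0 ==> b > 0 ==>
   (LN x. epow (f x) p) <= ennreal (a powr p) ==> (LN x. epow (g x) q) <= ennreal (b powr q) ==>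
   (LN x. epow (lac u v f g x) r) <= ennreal (C * (a * b) powr r)"
proof -
 interpret bisublinear lborel "lac u v" by (rule bisublinear_lac)
 obtain eps \<eta> where e: "0 < eps" "eps < 1 / p" "eps < 1 / q" "\<eta> > 0"
  "rw_admissible CARD('n) ((1 + \<eta>) * (1 / p + eps)) ((1 + \<eta>) * (1 / q - eps))" "rw_admissible CARD('n) ((1 + \<eta>) * (1 / p - eps)) ((1 + \<eta>) * (1 / q + eps))"
  by (rule rw_admissible_interior[OF pq])
 have "1 / p > 0" "1 / q > 0" using e by linarith+
 hence p: "p > 0" "q > 0" by simp_all
 have "\<exists>C>0. \<forall>f\<in>Bor. \<forall>g\<in>Bor.
   (LN x. epow (f x) p) <= 1 --> (LN x. epow (g x) q) <= 1 -->
   (LN x. epow (lac u v f g x) r) <= ennreal C"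
 proof (cases "1 / p + 1 / q >= 1")
  case True
  obtain C where "C > 0" "!!f g. f \<in> borel_measurable lborel ==> g \<in> borel_measurable lborel ==> (LN x. epow (f x) (1 / (1 / p))) <= 1 ==> (LN x. epow (g x) (1 / (1 / q))) <= 1 ==>
   (LN x. epow (lac u v f g x) (1 / (1 / p + 1 / q))) <= ennreal C"
   by (rule strong[OF _ _ True e(1-4) weak_lac[OF d u e(5)] weak_lac[OF d u e(6)]]) (use p in auto)
  thus ?thesis unfolding r(2)[symmetric] by (intro exI[of _ C]) simp
 next
  case False
  have "1 / r < 1" using False r(2) by simp
  hence r1: "r >= 1" using r(1) by (simp add: divide_less_eq)
  have P: "r / p > 0" "r / q > 0" "r / p + r / q = 1"
  proof -
   have "r * (1 / p + 1 / q) = 1" unfolding r(2)[symmetric] using r(1) by simp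
   thus "r / p + r / q = 1" by (simp add: distrib_left)
  qed (use p r in auto)
  have d2: "CARD('n) >= 2" using d by simp
  obtain eps \<eta> where e: "0 < eps" "eps < r / p" "eps < r / q" "\<eta> > 0"
   "rw_admissible CARD('n) ((1 + \<eta>) * (r / p + eps)) ((1 + \<eta>) * (r / q - eps))" "rw_admissible CARD('n) ((1 + \<eta>) * (r / p - eps)) ((1 + \<eta>) * (r / q + eps))"
   by (rule rw_admissible_diagonal[OF d2 P])
  obtain C where C: "C > 0" "!!f g. f \<in> borel_measurable lborel ==> g \<in> borel_measurable lborel ==> (LN x. epow (f x) (1 / (r / p))) <= 1 ==> (LN x. epow (g x) (1 / (r / q))) <= 1 ==>
   (LN x. epow (lac u v f g x) (1 / (r / p + r / q))) <= ennreal C"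
   by (rule strong[OF P(1,2) _ e(1-4) weak_lac[OF d u e(5)] weak_lac[OF d u e(6)]]) (use P in auto)
  show ?thesis
  proof (intro exI[of _ C] conjI ballI impI C(1))
   fix f g :: "real^'n => ennreal"
   assume f[measurable]: "f \<in> Bor" and g[measurable]: "g \<in> Bor"
    and fn: "(LN x. epow (f x) p) <= 1" and gn: "(LN x. epow (g x) q) <= 1"
   have "(LN x. epow (lac u v f g x) r) <= (LN x. lac u v (%x. epow (f x) r) (%x. epow (g x) r) x)"
    by (intro nn_integral_mono lac_power_le f g r1)
   also have "... <= ennreal C"
    using C(2)[of "%x. epow (f x) r" "%x. epow (g x) r"] fn gn p r P(3) by (simp add: ennreal_power_power)
   finally show "(LN x. epow (lac u v f g x) r) <= ennreal C" .
  qed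
 qed
 then obtain C where C: "C > 0" "!!f g. f \<in> Bor ==> g \<in> Bor ==>
   (LN x. epow (f x) p) <= 1 ==> (LN x. epow (g x) q) <= 1 ==>
   (LN x. epow (lac u v f g x) r) <= ennreal C" by blast
 show ?thesis
 proof (rule that[OF C(1) p])
  fix f g :: "real^'n => ennreal" and a b :: real
  assume f[measurable]: "f \<in> Bor" and g[measurable]: "g \<in> Bor" and ab: "a > 0" "b > 0"
   and fn: "(LN x. epow (f x) p) <= ennreal (a powr p)" and gn: "(LN x. epow (g x) q) <= ennreal (b powr q)"
  have 1: "(LN x. epow (lac u v (%x. ennreal (1 / a) * f x) (%x. ennreal (1 / b) * g x) x) r) <= ennreal C"
   by (rule C(2)) (use normalize_power[OF _ ab(1) fn] normalize_power[OF _ ab(2) gn] in auto)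
  have eq: "lac u v f g x = ennreal (a * b) * lac u v (%x. ennreal (1 / a) * f x) (%x. ennreal (1 / b) * g x) x" for x
  proof -
   have "ennreal (a * b) * (ennreal (1 / a) * (ennreal (1 / b) * z)) = z" for z
    using ab by (simp add: mult.assoc[symmetric] ennreal_mult[symmetric])
   thus ?thesis by (simp add: lac_cmult2[OF f g])
  qed
  have "(LN x. epow (lac u v f g x) r) = ennreal ((a * b) powr r) * (LN x. epow (lac u v (%x. ennreal (1 / a) * f x) (%x. ennreal (1 / b) * g x) x) r)"
   unfolding eq using ab by (simp add: ennreal_power_cmult nn_integral_cmult)
  also have "... <= ennreal ((a * b) powr r) * ennreal C" by (intro mult_left_mono 1) simp
  also have "... = ennreal (C * (a * b) powr r)" using C(1) by (simp add: ennreal_mult[symmetric] mult.commute)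
  finally show "(LN x. epow (lac u v f g x) r) <= ennreal (C * (a * b) powr r)" .
 qed
qed

text \<open>For q <= 2 the product operator is used at P = Q = 1/q, where P + Q >= 1 as
  \<open>strong\<close> demands; larger q are reduced to the exponent 2 by Jensen's
  inequality.\<close>

lemma linear_strong:
 assumes d: "CARD('n) >= 2" and u: "norm (u :: real^'n) = 1" "norm v = 1" and q: "q > 1"
 obtains C where "C > 0"
  "!!f b. f \<in> Bor ==> b > 0 ==> (LN x. epow (f x) q) <= ennreal (b powr q) ==>
   (LN x. epow (lac u v f (%y. 1) x) q) <= ennreal (C * b powr q)"
proof -
 have low: "\<exists>C>0. \<forall>f\<in>Bor. (LN x. epow (f x) q) <= 1 -->
   (LN x. epow (lac u v f (%y. 1) x) q) <= ennreal C" if q: "1 < q" "q <= 2" for q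
 proof -
  interpret bisublinear lborel "%f g x. lac u v f (%y. 1) x * lac u v g (%y. 1) x" by (rule bisublinear_lac_product)
  define P where "P = 1 / q"
  have P: "0 < P" "P < 1" "P + P >= 1" using q by (auto simp: P_def field_simps)
  \<comment> \<open>One number serves both as perturbation and as \<eta>, so (1 + eps) (P + eps) has
    to stay below 1.\<close>
  define eps where "eps = min ((1 - P) / 4) (P / 2)"
  have e: "0 < eps" "eps < P" "P + 4 * eps <= 1" using P by (auto simp: eps_def min_def field_simps)
  have b1: "(1 + eps) * (P + eps) < 1"
  proof -
   have "eps * (P + eps) <= eps * 1" using e by (intro mult_left_mono) auto
   thus ?thesis using e by (simp add: algebra_simps)
  qed
  have b2: "(1 + eps) * (P - eps) < 1" "0 < (1 + eps) * (P - eps)" "0 < (1 + eps) * (P + eps)"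
   using e P by (auto intro!: mult_pos_pos order_le_less_trans[OF mult_left_mono b1])
  obtain C where C: "C > 0" "!!f g. f \<in> borel_measurable lborel ==> g \<in> borel_measurable lborel ==> (LN x. epow (f x) (1 / P)) <= 1 ==> (LN x. epow (g x) (1 / P)) <= 1 ==>
   (LN x. epow (lac u v f (%y. 1) x * lac u v g (%y. 1) x) (1 / (P + P))) <= ennreal C"
   by (rule strong[OF P(1,1,3) e(1,2,2,1) weak_lac_product[OF d u b2(3) b1 b2(2,1)] weak_lac_product[OF d u b2(2,1) b2(3) b1]]) blast
  have sq: "epow (z * z) (1 / (P + P)) = epow z q" for z
   using q by (cases z) (auto simp: P_def ennreal_mult[symmetric] powr_mult powr_add[symmetric] ennreal_top_mult)
  show ?thesis
  proof (intro exI[of _ C] conjI ballI impI C(1))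
   fix f :: "real^'n => ennreal" assume "f \<in> Bor" "(LN x. epow (f x) q) <= 1"
   thus "(LN x. epow (lac u v f (%y. 1) x) q) <= ennreal C"
    using C(2)[of f f] unfolding sq by (simp add: P_def)
  qed
 qed
 have "\<exists>C>0. \<forall>f\<in>Bor. (LN x. epow (f x) q) <= 1 -->
   (LN x. epow (lac u v f (%y. 1) x) q) <= ennreal C"
 proof (cases "q <= 2")
  case False
  obtain C where C: "C > 0" "!!f. f \<in> Bor ==> (LN x. epow (f x) 2) <= 1 ==>
   (LN x. epow (lac u v f (%y. 1) x) 2) <= ennreal C" using low[of 2] by auto
  show ?thesis
  proof (intro exI[of _ C] conjI ballI impI C(1))
   fix f :: "real^'n => ennreal" assume f[measurable]: "f \<in> Bor" and fn: "(LN x. epow (f x) q) <= 1"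
   have one: "epow 1 k = 1" for k using ennreal_power_ennreal[of 1 k] by simp
   have "(LN x. epow (lac u v f (%y. 1) x) q) = (LN x. epow (epow (lac u v f (%y. 1) x) (q / 2)) 2)"
    using False by (simp add: ennreal_power_power)
   also have "... <= (LN x. epow (lac u v (%x. epow (f x) (q / 2)) (%y. 1) x) 2)"
    using lac_power_le[OF f, of "%y. 1" "q / 2" u v] False by (intro nn_integral_mono ennreal_power_mono) (auto simp: one)
   also have "... <= ennreal C" using fn False by (intro C(2)) (auto simp: ennreal_power_power)
   finally show "(LN x. epow (lac u v f (%y. 1) x) q) <= ennreal C" .
  qed
 qed (use low q in auto)
 then obtain C where C: "C > 0" "!!f. f \<in> Bor ==> (LN x. epow (f x) q) <= 1 ==>
   (LN x. epow (lac u v f (%y. 1) x) q) <= ennreal C" by blast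
 show ?thesis
 proof (rule that[OF C(1)])
  fix f :: "real^'n => ennreal" and b :: real
  assume f[measurable]: "f \<in> Bor" and b: "b > 0" and fn: "(LN x. epow (f x) q) <= ennreal (b powr q)"
  have 1: "(LN x. epow (lac u v (%x. ennreal (1 / b) * f x) (%y. 1) x) q) <= ennreal C"
   by (rule C(2)) (use normalize_power[OF _ b fn] in auto)
  have eq: "lac u v f (%y. 1) x = ennreal b * lac u v (%x. ennreal (1 / b) * f x) (%y. 1) x" for x
  proof -
   have "ennreal b * (ennreal (1 / b) * z) = z" for z
    using b by (simp add: mult.assoc[symmetric] ennreal_mult[symmetric])
   thus ?thesis by (simp add: lac_cmult)
  qed
  have "(LN x. epow (lac u v f (%y. 1) x) q) = ennreal (b powr q) * (LN x. epow (lac u v (%x. ennreal (1 / b) * f x) (%y. 1) x) q)"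
   unfolding eq using b by (simp add: ennreal_power_cmult nn_integral_cmult)
  also have "... <= ennreal (b powr q) * ennreal C" by (intro mult_left_mono 1) simp
  also have "... = ennreal (C * b powr q)" using C(1) by (simp add: ennreal_mult[symmetric] mult.commute)
  finally show "(LN x. epow (lac u v f (%y. 1) x) q) <= ennreal (C * b powr q)" .
 qed
qed

end

section \<open>Lebesgue measurable functions\<close>

lemma completion_AE_measurable:
 assumes g: "g \<in> M \<rightarrow>\<^sub>M borel" and ae: "AE x in M. f x = g x"
 shows "f \<in> completion M \<rightarrow>\<^sub>M borel"
proof (rule measurableI)
 fix A :: "'b set" assume A: "A \<in> sets borel"
 show "f -` A \<inter> space (completion M) \<in> sets (completion M)"
 proof (rule completion.in_sets_AE)
  show "AE x in completion M. x \<in> g -` A \<inter> space M \<longleftrightarrow> x \<in> f -` A \<inter> space (completion M)"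
   using AE_completion[OF ae] by eventually_elim simp
  show "g -` A \<inter> space M \<in> sets (completion M)" using measurable_sets[OF g A] by (rule sets_completionI_sets)
 qed simp
qed simp

lemma lebesgue_complex_borel:
 fixes f :: "'a::euclidean_space => complex"
 assumes "f \<in> borel_measurable lebesgue"
 obtains F where "F \<in> Bor" "AE x in lborel. f x = F x"
proof -
 have "(%x. Re (f x)) \<in> borel_measurable lebesgue" "(%x. Im (f x)) \<in> borel_measurable lebesgue" using assms by measurable
 then obtain a b where ab: "a \<in> borel_measurable lborel" "AE x in lborel. Re (f x) = a x" "b \<in> borel_measurable lborel" "AE x in lborel. Im (f x) = b x"
  using completion_ex_borel_measurable_real by metis
 show ?thesis
 proof (rule that[of "%x. Complex (a x) (b x)"])
  show "(%x. Complex (a x) (b x)) \<in> Bor" using ab(1,3) by (simp add: Complex_eq)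
  show "AE x in lborel. f x = Complex (a x) (b x)" using ab(2,4) by eventually_elim (simp add: complex_eq_iff)
 qed
qed

text \<open>Valid also for non-integrable integrands, whose Bochner integral has the default value
  0.\<close>

lemma norm_integral_le_nn_integral:
 fixes h :: "'a => 'b::{banach, second_countable_topology}"
 shows "ennreal (norm (\<integral>x. h x \<partial>M)) <= (\<integral>\<^sup>+x. ennreal (norm (h x)) \<partial>M)"
 by (cases "integrable M h") (auto simp: integral_norm_bound_ennreal not_integrable_integral_eq)

lemma Lp_norm_real: "p > 0 ==> Lp_norm (ennreal p) h = epow (\<integral>\<^sup>+x. epow (h x) p \<partial>lebesgue) (1 / p)"
 by (simp add: Lp_norm_def)

text \<open>Requiring the estimate only for a > a0 and b > b0 admits vanishing norms, which cannot
  be normalised; a limit recovers a0 and b0.\<close>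

lemma Lp_norm_bound:
 assumes r: "r > 0" and C: "C > 0" and ab: "a0 >= 0" "b0 >= 0"
  and le: "!!a b. a > a0 ==> b > b0 ==> (\<integral>\<^sup>+x. epow (T x) r \<partial>lebesgue) <= ennreal (C * (a * b) powr r)"
 shows "Lp_norm (ennreal r) T <= ennreal (C powr (1 / r)) * ennreal a0 * ennreal b0"
proof -
 let ?K = "C powr (1 / r)"
 have 1: "Lp_norm (ennreal r) T <= ennreal (?K * (a * b))" if "a > a0" "b > b0" for a b
 proof -
  have "Lp_norm (ennreal r) T <= epow (ennreal (C * (a * b) powr r)) (1 / r)"
   unfolding Lp_norm_real[OF r] using r by (intro ennreal_power_mono le that) auto
  also have "... = ennreal (?K * (a * b))" using C r ab that by (simp add: powr_mult powr_powr)
  finally show ?thesis .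
 qed
 have "(%n. ennreal (?K * ((a0 + inverse (real (Suc n))) * (b0 + inverse (real (Suc n)))))) \<longlonglongrightarrow> ennreal (?K * ((a0 + 0) * (b0 + 0)))"
  by (intro tendsto_ennrealI tendsto_intros LIMSEQ_inverse_real_of_nat)
 hence "Lp_norm (ennreal r) T <= ennreal (?K * ((a0 + 0) * (b0 + 0)))"
  by (rule LIMSEQ_le_const) (auto intro!: exI[of _ 0] 1)
 thus ?thesis using ab by (simp add: ennreal_mult mult.assoc)
qed

lemma Lp_real_obtain:
 fixes f :: "'a::euclidean_space => complex"
 assumes f: "f \<in> Lp (ennreal p)" and p: "p > 0"
 obtains F a0 where "F \<in> Bor" "AE x in lborel. f x = F x" "a0 >= 0" "cLp_norm (ennreal p) f = ennreal a0"
  "!!a. a > a0 ==> (LN x. epow (ennreal (cmod (F x))) p) <= ennreal (a powr p)"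
proof -
 have fm: "f \<in> borel_measurable lebesgue" "cLp_norm (ennreal p) f < \<infinity>" using f by (auto simp: Lp_def)
 obtain F where F: "F \<in> Bor" "AE x in lborel. f x = F x" by (rule lebesgue_complex_borel[OF fm(1)])
 obtain a0 where a0: "a0 >= 0" "cLp_norm (ennreal p) f = ennreal a0" using fm(2) by (cases "cLp_norm (ennreal p) f") auto
 let ?I = "(LN x. epow (ennreal (cmod (F x))) p)"
 have "(\<integral>\<^sup>+x. epow (ennreal (cmod (f x))) p \<partial>lebesgue) = ?I"
  unfolding nn_integral_completion by (rule nn_integral_cong_AE) (use F(2) in eventually_elim, simp)
 hence "epow ?I (1 / p) = ennreal a0" using a0(2) by (simp add: Lp_norm_real[OF p])
 hence "epow (epow ?I (1 / p)) p = ennreal (a0 powr p)" using a0(1) by simp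
 hence I: "?I = ennreal (a0 powr p)" using p by (simp add: ennreal_power_power)
 show ?thesis
  by (rule that[OF F a0]) (unfold I, use a0 p in \<open>auto intro!: ennreal_leI powr_mono2\<close>)
qed

lemma Linf_obtain:
 fixes f :: "'a::euclidean_space => complex"
 assumes f: "f \<in> Lp \<infinity>"
 obtains F a0 where "F \<in> Bor" "AE x in lborel. f x = F x" "a0 >= 0" "cLp_norm \<infinity> f = ennreal a0" "!!x. cmod (F x) <= a0"
proof -
 have fm: "f \<in> borel_measurable lebesgue" "cLp_norm \<infinity> f < \<infinity>" using f by (auto simp: Lp_def)
 obtain F where F: "F \<in> Bor" "AE x in lborel. f x = F x" by (rule lebesgue_complex_borel[OF fm(1)])
 obtain a0 where a0: "a0 >= 0" "cLp_norm \<infinity> f = ennreal a0" using fm(2) by (cases "cLp_norm \<infinity> f") auto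
 have "AE x in lebesgue. ennreal (cmod (f x)) <= ennreal a0"
  using esssup_AE[of "%x. ennreal (cmod (f x))" lebesgue] a0(2) by (simp add: Lp_norm_def)
 hence ae: "AE x in lborel. cmod (f x) <= a0" using a0(1) by (simp add: AE_completion_iff ennreal_le_iff)
 show ?thesis
 \<comment> \<open>The representative is set to 0 on a null set, so that the essential bound holds
   everywhere.\<close>
 proof (rule that[of "%x. if cmod (F x) <= a0 then F x else 0" a0])
  show "(%x. if cmod (F x) <= a0 then F x else 0) \<in> Bor" using F(1) by measurable
  show "AE x in lborel. f x = (if cmod (F x) <= a0 then F x else 0)" using F(2) ae by eventually_elim auto
 qed (use a0 in auto)
qed

lemma triangle_avg_commute: "triangle_avg H u v t f g = triangle_avg H v u t g f"
 by (intro ext) (simp add: triangle_avg_def mult.commute)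

lemma triangle_lac_commute: "triangle_lac H u v f g = triangle_lac H v u g f"
 unfolding triangle_lac_def by (subst triangle_avg_commute) simp

section \<open>Passage to Borel representatives\<close>

context haar_orthogonal
begin

text \<open>By Fubini and translation invariance, for almost every x the rotated and dilated points
  x - t R w meet a given null set with probability 0; the scales are countable.\<close>

lemma AE_orbit:
 fixes P :: "real^'n => bool"
 assumes "AE x in lborel. P x"
 shows "AE x in lborel. \<forall>l::int. AE R in H. P (x - 2 powi l *\<^sub>R (R *v w))"
 unfolding AE_all_countable
proof
 fix l :: int
 obtain N where N: "{x \<in> space lborel. ~ P x} \<subseteq> N" "evol N = 0" "N \<in> sets lborel" using assms by (rule AE_E)
 have [measurable]: "N \<in> sets borel" using N(3) by simp
 have "(LN x. (HN R. indicator N (x - 2 powi l *\<^sub>R (R *v w)))) = 0"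
  by (subst nn_integral_shift_H) (use N in auto)
 hence "AE x in lborel. (HN R. indicator N (x - 2 powi l *\<^sub>R (R *v w))) = 0"
  by (subst (asm) nn_integral_0_iff_AE) auto
 thus "AE x in lborel. AE R in H. P (x - 2 powi l *\<^sub>R (R *v w))"
 proof eventually_elim
  case (elim x)
  hence "AE R in H. (indicator N (x - 2 powi l *\<^sub>R (R *v w)) :: ennreal) = 0" by (subst (asm) nn_integral_0_iff_AE) auto
  thus ?case by eventually_elim (use N(1) in \<open>auto simp: indicator_def split: if_splits\<close>)
 qed
qed

lemma triangle_avg_AE_eq:
 fixes f g F G :: "real^'n => complex"
 assumes [measurable]: "F \<in> Bor" "G \<in> Bor"
  and ae: "AE x in lborel. f x = F x" "AE x in lborel. g x = G x"
 shows "AE x in lborel. \<forall>l::int. triangle_avg H u v (2 powi l) f g x = (HI R. F (x - 2 powi l *\<^sub>R (R *v u)) * G (x - 2 powi l *\<^sub>R (R *v v)))"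
 using AE_orbit[OF ae(1), of u] AE_orbit[OF ae(2), of v]
proof eventually_elim
 case (elim x)
 show ?case
 proof
  fix l :: int
  let ?h = "%R. F (x - 2 powi l *\<^sub>R (R *v u)) * G (x - 2 powi l *\<^sub>R (R *v v))"
  have eq: "AE R in H. f (x - 2 powi l *\<^sub>R (R *v u)) * g (x - 2 powi l *\<^sub>R (R *v v)) = ?h R"
   using elim(1)[rule_format, of l] elim(2)[rule_format, of l] by eventually_elim simp
  have m: "?h \<in> borel_measurable H" by measurable
  have "triangle_avg H u v (2 powi l) f g x = (\<integral>R. ?h R \<partial>(completion H))"
   unfolding triangle_avg_def
   by (rule integral_cong_AE[OF completion_AE_measurable[OF m eq] measurable_completion[OF m] AE_completion[OF eq]])
  also have "... = (HI R. ?h R)" by (rule integral_completion[OF m])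
  finally show "triangle_avg H u v (2 powi l) f g x = (HI R. ?h R)" .
 qed
qed

lemma triangle_lac_AE_le:
 fixes f g F G :: "real^'n => complex"
 assumes [measurable]: "F \<in> Bor" "G \<in> Bor"
  and ae: "AE x in lborel. f x = F x" "AE x in lborel. g x = G x"
 shows "AE x in lborel. triangle_lac H u v f g x <= lac u v (%x. ennreal (cmod (F x))) (%x. ennreal (cmod (G x))) x"
 using triangle_avg_AE_eq[OF assms, of u v]
proof eventually_elim
 case (elim x)
 show ?case
  unfolding triangle_lac_def lac_def
 proof (rule SUP_mono)
  fix l :: int
  have "ennreal (cmod (triangle_avg H u v (2 powi l) f g x)) <= navg u v (2 powi l) (%x. ennreal (cmod (F x))) (%x. ennreal (cmod (G x))) x"
   unfolding elim[rule_format] navg_def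
   by (rule order_trans[OF norm_integral_le_nn_integral]) (simp add: norm_mult ennreal_mult)
  thus "\<exists>m\<in>UNIV. ennreal (cmod (triangle_avg H u v (2 powi l) f g x)) <= navg u v (2 powi m) (%x. ennreal (cmod (F x))) (%x. ennreal (cmod (G x))) x"
   by blast
 qed
qed

lemma triangle_lac_measurable:
 fixes f g :: "real^'n => complex"
 assumes [measurable]: "F \<in> Bor" "G \<in> Bor"
  and ae: "AE x in lborel. f x = F x" "AE x in lborel. g x = G x"
 shows "triangle_lac H u v f g \<in> borel_measurable lebesgue"
proof (rule completion_AE_measurable)
 let ?T = "%x. SUP l::int. ennreal (cmod (HI R. F (x - 2 powi l *\<^sub>R (R *v u)) * G (x - 2 powi l *\<^sub>R (R *v v))))"
 have "?T \<in> Bor" by measurable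
 thus "?T \<in> borel_measurable lborel" by simp
 show "AE x in lborel. triangle_lac H u v f g x = ?T x"
  using triangle_avg_AE_eq[OF assms, of u v] by eventually_elim (simp add: triangle_lac_def)
qed

lemma lac_bounded_left:
 assumes [measurable]: "g \<in> Bor" and "!!x. f x <= ennreal a"
 shows "lac u v f g x <= ennreal a * lac v u g (%y. 1) x"
proof -
 have "lac u v f g x <= lac u v (%x. ennreal a * 1) g x" using assms(2) by (intro lac_mono) auto
 also have "... = ennreal a * lac u v (%x. 1) g x" by (rule lac_cmult) measurable
 finally show ?thesis by (simp add: lac_commute[of u v])
qed

section \<open>The norm inequalities\<close>

lemma lac_interior_bound:
 assumes d: "CARD('n) >= 3" and u: "norm (u :: real^'n) = 1" "norm v = 1" "norm (u - v) = 1"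
  and pq: "(1 / p, 1 / q) \<in> interior (region_R1 CARD('n))" and r: "0 < r" "1 / r = 1 / p + 1 / q"
 shows "\<exists>C::real. \<forall>f \<in> Lp (ennreal p). \<forall>g \<in> Lp (ennreal q).
  Lp_norm (ennreal r) (triangle_lac H u v f g) <= ennreal C * cLp_norm (ennreal p) f * cLp_norm (ennreal q) g"
proof -
 obtain C where C: "C > 0" and p: "p > 0" "q > 0" and bound:
  "!!f g a b. f \<in> Bor ==> g \<in> Bor ==> a > 0 ==> b > 0 ==>
   (LN x. epow (f x) p) <= ennreal (a powr p) ==> (LN x. epow (g x) q) <= ennreal (b powr q) ==>
   (LN x. epow (lac u v f g x) r) <= ennreal (C * (a * b) powr r)"
  by (rule bilinear_strong[OF d u pq r]) blast
 show ?thesis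
 proof (intro exI[of _ "C powr (1 / r)"] ballI)
  fix f g :: "real^'n => complex" assume f: "f \<in> Lp (ennreal p)" and g: "g \<in> Lp (ennreal q)"
  obtain F a0 where F: "F \<in> Bor" "AE x in lborel. f x = F x" "a0 >= 0" "cLp_norm (ennreal p) f = ennreal a0"
   and Fb: "!!a. a > a0 ==> (LN x. epow (ennreal (cmod (F x))) p) <= ennreal (a powr p)"
   using Lp_real_obtain[OF f p(1)] by blast
  obtain G b0 where G: "G \<in> Bor" "AE x in lborel. g x = G x" "b0 >= 0" "cLp_norm (ennreal q) g = ennreal b0"
   and Gb: "!!a. a > b0 ==> (LN x. epow (ennreal (cmod (G x))) q) <= ennreal (a powr q)"
   using Lp_real_obtain[OF g p(2)] by blast
  note [measurable] = F(1) G(1)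
  show "Lp_norm (ennreal r) (triangle_lac H u v f g) <= ennreal (C powr (1 / r)) * cLp_norm (ennreal p) f * cLp_norm (ennreal q) g"
   unfolding F(4) G(4)
  proof (rule Lp_norm_bound[OF r(1) C F(3) G(3)])
   fix a b assume ab: "a > a0" "b > b0"
   have "(LN x. epow (triangle_lac H u v f g x) r) <= (LN x. epow (lac u v (%x. ennreal (cmod (F x))) (%x. ennreal (cmod (G x))) x) r)"
    by (rule nn_integral_mono_AE) (use triangle_lac_AE_le[OF F(1) G(1) F(2) G(2), of u v] in eventually_elim, use r(1) in \<open>simp add: ennreal_power_mono\<close>)
   also have "... <= ennreal (C * (a * b) powr r)"
    by (rule bound[OF _ _ _ _ Fb[OF ab(1)] Gb[OF ab(2)]]) (use ab F(3) G(3) in auto)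
   finally show "(\<integral>\<^sup>+x. epow (triangle_lac H u v f g x) r \<partial>lebesgue) <= ennreal (C * (a * b) powr r)"
    by (simp add: nn_integral_completion)
  qed
 qed
qed

text \<open>Once f is replaced by a constant, only the linear maximal function of g is left, with
  the two vertices exchanged; for q = \<infinity> the bound 1 on indicators is enough.\<close>

lemma lac_Linf_bound:
 assumes d: "CARD('n) >= 2" and u: "norm (u :: real^'n) = 1" "norm v = 1" and q: "1 < q"
 shows "\<exists>C::real. \<forall>f \<in> Lp \<infinity>. \<forall>g \<in> Lp q. Lp_norm q (triangle_lac H u v f g) <= ennreal C * cLp_norm \<infinity> f * cLp_norm q g"
proof (cases q)
 case (real q')
 hence q1: "q' > 1" using q by (simp add: ennreal_less_iff flip: ennreal_1)
 hence q0: "q' > 0" by simp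
 obtain C where C: "C > 0" and bound: "!!f b. f \<in> Bor ==> b > 0 ==> (LN x. epow (f x) q') <= ennreal (b powr q') ==>
   (LN x. epow (lac v u f (%y. 1) x) q') <= ennreal (C * b powr q')"
  by (rule linear_strong[OF d u(2,1) q1]) blast
 show ?thesis
 proof (intro exI[of _ "C powr (1 / q')"] ballI)
  fix f g :: "real^'n => complex" assume f: "f \<in> Lp \<infinity>" and g: "g \<in> Lp q"
  obtain F a0 where F: "F \<in> Bor" "AE x in lborel. f x = F x" "a0 >= 0" "cLp_norm \<infinity> f = ennreal a0" "!!x. cmod (F x) <= a0"
   using Linf_obtain[OF f] by blast
  obtain G b0 where G: "G \<in> Bor" "AE x in lborel. g x = G x" "b0 >= 0" "cLp_norm (ennreal q') g = ennreal b0"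
   and Gb: "!!a. a > b0 ==> (LN x. epow (ennreal (cmod (G x))) q') <= ennreal (a powr q')"
   using Lp_real_obtain[OF g[unfolded real(2)] q0] by blast
  note [measurable] = F(1) G(1)
  show "Lp_norm q (triangle_lac H u v f g) <= ennreal (C powr (1 / q')) * cLp_norm \<infinity> f * cLp_norm q g"
   unfolding F(4) real(2) G(4)
  proof (rule Lp_norm_bound[OF q0 C F(3) G(3)])
   fix a b assume ab: "a > a0" "b > b0"
   hence a: "a > 0" "b > 0" using F(3) G(3) by auto
   let ?g = "%x. ennreal (cmod (G x))"
   have "(LN x. epow (triangle_lac H u v f g x) q') <= (LN x. epow (ennreal a * lac v u ?g (%y. 1) x) q')"
   proof (rule nn_integral_mono_AE)
    show "AE x in lborel. epow (triangle_lac H u v f g x) q' <= epow (ennreal a * lac v u ?g (%y. 1) x) q'"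
     using triangle_lac_AE_le[OF F(1) G(1) F(2) G(2), of u v]
    proof eventually_elim
     case (elim x)
     have "lac u v (%x. ennreal (cmod (F x))) ?g x <= ennreal a * lac v u ?g (%y. 1) x"
     proof (rule lac_bounded_left)
      show "ennreal (cmod (F y)) <= ennreal a" for y using F(5)[of y] ab by (intro ennreal_leI) linarith
     qed simp
     thus ?case using elim q0 by (intro ennreal_power_mono) auto
    qed
   qed
   also have "... = ennreal (a powr q') * (LN x. epow (lac v u ?g (%y. 1) x) q')"
    using a by (simp add: ennreal_power_cmult nn_integral_cmult)
   also have "... <= ennreal (a powr q') * ennreal (C * b powr q')"
    by (intro mult_left_mono bound[OF _ a(2) Gb[OF ab(2)]]) auto
   also have "... = ennreal (C * (a * b) powr q')" using C a by (simp add: ennreal_mult[symmetric] powr_mult mult_ac)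
   finally show "(\<integral>\<^sup>+x. epow (triangle_lac H u v f g x) q' \<partial>lebesgue) <= ennreal (C * (a * b) powr q')"
    by (simp add: nn_integral_completion)
  qed
 qed
next
 case top
 show ?thesis
 proof (intro exI[of _ 1] ballI)
  fix f g :: "real^'n => complex" assume f: "f \<in> Lp \<infinity>" and g: "g \<in> Lp q"
  obtain F a0 where F: "F \<in> Bor" "AE x in lborel. f x = F x" "a0 >= 0" "cLp_norm \<infinity> f = ennreal a0" "!!x. cmod (F x) <= a0"
   using Linf_obtain[OF f] by blast
  have g': "g \<in> Lp \<infinity>" using g top by simp
  obtain G b0 where G: "G \<in> Bor" "AE x in lborel. g x = G x" "b0 >= 0" "cLp_norm \<infinity> g = ennreal b0" "!!x. cmod (G x) <= b0"
   using Linf_obtain[OF g'] by blast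
  note [measurable] = F(1) G(1)
  have q: "q = \<infinity>" using top by simp
  have "esssup lebesgue (triangle_lac H u v f g) <= ennreal (a0 * b0)"
  proof (rule esssup_I)
   show "triangle_lac H u v f g \<in> borel_measurable lebesgue" by (rule triangle_lac_measurable[OF F(1) G(1) F(2) G(2)])
   show "AE x in lebesgue. triangle_lac H u v f g x <= ennreal (a0 * b0)"
    unfolding AE_completion_iff using triangle_lac_AE_le[OF F(1) G(1) F(2) G(2), of u v]
   proof eventually_elim
    case (elim x)
    have "lac u v (%x. ennreal (cmod (F x))) (%x. ennreal (cmod (G x))) x <= lac u v (%x. ennreal a0 * indicator UNIV x) (%x. ennreal b0 * indicator UNIV x) x"
     using F(5) G(5) by (intro lac_mono) (auto intro: ennreal_leI)
    also have "... = ennreal a0 * (ennreal b0 * lac u v (indicator UNIV) (indicator UNIV) x)" by (rule lac_cmult2) measurable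
    also have "... <= ennreal a0 * (ennreal b0 * 1)" by (intro mult_left_mono lac_indicator_le_1) auto
    finally show ?case using elim F(3) G(3) by (simp add: ennreal_mult)
   qed
  qed
  thus "Lp_norm q (triangle_lac H u v f g) <= ennreal 1 * cLp_norm \<infinity> f * cLp_norm q g"
   unfolding q F(4) G(4) using F(3) G(3) by (simp add: Lp_norm_def ennreal_mult)
 qed
qed

end

theorem theorem5:
  fixes H :: "(real^'n^'n) measure" and u v :: "real^'n"
  assumes "normalized_haar_orthogonal H"
    and "(u, v) \<in> triangle_set"
  shows
    "(CARD('n) \<ge> 7 \<longrightarrow>
       (\<forall>p q r :: real.
          (1 / p, 1 / q) \<in> interior (region_R1 CARD('n)) \<longrightarrow> 0 < r \<longrightarrow> 1 / r = 1 / p + 1 / q \<longrightarrow>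
          (\<exists>C::real. \<forall>f \<in> Lp (ennreal p). \<forall>g \<in> Lp (ennreal q).
             Lp_norm (ennreal r) (triangle_lac H u v f g)
               \<le> ennreal C * cLp_norm (ennreal p) f * cLp_norm (ennreal q) g)))
     \<and>
     (CARD('n) \<ge> 2 \<longrightarrow>
       (\<forall>q :: ennreal. 1 < q \<longrightarrow>
          (\<exists>C::real. \<forall>f \<in> Lp \<infinity>. \<forall>g \<in> Lp q.
             Lp_norm q (triangle_lac H u v f g) \<le> ennreal C * cLp_norm \<infinity> f * cLp_norm q g) \<and>
          (\<exists>C::real. \<forall>f \<in> Lp q. \<forall>g \<in> Lp \<infinity>.
             Lp_norm q (triangle_lac H u v f g) \<le> ennreal C * cLp_norm q f * cLp_norm \<infinity> g)))"
proof -
  interpret haar_orthogonal H by unfold_locales (rule assms(1))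
  have uv: "norm u = 1" "norm v = 1" "norm (u - v) = 1" using assms(2) by (auto simp: triangle_set_def)
  have "\<exists>C::real. \<forall>f \<in> Lp q. \<forall>g \<in> Lp \<infinity>. Lp_norm q (triangle_lac H u v f g) \<le> ennreal C * cLp_norm q f * cLp_norm \<infinity> g"
    if d: "CARD('n) \<ge> 2" and q: "1 < q" for q :: ennreal
  proof -
    obtain C where "\<forall>g \<in> Lp \<infinity>. \<forall>f \<in> Lp q. Lp_norm q (triangle_lac H v u g f) \<le> ennreal C * cLp_norm \<infinity> g * cLp_norm q f"
      using lac_Linf_bound[OF d uv(2,1) q] by blast
    then show ?thesis by (intro exI[of _ C]) (simp add: triangle_lac_commute[of H u v] mult_ac)
  qed
  then show ?thesis
    using lac_interior_bound[OF _ uv] lac_Linf_bound[OF _ uv(1,2)] by auto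
qed

end
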